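(* Assume $\gamma\neq1$. Define, for the elliptic quantum toroidal algebra $\mathcal U_{q,t,p}$, $$E^{\pm}(\alpha,z)=\exp\Big\{\pm\sum_{n>0}\tfrac{1}{\gamma^n-\gamma^{-n}}\alpha_{\pm n}(\gamma^{-1/2}z)^{\mp n}\Big\},\qquad E^{\pm}(\alpha',z)=\exp\Big\{\mp\sum_{n>0}\tfrac{1}{\gamma^n-\gamma^{-n}}\alpha'_{\pm n}(\gamma^{-1/2}z)^{\mp n}\Big\},$$ $$\mathcal Z^+(z)=E^-(\alpha,z)x^+(z)E^+(\alpha,z),\qquad \mathcal Z^-(z)=E^-(\alpha',z)x^-(z)E^+(\alpha',z).$$ Then the following relations hold: $$z^3G^-(w/z)g(w/z;\gamma^2)^{-1}\mathcal Z^\pm(z)\mathcal Z^\pm(w)=-w^3G^-(z/w)g(z/w;\gamma^2)^{-1}\mathcal Z^\pm(w)\mathcal Z^\pm(z),$$ $$g(\gamma w/z)g(\gamma w/z;\gamma^2)\mathcal Z^+(z)\mathcal Z^-(w)-g(\gamma z/w)g(\gamma z/w;\gamma^2)\mathcal Z^-(w)\mathcal Z^+(z)=\frac{(1-q)(1-1/t)}{1-q/t}\left\{\delta(\gamma^{-1}z/w)\psi_0^+-\delta(\gamma z/w)\psi_0^-\right\},$$ $$g(\tfrac wz)^{-1}g(\tfrac uw)^{-1}g(\tfrac uz)^{-1}g(\tfrac wz;\gamma^2)^{-1}g(\tfrac uw;\gamma^2)^{-1}g(\tfrac uz;\gamma^2)^{-1}\Big(\tfrac wu+\tfrac wz-\tfrac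 zw-\tfrac uw\Big)\mathcal Z^+(z)\mathcal Z^+(w)\mathcal Z^+(u)+\text{permutations in }z,w,u=0,$$ $$g(\tfrac wz;\gamma^2)^{-1}g(\tfrac uw;\gamma^2)^{-1}g(\tfrac uz;\gamma^2)^{-1}\Big(\tfrac wu+\tfrac wz-\tfrac zw-\tfrac uw\Big)\mathcal Z^-(z)\mathcal Z^-(w)\mathcal Z^-(u)+\text{permutations in }z,w,u=0.$$
   Context: Let $q,t\in\mathbb C^\times$ with $q,t,q/t$ not roots of unity. Set $\kappa_m=(1-q^m)(1-t^{-m})(1-(t/q)^m)$, $G^{\pm}(z)=(1-q^{\pm1}z)(1-t^{\mp1}z)(1-(q/t)^{\mp1}z)$, $\delta(z)=\sum_{n\in\mathbb Z}z^n$, $g(z;s)=\exp\big(\sum_{m>0}\frac{\kappa_m}{m}\frac{s^m}{1-s^m}z^m\big)$ (used for $s=p,p^*,\gamma^2$) and $g(z)=\exp\big(\sum_{m>0}\frac{\kappa_m}{m}z^m\big)$. The elliptic quantum toroidal algebra $\mathcal U_{q,t,p}=U_{q,t,p}(\mathfrak{gl}_{1,tor})$ is the (topological, with respect to the $p$-adic topology) $\mathbb C[[p]]$-algebra generated by $\alpha_m$ ($m\in\mathbb Z\setminus\{0\}$), $x^\pm_n$ ($n\in\mathbb Z$) and invertible elements $\psi_0^\pm,\gamma^{1/2}$. Put $p^*=p\gamma^{-2}$, $x^\pm(z)=\sum_n x^\pm_nz^{-n}$, $$\psi^+(z)=\psi_0^+\exp\Big(-\sum_{m>0}\tfrac{p^m}{1-p^m}\alpha_{-m}(\gamma^{-1/2}z)^m\Big)\exp\Big(\sum_{m>0}\tfrac{1}{1-p^m}\alpha_m(\gamma^{-1/2}z)^{-m}\Big),$$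 $$\psi^-(z)=\psi_0^-\exp\Big(-\sum_{m>0}\tfrac{1}{1-p^m}\alpha_{-m}(\gamma^{1/2}z)^m\Big)\exp\Big(\sum_{m>0}\tfrac{p^m}{1-p^m}\alpha_m(\gamma^{1/2}z)^{-m}\Big).$$ Defining relations (identities of formal Laurent series): $\psi_0^\pm,\gamma^{1/2}$ are central; $[\alpha_m,\alpha_n]=-\frac{\kappa_m}{m}(\gamma^m-\gamma^{-m})\gamma^{-m}\frac{1-p^m}{1-p^{*m}}\delta_{m+n,0}$; $[\alpha_m,x^+(z)]=-\frac{\kappa_m}{m}\frac{1-p^m}{1-p^{*m}}\gamma^{-3m/2}z^mx^+(z)$; $[\alpha_m,x^-(z)]=\frac{\kappa_m}{m}\gamma^{-m/2}z^mx^-(z)$; $[x^+(z),x^-(w)]=\frac{(1-q)(1-1/t)}{1-q/t}\big(\delta(\gamma^{-1}z/w)\psi^+(w)-\delta(\gamma z/w)\psi^-(\gamma^{-1}w)\big)$; $z^3G^+(w/z)g(w/z;p^* )x^+(z)x^+(w)=-w^3G^+(z/w)g(z/w;p^* )x^+(w)x^+(z)$; $z^3G^-(w/z)g(w/z;p)^{-1}x^-(z)x^-(w)=-w^3G^-(z/w)g(z/w;p)^{-1}x^-(w)x^-(z)$; $g(w/z;p^* )g(u/w;p^* )g(u/z;p^* )\big(\frac wu+\frac wz-\frac zw-\frac uw\big)x^+(z)x^+(w)x^+(u)+$ permutations in $z,w,u$ $=0$; $g(w/z;p)^{-1}g(u/w;p)^{-1}g(u/z;p)^{-1}\big(\frac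 wu+\frac wz-\frac zw-\frac uw\big)x^-(z)x^-(w)x^-(u)+$ permutations in $z,w,u$ $=0$. Also $\alpha'_m=\frac{1-p^{*m}}{1-p^m}\gamma^m\alpha_m$ for $m\neq0$. "Permutations in $z,w,u$" means the sum over all simultaneous permutations of the three variables in the displayed expression. All identities are between formal Laurent series in $z,w,u$. *)

theory Defs
  imports
    "HOL-Analysis.Analysis"
    "HOL-Computational_Algebra.Formal_Power_Series"
    "HOL-Combinatorics.Permutations"
    "HOL-Library.Function_Algebras"
begin

section \<open>The completed free algebra\<close>

text \<open>
  The letters of the free algebra.  \<open>Psi0p\<close>, \<open>Psi0m\<close>, \<open>GammaHalf\<close> stand for
  $\psi_0^+$, $\psi_0^-$, $\gamma^{1/2}$, the letters ending in \<open>Inv\<close> for their inverses, and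
  \<open>DiffInv n\<close> for the inverse of $\gamma^n-\gamma^{-n}$ ($n>0$): the standing assumption
  $\gamma\neq 1$ is needed exactly in order to divide by these elements, so they are inverted.
  The superfluous letters \<open>Alpha 0\<close> and \<open>DiffInv 0\<close> are set to \<open>0\<close> in \<open>ell_relations\<close> below.
\<close>

datatype gen =
    Alpha int | Xplus int | Xminus int
  | Psi0p | Psi0pInv | Psi0m | Psi0mInv | GammaHalf | GammaHalfInv
  | DiffInv nat

fun gdeg :: "gen \<Rightarrow> int" where
  "gdeg (Alpha m) = m"
| "gdeg (Xplus n) = n"
| "gdeg (Xminus n) = n"
| "gdeg _ = 0"

definition wdeg :: "gen list \<Rightarrow> int" where
  "wdeg w = sum_list (map gdeg w)"

text \<open>
  An element is an infinite sum $\sum_w f(w)\,w$ over words with coefficients in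
  $\mathbb C[[p]]$.  Topology: the neighbourhoods of \<open>0\<close> are \<open>nbh0 N\<close>, the closed left ideal
  generated by $p^N$ and all words of degree at least \<open>N\<close>.  In the $p$-adic topology alone the
  defining relations converge, but the coefficients of $\mathcal Z^\pm(z)$ and of products such
  as $g(w/z;\gamma^2)^{-1}\mathcal Z^\pm(z)\mathcal Z^\pm(w)$ do not; they do converge in this
  (usual) completion, which acts on every module on which elements of large
  degree eventually kill each vector.  A word lies in the left ideal generated by the words of
  degree at least \<open>N\<close> iff one of its suffixes has degree at least \<open>N\<close>.
\<close>

definition low :: "nat \<Rightarrow> gen list \<Rightarrow> bool" where
  "low N w \<longleftrightarrow> (\<forall>i\<le>length w. wdeg (drop i w) < int N)"

definition admissible :: "(gen list \<Rightarrow> complex fps) \<Rightarrow> bool" where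
  "admissible f \<longleftrightarrow> (\<forall>N. finite {w. low N w \<and> (\<exists>k<N. fps_nth (f w) k \<noteq> 0)})"

lemma wdeg_append [simp]: "wdeg (u @ v) = wdeg u + wdeg v"
  by (simp add: wdeg_def)

lemma wdeg_Nil [simp]: "wdeg [] = 0"
  by (simp add: wdeg_def)

lemma low_mono: "low N w \<Longrightarrow> N \<le> M \<Longrightarrow> low M w"
  unfolding low_def by (meson le_less_trans less_le_trans of_nat_le_iff order_less_le_trans)

lemma low_suffix:
  assumes "low N (u @ v)"
  shows "low N v"
  unfolding low_def
proof (intro allI impI)
  fix i assume "i \<le> length v"
  then show "wdeg (drop i v) < int N"
    using assms[unfolded low_def, rule_format, of "length u + i"] by simp
qed

lemma low_prefix:
  assumes "low N (u @ v)"
  shows "low (N + nat (- wdeg v)) u"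
  unfolding low_def
proof (intro allI impI)
  fix i assume "i \<le> length u"
  then have "wdeg (drop i u) + wdeg v < int N"
    using assms[unfolded low_def, rule_format, of i] by simp
  then show "wdeg (drop i u) < int (N + nat (- wdeg v))" by linarith
qed

lemma admissible_finite_support:
  assumes "finite {w. f w \<noteq> 0}"
  shows "admissible f"
  unfolding admissible_def
  by (intro allI finite_subset[OF _ assms]) auto

definition free_times ::
  "(gen list \<Rightarrow> complex fps) \<Rightarrow> (gen list \<Rightarrow> complex fps) \<Rightarrow> gen list \<Rightarrow> complex fps" where
  "free_times f g w = (\<Sum>i\<le>length w. f (take i w) * g (drop i w))"

lemma admissible_free_times:
  assumes f: "admissible f" and g: "admissible g"
  shows "admissible (free_times f g)"
  unfolding admissible_def
proof
  fix N
  let ?V = "{v. low N v \<and> (\<exists>k<N. fps_nth (g v) k \<noteq> 0)}"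
  let ?U = "\<lambda>v. {u. low (N + nat (- wdeg v)) u \<and> (\<exists>k<N + nat (- wdeg v). fps_nth (f u) k \<noteq> 0)}"
  have fin: "finite (\<Union>v\<in>?V. (\<lambda>u. u @ v) ` ?U v)"
    using f g unfolding admissible_def by blast
  have "{w. low N w \<and> (\<exists>k<N. fps_nth (free_times f g w) k \<noteq> 0)} \<subseteq> (\<Union>v\<in>?V. (\<lambda>u. u @ v) ` ?U v)"
  proof
    fix w assume "w \<in> {w. low N w \<and> (\<exists>k<N. fps_nth (free_times f g w) k \<noteq> 0)}"
    then obtain k where w: "low N w" and k: "k < N" "fps_nth (free_times f g w) k \<noteq> 0" by auto
    from k(2) obtain i where "fps_nth (f (take i w) * g (drop i w)) k \<noteq> 0"
      unfolding free_times_def fps_sum_nth by (meson sum.not_neutral_contains_not_neutral)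
    then obtain j where j: "j \<le> k" "fps_nth (f (take i w)) j \<noteq> 0"
        "fps_nth (g (drop i w)) (k - j) \<noteq> 0"
      unfolding fps_mult_nth by (metis (no_types, lifting) atLeastAtMost_iff mult_eq_0_iff sum.neutral)
    have lw: "low N (take i w @ drop i w)" using w by simp
    have "drop i w \<in> ?V" using low_suffix[OF lw] j k by (auto intro!: exI[of _ "k - j"])
    moreover have "take i w \<in> ?U (drop i w)" using low_prefix[OF lw] j k by (auto intro!: exI[of _ j])
    ultimately show "w \<in> (\<Union>v\<in>?V. (\<lambda>u. u @ v) ` ?U v)"
      by (intro UN_I[of "drop i w"] image_eqI[of _ _ "take i w"]) simp_all
  qed
  then show "finite {w. low N w \<and> (\<exists>k<N. fps_nth (free_times f g w) k \<noteq> 0)}"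
    using fin finite_subset by blast
qed

lemma admissible_add: "admissible f \<Longrightarrow> admissible g \<Longrightarrow> admissible (\<lambda>w. f w + g w)"
  unfolding admissible_def
proof
  fix N
  assume "\<forall>N. finite {w. low N w \<and> (\<exists>k<N. fps_nth (f w) k \<noteq> 0)}"
    and "\<forall>N. finite {w. low N w \<and> (\<exists>k<N. fps_nth (g w) k \<noteq> 0)}"
  then have "finite ({w. low N w \<and> (\<exists>k<N. fps_nth (f w) k \<noteq> 0)} \<union>
      {w. low N w \<and> (\<exists>k<N. fps_nth (g w) k \<noteq> 0)})" by blast
  then show "finite {w. low N w \<and> (\<exists>k<N. fps_nth (f w + g w) k \<noteq> 0)}"
    by (rule rev_finite_subset) auto
qed

typedef free_alg = "{f. admissible f}"
  by (rule exI[of _ "\<lambda>_. 0"]) (simp add: admissible_finite_support)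

setup_lifting type_definition_free_alg

lemma free_times_assoc: "free_times (free_times f g) h w = free_times f (free_times g h) w"
proof -
  have "free_times (free_times f g) h w =
      (\<Sum>i\<le>length w. \<Sum>j\<le>i. f (take j w) * g (drop j (take i w)) * h (drop i w))"
    unfolding free_times_def
    by (auto simp: sum_distrib_right min_def intro!: sum.cong)
  also have "\<dots> = (\<Sum>(i, j)\<in>Sigma {..length w} (\<lambda>i. {..i}).
      f (take j w) * g (drop j (take i w)) * h (drop i w))"
    by (rule sum.Sigma) auto
  also have "\<dots> = (\<Sum>(j, i)\<in>Sigma {..length w} (\<lambda>j. {..length w - j}).
      f (take j w) * (g (take i (drop j w)) * h (drop i (drop j w))))"
    by (rule sum.reindex_bij_witness[of _ "\<lambda>(j, i). (i + j, j)" "\<lambda>(i, j). (j, i - j)"])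
       (auto simp: drop_take mult.assoc)
  also have "\<dots> = (\<Sum>j\<le>length w. \<Sum>i\<le>length w - j.
      f (take j w) * (g (take i (drop j w)) * h (drop i (drop j w))))"
    by (rule sum.Sigma[symmetric]) auto
  also have "\<dots> = free_times f (free_times g h) w"
    unfolding free_times_def by (auto simp: sum_distrib_left intro!: sum.cong)
  finally show ?thesis .
qed

lemma free_times_scal_left: "free_times (\<lambda>w. if w = [] then c else 0) g w = c * g w"
proof -
  have "free_times (\<lambda>w. if w = [] then c else 0) g w = (\<Sum>i\<in>{0}. c * g (drop i w))"
    unfolding free_times_def by (rule sum.mono_neutral_cong_right) (auto simp: take_eq_Nil)
  then show ?thesis by simp
qed

lemma free_times_scal_right: "free_times g (\<lambda>w. if w = [] then c else 0) w = g w * c"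
proof -
  have "free_times g (\<lambda>w. if w = [] then c else 0) w = (\<Sum>i\<in>{length w}. g (take i w) * c)"
    unfolding free_times_def by (rule sum.mono_neutral_cong_right) auto
  then show ?thesis by simp
qed

instantiation free_alg :: ring_1
begin

lift_definition zero_free_alg :: free_alg is "\<lambda>_. 0"
  by (simp add: admissible_finite_support)

lift_definition one_free_alg :: free_alg is "\<lambda>w. if w = [] then 1 else 0"
  by (rule admissible_finite_support, rule finite_subset[of _ "{[]}"]) auto

lift_definition plus_free_alg :: "free_alg \<Rightarrow> free_alg \<Rightarrow> free_alg" is "\<lambda>f g w. f w + g w"
  by (rule admissible_add)

lift_definition uminus_free_alg :: "free_alg \<Rightarrow> free_alg" is "\<lambda>f w. - f w"
  by (simp add: admissible_def)

lift_definition minus_free_alg :: "free_alg \<Rightarrow> free_alg \<Rightarrow> free_alg" is "\<lambda>f g w. f w - g w"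
proof -
  fix f g assume "admissible f" "admissible g"
  then have "admissible (\<lambda>w. f w + (- g w))"
    by (intro admissible_add) (simp_all add: admissible_def)
  then show "admissible (\<lambda>w. f w - g w)" by simp
qed

lift_definition times_free_alg :: "free_alg \<Rightarrow> free_alg \<Rightarrow> free_alg" is free_times
  by (rule admissible_free_times)

instance
proof
  fix a b c :: free_alg
  show "a * b * c = a * (b * c)" by transfer (rule ext, rule free_times_assoc)
  show "1 * a = a" by transfer (rule ext, rule trans[OF free_times_scal_left], simp)
  show "a * 1 = a" by transfer (rule ext, rule trans[OF free_times_scal_right], simp)
  show "(a + b) * c = a * c + b * c"
    by transfer (auto simp: free_times_def distrib_right sum.distrib)
  show "a * (b + c) = a * b + a * c"
    by transfer (auto simp: free_times_def distrib_left sum.distrib)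
  show "(0::free_alg) \<noteq> 1" by transfer (metis zero_neq_one)
qed (transfer; simp add: algebra_simps)+

end

definition coef :: "free_alg \<Rightarrow> gen list \<Rightarrow> nat \<Rightarrow> complex" where
  "coef a w k = fps_nth (Rep_free_alg a w) k"

definition nbh0 :: "nat \<Rightarrow> free_alg set" where
  "nbh0 N = {a. \<forall>w. low N w \<longrightarrow> (\<forall>k<N. coef a w k = 0)}"

lemma coef_simps [simp]:
  "coef 0 w k = 0"
  "coef (a + b) w k = coef a w k + coef b w k"
  "coef (a - b) w k = coef a w k - coef b w k"
  by (simp_all add: coef_def zero_free_alg.rep_eq plus_free_alg.rep_eq minus_free_alg.rep_eq)

lemma coef_sum: "coef (sum f A) w k = (\<Sum>i\<in>A. coef (f i) w k)"
  by (induction A rule: infinite_finite_induct) simp_all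

lemma free_alg_eqI: "(\<And>w k. coef a w k = coef b w k) \<Longrightarrow> a = b"
  by (metis Rep_free_alg_inject coef_def ext fps_ext)

lemma nbh0_antimono: "N \<le> M \<Longrightarrow> nbh0 M \<subseteq> nbh0 N"
  unfolding nbh0_def using low_mono by (fastforce dest: order_less_le_trans)

lemma nbh0_zero [simp]: "0 \<in> nbh0 N"
  by (simp add: nbh0_def)

lemma nbh0_add: "a \<in> nbh0 N \<Longrightarrow> b \<in> nbh0 N \<Longrightarrow> a + b \<in> nbh0 N"
  by (simp add: nbh0_def)

lemma ex_low: "\<exists>N>k. low N w"
proof -
  let ?M = "Max ((\<lambda>i. wdeg (drop i w)) ` {..length w})"
  have "\<forall>i\<le>length w. wdeg (drop i w) \<le> ?M" by (auto intro!: Max_ge)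
  then have "low (Suc k + nat (?M + 1)) w" unfolding low_def by (smt (verit) int_nat_eq of_nat_add of_nat_0_le_iff)
  then show ?thesis by (intro exI[of _ "Suc k + nat (?M + 1)"]) simp
qed

instantiation free_alg :: t2_space
begin

definition open_free_alg :: "free_alg set \<Rightarrow> bool" where
  "open_free_alg S \<longleftrightarrow> (\<forall>a\<in>S. \<exists>N. \<forall>b. b - a \<in> nbh0 N \<longrightarrow> b \<in> S)"

instance
proof
  show "open (UNIV :: free_alg set)" by (simp add: open_free_alg_def)
next
  fix S T :: "free_alg set" assume S: "open S" and T: "open T"
  show "open (S \<inter> T)"
    unfolding open_free_alg_def
  proof
    fix a assume "a \<in> S \<inter> T"
    then obtain N M where "\<forall>b. b - a \<in> nbh0 N \<longrightarrow> b \<in> S" "\<forall>b. b - a \<in> nbh0 M \<longrightarrow> b \<in> T"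
      using S T unfolding open_free_alg_def by blast
    then show "\<exists>N. \<forall>b. b - a \<in> nbh0 N \<longrightarrow> b \<in> S \<inter> T"
      using nbh0_antimono[of N "max N M"] nbh0_antimono[of M "max N M"]
      by (intro exI[of _ "max N M"]) auto
  qed
next
  fix K :: "free_alg set set" assume "\<forall>S\<in>K. open S"
  then show "open (\<Union>K)" unfolding open_free_alg_def by (meson UnionE UnionI)
next
  fix x y :: free_alg assume "x \<noteq> y"
  then obtain w k where wk: "coef x w k \<noteq> coef y w k" using free_alg_eqI by blast
  obtain N where N: "N > k" "low N w" using ex_low by blast
  have op: "open {b. b - a \<in> nbh0 N}" for a
    unfolding open_free_alg_def
  proof (intro ballI exI[of _ N] allI impI)
    fix c b assume "c \<in> {b. b - a \<in> nbh0 N}" and "b - c \<in> nbh0 N"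
    then have "(c - a) + (b - c) \<in> nbh0 N" by (intro nbh0_add) simp_all
    then show "b \<in> {b. b - a \<in> nbh0 N}" by (simp add: algebra_simps)
  qed
  have "False" if b: "b - x \<in> nbh0 N" "b - y \<in> nbh0 N" for b
  proof -
    have "coef b w k = coef x w k" "coef b w k = coef y w k"
      using b N unfolding nbh0_def by force+
    then show False using wk by simp
  qed
  then have "{b. b - x \<in> nbh0 N} \<inter> {b. b - y \<in> nbh0 N} = {}" by blast
  then show "\<exists>U V. open U \<and> open V \<and> x \<in> U \<and> y \<in> V \<and> U \<inter> V = {}"
    using op by (intro exI[of _ "{b. b - x \<in> nbh0 N}"] exI[of _ "{b. b - y \<in> nbh0 N}"]) simp
qed

end

lemma summable_on_free_alg:
  fixes f :: "'i \<Rightarrow> free_alg"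
  assumes fin: "\<And>N. finite {i \<in> A. f i \<notin> nbh0 N}"
  shows "f summable_on A"
proof -
  define S where "S N = {i \<in> A. f i \<notin> nbh0 N}" for N
  define L where "L w = Abs_fps (\<lambda>k. \<Sum>i | i \<in> A \<and> coef (f i) w k \<noteq> 0. coef (f i) w k)" for w
  have sub: "{i \<in> A. coef (f i) w k \<noteq> 0} \<subseteq> S N" if "low N w" "k < N" for N w k
    using that by (auto simp: S_def nbh0_def)
  have L: "fps_nth (L w) k = coef (sum f F) w k"
    if "low N w" "k < N" "S N \<subseteq> F" "finite F" "F \<subseteq> A" for N w k F
  proof -
    have "(\<Sum>i | i \<in> A \<and> coef (f i) w k \<noteq> 0. coef (f i) w k) = (\<Sum>i\<in>F. coef (f i) w k)"
      using sub[OF that(1,2)] that by (intro sum.mono_neutral_left) auto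
    then show ?thesis by (simp add: L_def coef_sum)
  qed
  have SA: "S N \<subseteq> A" and SF: "finite (S N)" for N using fin by (auto simp: S_def)
  have "admissible L"
    unfolding admissible_def
  proof
    fix N
    have "finite {w. low N w \<and> (\<exists>k<N. fps_nth (Rep_free_alg (sum f (S N)) w) k \<noteq> 0)}"
      using Rep_free_alg[of "sum f (S N)"] by (auto simp: admissible_def)
    then show "finite {w. low N w \<and> (\<exists>k<N. fps_nth (L w) k \<noteq> 0)}"
      by (rule rev_finite_subset) (use L[OF _ _ order_refl SF SA] in \<open>auto simp: coef_def\<close>)
  qed
  then have cL: "coef (Abs_free_alg L) w k = fps_nth (L w) k" for w k
    by (simp add: coef_def Abs_free_alg_inverse)
  have "(f has_sum Abs_free_alg L) A"
    unfolding has_sum_def tendsto_def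
  proof (intro allI impI)
    fix T assume "open T" "Abs_free_alg L \<in> T"
    then obtain N where N: "\<And>b. b - Abs_free_alg L \<in> nbh0 N \<Longrightarrow> b \<in> T"
      unfolding open_free_alg_def by blast
    show "\<forall>\<^sub>F F in finite_subsets_at_top A. sum f F \<in> T"
      unfolding eventually_finite_subsets_at_top
      by (intro exI[of _ "S N"] conjI allI impI SF SA N) (auto simp: nbh0_def cL L)
  qed
  then show ?thesis by (auto simp: summable_on_def)
qed

lift_definition scal :: "complex fps \<Rightarrow> free_alg" is "\<lambda>c w. if w = [] then c else 0"
  by (rule admissible_finite_support, rule finite_subset[of _ "{[]}"]) auto

lift_definition letter :: "gen \<Rightarrow> free_alg" is "\<lambda>x w. if w = [x] then 1 else 0"
  subgoal for x by (rule admissible_finite_support, rule finite_subset[of _ "{[x]}"]) auto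
  done

definition cc :: "complex \<Rightarrow> free_alg" where
  "cc c = scal (fps_const c)"

definition pp :: free_alg where
  "pp = scal fps_X"

definition alpha :: "int \<Rightarrow> free_alg" where
  "alpha m = letter (Alpha m)"

text \<open>\<open>gam k\<close> is $\gamma^{k/2}$.\<close>

definition gam :: "int \<Rightarrow> free_alg" where
  "gam k = (if k \<ge> 0 then letter GammaHalf ^ nat k else letter GammaHalfInv ^ nat (- k))"

definition pstar :: free_alg where
  "pstar = pp * gam (- 4)"


section \<open>Formal Laurent series\<close>

text \<open>
  A formal Laurent series is its family of coefficients, indexed by exponents: \<open>int\<close> for one
  variable, \<open>var \<Rightarrow> int\<close> for series in $z,w,u$ (\<open>Zv\<close>, \<open>Wv\<close>, \<open>Uv\<close>).  Sums of series are pointwise,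
  products are given by \<open>\<star>\<close> (not by \<open>*\<close>, which is pointwise on functions); the infinite sums are
  taken in the topology of \<open>free_alg\<close>.
\<close>

type_synonym 'm series = "'m \<Rightarrow> free_alg"

datatype var = Zv | Wv | Uv

definition smult :: "('m::ab_group_add) series \<Rightarrow> 'm series \<Rightarrow> 'm series" (infixl "\<star>" 70) where
  "F \<star> G = (\<lambda>m. \<Sum>\<^sub>\<infinity>k. F k * G (m - k))"

definition mono_ser :: "'m \<Rightarrow> 'm series" where
  "mono_ser e = (\<lambda>m. if m = e then 1 else 0)"

definition const_ser :: "free_alg \<Rightarrow> ('m::ab_group_add) series" where
  "const_ser a = (\<lambda>m. if m = 0 then a else 0)"

definition vexp :: "var \<Rightarrow> int \<Rightarrow> var \<Rightarrow> int" where
  "vexp v k = (\<lambda>v'. if v' = v then k else 0)"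

text \<open>\<open>at_var X v\<close> is $X(v)$, and \<open>at_ratio X v v'\<close> is $X(v/v')$ for distinct variables.\<close>

definition at_var :: "int series \<Rightarrow> var \<Rightarrow> (var \<Rightarrow> int) series" where
  "at_var X v = (\<lambda>m. if m = vexp v (m v) then X (m v) else 0)"

definition at_ratio :: "int series \<Rightarrow> var \<Rightarrow> var \<Rightarrow> (var \<Rightarrow> int) series" where
  "at_ratio X v v' = (\<lambda>m. if m = vexp v (m v) - vexp v' (m v) then X (m v) else 0)"

text \<open>\<open>dilate k X\<close> is $X(\gamma^{k/2}z)$.\<close>

definition dilate :: "int \<Rightarrow> int series \<Rightarrow> int series" where
  "dilate k X = (\<lambda>n. gam (k * n) * X n)"

definition delta :: "int series" where
  "delta = (\<lambda>_. 1)"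

definition in_pos :: "free_alg fps \<Rightarrow> int series" where
  "in_pos F = (\<lambda>n. if n \<ge> 0 then fps_nth F (nat n) else 0)"

definition in_neg :: "free_alg fps \<Rightarrow> int series" where
  "in_neg F = (\<lambda>n. if n \<le> 0 then fps_nth F (nat (- n)) else 0)"

text \<open>$\exp\big(\sum_{m>0} a_m x^m\big)$; the value of \<open>a 0\<close> is irrelevant\<close>

definition exp_sum :: "(nat \<Rightarrow> free_alg) \<Rightarrow> free_alg fps" where
  "exp_sum a = Abs_fps (\<lambda>n. cc (1 / fact n)) oo Abs_fps (\<lambda>m. if m = 0 then 0 else a m)"

text \<open>$1/(1-s)$ for $s\in\{p^m,p^{*m}\}$\<close>

definition geo :: "free_alg \<Rightarrow> free_alg" where
  "geo s = (\<Sum>\<^sub>\<infinity>k. s ^ k)"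


section \<open>Structure functions\<close>

definition kappa :: "complex \<Rightarrow> complex \<Rightarrow> int \<Rightarrow> complex" where
  "kappa q t m = (1 - q powi m) * (1 - t powi (- m)) * (1 - (t / q) powi m)"

text \<open>\<open>Gpol q t 1\<close> is $G^+$ and \<open>Gpol q t (- 1)\<close> is $G^-$.\<close>

definition Gpol :: "complex \<Rightarrow> complex \<Rightarrow> int \<Rightarrow> int series" where
  "Gpol q t e = in_pos
    ((1 - fps_const (cc (q powi e)) * fps_X) *
     (1 - fps_const (cc (t powi (- e))) * fps_X) *
     (1 - fps_const (cc ((q / t) powi (- e))) * fps_X))"

text \<open>
  \<open>gser q t r\<close> is $\exp\big(\sum_{m>0}\frac{\kappa_m}{m}r_m z^m\big)$, so that $g(z;s)$ is the case
  $r_m=\frac{s^m}{1-s^m}$ and $g(z)$ the case $r_m=1$.  The inverse of such a series is obtained by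
  changing the sign of the exponent.  For $s=\gamma^2$ one has
  $\frac{\gamma^{2m}}{1-\gamma^{2m}}=-\gamma^m\,(\gamma^m-\gamma^{-m})^{-1}$.
\<close>

definition gser :: "complex \<Rightarrow> complex \<Rightarrow> (nat \<Rightarrow> free_alg) \<Rightarrow> int series" where
  "gser q t r = in_pos (exp_sum (\<lambda>m. cc (kappa q t (int m) / of_nat m) * r m))"

definition gser_inv :: "complex \<Rightarrow> complex \<Rightarrow> (nat \<Rightarrow> free_alg) \<Rightarrow> int series" where
  "gser_inv q t r = in_pos (exp_sum (\<lambda>m. - (cc (kappa q t (int m) / of_nat m) * r m)))"

definition r_one :: "nat \<Rightarrow> free_alg" where
  "r_one m = 1"

definition r_p :: "nat \<Rightarrow> free_alg" where
  "r_p m = pp ^ m * geo (pp ^ m)"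

definition r_pstar :: "nat \<Rightarrow> free_alg" where
  "r_pstar m = pstar ^ m * geo (pstar ^ m)"

definition r_gam2 :: "nat \<Rightarrow> free_alg" where
  "r_gam2 m = - (gam (2 * int m) * letter (DiffInv m))"

text \<open>
  \<open>pratio m\<close> is $\frac{1-p^m}{1-p^{*m}}$ and \<open>pratio_inv m\<close> its inverse, for $m\neq 0$.  For $m<0$,
  $p^m/p^{*m}=\gamma^{2m}$ gives
  $\frac{1-p^m}{1-p^{*m}}=\gamma^{2m}\,\frac{1-p^{|m|}}{1-p^{*|m|}}$.
\<close>

definition pratio :: "int \<Rightarrow> free_alg" where
  "pratio m = (if m > 0 then 1 else gam (4 * m)) *
     (1 - pp ^ nat \<bar>m\<bar>) * geo (pstar ^ nat \<bar>m\<bar>)"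

definition pratio_inv :: "int \<Rightarrow> free_alg" where
  "pratio_inv m = (if m > 0 then 1 else gam (- 4 * m)) *
     (1 - pstar ^ nat \<bar>m\<bar>) * geo (pp ^ nat \<bar>m\<bar>)"

definition alpha' :: "int \<Rightarrow> free_alg" where
  "alpha' m = pratio_inv m * gam (2 * m) * alpha m"

definition const_C :: "complex \<Rightarrow> complex \<Rightarrow> free_alg" where
  "const_C q t = cc ((1 - q) * (1 - 1 / t) / (1 - q / t))"

text \<open>$\frac wu+\frac wz-\frac zw-\frac uw$\<close>

definition bracket :: "var \<Rightarrow> var \<Rightarrow> var \<Rightarrow> (var \<Rightarrow> int) series" where
  "bracket z w u =
     mono_ser (vexp w 1 - vexp u 1) + mono_ser (vexp w 1 - vexp z 1)
     - mono_ser (vexp z 1 - vexp w 1) - mono_ser (vexp u 1 - vexp w 1)"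

definition perm_sum ::
  "(var \<Rightarrow> var \<Rightarrow> var \<Rightarrow> (var \<Rightarrow> int) series) \<Rightarrow> (var \<Rightarrow> int) series" where
  "perm_sum T = (\<Sum>\<sigma> | \<sigma> permutes {Zv, Wv, Uv}. T (\<sigma> Zv) (\<sigma> Wv) (\<sigma> Uv))"


section \<open>The elliptic quantum toroidal algebra\<close>

definition x_plus :: "int series" where
  "x_plus = (\<lambda>k. letter (Xplus (- k)))"

definition x_minus :: "int series" where
  "x_minus = (\<lambda>k. letter (Xminus (- k)))"

definition psi_plus :: "int series" where
  "psi_plus = const_ser (letter Psi0p) \<star>
     in_pos (exp_sum (\<lambda>m. - (pp ^ m * geo (pp ^ m) * alpha (- int m) * gam (- int m)))) \<star>
     in_neg (exp_sum (\<lambda>m. geo (pp ^ m) * alpha (int m) * gam (int m)))"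

definition psi_minus :: "int series" where
  "psi_minus = const_ser (letter Psi0m) \<star>
     in_pos (exp_sum (\<lambda>m. - (geo (pp ^ m) * alpha (- int m) * gam (int m)))) \<star>
     in_neg (exp_sum (\<lambda>m. pp ^ m * geo (pp ^ m) * alpha (int m) * gam (- int m)))"

text \<open>Equality modulo an ideal, for elements and coefficientwise for series.\<close>

definition elt_eq :: "free_alg \<Rightarrow> free_alg set \<Rightarrow> free_alg \<Rightarrow> bool"
    ("(_/ \<simeq>\<^bsub>_\<^esub>/ _)" [51, 0, 51] 50) where
  "a \<simeq>\<^bsub>I\<^esub> b \<longleftrightarrow> a - b \<in> I"

definition ser_eq :: "'m series \<Rightarrow> free_alg set \<Rightarrow> 'm series \<Rightarrow> bool"
    ("(_/ \<approx>\<^bsub>_\<^esub>/ _)" [51, 0, 51] 50) where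
  "F \<approx>\<^bsub>I\<^esub> G \<longleftrightarrow> (\<forall>m. F m \<simeq>\<^bsub>I\<^esub> G m)"

definition ell_relations :: "complex \<Rightarrow> complex \<Rightarrow> free_alg set \<Rightarrow> bool" where
  "ell_relations q t I \<longleftrightarrow>
    alpha 0 \<simeq>\<^bsub>I\<^esub> 0 \<and> letter (DiffInv 0) \<simeq>\<^bsub>I\<^esub> 0 \<and>
    letter Psi0p * letter Psi0pInv \<simeq>\<^bsub>I\<^esub> 1 \<and> letter Psi0pInv * letter Psi0p \<simeq>\<^bsub>I\<^esub> 1 \<and>
    letter Psi0m * letter Psi0mInv \<simeq>\<^bsub>I\<^esub> 1 \<and> letter Psi0mInv * letter Psi0m \<simeq>\<^bsub>I\<^esub> 1 \<and>
    letter GammaHalf * letter GammaHalfInv \<simeq>\<^bsub>I\<^esub> 1 \<and>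
    letter GammaHalfInv * letter GammaHalf \<simeq>\<^bsub>I\<^esub> 1 \<and>
    (\<forall>n>0. (gam (2 * int n) - gam (- 2 * int n)) * letter (DiffInv n) \<simeq>\<^bsub>I\<^esub> 1 \<and>
           letter (DiffInv n) * (gam (2 * int n) - gam (- 2 * int n)) \<simeq>\<^bsub>I\<^esub> 1) \<and>
    (\<forall>a. letter Psi0p * a \<simeq>\<^bsub>I\<^esub> a * letter Psi0p \<and>
         letter Psi0m * a \<simeq>\<^bsub>I\<^esub> a * letter Psi0m \<and>
         letter GammaHalf * a \<simeq>\<^bsub>I\<^esub> a * letter GammaHalf) \<and>
    (\<forall>m n. m \<noteq> 0 \<longrightarrow> n \<noteq> 0 \<longrightarrow>
       alpha m * alpha n - alpha n * alpha m \<simeq>\<^bsub>I\<^esub>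
       (if m + n = 0
        then - (cc (kappa q t m / of_int m) * (gam (2 * m) - gam (- 2 * m)) * gam (- 2 * m) * pratio m)
        else 0)) \<and>
    (\<forall>m. m \<noteq> 0 \<longrightarrow>
       const_ser (alpha m) \<star> x_plus - x_plus \<star> const_ser (alpha m) \<approx>\<^bsub>I\<^esub>
       const_ser (- (cc (kappa q t m / of_int m) * pratio m * gam (- 3 * m))) \<star> mono_ser m \<star> x_plus) \<and>
    (\<forall>m. m \<noteq> 0 \<longrightarrow>
       const_ser (alpha m) \<star> x_minus - x_minus \<star> const_ser (alpha m) \<approx>\<^bsub>I\<^esub>
       const_ser (cc (kappa q t m / of_int m) * gam (- m)) \<star> mono_ser m \<star> x_minus) \<and>
    at_var x_plus Zv \<star> at_var x_minus Wv - at_var x_minus Wv \<star> at_var x_plus Zv \<approx>\<^bsub>I\<^esub>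
      const_ser (const_C q t) \<star>
        (at_ratio (dilate (- 2) delta) Zv Wv \<star> at_var psi_plus Wv
         - at_ratio (dilate 2 delta) Zv Wv \<star> at_var (dilate (- 2) psi_minus) Wv) \<and>
    mono_ser (vexp Zv 3) \<star> at_ratio (Gpol q t 1) Wv Zv \<star> at_ratio (gser q t r_pstar) Wv Zv
        \<star> at_var x_plus Zv \<star> at_var x_plus Wv \<approx>\<^bsub>I\<^esub>
      - (mono_ser (vexp Wv 3) \<star> at_ratio (Gpol q t 1) Zv Wv \<star> at_ratio (gser q t r_pstar) Zv Wv
        \<star> at_var x_plus Wv \<star> at_var x_plus Zv) \<and>
    mono_ser (vexp Zv 3) \<star> at_ratio (Gpol q t (- 1)) Wv Zv \<star> at_ratio (gser_inv q t r_p) Wv Zv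
        \<star> at_var x_minus Zv \<star> at_var x_minus Wv \<approx>\<^bsub>I\<^esub>
      - (mono_ser (vexp Wv 3) \<star> at_ratio (Gpol q t (- 1)) Zv Wv \<star> at_ratio (gser_inv q t r_p) Zv Wv
        \<star> at_var x_minus Wv \<star> at_var x_minus Zv) \<and>
    perm_sum (\<lambda>z w u.
        at_ratio (gser q t r_pstar) w z \<star> at_ratio (gser q t r_pstar) u w
        \<star> at_ratio (gser q t r_pstar) u z \<star> bracket z w u
        \<star> at_var x_plus z \<star> at_var x_plus w \<star> at_var x_plus u) \<approx>\<^bsub>I\<^esub> 0 \<and>
    perm_sum (\<lambda>z w u.
        at_ratio (gser_inv q t r_p) w z \<star> at_ratio (gser_inv q t r_p) u w
        \<star> at_ratio (gser_inv q t r_p) u z \<star> bracket z w u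
        \<star> at_var x_minus z \<star> at_var x_minus w \<star> at_var x_minus u) \<approx>\<^bsub>I\<^esub> 0"

definition two_sided_ideal :: "free_alg set \<Rightarrow> bool" where
  "two_sided_ideal I \<longleftrightarrow> 0 \<in> I \<and> (\<forall>a\<in>I. \<forall>b\<in>I. a - b \<in> I) \<and>
    (\<forall>a\<in>I. \<forall>r. r * a \<in> I \<and> a * r \<in> I)"

text \<open>
  $\mathcal U_{q,t,p}$, with the elements $\gamma^n-\gamma^{-n}$ inverted and completed as above, is
  the quotient of \<open>free_alg\<close> by \<open>ell_ideal q t\<close>, the smallest closed two-sided ideal modulo which
  the defining relations hold.  An identity in $\mathcal U_{q,t,p}$ is an
  identity modulo this ideal.
\<close>

definition ell_ideal :: "complex \<Rightarrow> complex \<Rightarrow> free_alg set" where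
  "ell_ideal q t = \<Inter>{I. two_sided_ideal I \<and> closed I \<and> ell_relations q t I}"

lemma two_sided_ideal_ell_ideal: "two_sided_ideal (ell_ideal q t)"
  unfolding two_sided_ideal_def ell_ideal_def by blast

lemma closed_ell_ideal: "closed (ell_ideal q t)"
  unfolding ell_ideal_def by (rule closed_Inter) blast

lemma ell_relations_ell_ideal: "ell_relations q t (ell_ideal q t)"
  unfolding ell_ideal_def ell_relations_def ser_eq_def elt_eq_def
  by (intro conjI allI impI InterI; drule CollectD; elim conjE; simp only: simp_thms)


section \<open>The currents $\mathcal Z^\pm(z)$\<close>

definition E_plus :: "int series" where
  "E_plus = in_neg (exp_sum (\<lambda>n. letter (DiffInv n) * alpha (int n) * gam (int n)))"

definition E_minus :: "int series" where
  "E_minus = in_pos (exp_sum (\<lambda>n. - (letter (DiffInv n) * alpha (- int n) * gam (- int n))))"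

definition E'_plus :: "int series" where
  "E'_plus = in_neg (exp_sum (\<lambda>n. - (letter (DiffInv n) * alpha' (int n) * gam (int n))))"

definition E'_minus :: "int series" where
  "E'_minus = in_pos (exp_sum (\<lambda>n. letter (DiffInv n) * alpha' (- int n) * gam (- int n)))"

definition Z_plus :: "int series" where
  "Z_plus = E_minus \<star> x_plus \<star> E_plus"

definition Z_minus :: "int series" where
  "Z_minus = E'_minus \<star> x_minus \<star> E'_plus"

end

theory Submission imports Defs
begin

text \<open>
  Since $[\alpha_m, x^\pm(z)]$ is a scalar multiple of $z^m x^\pm(z)$, moving the half vertex
  operator $E^-(w)$ to the left through $x(z)$ produces a scalar series in $w/z$.  Moving $E^+(z)$
  to the right through $E^-(w)x(w)$ produces two scalar series that cancel.  Hence
  $Z(z)Z(w) = S(w/z)\,E^-(z)E^-(w)\,x(z)x(w)\,E^+(z)E^+(w)$, and the structure functions on the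
  left of the relations for $Z$ times $S$ are the structure functions in the relations for $x$.
  The outer operators do not depend on the order of the variables, so the quadratic and the cubic
  relations follow.  In the mixed relation the structure functions cancel $S$, the delta functions
  identify $z$ with a power of $\gamma$ times $w$, and then the half vertex operators cancel those
  in $\psi^\pm$.

  The products are formal series in several variables whose coefficients are infinite sums.
  They may be rebracketed because the coefficient of a monomial is homogeneous of degree minus
  that of the monomial, so that modulo a neighbourhood of zero only finitely many exponents
  contribute.
\<close>

section \<open>Summable families\<close>

text \<open>The neighbourhoods of zero are left ideals only, so multiplication on the right is
  controlled only for homogeneous factors, and every rebracketing needs a convergence check. That
  check is made mechanical: a factor is a series paired with the shape of its support, and a
  criterion on lists of shapes is evaluated by the simplifier. Calculations then become chains of
  local rewritings of lists modulo the closed ideal. The cancellation of the two scalar series is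
  due to the exponents 1/(\<gamma>^n - \<gamma>^(-n)): with them E^-(w) x(w) commutes with every
  mode \<alpha>_n, n > 0. Scalars are computed in the center of the quotient, a commutative ring,
  where everything reduces to eight identities between p^n, p*^n, \<gamma>^(n/2) and inverses.
  Exponentials are handled through a first order differential equation: comparing coefficients gives
  recursions from which the exchange rules follow by induction.\<close>

lemma coef_times:
  "coef (a * b) w k =
    (\<Sum>i\<le>length w. \<Sum>j\<le>k. coef a (take i w) j * coef b (drop i w) (k - j))"
  by (simp add: coef_def times_free_alg.rep_eq free_times_def fps_sum_nth fps_mult_nth atLeast0AtMost)

lemma coef_uminus [simp]: "coef (- a) w k = - coef a w k"
  by (simp add: coef_def uminus_free_alg.rep_eq)

lemma nbh0_diff: "a \<in> nbh0 N \<Longrightarrow> b \<in> nbh0 N \<Longrightarrow> a - b \<in> nbh0 N"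
  by (simp add: nbh0_def)

lemma nbh0_sum: "(\<And>i. i \<in> A \<Longrightarrow> f i \<in> nbh0 N) \<Longrightarrow> sum f A \<in> nbh0 N"
  by (induction A rule: infinite_finite_induct) (auto intro: nbh0_add)

text \<open>A suffix of a \<open>low\<close> word is \<open>low\<close>, so the right factor of
  every term already vanishes. There is no such argument on the other side, because a prefix need
  not be \<open>low\<close>.\<close>

lemma nbh0_left_mult:
  assumes "a \<in> nbh0 N"
  shows "r * a \<in> nbh0 N"
  unfolding nbh0_def
proof (intro CollectI allI impI)
  fix w k assume w: "low N w" and k: "k < N"
  have "coef a (drop i w) (k - j) = 0" for i j
    using assms low_suffix[of N "take i w" "drop i w"] w k unfolding nbh0_def by auto
  then show "coef (r * a) w k = 0" unfolding coef_times by (intro sum.neutral ballI) simp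
qed

lemma nbh0_Inter: "(\<And>N. a \<in> nbh0 N) \<Longrightarrow> a = 0"
  by (rule free_alg_eqI) (use ex_low in \<open>force simp: nbh0_def\<close>)

text \<open>The hypothesis of \<open>summable_on_free_alg\<close> as a predicate. Unlike mere
  summability, it is uniform enough to rearrange double sums.\<close>

definition null_family :: "('i \<Rightarrow> free_alg) \<Rightarrow> 'i set \<Rightarrow> bool" where
  "null_family f A \<longleftrightarrow> (\<forall>N. finite {i \<in> A. f i \<notin> nbh0 N})"

lemma null_familyD: "null_family f A \<Longrightarrow> finite {i \<in> A. f i \<notin> nbh0 N}"
  by (simp add: null_family_def)

text \<open>Each word and each power of \<open>p\<close> is seen by some \<open>nbh0 N\<close>, so a
  single coefficient is locally constant and its zero set is closed.\<close>

lemma closed_coef_vanish: "closed {a. \<forall>w k. P w k \<longrightarrow> coef a w k = 0}"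
proof -
  have "open (- {a. \<forall>w k. P w k \<longrightarrow> coef a w k = 0})"
    unfolding open_free_alg_def
  proof
    fix a assume "a \<in> - {a. \<forall>w k. P w k \<longrightarrow> coef a w k = 0}"
    then obtain w k where a: "P w k" "coef a w k \<noteq> 0" by auto
    obtain N where N: "N > k" "low N w" using ex_low by blast
    then have "coef b w k = coef a w k" if "b - a \<in> nbh0 N" for b
      using that unfolding nbh0_def by auto
    then have "b \<in> - {a. \<forall>w k. P w k \<longrightarrow> coef a w k = 0}" if "b - a \<in> nbh0 N" for b
      using a that by (metis (mono_tags, lifting) ComplI mem_Collect_eq)
    then show "\<exists>N. \<forall>b. b - a \<in> nbh0 N \<longrightarrow> b \<in> - {a. \<forall>w k. P w k \<longrightarrow> coef a w k = 0}"
      by blast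
  qed
  then show ?thesis by (simp add: closed_def)
qed

text \<open>A summable family has a limit of finite sums as its value; for any other family
  \<open>infsum\<close> takes the default value 0, which lies in \<open>S\<close> too.\<close>

lemma infsum_in_closed:
  fixes f :: "'i \<Rightarrow> free_alg"
  assumes S: "closed S" "0 \<in> S" "\<And>a b. a \<in> S \<Longrightarrow> b \<in> S \<Longrightarrow> a + b \<in> S"
    and f: "\<And>i. i \<in> A \<Longrightarrow> f i \<in> S"
  shows "infsum f A \<in> S"
proof (cases "f summable_on A")
  case True
  have fin: "sum f F \<in> S" if "F \<subseteq> A" "finite F" for F
    using that(2,1) by (induction F) (auto intro: S f)
  have "(sum f \<longlongrightarrow> infsum f A) (finite_subsets_at_top A)"
    using True has_sum_def has_sum_infsum by blast
  moreover have "\<forall>\<^sub>F F in finite_subsets_at_top A. sum f F \<in> S"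
    by (rule eventually_finite_subsets_at_top_weakI) (rule fin)
  ultimately show ?thesis
    using Lim_in_closed_set[OF S(1)] finite_subsets_at_top_neq_bot by blast
next
  case False
  then show ?thesis using S by (simp add: infsum_not_exists)
qed

text \<open>Enlarging \<open>F\<close> to a set that is good enough for the limit adds only terms in
  \<open>nbh0 N\<close>. So the sum can be read off modulo \<open>nbh0 N\<close> from any finite set
  containing the exceptional indices.\<close>

lemma infsum_approx:
  assumes f: "null_family f A" and F: "finite F" "F \<subseteq> A" "{i \<in> A. f i \<notin> nbh0 N} \<subseteq> F"
  shows "infsum f A - sum f F \<in> nbh0 N"
proof -
  let ?s = "infsum f A"
  have "f summable_on A"
    by (rule summable_on_free_alg) (rule null_familyD[OF f])
  then have lim: "(sum f \<longlongrightarrow> ?s) (finite_subsets_at_top A)"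
    using has_sum_def has_sum_infsum by blast
  have "open {b. b - ?s \<in> nbh0 N}"
    unfolding open_free_alg_def
  proof (intro ballI exI[of _ N] allI impI)
    fix c b assume "c \<in> {b. b - ?s \<in> nbh0 N}" and "b - c \<in> nbh0 N"
    then have "(c - ?s) + (b - c) \<in> nbh0 N" by (intro nbh0_add) simp_all
    then show "b \<in> {b. b - ?s \<in> nbh0 N}" by (simp add: algebra_simps)
  qed
  from topological_tendstoD[OF lim this]
  have "\<forall>\<^sub>F G in finite_subsets_at_top A. sum f G - ?s \<in> nbh0 N" by simp
  then have "\<exists>G. finite G \<and> G \<subseteq> A \<and>
      (\<forall>Y. finite Y \<and> G \<subseteq> Y \<and> Y \<subseteq> A \<longrightarrow> sum f Y - ?s \<in> nbh0 N)"
    unfolding eventually_finite_subsets_at_top .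
  then obtain G where G: "finite G" "G \<subseteq> A"
    and GG: "\<And>Y. finite Y \<Longrightarrow> G \<subseteq> Y \<Longrightarrow> Y \<subseteq> A \<Longrightarrow> sum f Y - ?s \<in> nbh0 N"
    by metis
  have 1: "sum f (F \<union> G) - ?s \<in> nbh0 N" by (rule GG) (use F G in auto)
  have 2: "sum f (G - F) \<in> nbh0 N" by (rule nbh0_sum) (use F G in auto)
  have "sum f (F \<union> G) = sum f F + sum f (G - F)"
    using F G by (subst sum.union_disjoint[symmetric]) auto
  then have "?s - sum f F = sum f (G - F) - (sum f (F \<union> G) - ?s)" by simp
  then show ?thesis using nbh0_diff[OF 2 1] by (simp only:)
qed

text \<open>The neighbourhoods intersect in 0, so it suffices to identify the sum modulo each of
  them by one finite partial sum.\<close>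

lemma infsum_eqI_null:
  assumes f: "null_family f A"
    and s: "\<And>N. \<exists>F. finite F \<and> F \<subseteq> A \<and> {i \<in> A. f i \<notin> nbh0 N} \<subseteq> F \<and> s - sum f F \<in> nbh0 N"
  shows "infsum f A = s"
proof -
  have "s - infsum f A \<in> nbh0 N" for N
  proof -
    from s[of N] obtain F where F: "finite F" "F \<subseteq> A" "{i \<in> A. f i \<notin> nbh0 N} \<subseteq> F"
      "s - sum f F \<in> nbh0 N" by blast
    from nbh0_diff[OF F(4) infsum_approx[OF f F(1-3)]] show ?thesis by simp
  qed
  from nbh0_Inter[OF this] show ?thesis by simp
qed

lemma null_family_left_mult: "null_family f A \<Longrightarrow> null_family (\<lambda>i. a * f i) A"
  unfolding null_family_def
  by (intro allI, rule finite_subset[of _ "{i \<in> A. f i \<notin> nbh0 N}" for N]) (auto intro: nbh0_left_mult)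

lemma infsum_left_mult:
  assumes "null_family f A"
  shows "(\<Sum>\<^sub>\<infinity>i\<in>A. a * f i) = a * infsum f A"
proof (rule infsum_eqI_null[OF null_family_left_mult[OF assms]])
  fix N
  let ?F = "{i \<in> A. f i \<notin> nbh0 N}"
  have "a * (infsum f A - sum f ?F) \<in> nbh0 N"
    by (intro nbh0_left_mult infsum_approx[OF assms] null_familyD[OF assms]) auto
  then show "\<exists>F. finite F \<and> F \<subseteq> A \<and> {i \<in> A. a * f i \<notin> nbh0 N} \<subseteq> F \<and>
      a * infsum f A - (\<Sum>i\<in>F. a * f i) \<in> nbh0 N"
    by (intro exI[of _ ?F] conjI null_familyD[OF assms])
       (auto simp: sum_distrib_left right_diff_distrib intro: nbh0_left_mult)
qed

lemma null_family_add:
  assumes "null_family f A" "null_family g A"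
  shows "null_family (\<lambda>i. f i + g i) A"
  unfolding null_family_def
proof
  fix N
  show "finite {i \<in> A. f i + g i \<notin> nbh0 N}"
    by (rule finite_subset[OF _ finite_UnI[OF null_familyD[OF assms(1)] null_familyD[OF assms(2)]]])
       (auto intro: nbh0_add)
qed

lemma infsum_add_null:
  assumes f: "null_family f A" and g: "null_family g A"
  shows "(\<Sum>\<^sub>\<infinity>i\<in>A. f i + g i) = infsum f A + infsum g A"
proof (rule infsum_eqI_null[OF null_family_add[OF f g]])
  fix N
  let ?F = "{i \<in> A. f i \<notin> nbh0 N} \<union> {i \<in> A. g i \<notin> nbh0 N}"
  have fin: "finite ?F" using null_familyD[OF f] null_familyD[OF g] by blast
  have "(infsum f A - sum f ?F) + (infsum g A - sum g ?F) \<in> nbh0 N"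
    by (intro nbh0_add infsum_approx f g fin) auto
  then show "\<exists>F. finite F \<and> F \<subseteq> A \<and> {i \<in> A. f i + g i \<notin> nbh0 N} \<subseteq> F \<and>
      infsum f A + infsum g A - (\<Sum>i\<in>F. f i + g i) \<in> nbh0 N"
    by (intro exI[of _ ?F] conjI fin) (auto simp: sum.distrib algebra_simps intro: nbh0_add)
qed

lemma null_family_sum:
  assumes "\<And>j. j \<in> J \<Longrightarrow> null_family (f j) A"
  shows "null_family (\<lambda>i. \<Sum>j\<in>J. f j i) A"
  using assms
proof (induction J rule: infinite_finite_induct)
  case (insert j J)
  then have "null_family (\<lambda>i. f j i + (\<Sum>j\<in>J. f j i)) A" by (intro null_family_add) auto
  with insert(1,2) show ?case by simp
qed (auto simp: null_family_def)

lemma infsum_sum_null: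
  assumes "\<And>j. j \<in> J \<Longrightarrow> null_family (f j) A"
  shows "(\<Sum>\<^sub>\<infinity>i\<in>A. \<Sum>j\<in>J. f j i) = (\<Sum>j\<in>J. infsum (f j) A)"
  using assms
proof (induction J rule: infinite_finite_induct)
  case (insert j J)
  then have "(\<Sum>\<^sub>\<infinity>i\<in>A. f j i + (\<Sum>j\<in>J. f j i)) = infsum (f j) A + (\<Sum>\<^sub>\<infinity>i\<in>A. \<Sum>j\<in>J. f j i)"
    by (intro infsum_add_null null_family_sum) auto
  with insert show ?case by auto
qed auto

text \<open>Everything comes from the finite set of exceptional pairs for a given \<open>N\<close>
  and its two projections. For the last claim both sides are approximated by the finite rectangle
  that the projections span.\<close>

lemma null_family_fubini:
  assumes f: "null_family (\<lambda>(i, j). f i j) (A \<times> B)"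
  shows "i \<in> A \<Longrightarrow> null_family (f i) B"
    and "null_family (\<lambda>i. infsum (f i) B) A"
    and "(\<Sum>\<^sub>\<infinity>i\<in>A. infsum (f i) B) = (\<Sum>\<^sub>\<infinity>(i, j)\<in>A \<times> B. f i j)"
proof -
  have inner: "null_family (f i) B" if "i \<in> A" for i
    unfolding null_family_def
  proof
    fix N
    have "finite (snd ` {p \<in> A \<times> B. (case p of (i, j) \<Rightarrow> f i j) \<notin> nbh0 N})"
      by (rule finite_imageI) (rule null_familyD[OF f])
    then show "finite {j \<in> B. f i j \<notin> nbh0 N}"
      by (rule rev_finite_subset) (use that in force)
  qed
  then show "i \<in> A \<Longrightarrow> null_family (f i) B" .
  have closed: "closed (nbh0 N)" for N
  proof -
    have "nbh0 N = {a. \<forall>w k. low N w \<and> k < N \<longrightarrow> coef a w k = 0}" by (auto simp: nbh0_def)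
    then show ?thesis using closed_coef_vanish[of "\<lambda>w k. low N w \<and> k < N"] by simp
  qed
  have sub: "{i \<in> A. infsum (f i) B \<notin> nbh0 N}
      \<subseteq> fst ` {p \<in> A \<times> B. (case p of (i, j) \<Rightarrow> f i j) \<notin> nbh0 N}" for N
  proof
    fix i assume i: "i \<in> {i \<in> A. infsum (f i) B \<notin> nbh0 N}"
    then have "\<exists>j\<in>B. f i j \<notin> nbh0 N"
      using infsum_in_closed[OF closed nbh0_zero nbh0_add, where A = B and f = "f i"] by blast
    then show "i \<in> fst ` {p \<in> A \<times> B. (case p of (i, j) \<Rightarrow> f i j) \<notin> nbh0 N}"
      using i by force
  qed
  then show outer: "null_family (\<lambda>i. infsum (f i) B) A"
    unfolding null_family_def using finite_imageI[OF null_familyD[OF f]] finite_subset by blast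
  show "(\<Sum>\<^sub>\<infinity>i\<in>A. infsum (f i) B) = (\<Sum>\<^sub>\<infinity>(i, j)\<in>A \<times> B. f i j)"
  proof (rule infsum_eqI_null[OF outer])
    fix N
    let ?P = "{p \<in> A \<times> B. (case p of (i, j) \<Rightarrow> f i j) \<notin> nbh0 N}"
    have fin: "finite ?P" by (rule null_familyD[OF f])
    let ?F = "fst ` ?P" and ?G = "snd ` ?P"
    have fs: "finite ?F" "finite ?G" "?F \<subseteq> A" "?G \<subseteq> B" using fin by auto
    have 1: "(\<Sum>\<^sub>\<infinity>(i, j)\<in>A \<times> B. f i j) - (\<Sum>(i, j)\<in>?F \<times> ?G. f i j) \<in> nbh0 N"
      by (rule infsum_approx[OF f]) (use fs in \<open>force simp: image_iff\<close>)+
    have 2: "(\<Sum>i\<in>?F. infsum (f i) B - sum (f i) ?G) \<in> nbh0 N"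
    proof (rule nbh0_sum)
      fix i assume "i \<in> ?F"
      then have i: "i \<in> A" using fs by blast
      show "infsum (f i) B - sum (f i) ?G \<in> nbh0 N"
        by (rule infsum_approx[OF inner[OF i]]) (use fs i in \<open>force simp: image_iff\<close>)+
    qed
    have "(\<Sum>\<^sub>\<infinity>(i, j)\<in>A \<times> B. f i j) - (\<Sum>i\<in>?F. infsum (f i) B) =
      ((\<Sum>\<^sub>\<infinity>(i, j)\<in>A \<times> B. f i j) - (\<Sum>(i, j)\<in>?F \<times> ?G. f i j))
      - (\<Sum>i\<in>?F. infsum (f i) B - sum (f i) ?G)"
      by (simp add: sum_subtractf sum.cartesian_product)
    then have "(\<Sum>\<^sub>\<infinity>(i, j)\<in>A \<times> B. f i j) - (\<Sum>i\<in>?F. infsum (f i) B) \<in> nbh0 N"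
      using nbh0_diff[OF 1 2] by (simp only:)
    then show "\<exists>F. finite F \<and> F \<subseteq> A \<and> {i \<in> A. infsum (f i) B \<notin> nbh0 N} \<subseteq> F \<and>
        (\<Sum>\<^sub>\<infinity>(i, j)\<in>A \<times> B. f i j) - (\<Sum>i\<in>F. infsum (f i) B) \<in> nbh0 N"
      using fs sub by (intro exI[of _ ?F]) blast
  qed
qed

lemma infsum_swap_null:
  assumes "null_family (\<lambda>(i, j). f i j) (A \<times> B)"
  shows "(\<Sum>\<^sub>\<infinity>i\<in>A. \<Sum>\<^sub>\<infinity>j\<in>B. f i j) = (\<Sum>\<^sub>\<infinity>j\<in>B. \<Sum>\<^sub>\<infinity>i\<in>A. f i j)"
proof -
  have bij: "bij_betw prod.swap (B \<times> A) (A \<times> B)"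
    by (auto simp: bij_betw_def inj_on_def)
  have swap: "null_family (\<lambda>(j, i). f i j) (B \<times> A)"
    unfolding null_family_def
  proof
    fix N
    have "finite (prod.swap ` {p \<in> A \<times> B. (case p of (i, j) \<Rightarrow> f i j) \<notin> nbh0 N})"
      by (rule finite_imageI) (rule null_familyD[OF assms])
    then show "finite {p \<in> B \<times> A. (case p of (j, i) \<Rightarrow> f i j) \<notin> nbh0 N}"
      by (rule rev_finite_subset) (force simp: image_iff)
  qed
  show ?thesis
    unfolding null_family_fubini(3)[OF assms] null_family_fubini(3)[OF swap]
    using infsum_reindex_bij_betw[OF bij, of "\<lambda>(i, j). f i j"]
    by (simp add: case_prod_unfold)
qed

section \<open>Degrees\<close>

definition homog :: "int \<Rightarrow> free_alg set" where
  "homog d = {a. \<forall>w k. wdeg w \<noteq> d \<longrightarrow> coef a w k = 0}"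

text \<open>The part of \<open>nbh0\<close> that concerns degrees, without the condition on powers
  of \<open>p\<close>, and with an integer bound because degrees take both signs. Finiteness is
  proved for \<open>deep\<close> and transferred by \<open>deep_nbh0\<close>.\<close>

definition deep :: "int \<Rightarrow> free_alg set" where
  "deep N = {a. \<forall>w k. (\<forall>i\<le>length w. wdeg (drop i w) < N) \<longrightarrow> coef a w k = 0}"

lemma closed_homog: "closed (homog d)"
  unfolding homog_def by (rule closed_coef_vanish)

lemma closed_deep: "closed (deep N)"
  unfolding deep_def by (rule closed_coef_vanish)

lemma homog_0 [simp]: "0 \<in> homog d" by (simp add: homog_def)
lemma homog_add: "a \<in> homog d \<Longrightarrow> b \<in> homog d \<Longrightarrow> a + b \<in> homog d" by (simp add: homog_def)
lemma homog_diff: "a \<in> homog d \<Longrightarrow> b \<in> homog d \<Longrightarrow> a - b \<in> homog d" by (simp add: homog_def)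
lemma homog_uminus: "a \<in> homog d \<Longrightarrow> - a \<in> homog d" by (simp add: homog_def)

lemma homog_sum: "(\<And>i. i \<in> A \<Longrightarrow> f i \<in> homog d) \<Longrightarrow> sum f A \<in> homog d"
  by (induction A rule: infinite_finite_induct) (auto intro: homog_add)

lemma homog_infsum: "(\<And>i. i \<in> A \<Longrightarrow> f i \<in> homog d) \<Longrightarrow> infsum f A \<in> homog d"
  by (rule infsum_in_closed[OF closed_homog]) (auto intro: homog_add)

lemma homog_mult:
  assumes a: "a \<in> homog d" and b: "b \<in> homog e"
  shows "a * b \<in> homog (d + e)"
  unfolding homog_def
proof (intro CollectI allI impI)
  fix w k assume w: "wdeg w \<noteq> d + e"
  have "coef a (take i w) j * coef b (drop i w) l = 0" for i j l
  proof -
    have "wdeg (take i w) + wdeg (drop i w) = wdeg w"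
      by (metis wdeg_append append_take_drop_id)
    then have "wdeg (take i w) \<noteq> d \<or> wdeg (drop i w) \<noteq> e" using w by auto
    then show ?thesis using a b by (auto simp: homog_def)
  qed
  then show "coef (a * b) w k = 0" unfolding coef_times by (intro sum.neutral ballI) simp
qed

lemma homog_1 [simp]: "1 \<in> homog 0"
  by (auto simp: homog_def coef_def one_free_alg.rep_eq)

lemma homog_letter: "letter x \<in> homog (gdeg x)"
  by (auto simp: homog_def coef_def letter.rep_eq wdeg_def)

lemma homog_scal: "scal c \<in> homog 0"
  by (auto simp: homog_def coef_def scal.rep_eq)

lemma homog_power: "a \<in> homog 0 \<Longrightarrow> a ^ n \<in> homog 0"
  by (induction n) (auto dest: homog_mult)

lemma homog_mult_0: "a \<in> homog 0 \<Longrightarrow> b \<in> homog d \<Longrightarrow> a * b \<in> homog d"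
  "a \<in> homog d \<Longrightarrow> b \<in> homog 0 \<Longrightarrow> a * b \<in> homog d"
  using homog_mult by force+

lemma deep_0 [simp]: "0 \<in> deep N" by (simp add: deep_def)
lemma deep_add: "a \<in> deep N \<Longrightarrow> b \<in> deep N \<Longrightarrow> a + b \<in> deep N" by (simp add: deep_def)

lemma deep_left_mult:
  assumes "a \<in> deep N"
  shows "r * a \<in> deep N"
  unfolding deep_def
proof (intro CollectI allI impI)
  fix w k assume w: "\<forall>i\<le>length w. wdeg (drop i w) < N"
  have "coef a (drop i w) l = 0" for i l
  proof (cases "i \<le> length w")
    case True
    have "wdeg (drop j (drop i w)) < N" if "j \<le> length (drop i w)" for j
      using w[rule_format, of "j + i"] that True by simp
    then show ?thesis using assms by (auto simp: deep_def)
  next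
    case False
    then have "drop i w = drop (length w) w" by simp
    moreover have "wdeg (drop (length w) w) < N" using w by blast
    ultimately show ?thesis using assms by (auto simp: deep_def)
  qed
  then show "coef (r * a) w k = 0" unfolding coef_times by (intro sum.neutral ballI) simp
qed

lemma homog_deep: "a \<in> homog d \<Longrightarrow> a \<in> deep d"
  unfolding homog_def deep_def by (fastforce dest: spec[of _ 0])

lemma deep_mono:
  assumes "a \<in> deep N" "M \<le> N"
  shows "a \<in> deep M"
  unfolding deep_def
proof (intro CollectI allI impI)
  fix w k assume "\<forall>i\<le>length w. wdeg (drop i w) < M"
  then have "\<forall>i\<le>length w. wdeg (drop i w) < N" using assms(2) by force
  then show "coef a w k = 0" using assms(1) by (simp add: deep_def)
qed

lemma deep_nbh0: "a \<in> deep (int N) \<Longrightarrow> a \<in> nbh0 N"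
  unfolding deep_def nbh0_def low_def by blast

lemma null_family_deepI:
  assumes "\<And>N. finite {i \<in> A. f i \<notin> deep N}"
  shows "null_family f A"
  unfolding null_family_def
proof
  fix N
  show "finite {i \<in> A. f i \<notin> nbh0 N}"
    by (rule finite_subset[OF _ assms[of "int N"]]) (auto intro: deep_nbh0)
qed

text \<open>Splitting off a suffix of degree \<open>d\<close> raises the bound on the remaining
  prefix by at most \<open>nat (- d)\<close>. This loss depends on \<open>b\<close> alone, so right
  multiplication by a homogeneous element is continuous.\<close>

lemma nbh0_mult_homog:
  assumes a: "a \<in> nbh0 (N + nat (- d))" and b: "b \<in> homog d"
  shows "a * b \<in> nbh0 N"
  unfolding nbh0_def
proof (intro CollectI allI impI)
  fix w k assume w: "low N w" and k: "k < N"
  have "coef a (take i w) j * coef b (drop i w) l = 0" if "j \<le> k" for i j l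
  proof (cases "wdeg (drop i w) = d")
    case True
    then have "low (N + nat (- d)) (take i w)"
      using low_prefix[of N "take i w" "drop i w"] w by simp
    then show ?thesis using a k that by (simp add: nbh0_def)
  qed (use b in \<open>simp add: homog_def\<close>)
  then show "coef (a * b) w k = 0" unfolding coef_times by (intro sum.neutral ballI) simp
qed

lemma null_family_right_mult:
  assumes f: "null_family f A" and b: "b \<in> homog d"
  shows "null_family (\<lambda>i. f i * b) A"
  unfolding null_family_def
proof
  fix N
  show "finite {i \<in> A. f i * b \<notin> nbh0 N}"
    by (rule finite_subset[OF _ null_familyD[OF f, of "N + nat (- d)"]]) (auto intro: nbh0_mult_homog[OF _ b])
qed

lemma infsum_right_mult:
  assumes f: "null_family f A" and b: "b \<in> homog d"
  shows "(\<Sum>\<^sub>\<infinity>i\<in>A. f i * b) = infsum f A * b"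
proof (rule infsum_eqI_null[OF null_family_right_mult[OF f b]])
  fix N
  let ?F = "{i \<in> A. f i \<notin> nbh0 (N + nat (- d))}"
  have "(infsum f A - sum f ?F) * b \<in> nbh0 N"
    by (intro nbh0_mult_homog[OF _ b] infsum_approx[OF f] null_familyD[OF f]) auto
  then show "\<exists>F. finite F \<and> F \<subseteq> A \<and> {i \<in> A. f i * b \<notin> nbh0 N} \<subseteq> F \<and>
      infsum f A * b - (\<Sum>i\<in>F. f i * b) \<in> nbh0 N"
    by (intro exI[of _ ?F] conjI null_familyD[OF f])
       (auto simp: sum_distrib_right left_diff_distrib intro: nbh0_mult_homog[OF _ b])
qed

section \<open>Products of several series\<close>

lemma UNIV_var: "(UNIV :: var set) = {Zv, Wv, Uv}"
  using var.exhaust by auto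

lemma finite_UNIV_var [simp]: "finite (UNIV :: var set)"
  by (simp add: UNIV_var)

section \<open>Exponents in several variables and supports of factors\<close>

definition vdeg :: "(var \<Rightarrow> int) \<Rightarrow> int" where
  "vdeg m = (\<Sum>v\<in>UNIV. m v)"

lemma vdeg_simps [simp]:
  "vdeg 0 = 0" "vdeg (m + n) = vdeg m + vdeg n" "vdeg (m - n) = vdeg m - vdeg n"
  "vdeg (- m) = - vdeg m"
  by (simp_all add: vdeg_def sum.distrib sum_subtractf sum_negf)

lemma vexp_apply: "vexp v n v' = (if v' = v then n else 0)"
  by (simp add: vexp_def)

lemma vdeg_vexp [simp]: "vdeg (vexp v n) = n"
  by (simp add: vdeg_def vexp_def)

lemma vdeg_split:
  assumes "distinct vs"
  shows "vdeg m = sum_list (map m vs) + (\<Sum>v\<in>- set vs. m v)"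
  unfolding vdeg_def sum_list_distinct_conv_sum_set[OF assms]
  by (subst sum.union_disjoint[symmetric]) (auto intro: finite_subset[OF _ finite_UNIV_var])

text \<open>\<open>Box\<close> serves constants and small monomials of degree zero,
  \<open>Line\<close> the currents, \<open>Up\<close> and \<open>Down\<close> the two kinds of half
  vertex operators, \<open>Ray\<close> the structure functions and \<open>Diag\<close> the delta
  functions.\<close>

datatype shape = Box nat | Line var | Up var | Down var | Ray var var | Diag var var

fun support :: "shape \<Rightarrow> (var \<Rightarrow> int) set" where
  "support (Box n) = {m. vdeg m = 0 \<and> (\<forall>v. \<bar>m v\<bar> \<le> int n)}"
| "support (Line v) = range (vexp v)"
| "support (Up v) = vexp v ` {0..}"
| "support (Down v) = vexp v ` {..0}"
| "support (Ray v v') = (\<lambda>n. vexp v n - vexp v' n) ` {0..}"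
| "support (Diag v v') = range (\<lambda>n. vexp v n - vexp v' n)"

lemma support_nonempty: "support s \<noteq> {}"
  by (cases s) (auto intro: exI[of _ 0])

definition graded :: "shape \<Rightarrow> (var \<Rightarrow> int) series \<Rightarrow> bool" where
  "graded s F \<longleftrightarrow> (\<forall>m. F m \<in> homog (- vdeg m)) \<and> (\<forall>m. m \<notin> support s \<longrightarrow> F m = 0)"

text \<open>
  Since the coefficients are homogeneous, a product $F_{k_1}\cdots F_{k_r}$ lies in \<open>deep N\<close> once
  some $-(|k_i|+\dots+|k_r|)$ is at least \<open>N\<close>; the remaining exponents are collected here.
\<close>

fun tuples :: "shape list \<Rightarrow> (var \<Rightarrow> int) \<Rightarrow> int \<Rightarrow> (var \<Rightarrow> int) list set" where
  "tuples [] m N = (if m = 0 \<and> 0 < N then {[]} else {})"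
| "tuples (s # ss) m N =
    (if - vdeg m < N then (\<Union>k\<in>support s. (#) k ` tuples ss (m - k) N) else {})"

lemma tuples_vdeg: "tuples ss m N \<noteq> {} \<Longrightarrow> - N < vdeg m"
  by (cases ss) (auto split: if_splits)

lemma tuples_ConsI:
  "k \<in> support s \<Longrightarrow> ks \<in> tuples ss (m - k) N \<Longrightarrow> - vdeg m < N \<Longrightarrow> k # ks \<in> tuples (s # ss) m N"
  by auto

definition convergent_shapes :: "shape list \<Rightarrow> bool" where
  "convergent_shapes ss \<longleftrightarrow> (\<forall>m N. finite (tuples ss m N))"

lemma tuples_mono: "N \<le> M \<Longrightarrow> tuples ss m N \<subseteq> tuples ss m M"
proof (induction ss arbitrary: m)
  case (Cons s ss)
  then show ?case by (auto split: if_splits)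
qed auto

text \<open>Prepending one fixed exponent from the nonempty support embeds the tuples of the tail
  into those of the longer list, for a larger bound.\<close>

lemma convergent_shapes_tl:
  assumes "convergent_shapes (s # ss)"
  shows "convergent_shapes ss"
  unfolding convergent_shapes_def
proof (intro allI)
  fix m N
  obtain k where k: "k \<in> support s" using support_nonempty by blast
  let ?M = "max N (1 - vdeg (m + k))"
  have "(#) k ` tuples ss m N \<subseteq> tuples (s # ss) (m + k) ?M"
  proof -
    have "tuples ss m N \<subseteq> tuples ss m ?M" by (rule tuples_mono) simp
    then show ?thesis by (intro image_subsetI tuples_ConsI k) auto
  qed
  then have "finite ((#) k ` tuples ss m N)"
    using assms finite_subset unfolding convergent_shapes_def by blast
  then show "finite (tuples ss m N)" by (rule finite_imageD) (simp add: inj_on_def)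
qed

lemma ex_tuple: "\<exists>s N ks. ks \<in> tuples ss s N"
proof (induction ss)
  case Nil
  have "[] \<in> tuples [] 0 1" by simp
  then show ?case by blast
next
  case (Cons a ss)
  then obtain s N ks where ks: "ks \<in> tuples ss s N" by blast
  obtain k where k: "k \<in> support a" using support_nonempty by blast
  let ?M = "max N (1 - vdeg (s + k))"
  have "ks \<in> tuples ss s ?M" using tuples_mono[of N ?M] ks by auto
  then have "k # ks \<in> tuples (a # ss) (s + k) ?M"
    by (intro tuples_ConsI k) auto
  then show ?case by blast
qed

text \<open>For the first list the embedding appends one fixed tuple \<open>ls\<close> of the second
  list, which shifts the target exponent by \<open>s\<close>.\<close>

lemma convergent_shapes_append:
  assumes "convergent_shapes (ss @ ss')"
  shows "convergent_shapes ss" "convergent_shapes ss'"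
proof -
  show "convergent_shapes ss'"
    using assms by (induction ss) (auto dest: convergent_shapes_tl)
  show "convergent_shapes ss"
    unfolding convergent_shapes_def
  proof (intro allI)
    fix m N
    obtain s M ls where ls: "ls \<in> tuples ss' s M" using ex_tuple by blast
    have "ks @ ls \<in> tuples (ss @ ss') (m + s) L"
      if "ks \<in> tuples ss m N" "L \<ge> M" "L \<ge> N - vdeg s" for ks L
      using that(1)
    proof (induction ss arbitrary: ks m)
      case Nil
      then show ?case using ls tuples_mono[OF that(2)] by (auto split: if_splits)
    next
      case (Cons a ss)
      then obtain k ks' where ks: "ks = k # ks'" "k \<in> support a" "ks' \<in> tuples ss (m - k) N"
        "- vdeg m < N" by (auto split: if_splits)
      have "ks' @ ls \<in> tuples (ss @ ss') (m - k + s) L"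
        by (rule Cons.IH[OF ks(3)])
      then have "ks' @ ls \<in> tuples (ss @ ss') (m + s - k) L" by (simp add: algebra_simps)
      moreover have "- vdeg (m + s) < L" using ks(4) that(3) by simp
      ultimately show ?case using ks(1,2) by (simp only: append_Cons tuples_ConsI)
    qed
    \<comment> \<open>The bound has to absorb the degree that \<open>ls\<close> adds to each partial
      sum.\<close>
    from this[of _ "max M (N - vdeg s)"]
    have "(\<lambda>ks. ks @ ls) ` tuples ss m N \<subseteq> tuples (ss @ ss') (m + s) (max M (N - vdeg s))" by auto
    then have "finite ((\<lambda>ks. ks @ ls) ` tuples ss m N)"
      using assms finite_subset unfolding convergent_shapes_def by blast
    then show "finite (tuples ss m N)" by (rule finite_imageD) (simp add: inj_on_def)
  qed
qed

subsection \<open>Associativity\<close>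

lemma null_family_reindex:
  assumes "null_family f A" "inj_on h B" "h ` B \<subseteq> A"
  shows "null_family (\<lambda>i. f (h i)) B"
  unfolding null_family_def
proof
  fix N
  have "finite (h -` {i \<in> A. f i \<notin> nbh0 N} \<inter> B)"
    by (rule finite_vimage_IntI[OF null_familyD[OF assms(1)] assms(2)])
  then show "finite {i \<in> B. f (h i) \<notin> nbh0 N}"
    by (rule rev_finite_subset) (use assms(3) in auto)
qed

text \<open>Both bracketings are iterated sums of one double family, related by
  \<open>n = k + l\<close> and an exchange of sums. Homogeneity of \<open>H\<close> lets it be
  pulled into the inner sum from the right.\<close>

lemma smult_assoc:
  fixes F G H :: "'m::ab_group_add series"
  assumes FGH: "\<And>m. null_family (\<lambda>(k, l). F k * G l * H (m - k - l)) (UNIV \<times> UNIV)"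
    and FG: "\<And>m. null_family (\<lambda>k. F k * G (m - k)) UNIV"
    and GH: "\<And>m. null_family (\<lambda>k. G k * H (m - k)) UNIV"
    and H: "\<And>m. \<exists>d. H m \<in> homog d"
  shows "F \<star> G \<star> H = F \<star> (G \<star> H)"
proof
  fix m
  have null: "null_family (\<lambda>(n, k). F k * G (n - k) * H (m - n)) (UNIV \<times> UNIV)"
  proof -
    have "null_family (\<lambda>p. case (case p of (n, k) \<Rightarrow> (k, n - k)) of (k, l) \<Rightarrow> F k * G l * H (m - k - l))
        (UNIV \<times> UNIV)"
      by (rule null_family_reindex[OF FGH[of m]]) (auto simp: inj_on_def)
    then show ?thesis by (simp add: case_prod_unfold)
  qed
  have "(F \<star> G \<star> H) m = (\<Sum>\<^sub>\<infinity>n. \<Sum>\<^sub>\<infinity>k. F k * G (n - k) * H (m - n))"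
    unfolding smult_def
    by (intro infsum_cong) (use H infsum_right_mult[OF FG] in metis)
  also have "\<dots> = (\<Sum>\<^sub>\<infinity>k. \<Sum>\<^sub>\<infinity>n. F k * G (n - k) * H (m - n))"
    by (rule infsum_swap_null) (rule null)
  also have "\<dots> = (\<Sum>\<^sub>\<infinity>k. \<Sum>\<^sub>\<infinity>l. F k * (G l * H (m - k - l)))"
  proof (rule infsum_cong)
    fix k :: 'm
    have "bij_betw (\<lambda>l. l + k) UNIV UNIV"
      by (rule bij_betw_byWitness[of _ "\<lambda>l. l - k"]) auto
    from infsum_reindex_bij_betw[OF this, of "\<lambda>n. F k * G (n - k) * H (m - n)"]
    show "(\<Sum>\<^sub>\<infinity>n. F k * G (n - k) * H (m - n)) = (\<Sum>\<^sub>\<infinity>l. F k * (G l * H (m - k - l)))"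
      by (simp add: algebra_simps)
  qed
  also have "\<dots> = (F \<star> (G \<star> H)) m"
    unfolding smult_def by (intro infsum_cong infsum_left_mult GH)
  finally show "(F \<star> G \<star> H) m = (F \<star> (G \<star> H)) m" .
qed

lemma infsum_delta:
  fixes f :: "'i \<Rightarrow> free_alg"
  assumes "\<And>i. i \<noteq> j \<Longrightarrow> f i = 0"
  shows "infsum f UNIV = f j"
proof -
  have "infsum f UNIV = infsum f {j}"
    by (rule infsum_cong_neutral) (use assms in auto)
  then show ?thesis by simp
qed

lemma smult_mono_left: "(mono_ser e \<star> F) m = F (m - e)"
  unfolding smult_def by (subst infsum_delta[of e]) (auto simp: mono_ser_def)

lemma smult_mono_right: "(F \<star> mono_ser e) m = F (m - e)"
  unfolding smult_def by (subst infsum_delta[of "m - e"]) (auto simp: mono_ser_def algebra_simps)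

lemma smult_const_left: "(const_ser a \<star> F) m = a * F m"
  unfolding smult_def by (subst infsum_delta[of 0]) (auto simp: const_ser_def)

lemma smult_const_right: "(F \<star> const_ser a) m = F m * a"
  unfolding smult_def by (subst infsum_delta[of m]) (auto simp: const_ser_def)

lemma smult_mono_0 [simp]: "mono_ser 0 \<star> F = F" "F \<star> mono_ser 0 = F"
  by (auto simp: smult_mono_left smult_mono_right)

text \<open>A monomial only shifts the summation index, and reindexing by a bijection preserves the
  value of \<open>infsum\<close> in every case.\<close>

lemma smult_mono_assoc: "mono_ser e \<star> F \<star> G = mono_ser e \<star> (F \<star> G)"
proof
  fix m
  have "bij_betw (\<lambda>l. l + e) UNIV UNIV"
    by (rule bij_betw_byWitness[of _ "\<lambda>l. l - e"]) auto
  from infsum_reindex_bij_betw[OF this, of "\<lambda>k. F (k - e) * G (m - k)"]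
  show "(mono_ser e \<star> F \<star> G) m = (mono_ser e \<star> (F \<star> G)) m"
    by (simp add: smult_mono_left smult_def[of _ G] algebra_simps)
qed

text \<open>The declared shape makes convergence of a product depend on a list of shapes only, which
  can be evaluated.\<close>

type_synonym factor = "shape \<times> (var \<Rightarrow> int) series"

fun ser_prod :: "factor list \<Rightarrow> (var \<Rightarrow> int) series" where
  "ser_prod [] = mono_ser 0"
| "ser_prod (A # As) = snd A \<star> ser_prod As"

fun term_prod :: "factor list \<Rightarrow> (var \<Rightarrow> int) list \<Rightarrow> free_alg" where
  "term_prod (A # As) (k # ks) = snd A k * term_prod As ks"
| "term_prod _ _ = 1"

definition graded_list :: "factor list \<Rightarrow> bool" where
  "graded_list As \<longleftrightarrow> (\<forall>A\<in>set As. graded (fst A) (snd A))"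

definition convergent_list :: "factor list \<Rightarrow> bool" where
  "convergent_list As \<longleftrightarrow> graded_list As \<and> convergent_shapes (map fst As)"

lemma convergent_list_append:
  assumes "convergent_list (As @ Bs)"
  shows "convergent_list As" "convergent_list Bs"
  using assms convergent_shapes_append[of "map fst As" "map fst Bs"]
  by (auto simp: convergent_list_def graded_list_def)

lemma graded_homog: "graded s F \<Longrightarrow> F m \<in> homog (- vdeg m)"
  by (simp add: graded_def)

lemma smult_homog:
  assumes "\<And>m. F m \<in> homog (- vdeg m)" "\<And>m. G m \<in> homog (- vdeg m)"
  shows "(F \<star> G) m \<in> homog (- vdeg m)"
  unfolding smult_def
proof (rule homog_infsum)
  fix k
  show "F k * G (m - k) \<in> homog (- vdeg m)"
    using homog_mult[OF assms(1)[of k] assms(2)[of "m - k"]] by simp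
qed

lemma ser_prod_homog: "graded_list As \<Longrightarrow> ser_prod As m \<in> homog (- vdeg m)"
proof (induction As arbitrary: m)
  case (Cons A As)
  then have "graded (fst A) (snd A)" "graded_list As" by (auto simp: graded_list_def)
  with Cons.IH show ?case by (simp add: smult_homog graded_homog)
qed (simp add: mono_ser_def)

text \<open>Left multiplication preserves each neighbourhood and right multiplication by
  \<open>b\<close> costs \<open>nat (- d)\<close>, so the map in question is continuous.\<close>

lemma closed_sandwich:
  assumes S: "closed S" and b: "b \<in> homog d"
  shows "closed {x. a * x * b \<in> S}"
proof -
  have "open (- {x. a * x * b \<in> S})"
    unfolding open_free_alg_def
  proof
    fix x assume "x \<in> - {x. a * x * b \<in> S}"
    then have "a * x * b \<in> - S" by simp
    moreover have "open (- S)" using S by (simp add: closed_def)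
    ultimately obtain N where N: "\<And>y. y - a * x * b \<in> nbh0 N \<Longrightarrow> y \<in> - S"
      unfolding open_free_alg_def by blast
    have "a * y * b \<in> - S" if "y - x \<in> nbh0 (N + nat (- d))" for y
    proof (rule N)
      have "a * (y - x) * b \<in> nbh0 N"
        by (intro nbh0_mult_homog[OF _ b] nbh0_left_mult that)
      then show "a * y * b - a * x * b \<in> nbh0 N" by (simp add: algebra_simps)
    qed
    then show "\<exists>N. \<forall>y. y - x \<in> nbh0 N \<longrightarrow> y \<in> - {x. a * x * b \<in> S}" by auto
  qed
  then show ?thesis by (simp add: closed_def)
qed

text \<open>The \<open>x\<close> with \<open>a * x * b\<close> in \<open>deep N\<close> form a
  closed set stable under addition, so a sum outside it has a term outside it. Unfolding one factor
  at a time moves the coefficient just found into \<open>a\<close>, which is therefore generalised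
  in the induction.\<close>

lemma ser_prod_term:
  assumes "graded_list As" "b \<in> homog d" "a * ser_prod As l * b \<notin> deep N"
  shows "\<exists>ks. list_all2 (\<lambda>k A. k \<in> support (fst A)) ks As \<and> sum_list ks = l \<and>
    a * term_prod As ks * b \<notin> deep N"
  using assms
proof (induction As arbitrary: a l)
  case Nil
  show ?case
  proof (cases "l = 0")
    case True
    then have "ser_prod [] l = 1" by (simp add: mono_ser_def)
    then have "a * 1 * b \<notin> deep N" using Nil(3) by metis
    with True show ?thesis by (intro exI[of _ "[]"]) simp
  next
    case False
    then have "ser_prod [] l = 0" by (simp add: mono_ser_def)
    with Nil(3) show ?thesis by simp
  qed
next
  case (Cons A As)
  have "\<exists>k. a * (snd A k * ser_prod As (l - k)) * b \<notin> deep N"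
  proof (rule ccontr)
    assume "\<not> ?thesis"
    then have "(\<Sum>\<^sub>\<infinity>k. snd A k * ser_prod As (l - k)) \<in> {x. a * x * b \<in> deep N}"
      by (intro infsum_in_closed closed_sandwich[OF closed_deep Cons.prems(2)])
         (auto simp: distrib_left distrib_right intro: deep_add)
    with Cons.prems(3) show False by (simp add: smult_def)
  qed
  then obtain k where k: "a * (snd A k * ser_prod As (l - k)) * b \<notin> deep N" by blast
  then have "a * snd A k * ser_prod As (l - k) * b \<notin> deep N" by (simp add: mult.assoc)
  moreover have "graded_list As" using Cons.prems(1) by (simp add: graded_list_def)
  ultimately obtain ks where ks:
    "list_all2 (\<lambda>k A. k \<in> support (fst A)) ks As" "sum_list ks = l - k"
    "a * snd A k * term_prod As ks * b \<notin> deep N"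
    using Cons.IH Cons.prems(2) by blast
  have "snd A k \<noteq> 0" using k by auto
  then have "k \<in> support (fst A)" using Cons.prems(1) by (auto simp: graded_list_def graded_def)
  with ks show ?case by (intro exI[of _ "k # ks"]) (auto simp: mult.assoc)
qed

lemma term_prod_homog:
  assumes "graded_list As" "list_all2 (\<lambda>k A. k \<in> support (fst A)) ks As"
  shows "term_prod As ks \<in> homog (- vdeg (sum_list ks))"
  using assms(2,1)
proof (induction ks As rule: list_all2_induct)
  case (Cons k ks A As)
  then have "snd A k \<in> homog (- vdeg k)" "term_prod As ks \<in> homog (- vdeg (sum_list ks))"
    by (auto simp: graded_list_def graded_def)
  from homog_mult[OF this] show ?case
    by (simp only: term_prod.simps sum_list.Cons vdeg_simps minus_add_distrib)
qed simp

text \<open>Since \<open>deep N\<close> is a left ideal, a product outside it has all its tails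
  outside it. The tails are homogeneous, so each of them satisfies the degree bound built into
  \<open>tuples\<close>.\<close>

lemma term_prod_tuples:
  assumes "graded_list As" "list_all2 (\<lambda>k A. k \<in> support (fst A)) ks As"
    "term_prod As ks \<notin> deep N"
  shows "ks \<in> tuples (map fst As) (sum_list ks) N"
  using assms(2,1,3)
proof (induction ks As rule: list_all2_induct)
  case Nil
  have "(1 :: free_alg) \<in> deep 0" by (rule homog_deep) simp
  then show ?case using Nil deep_mono[of 1 0 N] by force
next
  case (Cons k ks A As)
  have "term_prod (A # As) (k # ks) \<in> deep (- vdeg (sum_list (k # ks)))"
    by (intro homog_deep term_prod_homog list_all2_Cons[THEN iffD2] conjI Cons)
  then have "- vdeg (sum_list (k # ks)) < N"
    using Cons.prems(2) deep_mono[of "term_prod (A # As) (k # ks)" "- vdeg (sum_list (k # ks))" N]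
    by linarith
  moreover have "ks \<in> tuples (map fst As) (sum_list ks) N"
    using Cons deep_left_mult by (simp add: graded_list_def) blast
  then have "ks \<in> tuples (map fst As) (sum_list (k # ks) - k) N" by simp
  ultimately show ?case using Cons(1) by (simp only: list.map tuples_ConsI)
qed

lemma term_prod_append:
  "length ks = length As \<Longrightarrow> term_prod (As @ Bs) (ks @ ls) = term_prod As ks * term_prod Bs ls"
  by (induction ks As rule: list_induct2) (auto simp: mult.assoc)

text \<open>A pair whose summand is outside \<open>deep N\<close> is refined, by three uses of
  \<open>ser_prod_term\<close>, to a tuple of exponents of the single factors. The map
  \<open>?h\<close> recovers the pair by summing blocks, and there are finitely many such
  tuples.\<close>

lemma ser_prod_null3:
  assumes conv: "convergent_list (As @ Bs @ Cs)"
  shows "null_family (\<lambda>(k, l). ser_prod As k * ser_prod Bs l * ser_prod Cs (m - k - l)) (UNIV \<times> UNIV)"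
proof (rule null_family_deepI)
  fix N
  let ?f = "\<lambda>(k, l). ser_prod As k * ser_prod Bs l * ser_prod Cs (m - k - l)"
  let ?T = "tuples (map fst (As @ Bs @ Cs)) m N"
  let ?h = "\<lambda>ks. (sum_list (take (length As) ks), sum_list (take (length Bs) (drop (length As) ks)))"
  have gr: "graded_list (As @ Bs @ Cs)" "graded_list As" "graded_list Bs" "graded_list Cs"
    using conv by (auto simp: convergent_list_def graded_list_def)
  have "{p \<in> UNIV \<times> UNIV. ?f p \<notin> deep N} \<subseteq> ?h ` ?T"
  proof
    fix p assume "p \<in> {p \<in> UNIV \<times> UNIV. ?f p \<notin> deep N}"
    then obtain k l where p: "p = (k, l)"
      and kl: "ser_prod As k * ser_prod Bs l * ser_prod Cs (m - k - l) \<notin> deep N"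
      by (cases p) auto
    have 1: "1 * ser_prod As k * (ser_prod Bs l * ser_prod Cs (m - k - l)) \<notin> deep N"
      using kl by (simp add: mult.assoc)
    obtain ks where ks: "list_all2 (\<lambda>k A. k \<in> support (fst A)) ks As" "sum_list ks = k"
      "1 * term_prod As ks * (ser_prod Bs l * ser_prod Cs (m - k - l)) \<notin> deep N"
      using ser_prod_term[OF gr(2) homog_mult[OF ser_prod_homog[OF gr(3)] ser_prod_homog[OF gr(4)]] 1]
      by blast
    then have 2: "term_prod As ks * ser_prod Bs l * ser_prod Cs (m - k - l) \<notin> deep N"
      by (simp add: mult.assoc)
    obtain ls where ls: "list_all2 (\<lambda>k A. k \<in> support (fst A)) ls Bs" "sum_list ls = l"
      "term_prod As ks * term_prod Bs ls * ser_prod Cs (m - k - l) \<notin> deep N"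
      using ser_prod_term[OF gr(3) ser_prod_homog[OF gr(4)] 2] by blast
    then have 3: "term_prod As ks * term_prod Bs ls * ser_prod Cs (m - k - l) * 1 \<notin> deep N"
      by simp
    obtain ns where ns: "list_all2 (\<lambda>k A. k \<in> support (fst A)) ns Cs" "sum_list ns = m - k - l"
      "term_prod As ks * term_prod Bs ls * term_prod Cs ns * 1 \<notin> deep N"
      using ser_prod_term[OF gr(4) homog_1 3] by blast
    have len: "length ks = length As" "length ls = length Bs"
      using ks ls by (auto dest: list_all2_lengthD)
    have "term_prod (As @ Bs @ Cs) (ks @ ls @ ns) \<notin> deep N"
      using ns(3) len by (simp add: term_prod_append mult.assoc)
    then have "ks @ ls @ ns \<in> tuples (map fst (As @ Bs @ Cs)) (sum_list (ks @ ls @ ns)) N"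
      by (intro term_prod_tuples gr list_all2_appendI ks ls ns)
    then have "ks @ ls @ ns \<in> ?T" using ks ls ns by simp
    then show "p \<in> ?h ` ?T"
      using ks ls len by (intro image_eqI[of _ _ "ks @ ls @ ns"]) (auto simp: p)
  qed
  moreover have "finite ?T" using conv by (simp add: convergent_list_def convergent_shapes_def)
  ultimately show "finite {p \<in> UNIV \<times> UNIV. ?f p \<notin> deep N}" using finite_surj by blast
qed

lemma ser_prod_null2:
  assumes "convergent_list (As @ Bs)"
  shows "null_family (\<lambda>k. ser_prod As k * ser_prod Bs (m - k)) UNIV"
proof -
  have "null_family (\<lambda>(k, l). ser_prod [] k * ser_prod As l * ser_prod Bs (m - k - l)) (UNIV \<times> UNIV)"
    by (rule ser_prod_null3) (use assms in simp)
  from null_family_reindex[OF this, of "\<lambda>l. (0, l)" UNIV]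
  show ?thesis by (simp add: inj_on_def mono_ser_def)
qed

lemma ser_prod_assoc:
  assumes "convergent_list (As @ Bs @ Cs)"
  shows "ser_prod As \<star> ser_prod Bs \<star> ser_prod Cs = ser_prod As \<star> (ser_prod Bs \<star> ser_prod Cs)"
proof (rule smult_assoc)
  show "null_family (\<lambda>k. ser_prod As k * ser_prod Bs (m - k)) UNIV" for m
    by (rule ser_prod_null2, rule convergent_list_append(1)[of _ Cs]) (use assms in simp)
  show "null_family (\<lambda>k. ser_prod Bs k * ser_prod Cs (m - k)) UNIV" for m
    by (rule ser_prod_null2, rule convergent_list_append(2)[of As]) (use assms in simp)
  show "\<exists>d. ser_prod Cs m \<in> homog d" for m
    using assms ser_prod_homog[of Cs m] by (auto simp: convergent_list_def graded_list_def)
qed (rule ser_prod_null3[OF assms])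

lemma ser_prod_append:
  assumes "convergent_list (As @ Bs)"
  shows "ser_prod (As @ Bs) = ser_prod As \<star> ser_prod Bs"
  using assms
proof (induction As)
  case (Cons A As)
  from Cons.prems have "convergent_list (As @ Bs)" using convergent_list_append(2)[of "[A]"] by simp
  with Cons.IH ser_prod_assoc[of "[A]" As Bs] Cons.prems show ?case by simp
qed simp

text \<open>Products in the relations associate to the left, products of lists to the right; this
  converts between the two.\<close>

lemma ser_prod_foldl:
  assumes "convergent_list As"
  shows "ser_prod As = foldl (\<star>) (mono_ser 0) (map snd As)"
  using assms
proof (induction As rule: rev_induct)
  case (snoc A As)
  with ser_prod_append[of As "[A]"] convergent_list_append(1)[of As "[A]"] show ?case by simp
qed simp

subsection \<open>Congruences in context\<close>

lemma ideal_simps: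
  assumes "two_sided_ideal I"
  shows "0 \<in> I" "a \<in> I \<Longrightarrow> b \<in> I \<Longrightarrow> a - b \<in> I" "a \<in> I \<Longrightarrow> b \<in> I \<Longrightarrow> a + b \<in> I"
    "a \<in> I \<Longrightarrow> - a \<in> I" "a \<in> I \<Longrightarrow> r * a \<in> I" "a \<in> I \<Longrightarrow> a * r \<in> I"
proof -
  show 0: "0 \<in> I" using assms by (simp add: two_sided_ideal_def)
  have diff: "a \<in> I \<Longrightarrow> b \<in> I \<Longrightarrow> a - b \<in> I" for a b
    using assms by (simp add: two_sided_ideal_def)
  have neg: "a \<in> I \<Longrightarrow> - a \<in> I" for a using diff[OF 0, of a] by simp
  show "a \<in> I \<Longrightarrow> b \<in> I \<Longrightarrow> a - b \<in> I" "a \<in> I \<Longrightarrow> - a \<in> I" by (fact diff neg)+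
  show "a \<in> I \<Longrightarrow> b \<in> I \<Longrightarrow> a + b \<in> I" using diff[OF _ neg, of a b] by simp
  show "a \<in> I \<Longrightarrow> r * a \<in> I" "a \<in> I \<Longrightarrow> a * r \<in> I"
    using assms by (simp_all add: two_sided_ideal_def)
qed

text \<open>For each pair of outer exponents the inner combination lies in the ideal, and closedness
  carries this over to the infinite sum. An indexed combination covers two-term congruences, the
  four terms of the mixed relation and the six of a cubic one.\<close>

lemma ser_prod_context:
  assumes I: "two_sided_ideal I" "closed I"
    and conv: "\<And>j. j \<in> J \<Longrightarrow> convergent_list (As @ L j @ Bs)"
    and L: "\<And>m. (\<Sum>j\<in>J. of_int (c j) * ser_prod (L j) m) \<in> I"
  shows "(\<Sum>j\<in>J. of_int (c j) * ser_prod (As @ L j @ Bs) m) \<in> I"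
proof -
  let ?f = "\<lambda>j k l. ser_prod As k * ser_prod (L j) l * ser_prod Bs (m - k - l)"
  let ?X = "\<lambda>l. \<Sum>j\<in>J. of_int (c j) * ser_prod (L j) l"
  have null: "null_family (\<lambda>(k, l). ?f j k l) (UNIV \<times> UNIV)" if "j \<in> J" for j
    by (rule ser_prod_null3[OF conv[OF that]])
  have eq: "ser_prod (As @ L j @ Bs) m = (\<Sum>\<^sub>\<infinity>(k, l)\<in>UNIV \<times> UNIV. ?f j k l)" if j: "j \<in> J" for j
  proof -
    have c2: "convergent_list (L j @ Bs)" using convergent_list_append[OF conv[OF j]] by blast
    have "ser_prod (As @ L j @ Bs) m = (\<Sum>\<^sub>\<infinity>k. ser_prod As k * (\<Sum>\<^sub>\<infinity>l. ser_prod (L j) l * ser_prod Bs (m - k - l)))"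
      using ser_prod_append[OF conv[OF j]] ser_prod_append[OF c2] by (simp add: smult_def)
    also have "\<dots> = (\<Sum>\<^sub>\<infinity>k. \<Sum>\<^sub>\<infinity>l. ?f j k l)"
      by (intro infsum_cong) (simp add: mult.assoc infsum_left_mult[OF ser_prod_null2[OF c2]])
    also have "\<dots> = (\<Sum>\<^sub>\<infinity>(k, l)\<in>UNIV \<times> UNIV. ?f j k l)"
      by (rule null_family_fubini(3)[OF null[OF j]])
    finally show ?thesis .
  qed
  have "(\<Sum>j\<in>J. of_int (c j) * ser_prod (As @ L j @ Bs) m) =
      (\<Sum>j\<in>J. \<Sum>\<^sub>\<infinity>p\<in>UNIV \<times> UNIV. of_int (c j) * (case p of (k, l) \<Rightarrow> ?f j k l))"
    by (intro sum.cong refl) (simp only: eq infsum_left_mult[OF null])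
  also have "\<dots> = (\<Sum>\<^sub>\<infinity>p\<in>UNIV \<times> UNIV. \<Sum>j\<in>J. of_int (c j) * (case p of (k, l) \<Rightarrow> ?f j k l))"
    by (rule infsum_sum_null[symmetric]) (rule null_family_left_mult[OF null])
  also have "\<dots> \<in> I"
  proof (rule infsum_in_closed[OF I(2)])
    fix p :: "(var \<Rightarrow> int) \<times> (var \<Rightarrow> int)"
    obtain k l where p: "p = (k, l)" by (cases p)
    have comm: "of_int i * a = a * of_int i" for i and a :: free_alg
      by (rule mult_of_int_commute)
    have "(\<Sum>j\<in>J. of_int (c j) * (case p of (k, l) \<Rightarrow> ?f j k l)) =
        ser_prod As k * ?X l * ser_prod Bs (m - k - l)"
      unfolding p sum_distrib_left sum_distrib_right prod.case
      by (intro sum.cong refl) (metis mult.assoc comm)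
    also have "\<dots> \<in> I" by (intro ideal_simps[OF I(1)] L)
    finally show "(\<Sum>j\<in>J. of_int (c j) * (case p of (k, l) \<Rightarrow> ?f j k l)) \<in> I" .
  qed (intro ideal_simps[OF I(1)]; assumption)+
  finally show ?thesis .
qed

definition cong_prod :: "free_alg set \<Rightarrow> factor list \<Rightarrow> factor list \<Rightarrow> bool" where
  "cong_prod I As Bs \<longleftrightarrow> (\<forall>m. ser_prod As m - ser_prod Bs m \<in> I)"

lemma cong_prod_context:
  assumes I: "two_sided_ideal I" "closed I"
    and conv: "convergent_list (As @ L @ Bs)" "convergent_list (As @ L' @ Bs)"
    and L: "cong_prod I L L'"
  shows "cong_prod I (As @ L @ Bs) (As @ L' @ Bs)"
  unfolding cong_prod_def
proof
  fix m
  \<comment> \<open>A congruence is the combination indexed by the booleans with coefficients 1 and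
    -1.\<close>
  have "(\<Sum>j\<in>UNIV. of_int (if j then 1 else - 1) * ser_prod (As @ (if j then L else L') @ Bs) m) \<in> I"
    by (rule ser_prod_context[OF I]) (use conv L in \<open>auto simp: UNIV_bool cong_prod_def\<close>)
  then show "ser_prod (As @ L @ Bs) m - ser_prod (As @ L' @ Bs) m \<in> I" by (simp add: UNIV_bool)
qed

subsection \<open>A convergence criterion\<close>

text \<open>
  Reading a product from right to left, \<open>scan\<close> collects the variables \<open>v\<close> whose factor with
  support \<open>Line v\<close> has been met, the leftmost one first.
\<close>

fun scan :: "shape list \<Rightarrow> var list option" where
  "scan [] = Some []"
| "scan (s # ss) = (case scan ss of None \<Rightarrow> None | Some vs \<Rightarrow>
    (case s of
      Box n \<Rightarrow> Some vs
    | Line v \<Rightarrow> if v \<in> set vs then None else Some (v # vs)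
    | Up v \<Rightarrow> if v \<in> set vs then Some vs else None
    | Down v \<Rightarrow> if v \<in> set vs then None else Some vs
    | Ray w z \<Rightarrow> if w \<in> set vs \<and> z \<notin> set (dropWhile (\<lambda>v. v \<noteq> w) vs) then Some vs else None
    | Diag z w \<Rightarrow> None))"

text \<open>The invariant behind \<open>scan\<close>: exponents reachable modulo
  \<open>deep N\<close> are bounded above at each variable not yet collected, and every tail sum
  over the collected variables is bounded below in terms of \<open>N\<close>. The constant
  \<open>c\<close> depends on neither \<open>m\<close> nor \<open>N\<close>.\<close>

definition bounded_region :: "var list \<Rightarrow> shape list \<Rightarrow> int \<Rightarrow> bool" where
  "bounded_region vs ss c \<longleftrightarrow> (\<forall>m N. tuples ss m N \<noteq> {} \<longrightarrow>
    (\<forall>v. v \<notin> set vs \<longrightarrow> m v \<le> c) \<and>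
    (\<forall>us ws. vs = us @ ws \<longrightarrow> - N - c < sum_list (map m ws)))"

lemma bounded_regionD:
  assumes "bounded_region vs ss c" "tuples ss m N \<noteq> {}"
  shows "v \<notin> set vs \<Longrightarrow> m v \<le> c" "vs = us @ ws \<Longrightarrow> - N - c < sum_list (map m ws)"
  using assms unfolding bounded_region_def by auto

lemma convergent_ConsI:
  assumes "convergent_shapes ss"
    and "\<And>m N. finite {k \<in> support s. tuples ss (m - k) N \<noteq> {}}"
  shows "convergent_shapes (s # ss)"
  unfolding convergent_shapes_def
proof (intro allI)
  fix m N
  have "tuples (s # ss) m N \<subseteq>
      (\<Union>k\<in>{k \<in> support s. tuples ss (m - k) N \<noteq> {}}. (#) k ` tuples ss (m - k) N)"
    by (auto split: if_splits)
  then show "finite (tuples (s # ss) m N)"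
    by (rule finite_subset)
       (intro finite_UN_I assms(2) finite_imageI, use assms(1) in \<open>simp add: convergent_shapes_def\<close>)
qed

lemma tuples_Cons_nonempty:
  assumes "tuples (s # ss) m N \<noteq> {}"
  obtains k where "k \<in> support s" "tuples ss (m - k) N \<noteq> {}" "- N < vdeg m"
  using assms by (auto split: if_splits)

lemma finite_support_image:
  assumes "\<And>n. f n \<in> S \<Longrightarrow> P (f n) \<Longrightarrow> a \<le> n \<and> n \<le> (b :: int)" "S \<subseteq> range f"
  shows "finite {k \<in> S. P k}"
proof (rule finite_subset)
  show "{k \<in> S. P k} \<subseteq> f ` {a..b}" using assms by fastforce
qed simp

lemma finite_Box: "finite (support (Box n))"
proof (rule finite_subset)
  show "support (Box n) \<subseteq> (\<Pi>\<^sub>E v\<in>UNIV. {- int n..int n})"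
    by (auto simp: PiE_def Pi_def abs_le_iff minus_le_iff)
qed (intro finite_PiE, simp_all)

lemma sum_list_vexp:
  "distinct vs \<Longrightarrow> sum_list (map (vexp v n) vs) = (if v \<in> set vs then n else 0)"
  by (induction vs) (auto simp: vexp_apply)

lemma sum_list_diff:
  "sum_list (map (m - k) vs) = sum_list (map m vs) - (sum_list (map k vs) :: int)"
  by (induction vs) auto

text \<open>The invariant for the tail confines the first exponent to a finite interval and survives
  one more factor. A \<open>Ray w z\<close> moves degree from \<open>z\<close> to \<open>w\<close>;
  the condition in \<open>scan\<close> makes every tail of \<open>vs\<close> that contains
  \<open>z\<close> contain \<open>w\<close>, so no tail sum decreases.\<close>

lemma scan_convergent:
  assumes "scan ss = Some vs"
  shows "distinct vs \<and> convergent_shapes ss \<and> (\<exists>c\<ge>0. bounded_region vs ss c)"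
  using assms
proof (induction ss arbitrary: vs)
  case Nil
  then show ?case
    by (auto simp: convergent_shapes_def bounded_region_def intro!: exI[of _ 0] split: if_splits)
next
  case (Cons s ss)
  then obtain us where us: "scan ss = Some us" by (auto split: option.splits)
  from Cons.IH[OF us] obtain c where dist: "distinct us" and conv: "convergent_shapes ss"
    and c: "c \<ge> 0" and reg: "bounded_region us ss c" by blast
  note up = bounded_regionD(1)[OF reg] and suf = bounded_regionD(2)[OF reg]
  show ?case
  proof (cases s)
    case (Box n)
    then have vs: "vs = us" using Cons.prems us by simp
    have "convergent_shapes (s # ss)"
      by (rule convergent_ConsI[OF conv]) (rule finite_subset[OF _ finite_Box[of n]], auto simp: Box)
    \<comment> \<open>The entries of \<open>k\<close> have absolute value at most \<open>n\<close>:
      a single variable moves by at most \<open>n\<close>, a tail sum by at most \<open>n\<close>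
      times the length of \<open>us\<close>.\<close>
    moreover have "bounded_region vs (s # ss) (c + int n * (1 + int (length us)))"
      unfolding bounded_region_def
    proof (intro allI impI)
      fix m N assume "tuples (s # ss) m N \<noteq> {}"
      then obtain k where k: "k \<in> support s" "tuples ss (m - k) N \<noteq> {}"
        by (rule tuples_Cons_nonempty)
      have kb: "\<bar>k v\<bar> \<le> int n" for v using k(1) Box by simp
      have "- (int n * int (length ws)) \<le> sum_list (map k ws)" for ws
      proof (induction ws)
        case (Cons w ws)
        then show ?case using kb[of w] by (simp add: algebra_simps)
      qed simp
      moreover have "int n * int (length ws) \<le> int n * int (length us)" if "us = ts @ ws" for ts ws
        using that by (intro mult_left_mono) auto
      ultimately have "- N - (c + int n * (1 + int (length us))) < sum_list (map m ws)"
        if us: "us = ts @ ws" for ts ws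
      proof -
        have "- (int n * int (length ws)) \<le> sum_list (map k ws)"
          "int n * int (length ws) \<le> int n * int (length us)"
          using \<open>\<And>ws. - (int n * int (length ws)) \<le> sum_list (map k ws)\<close>
            \<open>\<And>ts ws. us = ts @ ws \<Longrightarrow> int n * int (length ws) \<le> int n * int (length us)\<close>[OF us]
          by blast+
        with suf[OF k(2) us] show ?thesis by (simp add: sum_list_diff distrib_left)
      qed
      moreover have "m v \<le> c + int n * (1 + int (length us))" if "v \<notin> set us" for v
      proof -
        have "0 \<le> int n * int (length us)" by (intro mult_nonneg_nonneg) simp_all
        moreover have "m v - k v \<le> c" using up[OF k(2) that] by simp
        ultimately show ?thesis using kb[of v] unfolding distrib_left by linarith
      qed
      ultimately show "(\<forall>v. v \<notin> set vs \<longrightarrow> m v \<le> c + int n * (1 + int (length us))) \<and>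
        (\<forall>us' ws. vs = us' @ ws \<longrightarrow> - N - (c + int n * (1 + int (length us))) < sum_list (map m ws))"
        by (auto simp: vs)
    qed
    moreover have "0 \<le> c + int n * (1 + int (length us))" using c by simp
    ultimately show ?thesis using dist vs by blast
  next
    case (Line v)
    then have vs: "vs = v # us" "v \<notin> set us" using Cons.prems us by (auto split: if_splits)
    have "convergent_shapes (s # ss)"
    proof (rule convergent_ConsI[OF conv])
      fix m N
      show "finite {k \<in> support s. tuples ss (m - k) N \<noteq> {}}"
      \<comment> \<open>The lower bound holds because \<open>v\<close> is not yet collected in the
        tail, the upper bound comes from the total degree of what remains.\<close>
      proof (rule finite_support_image[where f = "vexp v" and a = "m v - c" and b = "vdeg m + N"])
        fix n assume "tuples ss (m - vexp v n) N \<noteq> {}"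
        from up[OF this vs(2)] tuples_vdeg[OF this, unfolded vdeg_simps vdeg_vexp]
        show "m v - c \<le> n \<and> n \<le> vdeg m + N" by (simp add: vexp_apply)
      qed (auto simp: Line)
    qed
    \<comment> \<open>The sum over all of \<open>vs\<close> is the total degree minus the sum over
      the uncollected variables, of which there are at most three, each at most
      \<open>c\<close>.\<close>
    moreover have "bounded_region vs (s # ss) (4 * c)"
      unfolding bounded_region_def
    proof (intro allI impI)
      fix m N assume "tuples (s # ss) m N \<noteq> {}"
      then obtain n where n: "tuples ss (m - vexp v n) N \<noteq> {}" and N: "- N < vdeg m"
        by (rule tuples_Cons_nonempty) (use Line in auto)
      have u: "m w \<le> c" if "w \<notin> set vs" for w
        using up[OF n, of w] that by (auto simp: vs vexp_apply)
      have "(\<Sum>w\<in>- set vs. m w) \<le> (\<Sum>w\<in>- set vs. c)" by (rule sum_mono) (use u in auto)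
      also have "\<dots> \<le> (\<Sum>w\<in>(UNIV :: var set). c)" by (rule sum_mono2) (use c in auto)
      also have "\<dots> = 3 * c" by (simp add: UNIV_var)
      finally have full: "- N - 4 * c < sum_list (map m vs)"
        using vdeg_split[of vs m] N dist vs c by simp
      have "- N - 4 * c < sum_list (map m ws)" if "vs = us' @ ws" for us' ws
      proof (cases us')
        case Nil
        then show ?thesis using full that by simp
      next
        case (Cons a as)
        then have "us = as @ ws" using that vs by simp
        with suf[OF n this] vs c dist show ?thesis by (auto simp: sum_list_diff sum_list_vexp)
      qed
      with u c show "(\<forall>w. w \<notin> set vs \<longrightarrow> m w \<le> 4 * c) \<and>
          (\<forall>us ws. vs = us @ ws \<longrightarrow> - N - 4 * c < sum_list (map m ws))"
        by force
    qed
    ultimately show ?thesis using dist vs c by (intro conjI exI[of _ "4 * c"]) auto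
  next
    case (Up v)
    then have vs: "vs = us" "v \<in> set us" using Cons.prems us by (auto split: if_splits)
    then obtain as bs where ab: "us = as @ v # bs" by (meson split_list)
    have "convergent_shapes (s # ss)"
    proof (rule convergent_ConsI[OF conv])
      fix m N
      show "finite {k \<in> support s. tuples ss (m - k) N \<noteq> {}}"
      proof (rule finite_support_image[where f = "vexp v" and a = 0
            and b = "sum_list (map m (v # bs)) + N + c"])
        fix n assume s: "vexp v n \<in> support s" and "tuples ss (m - vexp v n) N \<noteq> {}"
        from suf[OF this(2) ab] have "n \<le> sum_list (map m (v # bs)) + N + c"
          using dist ab by (simp add: sum_list_diff sum_list_vexp vexp_apply)
        moreover have "n \<ge> 0" using s Up by (auto simp: vexp_apply fun_eq_iff) (metis)
        ultimately show "0 \<le> n \<and> n \<le> sum_list (map m (v # bs)) + N + c" by simp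
      qed (auto simp: Up)
    qed
    moreover have "bounded_region vs (s # ss) c"
      unfolding bounded_region_def
    proof (intro allI impI)
      fix m N assume "tuples (s # ss) m N \<noteq> {}"
      then obtain n where n: "tuples ss (m - vexp v n) N \<noteq> {}" and N: "n \<ge> 0"
        by (rule tuples_Cons_nonempty) (use Up in auto)
      have "m w \<le> c" if "w \<notin> set us" for w
        using up[OF n that] that vs(2) by (auto simp: vexp_apply split: if_splits)
      moreover have "- N - c < sum_list (map m ws)" if "us = us' @ ws" for us' ws
        using suf[OF n that] N that dist by (auto simp: sum_list_diff sum_list_vexp split: if_splits)
      ultimately show "(\<forall>w. w \<notin> set vs \<longrightarrow> m w \<le> c) \<and>
          (\<forall>us ws. vs = us @ ws \<longrightarrow> - N - c < sum_list (map m ws))"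
        by (auto simp: vs)
    qed
    ultimately show ?thesis using dist vs c by blast
  next
    case (Down v)
    then have vs: "vs = us" "v \<notin> set us" using Cons.prems us by (auto split: if_splits)
    have "convergent_shapes (s # ss)"
    proof (rule convergent_ConsI[OF conv])
      fix m N
      show "finite {k \<in> support s. tuples ss (m - k) N \<noteq> {}}"
      proof (rule finite_support_image[where f = "vexp v" and a = "m v - c" and b = 0])
        fix n assume s: "vexp v n \<in> support s" and "tuples ss (m - vexp v n) N \<noteq> {}"
        from up[OF this(2) vs(2)] have "m v - c \<le> n" by (simp add: vexp_apply)
        moreover have "n \<le> 0" using s Down by (auto simp: vexp_apply fun_eq_iff) (metis)
        ultimately show "m v - c \<le> n \<and> n \<le> 0" by simp
      qed (auto simp: Down)
    qed
    moreover have "bounded_region vs (s # ss) c"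
      unfolding bounded_region_def
    proof (intro allI impI)
      fix m N assume "tuples (s # ss) m N \<noteq> {}"
      then obtain n where n: "tuples ss (m - vexp v n) N \<noteq> {}" and N: "n \<le> 0"
        by (rule tuples_Cons_nonempty) (use Down in auto)
      have "m w \<le> c" if "w \<notin> set us" for w
        using up[OF n that] N by (auto simp: vexp_apply split: if_splits)
      moreover have "- N - c < sum_list (map m ws)" if "us = us' @ ws" for us' ws
        using suf[OF n that] that dist vs by (auto simp: sum_list_diff sum_list_vexp split: if_splits)
      ultimately show "(\<forall>w. w \<notin> set vs \<longrightarrow> m w \<le> c) \<and>
          (\<forall>us ws. vs = us @ ws \<longrightarrow> - N - c < sum_list (map m ws))"
        by (auto simp: vs)
    qed
    ultimately show ?thesis using dist vs c by blast
  next
    case (Ray w z)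
    then have vs: "vs = us" "w \<in> set us" "z \<notin> set (dropWhile (\<lambda>v. v \<noteq> w) us)"
      using Cons.prems us by (auto split: if_splits)
    then obtain as bs where ab: "us = as @ w # bs" "w \<notin> set as" by (meson split_list_first)
    then have drop: "dropWhile (\<lambda>v. v \<noteq> w) us = w # bs"
      by (subst ab(1), subst dropWhile_append2) auto
    with vs have z: "z \<notin> set bs" "z \<noteq> w" by auto
    have "convergent_shapes (s # ss)"
    proof (rule convergent_ConsI[OF conv])
      fix m N
      show "finite {k \<in> support s. tuples ss (m - k) N \<noteq> {}}"
      proof (rule finite_support_image[where f = "\<lambda>n. vexp w n - vexp z n" and a = 0
            and b = "sum_list (map m (w # bs)) + N + c"])
        fix n assume s: "vexp w n - vexp z n \<in> support s"
          and "tuples ss (m - (vexp w n - vexp z n)) N \<noteq> {}"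
        from suf[OF this(2) ab(1)] have "n \<le> sum_list (map m (w # bs)) + N + c"
          using dist ab z by (simp add: sum_list_diff sum_list_vexp vexp_apply)
        moreover have "n \<ge> 0"
          using s Ray z by (auto simp: vexp_apply fun_eq_iff) (metis diff_zero)
        ultimately show "0 \<le> n \<and> n \<le> sum_list (map m (w # bs)) + N + c" by simp
      qed (auto simp: Ray)
    qed
    moreover have "bounded_region vs (s # ss) c"
      unfolding bounded_region_def
    proof (intro allI impI)
      fix m N assume "tuples (s # ss) m N \<noteq> {}"
      then obtain n where n: "tuples ss (m - (vexp w n - vexp z n)) N \<noteq> {}" and N: "n \<ge> 0"
        by (rule tuples_Cons_nonempty) (use Ray in auto)
      have "m v \<le> c" if "v \<notin> set us" for v
        using up[OF n that] N that vs(2) by (auto simp: vexp_apply split: if_splits)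
      moreover have "- N - c < sum_list (map m ws)" if e: "us = us' @ ws" for us' ws
      proof -
        \<comment> \<open>Otherwise \<open>w\<close> stands to the left of this tail, which then
          lies in the part of \<open>us\<close> from \<open>w\<close> on, where \<open>z\<close>
          does not occur.\<close>
        have "w \<in> set ws" if "z \<in> set ws"
        proof (rule ccontr)
          assume "w \<notin> set ws"
          then have "w \<in> set us'" using vs(2) e by auto
          then have "set ws \<subseteq> set (dropWhile (\<lambda>v. v \<noteq> w) us)"
            unfolding e by (subst dropWhile_append1[of w]) auto
          then show False using that vs(3) by blast
        qed
        then show ?thesis
          using suf[OF n e] N dist e by (auto simp: sum_list_diff sum_list_vexp split: if_splits)
      qed
      ultimately show "(\<forall>w. w \<notin> set vs \<longrightarrow> m w \<le> c) \<and>
          (\<forall>us ws. vs = us @ ws \<longrightarrow> - N - c < sum_list (map m ws))"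
        by (auto simp: vs)
    qed
    ultimately show ?thesis using dist vs c by blast
  next
    case (Diag z w)
    then show ?thesis using Cons.prems us by simp
  qed
qed

fun avoids :: "var \<Rightarrow> shape \<Rightarrow> bool" where
  "avoids v (Box n) = (n = 0)"
| "avoids v (Line v') = (v \<noteq> v')"
| "avoids v (Up v') = (v \<noteq> v')"
| "avoids v (Down v') = (v \<noteq> v')"
| "avoids v _ = False"

text \<open>Some factors break the invariant of \<open>scan\<close> but may still be prefixed: a
  \<open>Box\<close> is finite, an \<open>Up\<close> is bounded through the total degree, and a
  \<open>Diag\<close> is bounded if on its right all variables are bounded above or \<open>z\<close>
  does not occur.\<close>

fun admissible_shapes :: "shape list \<Rightarrow> bool" where
  "admissible_shapes [] = True"
| "admissible_shapes (s # ss) = (scan (s # ss) \<noteq> None \<or> admissible_shapes ss \<and>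
    (case s of
      Box n \<Rightarrow> True
    | Up v \<Rightarrow> True
    | Diag z w \<Rightarrow> z \<noteq> w \<and> (scan ss = Some [] \<or> list_all (avoids z) ss)
    | _ \<Rightarrow> False))"

lemma tuples_avoids:
  assumes "tuples ss m N \<noteq> {}" "list_all (avoids z) ss"
  shows "m z = 0"
  using assms
proof (induction ss arbitrary: m)
  case Nil
  then show ?case by (auto split: if_splits)
next
  case (Cons s ss)
  from Cons.prems(1) obtain k where k: "k \<in> support s" "tuples ss (m - k) N \<noteq> {}"
    by (rule tuples_Cons_nonempty)
  have "(m - k) z = 0" using Cons.IH[OF k(2)] Cons.prems by simp
  moreover have "k z = 0" using k(1) Cons.prems(2) by (cases s) (auto simp: vexp_apply)
  ultimately show ?case by simp
qed

lemma admissible_convergent: "admissible_shapes ss \<Longrightarrow> convergent_shapes ss"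
proof (induction ss)
  case Nil
  then show ?case by (simp add: convergent_shapes_def)
next
  case (Cons s ss)
  show ?case
  proof (cases "scan (s # ss)")
    case (Some vs)
    then show ?thesis using scan_convergent by blast
  next
    case None
    with Cons.prems have adm: "admissible_shapes ss"
      and s: "case s of Box n \<Rightarrow> True | Up v \<Rightarrow> True
        | Diag z w \<Rightarrow> z \<noteq> w \<and> (scan ss = Some [] \<or> list_all (avoids z) ss) | _ \<Rightarrow> False"
      by auto
    show ?thesis
    proof (rule convergent_ConsI[OF Cons.IH[OF adm]])
      fix m N
      show "finite {k \<in> support s. tuples ss (m - k) N \<noteq> {}}"
      proof (cases s)
        case (Box n)
        then show ?thesis by (intro finite_subset[OF _ finite_Box[of n]]) auto
      next
        case (Up v)
        show ?thesis
        proof (rule finite_support_image[where f = "vexp v" and a = 0 and b = "vdeg m + N"])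
          fix n assume k: "vexp v n \<in> support s" and "tuples ss (m - vexp v n) N \<noteq> {}"
          from tuples_vdeg[OF this(2)] have "n \<le> vdeg m + N" by simp
          moreover have "n \<ge> 0" using k Up by (auto simp: vexp_apply fun_eq_iff) (metis)
          ultimately show "0 \<le> n \<and> n \<le> vdeg m + N" by simp
        qed (auto simp: Up)
      next
        case (Diag z w)
        with s have zw: "z \<noteq> w" and "scan ss = Some [] \<or> list_all (avoids z) ss" by auto
        then consider c where "bounded_region [] ss c" | "list_all (avoids z) ss"
          using scan_convergent by blast
        then show ?thesis
        proof cases
          case 1
          show ?thesis
          proof (rule finite_support_image[where f = "\<lambda>n. vexp z n - vexp w n" and a = "m z - c"
                and b = "c - m w"])
            fix n assume "tuples ss (m - (vexp z n - vexp w n)) N \<noteq> {}"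
            from bounded_regionD(1)[OF 1 this, of z] bounded_regionD(1)[OF 1 this, of w]
            show "m z - c \<le> n \<and> n \<le> c - m w" using zw by (auto simp: vexp_apply)
          qed (auto simp: Diag)
        next
          case 2
          show ?thesis
          proof (rule finite_support_image[where f = "\<lambda>n. vexp z n - vexp w n" and a = "m z"
                and b = "m z"])
            fix n assume "tuples ss (m - (vexp z n - vexp w n)) N \<noteq> {}"
            from tuples_avoids[OF this 2]
            show "m z \<le> n \<and> n \<le> m z" using zw by (auto simp: vexp_apply)
          qed (auto simp: Diag)
        qed
      qed (use s in auto)
    qed
  qed
qed

section \<open>Exponentials over a noncommutative ring\<close>

definition gen_fps :: "(nat \<Rightarrow> 'u::ring_1) \<Rightarrow> 'u fps" where
  "gen_fps b = Abs_fps (\<lambda>m. if m = 0 then 0 else b m)"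

lemma gen_fps_nth: "fps_nth (gen_fps b) m = (if m = 0 then 0 else b m)"
  by (simp add: gen_fps_def)

definition commuting :: "(nat \<Rightarrow> 'u::ring_1) \<Rightarrow> bool" where
  "commuting b \<longleftrightarrow> (\<forall>m>0. \<forall>n>0. b m * b n = b n * b m)"

lemma fps_mult_commuteI:
  fixes f g :: "'u::ring_1 fps"
  assumes "\<And>i j. fps_nth f i * fps_nth g j = fps_nth g j * fps_nth f i"
  shows "f * g = g * f"
proof (rule fps_ext)
  fix n
  have "(\<Sum>i=0..n. fps_nth f i * fps_nth g (n - i)) = (\<Sum>i=0..n. fps_nth f (n - i) * fps_nth g i)"
    by (rule fps_mult_commute_lemma)
  then show "fps_nth (f * g) n = fps_nth (g * f) n"
    by (simp add: fps_mult_nth assms)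
qed

lemma fps_mult_nth_commute:
  fixes f g :: "'u::ring_1 fps"
  assumes "\<And>i. x * fps_nth f i = fps_nth f i * x" "\<And>i. x * fps_nth g i = fps_nth g i * x"
  shows "x * fps_nth (f * g) n = fps_nth (f * g) n * x"
proof -
  have "x * (fps_nth f i * fps_nth g j) = fps_nth f i * fps_nth g j * x" for i j
    by (metis assms mult.assoc)
  then show ?thesis by (simp add: fps_mult_nth sum_distrib_left sum_distrib_right)
qed

lemma fps_power_nth_commute:
  fixes f :: "'u::ring_1 fps"
  assumes "\<And>i. x * fps_nth f i = fps_nth f i * x"
  shows "x * fps_nth (f ^ k) n = fps_nth (f ^ k) n * x"
proof (induction k arbitrary: n)
  case 0
  then show ?case by (cases n) auto
next
  case (Suc k)
  then show ?case unfolding power_Suc by (rule fps_mult_nth_commute[OF assms])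
qed

lemma fps_deriv_power_commuting:
  fixes f :: "'u::ring_1 fps"
  assumes "f * fps_deriv f = fps_deriv f * f"
  shows "fps_deriv (f ^ Suc k) = of_nat (Suc k) * fps_deriv f * f ^ k"
proof (induction k)
  case (Suc k)
  have 1: "f * (of_nat (Suc k) * fps_deriv f * f ^ k) = of_nat (Suc k) * fps_deriv f * f ^ Suc k"
    by (metis (no_types, lifting) assms mult.assoc mult_of_nat_commute power_Suc)
  have "fps_deriv (f ^ Suc (Suc k)) = f * fps_deriv (f ^ Suc k) + fps_deriv f * f ^ Suc k"
    by (simp only: power_Suc[of f "Suc k"] fps_deriv_mult)
  also have "\<dots> = of_nat (Suc k) * fps_deriv f * f ^ Suc k + fps_deriv f * f ^ Suc k"
    by (simp only: Suc 1)
  also have "\<dots> = of_nat (Suc (Suc k)) * fps_deriv f * f ^ Suc k"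
    by (simp only: of_nat_Suc[of "Suc k"] distrib_right mult_1_left add.commute)
  finally show ?case .
qed simp

lemma central_left_commute:
  fixes z :: "'u::ring_1"
  assumes "\<And>x. z * x = x * z"
  shows "a * (z * b) = z * (a * b)"
  by (metis assms mult.assoc)

lemma of_nat_left_commute: "a * (of_nat n * b) = of_nat n * (a * b)" for a b :: "'u::ring_1"
  by (rule central_left_commute) (rule mult_of_nat_commute)

text \<open>Central images of the complex numbers permit division by \<open>n\<close> and by
  factorials in a noncommutative ring.\<close>

locale ring_scalars =
  fixes c :: "complex \<Rightarrow> 'u::ring_1"
  assumes c_add: "c (a + b) = c a + c b"
    and c_mult: "c (a * b) = c a * c b"
    and c_1: "c 1 = 1"
    and c_comm: "c a * x = x * c a"
begin

lemma c_0: "c 0 = 0"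
  using c_add[of 0 0] by simp

lemma c_uminus: "c (- a) = - c a"
  using c_add[of a "- a"] by (simp add: c_0 eq_neg_iff_add_eq_0 add.commute)

lemma c_of_nat: "c (of_nat n) = of_nat n"
  by (induction n) (simp_all add: c_0 c_1 c_add)

lemma of_nat_cancel:
  assumes "n > 0" "of_nat n * x = of_nat n * (y :: 'u)"
  shows "x = y"
proof -
  have "c (1 / of_nat n) * of_nat n = 1"
    unfolding c_of_nat[symmetric] c_mult[symmetric] using assms(1) by (simp add: c_1)
  then show ?thesis using assms(2) by (metis mult.assoc mult_1)
qed

text \<open>The equation expresses \<open>n\<close> times the coefficient of order \<open>n\<close>
  through earlier coefficients, and \<open>n\<close> can be cancelled.\<close>

lemma fps_ode_unique:
  fixes F G H :: "'u fps"
  assumes "fps_deriv F = H * F" "fps_deriv G = H * G" "fps_nth F 0 = fps_nth G 0"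
  shows "F = G"
proof (rule fps_ext)
  fix n
  show "fps_nth F n = fps_nth G n"
  proof (induction n rule: less_induct)
    case (less n)
    show ?case
    proof (cases n)
      case (Suc k)
      have "of_nat n * fps_nth X n = (\<Sum>i=0..k. fps_nth H i * fps_nth X (k - i))"
        if "fps_deriv X = H * X" for X
        using arg_cong[OF that, of "\<lambda>f. fps_nth f k"] Suc by (simp add: fps_mult_nth)
      then have "of_nat n * fps_nth F n = of_nat n * fps_nth G n"
        using assms less Suc by simp
      then show ?thesis using of_nat_cancel Suc by blast
    qed (use assms in simp)
  qed
qed

definition uexp :: "(nat \<Rightarrow> 'u) \<Rightarrow> 'u fps" where
  "uexp b = Abs_fps (\<lambda>n. c (1 / fact n)) oo gen_fps b"

lemma uexp_nth: "fps_nth (uexp b) n = (\<Sum>i=0..n. c (1 / fact i) * fps_nth (gen_fps b ^ i) n)"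
  by (simp add: uexp_def fps_compose_nth)

lemma uexp_0 [simp]: "fps_nth (uexp b) 0 = 1"
  by (simp add: uexp_nth c_1)

lemma uexp_cong: "(\<And>m. m > 0 \<Longrightarrow> b m = b' m) \<Longrightarrow> uexp b = uexp b'"
  unfolding uexp_def by (rule arg_cong[of _ _ "\<lambda>x. _ oo x"]) (simp add: gen_fps_def fps_eq_iff)

lemma uexp_commute:
  assumes "\<And>m. m > 0 \<Longrightarrow> x * b m = b m * x"
  shows "x * fps_nth (uexp b) n = fps_nth (uexp b) n * x"
proof -
  have "x * fps_nth (gen_fps b ^ i) n = fps_nth (gen_fps b ^ i) n * x" for i
    by (rule fps_power_nth_commute) (simp add: gen_fps_nth assms)
  then have "x * (c a * fps_nth (gen_fps b ^ i) n) = c a * fps_nth (gen_fps b ^ i) n * x" for i a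
    by (metis c_comm mult.assoc)
  then show ?thesis by (simp add: uexp_nth sum_distrib_left sum_distrib_right)
qed

text \<open>Termwise differentiation: commuting \<open>b m\<close> make the exponent commute with
  its derivative. The powers \<open>?B ^ i\<close> vanish below order \<open>i\<close>, so all sums
  can be cut off at the common bound \<open>n\<close>.\<close>

lemma uexp_ode:
  assumes "commuting b"
  shows "fps_deriv (uexp b) = fps_deriv (gen_fps b) * uexp b"
proof (rule fps_ext)
  fix n
  let ?B = "gen_fps b"
  have comm: "?B * fps_deriv ?B = fps_deriv ?B * ?B"
  proof (rule fps_mult_commuteI)
    fix i j
    have "b i * b (Suc j) = b (Suc j) * b i" if "i \<noteq> 0"
      using assms that unfolding commuting_def by blast
    then show "fps_nth ?B i * fps_nth (fps_deriv ?B) j = fps_nth (fps_deriv ?B) j * fps_nth ?B i"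
      by (simp add: gen_fps_nth) (metis mult.assoc mult_of_nat_commute of_nat_Suc)
  qed
  have vanish: "fps_nth (?B ^ i) m = 0" if "m < i" for i m
    using startsby_zero_power_prefix[of ?B i] that by (simp add: gen_fps_nth)
  have z: "fps_nth (fps_deriv (?B ^ 0)) n = 0" by simp
  have "fps_nth (fps_deriv (uexp b)) n =
      (\<Sum>i=0..Suc n. c (1 / fact i) * fps_nth (fps_deriv (?B ^ i)) n)"
    by (simp only: fps_deriv_nth uexp_nth sum_distrib_left Suc_eq_plus1
        of_nat_left_commute[of "c _"])
  also have "\<dots> = (\<Sum>i=0..n. c (1 / fact (Suc i)) * fps_nth (fps_deriv (?B ^ Suc i)) n)"
    by (subst sum.atLeast0_atMost_Suc_shift) (simp only: o_def z mult_zero_right add_0)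
  also have "\<dots> = (\<Sum>i=0..n. c (1 / fact i) * fps_nth (fps_deriv ?B * ?B ^ i) n)"
  proof (intro sum.cong refl)
    fix i
    have "c (1 / fact (Suc i)) * of_nat (Suc i) = c (1 / fact i)"
      unfolding c_of_nat[symmetric] c_mult[symmetric] by (simp add: field_simps del: of_nat_Suc)
    moreover have "fps_nth (of_nat (Suc i) * fps_deriv ?B * ?B ^ i) n =
        of_nat (Suc i) * fps_nth (fps_deriv ?B * ?B ^ i) n"
      by (simp only: fps_of_nat[symmetric] mult.assoc fps_mult_left_const_nth)
    ultimately show "c (1 / fact (Suc i)) * fps_nth (fps_deriv (?B ^ Suc i)) n =
        c (1 / fact i) * fps_nth (fps_deriv ?B * ?B ^ i) n"
      unfolding fps_deriv_power_commuting[OF comm] by (metis mult.assoc)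
  qed
  also have "\<dots> = (\<Sum>i=0..n. \<Sum>j=0..n. fps_nth (fps_deriv ?B) j * (c (1 / fact i) * fps_nth (?B ^ i) (n - j)))"
    by (simp only: fps_mult_nth sum_distrib_left) (intro sum.cong refl, metis c_comm mult.assoc)
  also have "\<dots> = (\<Sum>j=0..n. \<Sum>i=0..n. fps_nth (fps_deriv ?B) j * (c (1 / fact i) * fps_nth (?B ^ i) (n - j)))"
    by (rule sum.swap)
  also have "\<dots> = (\<Sum>j=0..n. fps_nth (fps_deriv ?B) j * fps_nth (uexp b) (n - j))"
  proof (intro sum.cong refl)
    fix j
    have "(\<Sum>i=0..n. c (1 / fact i) * fps_nth (?B ^ i) (n - j)) = fps_nth (uexp b) (n - j)"
      unfolding uexp_nth by (rule sum.mono_neutral_right) (auto simp: vanish)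
    then show "(\<Sum>i=0..n. fps_nth (fps_deriv ?B) j * (c (1 / fact i) * fps_nth (?B ^ i) (n - j))) =
        fps_nth (fps_deriv ?B) j * fps_nth (uexp b) (n - j)"
      by (simp add: sum_distrib_left[symmetric])
  qed
  also have "\<dots> = fps_nth (fps_deriv ?B * uexp b) n" by (simp add: fps_mult_nth)
  finally show "fps_nth (fps_deriv (uexp b)) n = fps_nth (fps_deriv ?B * uexp b) n" .
qed

lemma uexp_recursion:
  assumes "commuting b"
  shows "of_nat n * fps_nth (uexp b) n = (\<Sum>k=1..n. of_nat k * b k * fps_nth (uexp b) (n - k))"
proof (cases n)
  case (Suc l)
  have "of_nat n * fps_nth (uexp b) n = fps_nth (fps_deriv (uexp b)) l" using Suc by simp
  also have "\<dots> = (\<Sum>i=0..l. of_nat (Suc i) * b (Suc i) * fps_nth (uexp b) (l - i))"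
    unfolding uexp_ode[OF assms] by (simp add: fps_mult_nth gen_fps_nth)
  also have "\<dots> = (\<Sum>k=1..n. of_nat k * b k * fps_nth (uexp b) (n - k))"
    by (rule sum.reindex_bij_witness[of _ "\<lambda>k. k - 1" Suc]) (auto simp: Suc)
  finally show ?thesis .
qed simp

lemma uexp_unique:
  assumes "commuting b" "fps_deriv F = fps_deriv (gen_fps b) * F" "fps_nth F 0 = 1"
  shows "F = uexp b"
  by (rule fps_ode_unique[OF assms(2) uexp_ode[OF assms(1)]]) (simp add: assms)

text \<open>The product solves the equation with the summed exponent, because \<open>uexp a\<close>
  commutes with every \<open>b n\<close>.\<close>

lemma uexp_add:
  assumes comm: "\<And>m n. m > 0 \<Longrightarrow> n > 0 \<Longrightarrow> a m * b n = b n * a m"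
    and a: "commuting a" and b: "commuting b"
  shows "uexp a * uexp b = uexp (\<lambda>n. a n + b n)"
proof (rule uexp_unique)
  show "commuting (\<lambda>n. a n + b n)"
    using comm a b by (auto simp: commuting_def distrib_left distrib_right)
  have g: "gen_fps (\<lambda>n. a n + b n) = gen_fps a + gen_fps b"
    by (rule fps_ext) (simp add: gen_fps_nth)
  have "uexp a * fps_deriv (gen_fps b) = fps_deriv (gen_fps b) * uexp a"
  proof (rule fps_mult_commuteI)
    fix i j
    have "fps_nth (fps_deriv (gen_fps b)) j * a m = a m * fps_nth (fps_deriv (gen_fps b)) j" if "m > 0" for m
      using comm[OF that, of "Suc j"] by (simp add: gen_fps_nth) (metis mult.assoc mult_of_nat_commute of_nat_Suc)
    from uexp_commute[of _ a, OF this]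
    show "fps_nth (uexp a) i * fps_nth (fps_deriv (gen_fps b)) j =
        fps_nth (fps_deriv (gen_fps b)) j * fps_nth (uexp a) i" by simp
  qed
  then show "fps_deriv (uexp a * uexp b) = fps_deriv (gen_fps (\<lambda>n. a n + b n)) * (uexp a * uexp b)"
    by (simp add: g uexp_ode a b distrib_left distrib_right mult.assoc[symmetric])
qed simp

lemma uexp_zero: "uexp (\<lambda>_. 0) = 1"
  by (rule uexp_unique[symmetric]) (auto simp: commuting_def gen_fps_def fps_zero_def[symmetric])

text \<open>The logarithm of a linear factor; it brings the polynomials G^+ and G^- into exponential
  form.\<close>

lemma uexp_geometric: "uexp (\<lambda>n. - c (a ^ n / of_nat n)) = 1 - fps_const (c a) * fps_X"
proof (rule uexp_unique[symmetric])
  show "commuting (\<lambda>n. - c (a ^ n / of_nat n))"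
    by (simp add: commuting_def c_mult[symmetric] mult.commute)
  have 1: "fps_nth (fps_deriv (gen_fps (\<lambda>n. - c (a ^ n / of_nat n)))) n = - c (a ^ Suc n)" for n
  proof -
    have "of_nat (n + 1) * c (a ^ Suc n / of_nat (Suc n)) = c (a ^ Suc n)"
      unfolding c_of_nat[symmetric] c_mult[symmetric] by (simp add: field_simps del: of_nat_Suc)
    then show ?thesis by (simp add: gen_fps_nth del: of_nat_Suc of_nat_add power_Suc)
  qed
  show "fps_deriv (1 - fps_const (c a) * fps_X) =
      fps_deriv (gen_fps (\<lambda>n. - c (a ^ n / of_nat n))) * (1 - fps_const (c a) * fps_X)"
    (is "?l = ?d * _")
  proof (rule fps_ext)
    fix n
    have "?d * (1 - fps_const (c a) * fps_X) = ?d - ?d * fps_const (c a) * fps_X"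
      by (simp add: right_diff_distrib mult.assoc)
    moreover have "fps_nth (?d * fps_const (c a) * fps_X) n = (if n = 0 then 0 else - c (a ^ Suc n))"
      by (cases n) (simp_all only: fps_X_mult_right_nth fps_mult_right_const_nth 1 diff_Suc_1
          mult_minus_left c_mult[symmetric] power_Suc2[symmetric] nat.simps simp_thms if_True if_False)
    moreover have "fps_nth ?l n = (if n = 0 then - c a else 0)" by simp
    ultimately show "fps_nth ?l n = fps_nth (?d * (1 - fps_const (c a) * fps_X)) n"
      by (simp only: fps_sub_nth 1) simp
  qed
qed simp

text \<open>Scaling the logarithm by a multiplicative central \<open>g\<close> amounts to scaling
  the variable; the recursion proves this order by order.\<close>

lemma uexp_dilate:
  assumes comm: "commuting b" and g: "\<And>m n. g (m + n) = g m * g n" "g 0 = 1" "\<And>m x. g m * x = x * g m"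
  shows "fps_nth (uexp (\<lambda>m. g m * b m)) n = g n * fps_nth (uexp b) n"
proof (induction n rule: less_induct)
  case (less n)
  have comm': "commuting (\<lambda>m. g m * b m)"
    using comm unfolding commuting_def by (metis g(3) mult.assoc)
  show ?case
  proof (cases "n = 0")
    case False
    have "of_nat n * fps_nth (uexp (\<lambda>m. g m * b m)) n =
        (\<Sum>k=1..n. of_nat k * (g k * b k) * (g (n - k) * fps_nth (uexp b) (n - k)))"
      unfolding uexp_recursion[OF comm'] by (intro sum.cong refl) (simp add: less)
    also have "\<dots> = (\<Sum>k=1..n. g n * (of_nat k * b k * fps_nth (uexp b) (n - k)))"
    proof (intro sum.cong refl)
      fix k assume "k \<in> {1..n}"
      then have "g n = g k * g (n - k)" by (simp add: g(1)[symmetric])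
      then show "of_nat k * (g k * b k) * (g (n - k) * fps_nth (uexp b) (n - k)) =
          g n * (of_nat k * b k * fps_nth (uexp b) (n - k))"
        by (simp only: mult.assoc central_left_commute[OF g(3), of "b k"]
            central_left_commute[OF g(3), of "of_nat k"])
    qed
    also have "\<dots> = of_nat n * (g n * fps_nth (uexp b) n)"
      by (simp only: sum_distrib_left[symmetric] uexp_recursion[OF comm, symmetric]
          of_nat_left_commute)
    finally show ?thesis using of_nat_cancel False by blast
  qed (simp add: g(2))
qed

text \<open>
  In terms of $y(z) = \sum_m y_m z^m$ this says $y(z)\exp(b(w)) = \exp(-s(w/z))\exp(b(w))y(z)$:
  the shift of the index of \<open>y\<close> is a power of the spectral variable.
\<close>

lemma uexp_intertwine:
  assumes b: "commuting b" and s: "\<And>n x. n > 0 \<Longrightarrow> s n * x = x * s n"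
    and y: "\<And>m n. n > 0 \<Longrightarrow> y m * b n = b n * y m - s n * y (m + int n)"
  shows "y m * fps_nth (uexp b) n =
    (\<Sum>i=0..n. fps_nth (uexp (\<lambda>n. - s n)) i * fps_nth (uexp b) (n - i) * y (m + int i))"
proof (induction n arbitrary: m rule: less_induct)
  case (less n)
  define E where "E = fps_nth (uexp b)"
  define S where "S = fps_nth (uexp (\<lambda>n. - s n))"
  define T where "T m n = (\<Sum>i=0..n. S i * E (n - i) * y (m + int i))" for m n
  have ss: "s j * s k = s k * s j" if "j > 0" for j k by (rule s[OF that])
  then have cs: "commuting (\<lambda>n. - s n)" unfolding commuting_def minus_mult_minus by blast
  have E: "of_nat n * E n = (\<Sum>k=1..n. of_nat k * b k * E (n - k))" for n
    unfolding E_def by (rule uexp_recursion[OF b])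
  have S: "of_nat n * S n = - (\<Sum>k=1..n. of_nat k * s k * S (n - k))" for n
    unfolding S_def by (simp add: uexp_recursion[OF cs] sum_negf)
  have Sc: "S n * x = x * S n" for n x
    unfolding S_def by (rule uexp_commute[symmetric]) (simp add: s)
  \<comment> \<open>Two enumerations of the decompositions of \<open>n\<close> into three parts with
    the part \<open>k\<close> positive, for the recursions of \<open>S\<close> and of
    \<open>E\<close> respectively.\<close>
  have tri: "(\<Sum>i=0..n. \<Sum>k=1..i. f k (i - k) (n - i)) = (\<Sum>k=1..n. \<Sum>i=0..n - k. f k i (n - k - i))"
    for f :: "nat \<Rightarrow> nat \<Rightarrow> nat \<Rightarrow> 'u"
  proof -
    have "(\<Sum>i=0..n. \<Sum>k=1..i. f k (i - k) (n - i)) =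
        (\<Sum>(i, k)\<in>(SIGMA i:{0..n}. {1..i}). f k (i - k) (n - i))"
      by (rule sum.Sigma) auto
    also have "\<dots> = (\<Sum>(k, i)\<in>(SIGMA k:{1..n}. {0..n - k}). f k i (n - k - i))"
      by (rule sum.reindex_bij_witness[of _ "\<lambda>(k, i). (i + k, k)" "\<lambda>(i, k). (k, i - k)"]) auto
    also have "\<dots> = (\<Sum>k=1..n. \<Sum>i=0..n - k. f k i (n - k - i))"
      by (rule sum.Sigma[symmetric]) auto
    finally show ?thesis .
  qed
  have tri2: "(\<Sum>i=0..n. \<Sum>k=1..n - i. f k i (n - i - k)) = (\<Sum>k=1..n. \<Sum>i=0..n - k. f k i (n - k - i))"
    for f :: "nat \<Rightarrow> nat \<Rightarrow> nat \<Rightarrow> 'u"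
  proof -
    have "(\<Sum>i=0..n. \<Sum>k=1..n - i. f k i (n - i - k)) =
        (\<Sum>(i, k)\<in>(SIGMA i:{0..n}. {1..n - i}). f k i (n - i - k))"
      by (rule sum.Sigma) auto
    also have "\<dots> = (\<Sum>(k, i)\<in>(SIGMA k:{1..n}. {0..n - k}). f k i (n - k - i))"
      by (rule sum.reindex_bij_witness[of _ "\<lambda>(k, i). (i, k)" "\<lambda>(i, k). (k, i)"])
         (auto simp: diff_commute add.commute)
    also have "\<dots> = (\<Sum>k=1..n. \<Sum>i=0..n - k. f k i (n - k - i))"
      by (rule sum.Sigma[symmetric]) auto
    finally show ?thesis .
  qed
  show ?case
  proof (cases "n = 0")
    case False
    \<comment> \<open>Both sides are taken \<open>n\<close> times. On the left the recursion for
      \<open>E\<close> and one commutation of \<open>y m\<close> past \<open>b k\<close> leave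
      shorter instances; on the right \<open>n = i + (n - i)\<close> is distributed over the
      recursions for \<open>S\<close> and \<open>E\<close>.\<close>
    have "of_nat n * (y m * E n) = y m * (of_nat n * E n)"
      by (metis mult.assoc mult_of_nat_commute)
    also have "\<dots> = (\<Sum>k=1..n. y m * (of_nat k * b k * E (n - k)))"
      by (simp only: E sum_distrib_left)
    also have "\<dots> = (\<Sum>k=1..n. of_nat k * b k * T m (n - k) - of_nat k * s k * T (m + int k) (n - k))"
    proof (intro sum.cong refl)
      fix k assume k: "k \<in> {1..n}"
      then have IH: "y l * E (n - k) = T l (n - k)" for l
        unfolding E_def S_def T_def by (intro less) auto
      have "y m * (of_nat k * b k * E (n - k)) = of_nat k * (y m * b k * E (n - k))"
        by (metis mult.assoc mult_of_nat_commute)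
      also have "\<dots> = of_nat k * (b k * (y m * E (n - k)) - s k * (y (m + int k) * E (n - k)))"
        using k by (simp add: y left_diff_distrib mult.assoc)
      finally show "y m * (of_nat k * b k * E (n - k)) =
          of_nat k * b k * T m (n - k) - of_nat k * s k * T (m + int k) (n - k)"
        by (simp add: IH right_diff_distrib mult.assoc)
    qed
    also have "\<dots> = of_nat n * T m n"
    proof -
      have "of_nat n * T m n =
          (\<Sum>i=0..n. of_nat i * S i * E (n - i) * y (m + int i)) +
          (\<Sum>i=0..n. S i * (of_nat (n - i) * E (n - i)) * y (m + int i))"
        unfolding T_def sum_distrib_left sum.distrib[symmetric]
      proof (intro sum.cong refl)
        fix i assume "i \<in> {0..n}"
        then have "(of_nat n :: 'u) = of_nat i + of_nat (n - i)"
          by (simp only: of_nat_add[symmetric]) simp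
        then show "of_nat n * (S i * E (n - i) * y (m + int i)) =
            of_nat i * S i * E (n - i) * y (m + int i) +
            S i * (of_nat (n - i) * E (n - i)) * y (m + int i)"
          by (simp only: distrib_right mult.assoc of_nat_left_commute[of "S i"])
      qed
      moreover have "(\<Sum>i=0..n. of_nat i * S i * E (n - i) * y (m + int i)) =
          - (\<Sum>k=1..n. of_nat k * s k * T (m + int k) (n - k))"
      proof -
        have "(\<Sum>i=0..n. of_nat i * S i * E (n - i) * y (m + int i)) =
            - (\<Sum>i=0..n. \<Sum>k=1..i. of_nat k * s k * S (i - k) * E (n - i) * y (m + int k + int (i - k)))"
          by (simp add: S sum_negf sum_distrib_right del: of_nat_diff)
             (intro sum.cong refl, auto)
        also have "\<dots> = - (\<Sum>k=1..n. \<Sum>i=0..n - k. of_nat k * s k * S i * E (n - k - i) * y (m + int k + int i))"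
          by (simp only: tri[of "\<lambda>k i l. of_nat k * s k * S i * E l * y (m + int k + int i)"])
        finally show ?thesis by (simp only: T_def sum_distrib_left mult.assoc)
      qed
      moreover have "(\<Sum>i=0..n. S i * (of_nat (n - i) * E (n - i)) * y (m + int i)) =
          (\<Sum>k=1..n. of_nat k * b k * T m (n - k))"
      proof -
        have "(\<Sum>i=0..n. S i * (of_nat (n - i) * E (n - i)) * y (m + int i)) =
            (\<Sum>i=0..n. \<Sum>k=1..n - i. of_nat k * b k * S i * E (n - i - k) * y (m + int i))"
          unfolding E sum_distrib_left sum_distrib_right
          by (intro sum.cong refl)
             (simp only: mult.assoc central_left_commute[OF Sc, of "b _"]
              central_left_commute[OF Sc, of "of_nat _"])
        also have "\<dots> = (\<Sum>k=1..n. \<Sum>i=0..n - k. of_nat k * b k * S i * E (n - k - i) * y (m + int i))"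
          by (rule tri2[of "\<lambda>k i l. of_nat k * b k * S i * E l * y (m + int i)"])
        finally show ?thesis by (simp only: T_def sum_distrib_left mult.assoc)
      qed
      ultimately show ?thesis by (simp add: sum_subtractf)
    qed
    finally have "y m * E n = T m n" using of_nat_cancel False by blast
    then show ?thesis by (simp only: E_def S_def T_def)
  qed simp
qed

text \<open>Taking the commutator with \<open>x\<close> is a derivation whose only nonzero value on
  the modes is the central \<open>r\<close> at index \<open>l\<close>, so it multiplies the
  exponential by \<open>r\<close> times the \<open>l\<close>-th power of the variable.\<close>

lemma uexp_commutator:
  assumes b: "commuting b" and r: "\<And>n. n > 0 \<Longrightarrow> b n * x - x * b n = (if n = l then r else 0)"
    and rc: "\<And>z. r * z = z * r" and l: "l > 0"
  shows "fps_nth (uexp b) n * x - x * fps_nth (uexp b) n =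
    (if l \<le> n then r * fps_nth (uexp b) (n - l) else 0)"
proof (induction n rule: less_induct)
  case (less n)
  define E where "E = fps_nth (uexp b)"
  have E: "of_nat n * E n = (\<Sum>k=1..n. of_nat k * b k * E (n - k))" for n
    unfolding E_def by (rule uexp_recursion[OF b])
  note IH = less[folded E_def]
  show ?case unfolding E_def[symmetric]
  proof (cases "n = 0")
    case False
    have "of_nat n * (E n * x - x * E n) = of_nat n * E n * x - x * (of_nat n * E n)"
      by (simp only: right_diff_distrib mult.assoc of_nat_left_commute[of x])
    also have "\<dots> = (\<Sum>k=1..n. of_nat k * (b k * E (n - k) * x - x * (b k * E (n - k))))"
      unfolding E sum_distrib_left sum_distrib_right sum_subtractf[symmetric]
      by (intro sum.cong refl)
         (simp only: right_diff_distrib mult.assoc of_nat_left_commute[of x])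
    also have "\<dots> = (\<Sum>k=1..n. of_nat k * ((if k = l then r * E (n - l) else 0) +
        (if l \<le> n - k then r * (b k * E (n - k - l)) else 0)))"
    proof (intro sum.cong refl)
      fix k assume k: "k \<in> {1..n}"
      have "b k * E (n - k) * x - x * (b k * E (n - k)) =
          b k * (E (n - k) * x - x * E (n - k)) + (b k * x - x * b k) * E (n - k)"
        by (simp add: right_diff_distrib left_diff_distrib mult.assoc)
      also have "E (n - k) * x - x * E (n - k) = (if l \<le> n - k then r * E (n - k - l) else 0)"
        by (rule IH) (use k in auto)
      also have "b k * x - x * b k = (if k = l then r else 0)" by (rule r) (use k in auto)
      finally have "b k * E (n - k) * x - x * (b k * E (n - k)) =
          (if k = l then r * E (n - l) else 0) +
          (if l \<le> n - k then r * (b k * E (n - k - l)) else 0)"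
        by (auto simp: central_left_commute[OF rc, of "b k"] mult.assoc)
      then show "of_nat k * (b k * E (n - k) * x - x * (b k * E (n - k))) =
          of_nat k * ((if k = l then r * E (n - l) else 0) +
          (if l \<le> n - k then r * (b k * E (n - k - l)) else 0))" by simp
    qed
    also have "\<dots> = of_nat n * (if l \<le> n then r * E (n - l) else 0)"
    proof (cases "l \<le> n")
      case True
      have "(\<Sum>k=1..n. of_nat k * (if k = l then r * E (n - l) else 0)) = of_nat l * (r * E (n - l))"
      proof -
        have "(\<Sum>k=1..n. of_nat k * (if k = l then r * E (n - l) else 0)) =
            (\<Sum>k\<in>{l}. of_nat k * (r * E (n - l)))"
          by (rule sum.mono_neutral_cong_right) (use True l in auto)
        then show ?thesis by simp
      qed
      moreover have "(\<Sum>k=1..n. of_nat k * (if l \<le> n - k then r * (b k * E (n - k - l)) else 0)) =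
          r * (of_nat (n - l) * E (n - l))"
      proof -
        have "(\<Sum>k=1..n. of_nat k * (if l \<le> n - k then r * (b k * E (n - k - l)) else 0)) =
            (\<Sum>k=1..n - l. r * (of_nat k * b k * E (n - l - k)))"
        proof (rule sum.mono_neutral_cong_right)
          fix k assume "k \<in> {1..n - l}"
          then have "l \<le> n - k" "n - k - l = n - l - k" by auto
          then show "of_nat k * (if l \<le> n - k then r * (b k * E (n - k - l)) else 0) =
              r * (of_nat k * b k * E (n - l - k))"
            by simp (metis rc mult.assoc)
        qed (use l in auto)
        then show ?thesis by (simp only: E sum_distrib_left)
      qed
      \<comment> \<open>The weight \<open>n\<close> splits into \<open>l\<close>, from the bracket
        with mode \<open>l\<close>, and \<open>n - l\<close>, from the recursion for the remaining
        coefficient.\<close>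
      moreover have "(of_nat n :: 'u) = of_nat l + of_nat (n - l)"
        using True by (simp only: of_nat_add[symmetric]) simp
      ultimately show ?thesis using True
        by (simp only: distrib_left sum.distrib distrib_right if_True of_nat_left_commute[of r])
    next
      case False
      then show ?thesis by (auto intro!: sum.neutral)
    qed
    finally show "E n * x - x * E n = (if l \<le> n then r * E (n - l) else 0)"
      using of_nat_cancel False by blast
  qed (use l in \<open>simp add: E_def\<close>)
qed

end

subsection \<open>The center\<close>

lemma central_mult:
  fixes a b :: "'u::ring_1"
  assumes a: "\<forall>x. a * x = x * a" and b: "\<forall>x. b * x = x * b"
  shows "a * b * x = x * (a * b)"
proof -
  have "a * b * x = a * (x * b)" using b by (simp only: mult.assoc)
  also have "\<dots> = a * x * b" by (simp only: mult.assoc)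
  also have "a * x = x * a" using a by blast
  also have "x * a * b = x * (a * b)" by (simp only: mult.assoc)
  finally show ?thesis .
qed

text \<open>As a type the center is a commutative ring, so commutative normalisation applies to
  scalars that are central only in the quotient.\<close>

typedef (overloaded) 'u center = "{a :: 'u::ring_1. \<forall>b. a * b = b * a}"
  morphisms from_center Center
  by (rule exI[of _ 0]) simp

setup_lifting type_definition_center

instantiation center :: (ring_1) comm_ring_1
begin

lift_definition zero_center :: "'a center" is 0 by simp
lift_definition one_center :: "'a center" is 1 by simp
lift_definition plus_center :: "'a center \<Rightarrow> 'a center \<Rightarrow> 'a center" is "(+)"
  by (simp add: distrib_left distrib_right)
lift_definition uminus_center :: "'a center \<Rightarrow> 'a center" is uminus by simp
lift_definition minus_center :: "'a center \<Rightarrow> 'a center \<Rightarrow> 'a center" is "(-)"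
  by (simp add: left_diff_distrib right_diff_distrib)
lift_definition times_center :: "'a center \<Rightarrow> 'a center \<Rightarrow> 'a center" is "(*)"
  using central_mult by blast

instance
proof
  fix a b d :: "'a center"
  note reps = from_center_inject[symmetric] zero_center.rep_eq one_center.rep_eq plus_center.rep_eq
    uminus_center.rep_eq minus_center.rep_eq times_center.rep_eq
  show "a * b * d = a * (b * d)" by (simp add: reps mult.assoc)
  have "from_center a * from_center b = from_center b * from_center a"
    using from_center[of a] by blast
  then show "a * b = b * a" by (simp only: reps)
  show "1 * a = a" by (simp add: reps)
  show "a + b + d = a + (b + d)" by (simp add: reps add.assoc)
  show "a + b = b + a" by (simp add: reps add.commute)
  show "0 + a = a" by (simp add: reps)
  show "- a + a = 0" by (simp add: reps)
  show "a - b = a + - b" by (simp add: reps)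
  show "(a + b) * d = a * d + b * d" by (simp add: reps distrib_right)
  show "(0 :: 'a center) \<noteq> 1" by (simp add: reps)
qed

end

lemma center_commute: "from_center a * b = b * from_center a"
  using from_center[of a] by blast

section \<open>Scalars and coefficients\<close>

lemma scal_commute: "scal x * a = a * scal x"
  by transfer (rule ext, simp only: free_times_scal_left free_times_scal_right mult.commute)

lemma scal_add: "scal (x + y) = scal x + scal y"
  by transfer auto

lemma scal_mult: "scal (x * y) = scal x * scal y"
  by transfer (rule ext, simp add: free_times_scal_left)

lemma scal_1: "scal 1 = 1"
  by transfer simp

lemma pp_power_nbh0: "pp ^ n * a \<in> nbh0 n"
proof -
  have pp: "coef (pp * b) w k = (if k = 0 then 0 else coef b w (k - 1))" for b w k
    by (simp add: coef_def pp_def times_free_alg.rep_eq scal.rep_eq free_times_scal_left)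
  have "coef (pp ^ n * a) w k = 0" if "k < n" for w k
    using that
  proof (induction n arbitrary: k)
    case (Suc n)
    then show ?case by (cases k) (simp_all add: mult.assoc pp)
  qed simp
  then show ?thesis by (simp add: nbh0_def)
qed

lemma pp_commute: "pp * a = a * pp"
  unfolding pp_def by (rule scal_commute)

text \<open>In the free algebra \<open>pp\<close> is central but \<gamma> is not, so the powers of
  \<gamma> are collected on the right.\<close>

lemma pstar_power: "pstar ^ n = pp ^ n * gam (- 4) ^ n"
proof (induction n)
  case (Suc n)
  have "pstar ^ Suc n = pp * gam (- 4) * (pp ^ n * gam (- 4) ^ n)"
    by (simp only: power_Suc Suc[symmetric]) (simp only: pstar_def)
  also have "\<dots> = pp * (gam (- 4) * pp ^ n) * gam (- 4) ^ n" by (simp only: mult.assoc)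
  also have "gam (- 4) * pp ^ n = pp ^ n * gam (- 4)"
    by (rule power_commuting_commutes[symmetric]) (rule pp_commute)
  finally show ?case by (simp add: mult.assoc)
qed simp

text \<open>The term with \<open>k = 0\<close> is 1 and the remaining terms sum to
  \<open>s * geo s\<close>.\<close>

lemma geo_inverse:
  assumes "null_family (\<lambda>k. s ^ k) UNIV"
  shows "(1 - s) * geo s = 1"
proof -
  let ?f = "\<lambda>k::nat. if k = 0 then 0 else s ^ k"
  have f: "null_family ?f UNIV"
    unfolding null_family_def
  proof
    fix N
    show "finite {k \<in> UNIV. ?f k \<notin> nbh0 N}"
      by (rule finite_subset[OF _ null_familyD[OF assms, of N]]) (auto split: if_splits)
  qed
  have g: "null_family (\<lambda>k::nat. if k = 0 then 1 else 0) UNIV"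
    unfolding null_family_def by (auto intro: finite_subset[of _ "{0}"])
  have "geo s = (\<Sum>\<^sub>\<infinity>k. (if k = 0 then 1 else 0) + ?f k)"
    unfolding geo_def by (rule infsum_cong) auto
  also have "\<dots> = 1 + infsum ?f UNIV"
    unfolding infsum_add_null[OF g f] by (subst infsum_delta[of 0]) auto
  also have "infsum ?f UNIV = infsum ?f (range Suc)"
    by (rule infsum_cong_neutral) (auto simp: image_iff gr0_conv_Suc)
  also have "\<dots> = (\<Sum>\<^sub>\<infinity>k. s * s ^ k)"
    by (subst infsum_reindex) (auto simp: o_def)
  also have "\<dots> = s * geo s" unfolding geo_def by (rule infsum_left_mult[OF assms])
  finally have "geo s = 1 + s * geo s" .
  then have "geo s - s * geo s = 1" by (metis add_diff_cancel_right')
  then show ?thesis by (simp add: left_diff_distrib)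
qed

lemma null_family_powers:
  assumes "\<And>k. s ^ k \<in> nbh0 k"
  shows "null_family (\<lambda>k. s ^ k) UNIV"
  unfolding null_family_def
proof
  fix N
  have "k < N" if "s ^ k \<notin> nbh0 N" for k
    using assms[of k] nbh0_antimono[of N k] that by (meson in_mono not_le)
  then show "finite {k \<in> UNIV. s ^ k \<notin> nbh0 N}" by (auto intro: finite_subset[of _ "{..<N}"])
qed

lemma geo_pp: "m > 0 \<Longrightarrow> (1 - pp ^ m) * geo (pp ^ m) = 1"
  by (rule geo_inverse, rule null_family_powers)
     (metis mult.right_neutral nbh0_antimono pp_power_nbh0 power_mult subsetD mult_le_mono1 mult_1
       Suc_leI One_nat_def)

lemma geo_pstar:
  assumes "m > 0"
  shows "(1 - pstar ^ m) * geo (pstar ^ m) = 1"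
proof (rule geo_inverse, rule null_family_powers)
  fix k
  have "k \<le> m * k" using assms by simp
  moreover have "(pstar ^ m) ^ k \<in> nbh0 (m * k)"
    unfolding power_mult[symmetric] unfolding pstar_power by (rule pp_power_nbh0)
  ultimately show "(pstar ^ m) ^ k \<in> nbh0 k" using nbh0_antimono by blast
qed

subsection \<open>Homogeneity\<close>

lemma homog_cc [simp]: "cc z \<in> homog 0" and homog_pp [simp]: "pp \<in> homog 0"
  by (simp_all add: cc_def pp_def homog_scal)

lemma homog_gam [simp]: "gam k \<in> homog 0"
  using homog_letter[of GammaHalf] homog_letter[of GammaHalfInv] by (simp add: gam_def homog_power)

lemma homog_alpha: "alpha m \<in> homog m"
  using homog_letter[of "Alpha m"] by (simp add: alpha_def)

lemma homog_DiffInv [simp]: "letter (DiffInv n) \<in> homog 0"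
  using homog_letter[of "DiffInv n"] by simp

lemma homog_geo [simp]: "s \<in> homog 0 \<Longrightarrow> geo s \<in> homog 0"
  unfolding geo_def by (rule homog_infsum) (rule homog_power)

lemma homog_pstar [simp]: "pstar \<in> homog 0"
  by (simp add: pstar_def homog_mult_0)

lemma homog_pratio [simp]: "pratio m \<in> homog 0" and homog_pratio_inv [simp]: "pratio_inv m \<in> homog 0"
  by (auto simp: pratio_def pratio_inv_def intro!: homog_mult_0 homog_diff homog_power homog_geo)

lemma homog_alpha': "alpha' m \<in> homog m"
  unfolding alpha'_def by (intro homog_mult_0(1) homog_alpha) (simp_all add: homog_mult_0)

text \<open>The sign \<open>e\<close> is -1 or 1 for half vertex operators in positive or negative
  powers, and 0 for scalar series.\<close>

lemma fps_power_homog: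
  assumes "\<And>n. fps_nth F n \<in> homog (e * int n)"
  shows "fps_nth (F ^ k) n \<in> homog (e * int n)"
proof (induction k arbitrary: n)
  case 0
  then show ?case by (cases n) auto
next
  case (Suc k)
  have "fps_nth F i * fps_nth (F ^ k) (n - i) \<in> homog (e * int n)" if "i \<in> {0..n}" for i
  proof -
    have "e * int i + e * int (n - i) = e * int n"
      using that by (simp add: distrib_left[symmetric])
    then show ?thesis using homog_mult[OF assms Suc, of i "n - i"] by simp
  qed
  then show ?case unfolding power_Suc fps_mult_nth by (rule homog_sum)
qed

lemma exp_sum_homog:
  assumes "\<And>m. m > 0 \<Longrightarrow> a m \<in> homog (e * int m)"
  shows "fps_nth (exp_sum a) n \<in> homog (e * int n)"
  unfolding exp_sum_def fps_compose_nth
proof (rule homog_sum)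
  fix i
  show "fps_nth (Abs_fps (\<lambda>n. cc (1 / fact n))) i *
      fps_nth (Abs_fps (\<lambda>m. if m = 0 then 0 else a m) ^ i) n \<in> homog (e * int n)"
    by (intro homog_mult_0(1) fps_power_homog) (auto simp: assms)
qed

subsection \<open>Coefficients of products\<close>

lemma graded_at_var_Line:
  assumes "\<And>n. X n \<in> homog (- n)"
  shows "graded (Line v) (at_var X v)"
proof -
  have "at_var X v m \<in> homog (- vdeg m)" for m
  proof (cases "m = vexp v (m v)")
    case True
    then have "vdeg m = m v" by (metis vdeg_vexp)
    then show ?thesis using assms by (simp add: at_var_def)
  qed (simp add: at_var_def)
  then show ?thesis by (auto simp: graded_def at_var_def)
qed

lemma graded_at_var_Up:
  assumes "\<And>n. X n \<in> homog (- n)" "\<And>n. n < 0 \<Longrightarrow> X n = 0"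
  shows "graded (Up v) (at_var X v)"
  using graded_at_var_Line[OF assms(1), of v] assms(2)
  by (force simp: graded_def at_var_def image_iff)

lemma graded_at_var_Down:
  assumes "\<And>n. X n \<in> homog (- n)" "\<And>n. n > 0 \<Longrightarrow> X n = 0"
  shows "graded (Down v) (at_var X v)"
  using graded_at_var_Line[OF assms(1), of v] assms(2)
  by (force simp: graded_def at_var_def image_iff)

lemma graded_at_ratio_Diag:
  assumes "\<And>n. X n \<in> homog 0"
  shows "graded (Diag v v') (at_ratio X v v')"
proof -
  have "at_ratio X v v' m \<in> homog (- vdeg m)" for m
  proof (cases "m = vexp v (m v) - vexp v' (m v)")
    case True
    then have "vdeg m = vdeg (vexp v (m v) - vexp v' (m v))" by (rule arg_cong)
    then have "vdeg m = 0" by simp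
    then show ?thesis using assms by (simp add: at_ratio_def)
  qed (simp add: at_ratio_def)
  then show ?thesis by (auto simp: graded_def at_ratio_def)
qed

lemma graded_at_ratio_Ray:
  assumes "\<And>n. X n \<in> homog 0" "\<And>n. n < 0 \<Longrightarrow> X n = 0"
  shows "graded (Ray v v') (at_ratio X v v')"
proof -
  have d: "graded (Diag v v') (at_ratio X v v')" by (rule graded_at_ratio_Diag) (rule assms(1))
  have "at_ratio X v v' m = 0" if "m \<notin> support (Ray v v')" for m
  proof (cases "m v < 0")
    case True
    then show ?thesis using assms(2) by (simp add: at_ratio_def)
  next
    case False
    then have "m \<noteq> vexp v (m v) - vexp v' (m v)" using that by (auto simp: image_iff)
    then show ?thesis unfolding at_ratio_def by (rule if_not_P)
  qed
  with d show ?thesis by (simp add: graded_def)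
qed

lemma graded_const: "a \<in> homog 0 \<Longrightarrow> graded (Box 0) (const_ser a)"
  by (auto simp: graded_def const_ser_def)

lemma at_var_outside: "k \<notin> range (vexp v) \<Longrightarrow> at_var X v k = 0"
  unfolding at_var_def by (metis rangeI)

lemma at_ratio_outside: "k \<notin> range (\<lambda>n. vexp v n - vexp v' n) \<Longrightarrow> at_ratio X v v' k = 0"
  unfolding at_ratio_def by (metis (mono_tags, lifting) rangeI)

lemma smult_at_var: "(at_var X v \<star> G) m = (\<Sum>\<^sub>\<infinity>n. X n * G (m - vexp v n))"
proof -
  have inj: "inj (vexp v)" by (rule injI) (metis vdeg_vexp)
  have "(at_var X v \<star> G) m = (\<Sum>\<^sub>\<infinity>k\<in>range (vexp v). at_var X v k * G (m - k))"
    unfolding smult_def by (rule infsum_cong_neutral) (simp_all add: at_var_outside)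
  also have "\<dots> = (\<Sum>\<^sub>\<infinity>n. at_var X v (vexp v n) * G (m - vexp v n))"
    using infsum_reindex[OF inj] by (simp add: o_def)
  finally show ?thesis by (simp add: at_var_def vexp_apply)
qed

lemma smult_at_ratio:
  assumes "v \<noteq> v'"
  shows "(at_ratio X v v' \<star> G) m = (\<Sum>\<^sub>\<infinity>n. X n * G (m - (vexp v n - vexp v' n)))"
proof -
  let ?h = "\<lambda>n. vexp v n - vexp v' n"
  have h: "?h n v = n" for n using assms by (simp add: vexp_apply)
  have inj: "inj ?h"
  proof (rule injI)
    fix a b assume "?h a = ?h b"
    from fun_cong[OF this, of v] show "a = b" by (simp only: h)
  qed
  have "(at_ratio X v v' \<star> G) m = (\<Sum>\<^sub>\<infinity>k\<in>range ?h. at_ratio X v v' k * G (m - k))"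
    unfolding smult_def by (rule infsum_cong_neutral) (simp_all add: at_ratio_outside)
  also have "\<dots> = (\<Sum>\<^sub>\<infinity>n. at_ratio X v v' (?h n) * G (m - ?h n))"
    using infsum_reindex[OF inj] by (simp add: o_def)
  finally show ?thesis using h by (simp add: at_ratio_def)
qed

lemma smult_at_var2:
  assumes "z \<noteq> w"
  shows "(at_var X z \<star> at_var Y w) m = (if m = vexp z (m z) + vexp w (m w) then X (m z) * Y (m w) else 0)"
proof -
  have "at_var Y w (m - vexp z n) = 0" if "n \<noteq> m z" for n
  proof -
    have "(m - vexp z n) z \<noteq> vexp w ((m - vexp z n) w) z" using that assms by (simp add: vexp_apply)
    then have "m - vexp z n \<noteq> vexp w ((m - vexp z n) w)" by metis
    then show ?thesis unfolding at_var_def by (rule if_not_P)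
  qed
  then have "(at_var X z \<star> at_var Y w) m = X (m z) * at_var Y w (m - vexp z (m z))"
    unfolding smult_at_var by (subst infsum_delta[of "m z"]) auto
  moreover have "m - vexp z (m z) = vexp w ((m - vexp z (m z)) w) \<longleftrightarrow> m = vexp z (m z) + vexp w (m w)"
    using assms by (auto simp: vexp_apply algebra_simps)
  ultimately show ?thesis using assms by (simp add: at_var_def vexp_apply)
qed

text \<open>Along the axis of \<open>v\<close> both sides are the same sum over the exponent of the
  left factor; off that axis both vanish.\<close>

lemma at_var_smult: "at_var (X \<star> Y) v = at_var X v \<star> at_var Y v"
proof
  fix m
  show "at_var (X \<star> Y) v m = (at_var X v \<star> at_var Y v) m"
  proof (cases "m = vexp v (m v)")
    case True
    have "at_var Y v (m - vexp v n) = Y (m v - n)" for n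
    proof -
      have "m - vexp v n = vexp v (m v - n)"
      proof
        fix v'
        show "(m - vexp v n) v' = vexp v (m v - n) v'"
          using fun_cong[OF True, of v'] by (simp add: vexp_apply)
      qed
      then show ?thesis by (simp add: at_var_def vexp_apply)
    qed
    with True show ?thesis unfolding smult_at_var by (simp add: at_var_def smult_def)
  next
    case False
    then obtain v' where "m v' \<noteq> vexp v (m v) v'" by auto
    then have v': "v' \<noteq> v" "m v' \<noteq> 0" by (auto simp: vexp_apply split: if_splits)
    have "at_var Y v (m - vexp v n) = 0" for n
    proof -
      have "(m - vexp v n) v' \<noteq> vexp v ((m - vexp v n) v) v'" using v' by (simp add: vexp_apply)
      then have "m - vexp v n \<noteq> vexp v ((m - vexp v n) v)" by metis
      then show ?thesis unfolding at_var_def by (rule if_not_P)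
    qed
    with False show ?thesis unfolding smult_at_var by (simp add: at_var_def)
  qed
qed

text \<open>Both exponents are nonnegative, so the sum is finite and is the coefficient sum of power
  series.\<close>

lemma smult_in_pos: "in_pos F \<star> in_pos G = in_pos (F * G)"
proof
  fix n :: int
  have "(in_pos F \<star> in_pos G) n = (\<Sum>\<^sub>\<infinity>k\<in>{0..n}. in_pos F k * in_pos G (n - k))"
    unfolding smult_def by (rule infsum_cong_neutral) (auto simp: in_pos_def)
  also have "\<dots> = (\<Sum>k\<in>{0..n}. in_pos F k * in_pos G (n - k))" by simp
  also have "\<dots> = in_pos (F * G) n"
  proof (cases "n \<ge> 0")
    case True
    have "(\<Sum>k\<in>{0..n}. in_pos F k * in_pos G (n - k)) = (\<Sum>i=0..nat n. fps_nth F i * fps_nth G (nat n - i))"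
      by (rule sum.reindex_bij_witness[of _ int nat]) (use True in \<open>auto simp: in_pos_def nat_diff_distrib\<close>)
    then show ?thesis using True by (simp add: in_pos_def fps_mult_nth)
  qed (simp add: in_pos_def)
  finally show "(in_pos F \<star> in_pos G) n = in_pos (F * G) n" .
qed

lemma smult_in_neg: "in_neg F \<star> in_neg G = in_neg (F * G)"
proof
  fix n :: int
  have "(in_neg F \<star> in_neg G) n = (\<Sum>\<^sub>\<infinity>k\<in>{n..0}. in_neg F k * in_neg G (n - k))"
    unfolding smult_def by (rule infsum_cong_neutral) (auto simp: in_neg_def)
  also have "\<dots> = (\<Sum>k\<in>{n..0}. in_neg F k * in_neg G (n - k))" by simp
  also have "\<dots> = in_neg (F * G) n"
  proof (cases "n \<le> 0")
    case True
    have "(\<Sum>k\<in>{n..0}. in_neg F k * in_neg G (n - k)) = (\<Sum>i=0..nat (- n). fps_nth F i * fps_nth G (nat (- n) - i))"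
      by (rule sum.reindex_bij_witness[of _ "\<lambda>i. - int i" "\<lambda>k. nat (- k)"])
         (use True in \<open>auto simp: in_neg_def nat_diff_distrib[symmetric]\<close>)
    then show ?thesis using True by (simp add: in_neg_def fps_mult_nth)
  qed (simp add: in_neg_def)
  finally show "(in_neg F \<star> in_neg G) n = in_neg (F * G) n" .
qed

lemma at_ratio_smult:
  assumes "v \<noteq> v'"
  shows "at_ratio (X \<star> Y) v v' = at_ratio X v v' \<star> at_ratio Y v v'"
proof
  fix m
  show "at_ratio (X \<star> Y) v v' m = (at_ratio X v v' \<star> at_ratio Y v v') m"
  proof (cases "m = vexp v (m v) - vexp v' (m v)")
    case True
    have "at_ratio Y v v' (m - (vexp v n - vexp v' n)) = Y (m v - n)" for n
    proof -
      have 1: "m - (vexp v n - vexp v' n) = vexp v (m v - n) - vexp v' (m v - n)"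
      proof
        fix x
        show "(m - (vexp v n - vexp v' n)) x = (vexp v (m v - n) - vexp v' (m v - n)) x"
          using fun_cong[OF True, of x] by (simp add: vexp_apply)
      qed
      have "(vexp v (m v - n) - vexp v' (m v - n)) v = m v - n" using assms by (simp add: vexp_apply)
      then show ?thesis unfolding 1 at_ratio_def by simp
    qed
    with True show ?thesis unfolding smult_at_ratio[OF assms] by (simp add: at_ratio_def smult_def)
  next
    case False
    have "at_ratio Y v v' (m - (vexp v n - vexp v' n)) = 0" for n
    proof -
      have "m - (vexp v n - vexp v' n) \<noteq>
          vexp v ((m - (vexp v n - vexp v' n)) v) - vexp v' ((m - (vexp v n - vexp v' n)) v)"
      proof
        assume e: "m - (vexp v n - vexp v' n) =
          vexp v ((m - (vexp v n - vexp v' n)) v) - vexp v' ((m - (vexp v n - vexp v' n)) v)"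
        have "m = vexp v (m v) - vexp v' (m v)"
        proof
          fix x
          show "m x = (vexp v (m v) - vexp v' (m v)) x"
            using fun_cong[OF e, of x] assms by (simp add: vexp_apply split: if_splits)
        qed
        with False show False by simp
      qed
      then show ?thesis by (simp add: at_ratio_def)
    qed
    with False show ?thesis unfolding smult_at_ratio[OF assms] by (simp add: at_ratio_def)
  qed
qed

lemma vexp_0 [simp]: "vexp v 0 = 0"
  by (auto simp: vexp_apply)

lemma at_ratio_one: "at_ratio (in_pos 1) v v' = mono_ser 0"
proof
  fix m
  have "in_pos 1 (m v) = 0" if "m \<noteq> 0" "m = vexp v (m v) - vexp v' (m v)"
  proof -
    have "m v \<noteq> 0"
    proof
      assume "m v = 0"
      with that(2) have "m = vexp v 0 - vexp v' 0" by metis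
      with that(1) show False by simp
    qed
    then show ?thesis by (simp add: in_pos_def)
  qed
  then show "at_ratio (in_pos 1) v v' m = mono_ser 0 m"
    by (cases "m = 0") (simp_all add: at_ratio_def mono_ser_def, simp add: in_pos_def)
qed

lemma at_var_one: "at_var (in_pos 1) v = mono_ser 0" "at_var (in_neg 1) v = mono_ser 0"
proof -
  have "at_var X v = mono_ser 0" if X: "\<And>n. n \<noteq> 0 \<Longrightarrow> X n = 0" "X 0 = 1" for X
  proof
    fix m
    have "X (m v) = 0" if "m \<noteq> 0" "m = vexp v (m v)"
      using X(1) that by (metis vexp_0)
    then show "at_var X v m = mono_ser 0 m"
      using X(2) by (cases "m = 0") (simp_all add: at_var_def mono_ser_def)
  qed
  from this[of "in_pos 1"] this[of "in_neg 1"]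
  show "at_var (in_pos 1) v = mono_ser 0" "at_var (in_neg 1) v = mono_ser 0"
    by (auto simp: in_pos_def in_neg_def)
qed

section \<open>Identities between scalars\<close>

text \<open>Here \<open>y\<close> is \<gamma>^(n/2), \<open>d\<close> is 1/(\<gamma>^n -
  \<gamma>^(-n)), \<open>P\<close> and \<open>Ps\<close> are p^n and p*^n, \<open>G\<close> and
  \<open>Gs\<close> are 1/(1 - P) and 1/(1 - Ps). The first three identities compare structure
  functions (plus, minus, mixed), the next four cancel half vertex operators against \<psi>, and by
  the last the two ratios are inverse to each other.\<close>

lemma scalar_identities:
  fixes y yi P Ps G Gs d :: "'a::comm_ring_1"
  assumes y: "y * yi = 1" and d: "(y * y - yi * yi) * d = 1"
    and G: "(1 - P) * G = 1" and Gs: "(1 - Ps) * Gs = 1" and P: "P = Ps * (y * y * y * y)"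
  shows "y * y * d - d * (yi * yi) * (1 - P) * Gs = 1 + Ps * Gs"
    and "y * y * d - d * (y * y) * (1 - Ps) * G = - (P * G)"
    and "y * y - (y * y * y * y) * d = - d"
    and "d * y * ((1 - Ps) * G - 1) = P * G * yi"
    and "d * yi - d * (y * y * y) * (1 - Ps) * G + G * y = 0"
    and "- (d * (yi * yi * yi)) + d * y * (1 - Ps) * G - G * yi = 0"
    and "d * (y * y * y) - d * (y * y * y) * (1 - Ps) * G + P * G * y = 0"
    and "(1 - P) * Gs * ((1 - Ps) * G) = 1"
proof -
  \<comment> \<open>The hypotheses become the vanishing of \<open>R\<close>, \<open>R3\<close>,
    \<open>R4\<close>, \<open>Y\<close>. The claims then follow from explicit combinations of these
    with polynomial cofactors, which expansion verifies.\<close>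
  define R where "R = (y * y - yi * yi) * d - 1"
  define R3 where "R3 = (1 - P) * G - 1"
  define R4 where "R4 = (1 - Ps) * Gs - 1"
  define Y where "Y = y * yi - 1"
  have zero: "R = 0" "R3 = 0" "R4 = 0" "Y = 0"
    using y d G Gs by (simp_all add: R_def R3_def R4_def Y_def)
  note defs = R_def R3_def R4_def Y_def P
  have "y * y * d - d * (yi * yi) * (1 - P) * Gs - (1 + Ps * Gs) =
      R - yi * yi * d * R4 + Ps * Gs * R + d * Ps * Gs * (y * y) * Y * (y * yi + 1)"
    unfolding defs by (simp add: algebra_simps)
  then show "y * y * d - d * (yi * yi) * (1 - P) * Gs = 1 + Ps * Gs" by (simp add: zero)
  have "y * y * d - d * (y * y) * (1 - Ps) * G + P * G =
      - (P * G * R) - d * Ps * G * (y * y) * Y * (y * yi + 1) - d * (y * y) * R3"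
    unfolding defs by (simp add: algebra_simps)
  then have ii: "y * y * d - d * (y * y) * (1 - Ps) * G + P * G = 0" by (simp add: zero)
  then show "y * y * d - d * (y * y) * (1 - Ps) * G = - (P * G)" by (simp add: eq_neg_iff_add_eq_0)
  have "y * y - (y * y * y * y) * d + d = - (y * y * R) - d * Y * (y * yi + 1)"
    unfolding defs by (simp add: algebra_simps)
  then show "y * y - (y * y * y * y) * d = - d" by (simp add: zero eq_neg_iff_add_eq_0)
  have "d * y * ((1 - Ps) * G - 1) - P * G * yi =
      - (d * P * G * y * Y) + d * Ps * G * y * Y * (y * yi * (y * yi) + y * yi + 1) + d * y * R3 + P * G * yi * R"
    unfolding defs by (simp add: algebra_simps)
  then show iv: "d * y * ((1 - Ps) * G - 1) = P * G * yi" by (simp add: zero)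
  have "d * yi - d * (y * y * y) * (1 - Ps) * G + G * y =
      - (y * R) - d * yi * Y - y * P * G * R - d * Ps * G * (y * y * y) * Y * (y * yi + 1) + y * R3
      - d * (y * y * y) * R3"
    unfolding defs by (simp add: algebra_simps)
  then show "d * yi - d * (y * y * y) * (1 - Ps) * G + G * y = 0" by (simp add: zero)
  have "- (d * (yi * yi * yi)) + d * y * (1 - Ps) * G - G * yi =
      (d * y * ((1 - Ps) * G - 1) - P * G * yi) + yi * R - d * y * Y - yi * R3"
    unfolding defs by (simp add: algebra_simps)
  then show "- (d * (yi * yi * yi)) + d * y * (1 - Ps) * G - G * yi = 0" by (simp add: zero iv)
  have "d * (y * y * y) - d * (y * y * y) * (1 - Ps) * G + P * G * y =
      y * (y * y * d - d * (y * y) * (1 - Ps) * G + P * G)"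
    by (simp add: algebra_simps)
  then show "d * (y * y * y) - d * (y * y * y) * (1 - Ps) * G + P * G * y = 0" by (simp add: ii)
  have "(1 - P) * Gs * ((1 - Ps) * G) = ((1 - P) * G) * ((1 - Ps) * Gs)"
    by (simp only: mult_ac)
  then show "(1 - P) * Gs * ((1 - Ps) * G) = 1" by (simp add: G Gs)
qed

text \<open>Inverting an argument turns 1 - x into -(1 - x)/x, and the three arguments q^m, t^(-m),
  (t/q)^m have product 1. Consequently \<kappa>_m / m is even in m.\<close>

lemma kappa_uminus:
  assumes "q \<noteq> 0" "t \<noteq> 0"
  shows "kappa q t (- m) = - kappa q t m"
proof -
  have "(1 - inverse x) * (1 - y) * (1 - inverse (y / x)) = - ((1 - x) * (1 - inverse y) * (1 - y / x))"
    if "x \<noteq> 0" "y \<noteq> 0" for x y :: complex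
    using that by (simp add: field_simps)
  from this[of "q powi m" "t powi m"] assms show ?thesis
    by (simp add: kappa_def power_int_minus power_int_divide_distrib)
qed

text \<open>The three arguments multiply to 1, so the expansion is a difference of two power sums:
  those in the logarithms of G^- and G^+.\<close>

lemma kappa_sum:
  assumes "q \<noteq> 0" "t \<noteq> 0"
  shows "kappa q t (int n) = (inverse q ^ n + t ^ n + (q / t) ^ n) - (q ^ n + inverse t ^ n + (t / q) ^ n)"
proof -
  have "(1 - x) * (1 - inverse y) * (1 - y / x) =
      (inverse x + y + x / y) - (x + inverse y + y / x)" if "x \<noteq> 0" "y \<noteq> 0" for x y :: complex
    using that by (simp add: field_simps)
  from this[of "q ^ n" "t ^ n"] assms show ?thesis
    by (simp add: kappa_def power_int_minus power_divide power_inverse)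
qed

text \<open>\<open>beta\<close> and \<open>rho\<close> are the coefficients of the modes -n and n in
  the logarithms of E^- and E^+, and \<open>xi\<close> is the scalar in the commutator of a mode
  with x. The flag \<open>True\<close> stands for the plus current.\<close>

definition beta :: "bool \<Rightarrow> nat \<Rightarrow> free_alg" where
  "beta s n = (if s then - (letter (DiffInv n) * gam (- int n))
     else letter (DiffInv n) * pratio_inv (- int n) * gam (- 2 * int n) * gam (- int n))"

definition rho :: "bool \<Rightarrow> nat \<Rightarrow> free_alg" where
  "rho s n = (if s then letter (DiffInv n) * gam (int n)
     else - (letter (DiffInv n) * pratio_inv (int n) * gam (2 * int n) * gam (int n)))"

definition xi :: "complex \<Rightarrow> complex \<Rightarrow> bool \<Rightarrow> int \<Rightarrow> free_alg" where
  "xi q t s m = (if s then - (cc (kappa q t m / of_int m) * pratio m * gam (- 3 * m))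
     else cc (kappa q t m / of_int m) * gam (- m))"

definition E_ser :: "bool \<Rightarrow> int series" where
  "E_ser s = (if s then E_minus else E'_minus)"

definition F_ser :: "bool \<Rightarrow> int series" where
  "F_ser s = (if s then E_plus else E'_plus)"

definition X_ser :: "bool \<Rightarrow> int series" where
  "X_ser s = (if s then x_plus else x_minus)"

text \<open>
  \<open>swap_exp q t a b n\<close> is the logarithm of the factor that appears when the positive current of
  sign \<open>a\<close> is moved to the right through the half vertex operator of sign \<open>b\<close>.
\<close>

definition swap_exp :: "complex \<Rightarrow> complex \<Rightarrow> bool \<Rightarrow> bool \<Rightarrow> nat \<Rightarrow> free_alg" where
  "swap_exp q t a b n = - (beta b n * xi q t a (- int n))"

text \<open>The logarithm of the factor in x E^+ = factor E^+ x, with E^+ of sign \<open>a\<close>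
  and x of sign \<open>b\<close>. The same factor appears in E^+ E^- = factor E^- E^+, that is, on
  the opposite side.\<close>

definition contract_exp :: "complex \<Rightarrow> complex \<Rightarrow> bool \<Rightarrow> bool \<Rightarrow> nat \<Rightarrow> free_alg" where
  "contract_exp q t a b n = - (rho a n * xi q t b (int n))"

text \<open>The quotient enters as an abstract surjective homomorphism with kernel \<open>I\<close>,
  so congruences are equations in a ring. All limits stay in \<open>free_alg\<close>; closedness of
  \<open>I\<close> takes the place of a topology on the target.\<close>

locale ell_quotient =
  fixes \<pi> :: "free_alg \<Rightarrow> 'u::ring_1" and I :: "free_alg set" and q t :: complex
  assumes pi_add: "\<pi> (a + b) = \<pi> a + \<pi> b"
    and pi_mult: "\<pi> (a * b) = \<pi> a * \<pi> b"
    and pi_1: "\<pi> 1 = 1"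
    and pi_eq_iff: "\<pi> a = \<pi> b \<longleftrightarrow> a - b \<in> I"
    and pi_surj: "surj \<pi>"
    and q: "q \<noteq> 0" and t: "t \<noteq> 0"
    and ideal: "two_sided_ideal I" and closed_I: "closed I"
    and relations: "ell_relations q t I"
begin

lemma pi_0: "\<pi> 0 = 0"
  using pi_add[of 0 0] by simp

lemma pi_uminus: "\<pi> (- a) = - \<pi> a"
  using pi_add[of a "- a"] by (simp add: pi_0 eq_neg_iff_add_eq_0 add.commute)

lemma pi_diff: "\<pi> (a - b) = \<pi> a - \<pi> b"
  using pi_add[of a "- b"] by (simp add: pi_uminus)

lemma pi_power: "\<pi> (a ^ n) = \<pi> a ^ n"
  by (induction n) (simp_all add: pi_1 pi_mult)

lemma pi_sum: "\<pi> (sum f A) = (\<Sum>i\<in>A. \<pi> (f i))"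
  by (induction A rule: infinite_finite_induct) (simp_all add: pi_0 pi_add)

lemmas pi_simps = pi_0 pi_1 pi_add pi_diff pi_uminus pi_mult pi_power

lemma elt_eq_pi: "a \<simeq>\<^bsub>I\<^esub> b \<longleftrightarrow> \<pi> a = \<pi> b"
  by (simp add: elt_eq_def pi_eq_iff)

definition c :: "complex \<Rightarrow> 'u" where
  "c z = \<pi> (cc z)"

sublocale ring_scalars c
proof
  fix a b x
  show "c (a + b) = c a + c b"
    by (simp add: c_def cc_def fps_const_add[symmetric] scal_add pi_add del: fps_const_add)
  show "c (a * b) = c a * c b"
    by (simp add: c_def cc_def fps_const_mult[symmetric] scal_mult pi_mult del: fps_const_mult)
  show "c 1 = 1" by (simp add: c_def cc_def scal_1 pi_1)
  obtain y where "x = \<pi> y" using pi_surj by blast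
  then show "c a * x = x * c a"
    by (simp add: c_def cc_def pi_mult[symmetric] scal_commute)
qed

definition central :: "free_alg \<Rightarrow> bool" where
  "central a \<longleftrightarrow> (\<forall>x. \<pi> a * x = x * \<pi> a)"

definition cen :: "free_alg \<Rightarrow> 'u center" where
  "cen a = Center (\<pi> a)"

lemma from_cen: "central a \<Longrightarrow> from_center (cen a) = \<pi> a"
  unfolding cen_def central_def by (rule Center_inverse) simp

lemma centralI: "(\<And>b. \<pi> (a * b) = \<pi> (b * a)) \<Longrightarrow> central a"
  unfolding central_def using pi_surj by (metis pi_mult surjD)

lemma centralD: "central a \<Longrightarrow> \<pi> a * x = x * \<pi> a"
  unfolding central_def by blast

lemma central_power: "central a \<Longrightarrow> central (a ^ n)"
  unfolding central_def pi_power by (metis power_commuting_commutes)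

text \<open>Gives centrality of \<gamma>^(-1/2), of the inverses of \<gamma>^n - \<gamma>^(-n) and
  of the geometric series, none of which is stated in the defining relations.\<close>

lemma central_inverse:
  assumes a: "central a" and 1: "\<pi> a * \<pi> b = 1"
  shows "central b"
  unfolding central_def
proof
  fix x
  have "\<pi> b * x = \<pi> b * x * (\<pi> a * \<pi> b)" using 1 by simp
  also have "\<dots> = \<pi> b * (\<pi> a * x) * \<pi> b" using centralD[OF a, of x] by (simp only: mult.assoc)
  also have "\<dots> = \<pi> a * \<pi> b * x * \<pi> b" using centralD[OF a, of "\<pi> b"] by (simp only: mult.assoc)
  also have "\<dots> = x * \<pi> b" using 1 by simp
  finally show "\<pi> b * x = x * \<pi> b" .
qed

text \<open>The chains of \<open>conjunct2\<close> below select clauses of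
  \<open>ell_relations\<close> by position.\<close>

lemmas rels = relations[unfolded ell_relations_def elt_eq_pi]

lemma gamma_half: "\<pi> (letter GammaHalf) * \<pi> (letter GammaHalfInv) = 1"
  using rels[THEN conjunct2, THEN conjunct2, THEN conjunct2, THEN conjunct2, THEN conjunct2,
      THEN conjunct2, THEN conjunct1] by (simp add: pi_simps)

lemma diff_inv: "n > 0 \<Longrightarrow>
    (\<pi> (gam (2 * int n)) - \<pi> (gam (- 2 * int n))) * \<pi> (letter (DiffInv n)) = 1"
  using rels[THEN conjunct2, THEN conjunct2, THEN conjunct2, THEN conjunct2, THEN conjunct2,
      THEN conjunct2, THEN conjunct2, THEN conjunct2, THEN conjunct1] by (simp add: pi_simps)

lemma central_letters:
  "central (letter Psi0p)" "central (letter Psi0m)" "central (letter GammaHalf)"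
  using rels[THEN conjunct2, THEN conjunct2, THEN conjunct2, THEN conjunct2, THEN conjunct2,
      THEN conjunct2, THEN conjunct2, THEN conjunct2, THEN conjunct2, THEN conjunct1]
  by (auto intro!: centralI)

lemma alpha_alpha: "m \<noteq> 0 \<Longrightarrow> n \<noteq> 0 \<Longrightarrow>
    \<pi> (alpha m) * \<pi> (alpha n) - \<pi> (alpha n) * \<pi> (alpha m) =
    \<pi> (if m + n = 0
        then - (cc (kappa q t m / of_int m) * (gam (2 * m) - gam (- 2 * m)) * gam (- 2 * m) * pratio m)
        else 0)"
  using rels[THEN conjunct2, THEN conjunct2, THEN conjunct2, THEN conjunct2, THEN conjunct2,
      THEN conjunct2, THEN conjunct2, THEN conjunct2, THEN conjunct2, THEN conjunct2, THEN conjunct1]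
  by (simp add: pi_diff pi_mult)

lemma alpha_x: "m \<noteq> 0 \<Longrightarrow>
    \<pi> (alpha m) * \<pi> (X_ser s k) - \<pi> (X_ser s k) * \<pi> (alpha m) =
    \<pi> (xi q t s m) * \<pi> (X_ser s (k - m))"
proof -
  assume m: "m \<noteq> 0"
  have assoc: "(const_ser a \<star> mono_ser m \<star> F) k = a * F (k - m)" for a and F :: "int series"
  proof -
    have "const_ser a \<star> mono_ser m \<star> F = mono_ser m \<star> const_ser a \<star> F"
      by (rule arg_cong[of _ _ "\<lambda>x. x \<star> F"])
         (rule ext, simp only: smult_mono_right smult_mono_left)
    then show ?thesis by (simp add: smult_mono_assoc smult_mono_left smult_const_left)
  qed
  show ?thesis
  proof (cases s)
    case True
    have "const_ser (alpha m) \<star> x_plus - x_plus \<star> const_ser (alpha m) \<approx>\<^bsub>I\<^esub>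
       const_ser (- (cc (kappa q t m / of_int m) * pratio m * gam (- 3 * m))) \<star> mono_ser m \<star> x_plus"
      using rels[THEN conjunct2, THEN conjunct2, THEN conjunct2, THEN conjunct2, THEN conjunct2,
          THEN conjunct2, THEN conjunct2, THEN conjunct2, THEN conjunct2, THEN conjunct2,
          THEN conjunct2, THEN conjunct1] m by blast
    then have "\<pi> ((const_ser (alpha m) \<star> x_plus - x_plus \<star> const_ser (alpha m)) k) =
      \<pi> ((const_ser (- (cc (kappa q t m / of_int m) * pratio m * gam (- 3 * m))) \<star> mono_ser m \<star> x_plus) k)"
      unfolding ser_eq_def elt_eq_pi by blast
    then show ?thesis using True
      by (simp add: assoc smult_const_left smult_const_right pi_diff pi_mult[symmetric] X_ser_def xi_def)
  next
    case False
    have "const_ser (alpha m) \<star> x_minus - x_minus \<star> const_ser (alpha m) \<approx>\<^bsub>I\<^esub>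
       const_ser (cc (kappa q t m / of_int m) * gam (- m)) \<star> mono_ser m \<star> x_minus"
      using rels[THEN conjunct2, THEN conjunct2, THEN conjunct2, THEN conjunct2, THEN conjunct2,
          THEN conjunct2, THEN conjunct2, THEN conjunct2, THEN conjunct2, THEN conjunct2,
          THEN conjunct2, THEN conjunct2, THEN conjunct1] m by blast
    then have "\<pi> ((const_ser (alpha m) \<star> x_minus - x_minus \<star> const_ser (alpha m)) k) =
      \<pi> ((const_ser (cc (kappa q t m / of_int m) * gam (- m)) \<star> mono_ser m \<star> x_minus) k)"
      unfolding ser_eq_def elt_eq_pi by blast
    then show ?thesis using False
      by (simp add: assoc smult_const_left smult_const_right pi_diff pi_mult[symmetric] X_ser_def xi_def)
  qed
qed

subsection \<open>Central scalars\<close>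

lemma central_cc: "central (cc z)"
  unfolding central_def using c_comm by (simp add: c_def)

lemma central_pp: "central pp"
  by (rule centralI) (simp add: pp_commute)

lemma central_gam: "central (gam k)"
proof -
  have "central (letter GammaHalfInv)"
    by (rule central_inverse[OF central_letters(3) gamma_half])
  then show ?thesis by (simp add: gam_def central_power central_letters)
qed

lemma central_DiffInv: "n > 0 \<Longrightarrow> central (letter (DiffInv n))"
proof (rule central_inverse)
  assume n: "n > 0"
  show "\<pi> (gam (2 * int n) - gam (- 2 * int n)) * \<pi> (letter (DiffInv n)) = 1"
    using diff_inv[OF n] by (simp add: pi_diff)
  show "central (gam (2 * int n) - gam (- 2 * int n))"
    using centralD[OF central_gam] by (simp add: central_def pi_diff left_diff_distrib right_diff_distrib)
qed

lemma central_pstar: "central pstar"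
  unfolding central_def pstar_def pi_mult
  by (metis central_gam central_pp central_def mult.assoc)

lemma central_1_minus: "central a \<Longrightarrow> central (1 - a)"
  by (simp add: central_def pi_diff pi_1 left_diff_distrib right_diff_distrib)

lemma central_geo:
  assumes "n > 0"
  shows "central (geo (pp ^ n))" "central (geo (pstar ^ n))"
proof -
  show "central (geo (pp ^ n))"
    by (rule central_inverse[OF central_1_minus[OF central_power[OF central_pp, where n = n]]])
       (simp only: pi_mult[symmetric] geo_pp[OF assms] pi_1)
  show "central (geo (pstar ^ n))"
    by (rule central_inverse[OF central_1_minus[OF central_power[OF central_pstar, where n = n]]])
       (simp only: pi_mult[symmetric] geo_pstar[OF assms] pi_1)
qed

text \<open>Exponents of mixed sign add only modulo the ideal, where the letters for \<gamma>^(1/2)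
  and its inverse cancel.\<close>

lemma pi_gam_add: "\<pi> (gam (k + l)) = \<pi> (gam k) * \<pi> (gam l)"
proof -
  let ?h = "\<pi> (letter GammaHalf)" and ?i = "\<pi> (letter GammaHalfInv)"
  have hi: "?h * ?i = 1" "?i * ?h = 1"
    using gamma_half centralD[OF central_letters(3), of ?i] by auto
  have up: "\<pi> (gam (k + 1)) = \<pi> (gam k) * ?h" for k
  proof (cases "k \<ge> 0")
    case True
    then have "nat (k + 1) = Suc (nat k)" by simp
    with True show ?thesis by (simp add: gam_def pi_mult power_Suc2 del: power_Suc)
  next
    case False
    then have "nat (- k) = Suc (nat (- (k + 1)))" by simp
    with False hi(2) show ?thesis
      by (cases "k = - 1") (simp_all add: gam_def pi_mult pi_1 power_Suc2 mult.assoc del: power_Suc)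
  qed
  have down: "\<pi> (gam (k - 1)) = \<pi> (gam k) * ?i" for k
    using up[of "k - 1"] hi(1) by (simp add: mult.assoc)
  show ?thesis
  proof (induction l rule: int_induct[of _ 0])
    case base
    then show ?case by (simp add: gam_def pi_1)
  next
    case (step1 l)
    then show ?case using up[of "k + l"] up[of l] by (simp add: mult.assoc add.assoc)
  next
    case (step2 l)
    then show ?case using down[of "k + l"] down[of l] by (simp add: mult.assoc add_diff_eq)
  qed
qed

lemma pi_gam_0: "\<pi> (gam 0) = 1"
  by (simp add: gam_def pi_1)

text \<open>A dictionary into the center: these instantiate \<open>y\<close>, \<open>yi\<close>,
  \<open>d\<close>, \<open>P\<close>, \<open>Ps\<close>, \<open>G\<close>, \<open>Gs\<close> of
  \<open>scalar_identities\<close>, and \<open>kk n\<close> is \<kappa>_n / n.\<close>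

definition yy where "yy n = cen (gam (int n))"
definition yi where "yi n = cen (gam (- int n))"
definition dd where "dd n = cen (letter (DiffInv n))"
definition PP where "PP n = cen (pp ^ n)"
definition PS where "PS n = cen (pstar ^ n)"
definition GG where "GG n = cen (geo (pp ^ n))"
definition GS where "GS n = cen (geo (pstar ^ n))"
definition kk where "kk n = cen (cc (kappa q t (int n) / of_nat n))"

lemmas center_reps = zero_center.rep_eq one_center.rep_eq plus_center.rep_eq
    uminus_center.rep_eq minus_center.rep_eq times_center.rep_eq

lemma pi_scalars:
  assumes "n > 0"
  shows "\<pi> (gam (int n)) = from_center (yy n)" "\<pi> (gam (- int n)) = from_center (yi n)"
    "\<pi> (letter (DiffInv n)) = from_center (dd n)"
    "\<pi> (pp ^ n) = from_center (PP n)" "\<pi> (pstar ^ n) = from_center (PS n)"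
    "\<pi> (geo (pp ^ n)) = from_center (GG n)" "\<pi> (geo (pstar ^ n)) = from_center (GS n)"
    "\<pi> (cc (kappa q t (int n) / of_nat n)) = from_center (kk n)"
  unfolding yy_def yi_def dd_def PP_def PS_def GG_def GS_def kk_def
  using assms
  by (auto simp: from_cen central_gam central_DiffInv central_power central_pp central_pstar
      central_geo central_cc)

lemma pi_gams:
  assumes n: "n > 0"
  shows "\<pi> (gam (2 * int n)) = from_center (yy n * yy n)"
    "\<pi> (gam (- 2 * int n)) = from_center (yi n * yi n)"
    "\<pi> (gam (3 * int n)) = from_center (yy n * yy n * yy n)"
    "\<pi> (gam (- 3 * int n)) = from_center (yi n * yi n * yi n)"
    "\<pi> (gam (4 * int n)) = from_center (yy n * yy n * yy n * yy n)"
    "\<pi> (gam (- 4 * int n)) = from_center (yi n * yi n * yi n * yi n)"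
proof -
  let ?n = "int n"
  have e: "2 * ?n = ?n + ?n" "3 * ?n = ?n + ?n + ?n" "4 * ?n = ?n + ?n + ?n + ?n"
    "- 2 * ?n = - ?n + - ?n" "- 3 * ?n = - ?n + - ?n + - ?n" "- 4 * ?n = - ?n + - ?n + - ?n + - ?n"
    by simp_all
  show "\<pi> (gam (2 * ?n)) = from_center (yy n * yy n)"
    "\<pi> (gam (- 2 * ?n)) = from_center (yi n * yi n)"
    "\<pi> (gam (3 * ?n)) = from_center (yy n * yy n * yy n)"
    "\<pi> (gam (- 3 * ?n)) = from_center (yi n * yi n * yi n)"
    "\<pi> (gam (4 * ?n)) = from_center (yy n * yy n * yy n * yy n)"
    "\<pi> (gam (- 4 * ?n)) = from_center (yi n * yi n * yi n * yi n)"
    unfolding e pi_gam_add pi_scalars[OF n] center_reps by (rule refl)+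
qed

lemma scalar_rels:
  assumes n: "n > 0"
  shows "yy n * yi n = 1" "(yy n * yy n - yi n * yi n) * dd n = 1"
    "(1 - PP n) * GG n = 1" "(1 - PS n) * GS n = 1"
    "PP n = PS n * (yy n * yy n * yy n * yy n)"
proof -
  show "yy n * yi n = 1"
    unfolding from_center_inject[symmetric] center_reps pi_scalars[OF n, symmetric] pi_gam_add[symmetric]
    by (simp add: pi_gam_0)
  show "(yy n * yy n - yi n * yi n) * dd n = 1"
    unfolding from_center_inject[symmetric] center_reps(2,6) minus_center.rep_eq pi_gams[OF n, symmetric]
      pi_scalars(3)[OF n, symmetric]
    using diff_inv[OF n] pi_gams[OF n] by (simp add: center_reps)
  show "(1 - PP n) * GG n = 1"
    unfolding from_center_inject[symmetric] center_reps pi_scalars[OF n, symmetric]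
    by (simp only: pi_simps[symmetric] geo_pp[OF n])
  show "(1 - PS n) * GS n = 1"
    unfolding from_center_inject[symmetric] center_reps pi_scalars[OF n, symmetric]
    by (simp only: pi_simps[symmetric] geo_pstar[OF n])
  have pow: "\<pi> (gam k ^ m) = \<pi> (gam (k * int m))" for k m
    by (induction m) (simp_all add: pi_mult pi_1 pi_gam_0 pi_gam_add distrib_left)
  have "\<pi> (gam (- 4 * int n)) * \<pi> (gam (4 * int n)) = 1"
    by (simp add: pi_gam_add[symmetric] pi_gam_0)
  then have "\<pi> (pstar ^ n) * \<pi> (gam (4 * int n)) = \<pi> (pp ^ n)"
    unfolding pstar_power pi_mult pow by (simp only: mult.assoc mult_1_right)
  then show "PP n = PS n * (yy n * yy n * yy n * yy n)"
    by (simp only: from_center_inject[symmetric] times_center.rep_eq pi_scalars[OF n] pi_gams[OF n])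
qed

lemmas scalar_ids = scalar_identities[OF scalar_rels]

lemma pi_pratio:
  assumes n: "n > 0"
  shows "\<pi> (pratio (int n)) = from_center ((1 - PP n) * GS n)"
    "\<pi> (pratio (- int n)) = from_center (yi n * yi n * yi n * yi n * ((1 - PP n) * GS n))"
    "\<pi> (pratio_inv (int n)) = from_center ((1 - PS n) * GG n)"
    "\<pi> (pratio_inv (- int n)) = from_center (yy n * yy n * yy n * yy n * ((1 - PS n) * GG n))"
  using n pi_gams(5,6)[OF n] pi_scalars(4-7)[OF n]
  by (simp_all add: pratio_def pratio_inv_def pi_mult pi_diff pi_1 center_reps mult.assoc)

lemma cc_kappa_uminus:
  "cc (kappa q t (- int n) / of_int (- int n)) = cc (kappa q t (int n) / of_nat n)"
  by (simp add: kappa_uminus[OF q t])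

text \<open>The trailing factor makes the cancellation applicable inside products normalised by
  \<open>mult_ac\<close>.\<close>

lemma cancel_yi:
  "n > 0 \<Longrightarrow> yi n * (yy n * x) = x" "n > 0 \<Longrightarrow> yy n * (yi n * x) = x"
proof -
  assume "n > 0"
  then have "yy n * yi n * x = x" using scalar_rels(1) by simp
  then show 1: "yi n * (yy n * x) = x" "yy n * (yi n * x) = x" by (simp_all only: mult_ac)
qed

lemma pi_beta:
  assumes n: "n > 0"
  shows "\<pi> (beta s n) = from_center (if s then - (dd n * yi n) else dd n * (yy n * ((1 - PS n) * GG n)))"
proof (cases s)
  case True
  then show ?thesis by (simp add: beta_def pi_simps pi_scalars[OF n] center_reps)
next
  case False
  have "\<pi> (beta s n) = from_center (dd n * (yy n * yy n * yy n * yy n * ((1 - PS n) * GG n)) * (yi n * yi n) * yi n)"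
    using False by (simp only: beta_def if_False pi_mult pi_pratio[OF n] pi_scalars[OF n] pi_gams[OF n] center_reps)
  also have "dd n * (yy n * yy n * yy n * yy n * ((1 - PS n) * GG n)) * (yi n * yi n) * yi n =
      dd n * (yy n * ((1 - PS n) * GG n))"
    by (simp only: mult_ac cancel_yi[OF n])
  finally show ?thesis using False by simp
qed

lemma pi_rho:
  assumes n: "n > 0"
  shows "\<pi> (rho s n) = from_center (if s then dd n * yy n else - (dd n * (yy n * yy n * yy n) * (1 - PS n) * GG n))"
proof (cases s)
  case True
  then show ?thesis by (simp add: rho_def pi_simps pi_scalars[OF n] center_reps)
next
  case False
  have "\<pi> (rho s n) = from_center (- (dd n * ((1 - PS n) * GG n) * (yy n * yy n) * yy n))"
    using False by (simp only: rho_def if_False pi_uminus pi_mult pi_pratio[OF n] pi_scalars[OF n] pi_gams[OF n] center_reps)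
  also have "dd n * ((1 - PS n) * GG n) * (yy n * yy n) * yy n = dd n * (yy n * yy n * yy n) * (1 - PS n) * GG n"
    by (simp only: mult_ac)
  finally show ?thesis using False by simp
qed

lemma pi_xi_pos:
  assumes n: "n > 0"
  shows "\<pi> (xi q t s (int n)) = from_center (if s then - (kk n * ((1 - PP n) * GS n) * (yi n * yi n * yi n)) else kk n * yi n)"
  using pi_pratio[OF n] pi_scalars[OF n] pi_gams[OF n]
  by (simp add: xi_def pi_simps center_reps)

lemma pi_xi_neg:
  assumes n: "n > 0"
  shows "\<pi> (xi q t s (- int n)) = from_center (if s then - (kk n * (yi n * ((1 - PP n) * GS n))) else kk n * yy n)"
proof -
  have e: "- 3 * - int n = 3 * int n" by simp
  have "\<pi> (xi q t s (- int n)) = from_center (if s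
      then - (kk n * (yi n * yi n * yi n * yi n * ((1 - PP n) * GS n)) * (yy n * yy n * yy n))
      else kk n * yy n)"
    by (cases s) (simp_all only: xi_def if_True if_False pi_uminus pi_mult cc_kappa_uminus e minus_minus
        pi_pratio[OF n] pi_scalars[OF n] pi_gams[OF n] center_reps)
  also have "kk n * (yi n * yi n * yi n * yi n * ((1 - PP n) * GS n)) * (yy n * yy n * yy n) =
      kk n * (yi n * ((1 - PP n) * GS n))"
    by (simp only: mult_ac cancel_yi[OF n])
  finally show ?thesis .
qed

text \<open>The central value of the Heisenberg bracket of the modes n and -n.\<close>

definition hh :: "nat \<Rightarrow> 'u center" where
  "hh n = - (kk n * (yy n * yy n - yi n * yi n) * (yi n * yi n) * ((1 - PP n) * GS n))"

lemma alpha_commute: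
  assumes "m > 0" "n > 0"
  shows "\<pi> (alpha (int m)) * \<pi> (alpha (int n)) = \<pi> (alpha (int n)) * \<pi> (alpha (int m))"
    and "\<pi> (alpha (- int m)) * \<pi> (alpha (- int n)) = \<pi> (alpha (- int n)) * \<pi> (alpha (- int m))"
  using alpha_alpha[of "int m" "int n"] alpha_alpha[of "- int m" "- int n"] assms by (simp_all add: pi_0)

lemma alpha_heisenberg:
  assumes "m > 0" "n > 0"
  shows "\<pi> (alpha (int m)) * \<pi> (alpha (- int n)) - \<pi> (alpha (- int n)) * \<pi> (alpha (int m)) =
    from_center (if m = n then hh n else 0)"
proof -
  have "\<pi> (cc (kappa q t (int n) / of_int (int n)) * (gam (2 * int n) - gam (- 2 * int n)) *
      gam (- 2 * int n) * pratio (int n)) =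
      from_center (kk n * (yy n * yy n - yi n * yi n) * (yi n * yi n) * ((1 - PP n) * GS n))"
    using assms by (simp only: pi_mult pi_diff pi_pratio pi_gams center_reps pi_scalars of_int_of_nat_eq)
  with alpha_alpha[of "int m" "- int n"] assms show ?thesis
    by (auto simp: hh_def pi_uminus pi_0 uminus_center.rep_eq zero_center.rep_eq)
qed

text \<open>The reason why \<alpha>_n with n > 0 commutes with E^-(w) x(w): the bracket with E^-
  contributes \<open>beta\<close> times \<open>hh\<close>, the bracket with x contributes
  \<open>xi\<close>. The inverse \<open>dd n\<close> cancels the factor \<gamma>^n - \<gamma>^(-n)
  of \<open>hh\<close>; for the minus sign the ratio in \<alpha>' cancels as well.\<close>

lemma xi_beta: "n > 0 \<Longrightarrow> \<pi> (xi q t s (int n)) = - (\<pi> (beta s n) * from_center (hh n))"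
proof -
  assume n: "n > 0"
  have "(if s then - (kk n * ((1 - PP n) * GS n) * (yi n * yi n * yi n)) else kk n * yi n) =
     - ((if s then - (dd n * yi n) else dd n * (yy n * ((1 - PS n) * GG n))) * hh n)"
  proof (cases s)
    case True
    have "dd n * yi n * (kk n * (yy n * yy n - yi n * yi n) * (yi n * yi n) * ((1 - PP n) * GS n)) =
      ((yy n * yy n - yi n * yi n) * dd n) * (kk n * ((1 - PP n) * GS n) * (yi n * yi n * yi n))"
      by (simp only: mult_ac)
    then show ?thesis using True by (simp add: hh_def scalar_rels(2)[OF n])
  next
    case False
    have "dd n * (yy n * ((1 - PS n) * GG n)) *
        (kk n * (yy n * yy n - yi n * yi n) * (yi n * yi n) * ((1 - PP n) * GS n)) =
      (yy n * yi n) * ((yy n * yy n - yi n * yi n) * dd n) * ((1 - PP n) * GS n * ((1 - PS n) * GG n)) *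
        (kk n * yi n)"
      by (simp only: mult_ac)
    then show ?thesis using False
      by (simp only: hh_def scalar_rels(1,2)[OF n] scalar_ids(8)[OF n n n n n]) simp
  qed
  then show ?thesis by (simp add: pi_xi_pos[OF n] pi_beta[OF n] center_reps)
qed

end

section \<open>Half vertex operators\<close>

definition E_fps :: "bool \<Rightarrow> free_alg fps" where
  "E_fps s = exp_sum (\<lambda>n. if s then - (letter (DiffInv n) * alpha (- int n) * gam (- int n))
     else letter (DiffInv n) * alpha' (- int n) * gam (- int n))"

definition F_fps :: "bool \<Rightarrow> free_alg fps" where
  "F_fps s = exp_sum (\<lambda>n. if s then letter (DiffInv n) * alpha (int n) * gam (int n)
     else - (letter (DiffInv n) * alpha' (int n) * gam (int n)))"

lemma E_ser_fps: "E_ser s = in_pos (E_fps s)"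
  by (cases s) (simp_all add: E_ser_def E_fps_def E_minus_def E'_minus_def)

lemma F_ser_fps: "F_ser s = in_neg (F_fps s)"
  by (cases s) (simp_all add: F_ser_def F_fps_def E_plus_def E'_plus_def)

lemma E_fps_homog: "fps_nth (E_fps s) n \<in> homog (- int n)"
proof -
  have "letter (DiffInv m) * alpha (- int m) * gam (- int m) \<in> homog (- 1 * int m)"
    "letter (DiffInv m) * alpha' (- int m) * gam (- int m) \<in> homog (- 1 * int m)" for m
    using homog_alpha[of "- int m"] homog_alpha'[of "- int m"] by (simp_all add: homog_mult_0)
  then have "fps_nth (E_fps s) n \<in> homog (- 1 * int n)"
    unfolding E_fps_def by (intro exp_sum_homog) (auto intro: homog_uminus)
  then show ?thesis by simp
qed

lemma F_fps_homog: "fps_nth (F_fps s) n \<in> homog (int n)"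
proof -
  have "letter (DiffInv m) * alpha (int m) * gam (int m) \<in> homog (1 * int m)"
    "letter (DiffInv m) * alpha' (int m) * gam (int m) \<in> homog (1 * int m)" for m
    using homog_alpha[of "int m"] homog_alpha'[of "int m"] by (simp_all add: homog_mult_0)
  then have "fps_nth (F_fps s) n \<in> homog (1 * int n)"
    unfolding F_fps_def by (intro exp_sum_homog) (auto intro: homog_uminus)
  then show ?thesis by simp
qed

definition psi_E :: "bool \<Rightarrow> free_alg fps" where
  "psi_E s = (if s then exp_sum (\<lambda>m. - (pp ^ m * geo (pp ^ m) * alpha (- int m) * gam (- int m)))
     else exp_sum (\<lambda>m. - (geo (pp ^ m) * alpha (- int m) * gam (int m))))"

definition psi_F :: "bool \<Rightarrow> free_alg fps" where
  "psi_F s = (if s then exp_sum (\<lambda>m. geo (pp ^ m) * alpha (int m) * gam (int m))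
     else exp_sum (\<lambda>m. pp ^ m * geo (pp ^ m) * alpha (int m) * gam (- int m)))"

lemma psi_E_homog: "fps_nth (psi_E s) n \<in> homog (- int n)"
proof -
  have "pp ^ m * geo (pp ^ m) * alpha (- int m) * gam (- int m) \<in> homog (- 1 * int m)"
    "geo (pp ^ m) * alpha (- int m) * gam (int m) \<in> homog (- 1 * int m)" for m
    using homog_alpha[of "- int m"] by (simp_all add: homog_mult_0 homog_power homog_geo)
  note h = this
  have "fps_nth (psi_E s) n \<in> homog (- 1 * int n)"
  proof (cases s)
    case True
    then show ?thesis unfolding psi_E_def by (simp only: if_True) (intro exp_sum_homog homog_uminus h)
  next
    case False
    then show ?thesis unfolding psi_E_def by (simp only: if_False) (intro exp_sum_homog homog_uminus h)
  qed
  then show ?thesis by simp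
qed

lemma psi_F_homog: "fps_nth (psi_F s) n \<in> homog (int n)"
proof -
  have "pp ^ m * geo (pp ^ m) * alpha (int m) * gam (- int m) \<in> homog (1 * int m)"
    "geo (pp ^ m) * alpha (int m) * gam (int m) \<in> homog (1 * int m)" for m
    using homog_alpha[of "int m"] by (simp_all add: homog_mult_0 homog_power homog_geo)
  note h = this
  have "fps_nth (psi_F s) n \<in> homog (1 * int n)"
  proof (cases s)
    case True
    then show ?thesis unfolding psi_F_def by (simp only: if_True) (intro exp_sum_homog h)
  next
    case False
    then show ?thesis unfolding psi_F_def by (simp only: if_False) (intro exp_sum_homog h)
  qed
  then show ?thesis by simp
qed

text \<open>For a series in z this substitutes \<gamma>^(k/2) z; once placed in negative powers by
  \<open>in_neg\<close> it substitutes \<gamma>^(-k/2) z.\<close>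

definition dil :: "int \<Rightarrow> free_alg fps \<Rightarrow> free_alg fps" where
  "dil k F = Abs_fps (\<lambda>n. gam (k * int n) * fps_nth F n)"

lemma dilate_in_pos: "dilate k (in_pos F) = in_pos (dil k F)"
  by (auto simp: dilate_def in_pos_def dil_def fun_eq_iff)

lemma dil_homog: "fps_nth F n \<in> homog d \<Longrightarrow> fps_nth (dil k F) n \<in> homog d"
  by (simp add: dil_def homog_mult_0)

definition g_fps :: "complex \<Rightarrow> complex \<Rightarrow> (nat \<Rightarrow> free_alg) \<Rightarrow> free_alg fps" where
  "g_fps q t r = exp_sum (\<lambda>m. cc (kappa q t (int m) / of_nat m) * r m)"

lemma gser_fps: "gser q t r = in_pos (g_fps q t r)"
  by (simp add: gser_def g_fps_def)

lemma gser_inv_fps: "gser_inv q t r = in_pos (g_fps q t (\<lambda>m. - r m))"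
  by (simp add: gser_inv_def g_fps_def)

definition G_fps :: "complex \<Rightarrow> complex \<Rightarrow> int \<Rightarrow> free_alg fps" where
  "G_fps q t e = (1 - fps_const (cc (q powi e)) * fps_X) * (1 - fps_const (cc (t powi (- e))) * fps_X) *
     (1 - fps_const (cc ((q / t) powi (- e))) * fps_X)"

lemma Gpol_fps: "Gpol q t e = in_pos (G_fps q t e)"
  by (simp add: Gpol_def G_fps_def)

lemma fps_mult_homog_0:
  assumes "\<And>n. fps_nth F n \<in> homog 0" "\<And>n. fps_nth G n \<in> homog 0"
  shows "fps_nth (F * G) n \<in> homog 0"
  unfolding fps_mult_nth by (intro homog_sum homog_mult_0 assms)

lemma G_fps_homog: "fps_nth (G_fps q t e) n \<in> homog 0"
proof -
  have "fps_nth (1 - fps_const (cc a) * fps_X) n \<in> homog 0" for a n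
    by (auto intro!: homog_diff homog_uminus simp: fps_X_def)
  then show ?thesis unfolding G_fps_def by (intro fps_mult_homog_0)
qed

lemma g_fps_homog:
  assumes "\<And>m. r m \<in> homog 0"
  shows "fps_nth (g_fps q t r) n \<in> homog 0"
  using exp_sum_homog[of "\<lambda>m. cc (kappa q t (int m) / of_nat m) * r m" 0 n] assms
  by (simp add: g_fps_def homog_mult_0)

lemma r_homog [simp]:
  "r_one m \<in> homog 0" "r_p m \<in> homog 0" "r_pstar m \<in> homog 0" "r_gam2 m \<in> homog 0"
  by (auto simp: r_one_def r_p_def r_pstar_def r_gam2_def
      intro!: homog_mult_0 homog_power homog_geo homog_uminus)

definition swap_fps :: "complex \<Rightarrow> complex \<Rightarrow> bool \<Rightarrow> bool \<Rightarrow> free_alg fps" where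
  "swap_fps q t a b = exp_sum (swap_exp q t a b)"

definition contract_fps :: "complex \<Rightarrow> complex \<Rightarrow> bool \<Rightarrow> bool \<Rightarrow> free_alg fps" where
  "contract_fps q t a b = exp_sum (contract_exp q t a b)"

lemma swap_fps_homog: "fps_nth (swap_fps q t a b) n \<in> homog 0"
  and contract_fps_homog: "fps_nth (contract_fps q t a b) n \<in> homog 0"
proof -
  have "beta b m \<in> homog 0" "xi q t a k \<in> homog 0" "rho b m \<in> homog 0" for a b m k
    by (auto simp: beta_def xi_def rho_def intro!: homog_mult_0 homog_uminus)
  then have "swap_exp q t a b m \<in> homog (0 * int m)" "contract_exp q t a b m \<in> homog (0 * int m)" for m
    by (auto simp: swap_exp_def contract_exp_def intro!: homog_uminus homog_mult_0)
  then show "fps_nth (swap_fps q t a b) n \<in> homog 0" "fps_nth (contract_fps q t a b) n \<in> homog 0"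
    using exp_sum_homog[of "swap_exp q t a b" 0 n] exp_sum_homog[of "contract_exp q t a b" 0 n]
    by (simp_all add: swap_fps_def contract_fps_def)
qed

context ell_quotient
begin

definition pi_fps :: "free_alg fps \<Rightarrow> 'u fps" where
  "pi_fps F = Abs_fps (\<lambda>n. \<pi> (fps_nth F n))"

lemma pi_fps_nth [simp]: "fps_nth (pi_fps F) n = \<pi> (fps_nth F n)"
  by (simp add: pi_fps_def)

lemma pi_fps_mult: "pi_fps (F * G) = pi_fps F * pi_fps G"
  by (rule fps_ext) (simp add: fps_mult_nth pi_sum pi_mult)

lemma pi_fps_diff: "pi_fps (F - G) = pi_fps F - pi_fps G"
  by (rule fps_ext) (simp add: pi_diff)

lemma pi_fps_1: "pi_fps 1 = 1"
  by (rule fps_ext) (simp add: pi_1 pi_0)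

lemma pi_fps_power: "pi_fps (F ^ n) = pi_fps F ^ n"
  by (induction n) (simp_all add: pi_fps_mult pi_fps_1)

lemma pi_exp_sum: "pi_fps (exp_sum a) = uexp (\<lambda>n. \<pi> (a n))"
proof (rule fps_ext)
  fix n
  have "pi_fps (Abs_fps (\<lambda>m. if m = 0 then 0 else a m)) = gen_fps (\<lambda>n. \<pi> (a n))"
    by (rule fps_ext) (simp add: gen_fps_nth pi_0)
  then have "\<pi> (fps_nth (Abs_fps (\<lambda>m. if m = 0 then 0 else a m) ^ i) n) =
      fps_nth (gen_fps (\<lambda>n. \<pi> (a n)) ^ i) n" for i
    by (metis pi_fps_nth pi_fps_power)
  then show "fps_nth (pi_fps (exp_sum a)) n = fps_nth (uexp (\<lambda>n. \<pi> (a n))) n"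
    by (simp add: exp_sum_def fps_compose_nth uexp_nth pi_sum pi_mult c_def)
qed

section \<open>Exponentials in the negative and in the positive modes\<close>

definition am :: "nat \<Rightarrow> 'u" where "am n = \<pi> (alpha (- int n))"
definition ap :: "nat \<Rightarrow> 'u" where "ap n = \<pi> (alpha (int n))"

lemma commuting_center:
  assumes "\<And>m n. m > 0 \<Longrightarrow> n > 0 \<Longrightarrow> x m * x n = x n * (x m :: 'u)" "m > 0" "n > 0"
  shows "from_center u * x m * (from_center v * x n) = from_center v * x n * (from_center u * x m)"
proof -
  have "from_center u * x m * (from_center v * x n) = from_center u * from_center v * (x m * x n)"
    by (simp only: mult.assoc central_left_commute[OF center_commute, of "x m"])
  also have "\<dots> = from_center v * from_center u * (x n * x m)"
    using assms by (simp only: center_commute[of u])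
  also have "\<dots> = from_center v * x n * (from_center u * x m)"
    by (simp only: mult.assoc central_left_commute[OF center_commute, of "x n"])
  finally show ?thesis .
qed

lemma am_commute: "m > 0 \<Longrightarrow> n > 0 \<Longrightarrow> am m * am n = am n * am m"
  and ap_commute: "m > 0 \<Longrightarrow> n > 0 \<Longrightarrow> ap m * ap n = ap n * ap m"
  by (simp_all add: am_def ap_def alpha_commute)

lemma commuting_am: "commuting (\<lambda>n. from_center (f n) * am n)"
  and commuting_ap: "commuting (\<lambda>n. from_center (f n) * ap n)"
  using commuting_center[of am] commuting_center[of ap] am_commute ap_commute
  by (simp_all add: commuting_def)

lemma uexp_add_am: "uexp (\<lambda>n. from_center (f n) * am n) * uexp (\<lambda>n. from_center (g n) * am n) =
    uexp (\<lambda>n. from_center (f n + g n) * am n)"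
  using uexp_add[of "\<lambda>n. from_center (f n) * am n" "\<lambda>n. from_center (g n) * am n"]
    commuting_center[of am] am_commute commuting_am
  by (simp add: plus_center.rep_eq distrib_right)

lemma uexp_add_ap: "uexp (\<lambda>n. from_center (f n) * ap n) * uexp (\<lambda>n. from_center (g n) * ap n) =
    uexp (\<lambda>n. from_center (f n + g n) * ap n)"
  using uexp_add[of "\<lambda>n. from_center (f n) * ap n" "\<lambda>n. from_center (g n) * ap n"]
    commuting_center[of ap] ap_commute commuting_ap
  by (simp add: plus_center.rep_eq distrib_right)

lemma commuting_from_center: "commuting (\<lambda>n. from_center (f n))"
  unfolding commuting_def using center_commute by blast

lemma uexp_add_center: "uexp (\<lambda>n. from_center (f n)) * uexp (\<lambda>n. from_center (g n)) =
    uexp (\<lambda>n. from_center (f n + g n))"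
  using uexp_add[OF center_commute commuting_from_center commuting_from_center, of f g]
  by (simp add: plus_center.rep_eq)

lemma pi_dil:
  assumes "commuting (\<lambda>n. \<pi> (a n))"
  shows "pi_fps (dil k (exp_sum a)) = uexp (\<lambda>n. \<pi> (gam (k * int n)) * \<pi> (a n))"
proof (rule fps_ext)
  fix n
  have "fps_nth (uexp (\<lambda>n. \<pi> (gam (k * int n)) * \<pi> (a n))) n =
      \<pi> (gam (k * int n)) * fps_nth (uexp (\<lambda>n. \<pi> (a n))) n"
  proof (rule uexp_dilate[OF assms, of "\<lambda>n. \<pi> (gam (k * int n))"])
    show "\<pi> (gam (k * int (m + n))) = \<pi> (gam (k * int m)) * \<pi> (gam (k * int n))" for m n
      by (simp only: of_nat_add distrib_left pi_gam_add)
    show "\<pi> (gam (k * int 0)) = 1" by (simp add: pi_gam_0)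
    show "\<pi> (gam (k * int m)) * x = x * \<pi> (gam (k * int m))" for m x
      by (rule centralD[OF central_gam])
  qed
  then show "fps_nth (pi_fps (dil k (exp_sum a))) n = fps_nth (uexp (\<lambda>n. \<pi> (gam (k * int n)) * \<pi> (a n))) n"
    by (simp add: dil_def pi_mult pi_exp_sum[symmetric])
qed

definition bc :: "bool \<Rightarrow> nat \<Rightarrow> 'u center" where
  "bc s n = (if s then - (dd n * yi n) else dd n * (yy n * ((1 - PS n) * GG n)))"

definition rc :: "bool \<Rightarrow> nat \<Rightarrow> 'u center" where
  "rc s n = (if s then dd n * yy n else - (dd n * (yy n * yy n * yy n) * (1 - PS n) * GG n))"

lemma E_log:
  assumes n: "n > 0"
  shows "\<pi> (if s then - (letter (DiffInv n) * alpha (- int n) * gam (- int n))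
     else letter (DiffInv n) * alpha' (- int n) * gam (- int n)) = from_center (bc s n) * am n"
proof -
  have "\<pi> (if s then - (letter (DiffInv n) * alpha (- int n) * gam (- int n))
     else letter (DiffInv n) * alpha' (- int n) * gam (- int n)) = \<pi> (beta s n) * am n"
  proof -
    have e: "2 * - int n = - 2 * int n" by simp
    show ?thesis
      by (cases s) (simp_all only: if_True if_False beta_def alpha'_def e pi_mult pi_uminus am_def
          mult.assoc mult_minus_left centralD[OF central_gam, of _ "\<pi> (alpha _)"])
  qed
  then show ?thesis by (simp add: pi_beta[OF n] bc_def)
qed

lemma F_log:
  assumes n: "n > 0"
  shows "\<pi> (if s then letter (DiffInv n) * alpha (int n) * gam (int n)
     else - (letter (DiffInv n) * alpha' (int n) * gam (int n))) = from_center (rc s n) * ap n"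
proof -
  have "\<pi> (if s then letter (DiffInv n) * alpha (int n) * gam (int n)
     else - (letter (DiffInv n) * alpha' (int n) * gam (int n))) = \<pi> (rho s n) * ap n"
    by (cases s) (simp_all only: if_True if_False rho_def alpha'_def pi_mult pi_uminus ap_def
        mult.assoc mult_minus_left centralD[OF central_gam, of _ "\<pi> (alpha _)"])
  then show ?thesis by (simp add: pi_rho[OF n] rc_def)
qed

lemma pi_E: "pi_fps (E_fps s) = uexp (\<lambda>n. from_center (bc s n) * am n)"
  unfolding E_fps_def pi_exp_sum by (rule uexp_cong) (rule E_log)

lemma pi_F: "pi_fps (F_fps s) = uexp (\<lambda>n. from_center (rc s n) * ap n)"
  unfolding F_fps_def pi_exp_sum by (rule uexp_cong) (rule F_log)

section \<open>Exchange of currents and half vertex operators, coefficient by coefficient\<close>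

lemma alpha_x_neg: "n > 0 \<Longrightarrow> am n * \<pi> (X_ser s k) - \<pi> (X_ser s k) * am n =
    \<pi> (xi q t s (- int n)) * \<pi> (X_ser s (k + int n))"
  using alpha_x[of "- int n" s k] by (simp add: am_def)

lemma alpha_x_pos: "n > 0 \<Longrightarrow> ap n * \<pi> (X_ser s k) - \<pi> (X_ser s k) * ap n =
    \<pi> (xi q t s (int n)) * \<pi> (X_ser s (k - int n))"
  using alpha_x[of "int n" s k] by (simp add: ap_def)

lemma pi_swap: "pi_fps (swap_fps q t a b) = uexp (\<lambda>n. - (\<pi> (beta b n) * \<pi> (xi q t a (- int n))))"
  unfolding swap_fps_def pi_exp_sum by (simp add: swap_exp_def pi_uminus pi_mult)

lemma pi_contract: "pi_fps (contract_fps q t a b) = uexp (\<lambda>n. - (\<pi> (rho a n) * \<pi> (xi q t b (int n))))"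
  unfolding contract_fps_def pi_exp_sum by (simp add: contract_exp_def pi_uminus pi_mult)

text \<open>\<open>uexp_intertwine\<close> with the coefficients of x as the family
  \<open>y\<close>: the mode -n raises their exponent by n.\<close>

lemma x_E: "\<pi> (X_ser a k) * \<pi> (fps_nth (E_fps b) n) =
    (\<Sum>i=0..n. \<pi> (fps_nth (swap_fps q t a b) i) * \<pi> (fps_nth (E_fps b) (n - i)) * \<pi> (X_ser a (k + int i)))"
proof -
  have "\<pi> (X_ser a k) * fps_nth (uexp (\<lambda>n. from_center (bc b n) * am n)) n =
    (\<Sum>i=0..n. fps_nth (uexp (\<lambda>n. - (\<pi> (beta b n) * \<pi> (xi q t a (- int n))))) i *
      fps_nth (uexp (\<lambda>n. from_center (bc b n) * am n)) (n - i) * \<pi> (X_ser a (k + int i)))"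
  proof (rule uexp_intertwine[of "\<lambda>n. from_center (bc b n) * am n"
        "\<lambda>n. \<pi> (beta b n) * \<pi> (xi q t a (- int n))" "\<lambda>k. \<pi> (X_ser a k)"])
    show "commuting (\<lambda>n. from_center (bc b n) * am n)" by (rule commuting_am)
    show "\<pi> (beta b n) * \<pi> (xi q t a (- int n)) * x = x * (\<pi> (beta b n) * \<pi> (xi q t a (- int n)))"
      if "n > 0" for n x
      unfolding pi_beta[OF that] pi_xi_neg[OF that] times_center.rep_eq[symmetric] by (rule center_commute)
    fix m n assume n: "n > (0::nat)"
    have "\<pi> (X_ser a m) * (from_center (bc b n) * am n) = from_center (bc b n) * (\<pi> (X_ser a m) * am n)"
      by (rule central_left_commute[OF center_commute])
    also have "\<pi> (X_ser a m) * am n = am n * \<pi> (X_ser a m) - \<pi> (xi q t a (- int n)) * \<pi> (X_ser a (m + int n))"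
      using alpha_x_neg[OF n, of a m] by (simp add: algebra_simps)
    finally show "\<pi> (X_ser a m) * (from_center (bc b n) * am n) = from_center (bc b n) * am n * \<pi> (X_ser a m)
       - \<pi> (beta b n) * \<pi> (xi q t a (- int n)) * \<pi> (X_ser a (m + int n))"
      by (simp add: right_diff_distrib mult.assoc pi_beta[OF n] bc_def)
  qed
  then show ?thesis by (simp only: pi_E[symmetric] pi_swap[symmetric] pi_fps_nth)
qed

lemma central_contract:
  assumes "n > 0"
  shows "\<pi> (rho a n) * \<pi> (xi q t b (int n)) * x = x * (\<pi> (rho a n) * \<pi> (xi q t b (int n)))"
  unfolding pi_rho[OF assms] pi_xi_pos[OF assms] times_center.rep_eq[symmetric] by (rule center_commute)

text \<open>Positive modes lower the exponent of x, so \<open>uexp_intertwine\<close> is applied to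
  the family with reflected index.\<close>

lemma x_F: "\<pi> (X_ser b k) * \<pi> (fps_nth (F_fps a) n) =
    (\<Sum>i=0..n. \<pi> (fps_nth (contract_fps q t a b) i) * \<pi> (fps_nth (F_fps a) (n - i)) * \<pi> (X_ser b (k - int i)))"
proof -
  have "\<pi> (X_ser b (- (- k))) * fps_nth (uexp (\<lambda>n. from_center (rc a n) * ap n)) n =
    (\<Sum>i=0..n. fps_nth (uexp (\<lambda>n. - (\<pi> (rho a n) * \<pi> (xi q t b (int n))))) i *
      fps_nth (uexp (\<lambda>n. from_center (rc a n) * ap n)) (n - i) * \<pi> (X_ser b (- (- k + int i))))"
  proof (rule uexp_intertwine[of "\<lambda>n. from_center (rc a n) * ap n"
        "\<lambda>n. \<pi> (rho a n) * \<pi> (xi q t b (int n))" "\<lambda>k. \<pi> (X_ser b (- k))"])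
    show "commuting (\<lambda>n. from_center (rc a n) * ap n)" by (rule commuting_ap)
    fix m n assume n: "n > (0::nat)"
    have "\<pi> (X_ser b (- m)) * (from_center (rc a n) * ap n) = from_center (rc a n) * (\<pi> (X_ser b (- m)) * ap n)"
      by (rule central_left_commute[OF center_commute])
    also have "\<pi> (X_ser b (- m)) * ap n =
        ap n * \<pi> (X_ser b (- m)) - \<pi> (xi q t b (int n)) * \<pi> (X_ser b (- (m + int n)))"
      using alpha_x_pos[OF n, of b "- m"] by (simp add: algebra_simps)
    finally show "\<pi> (X_ser b (- m)) * (from_center (rc a n) * ap n) =
        from_center (rc a n) * ap n * \<pi> (X_ser b (- m))
       - \<pi> (rho a n) * \<pi> (xi q t b (int n)) * \<pi> (X_ser b (- (m + int n)))"
      by (simp add: right_diff_distrib mult.assoc pi_rho[OF n] rc_def)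
  qed (rule central_contract)
  then show ?thesis by (simp only: pi_F[symmetric] pi_contract[symmetric] pi_fps_nth) simp
qed

text \<open>Here the coefficients of E^+ serve as the family \<open>y\<close>: by
  \<open>uexp_commutator\<close> the bracket with the mode -n shifts their index by n, and
  \<open>xi_beta\<close> identifies the scalar with the one for x. Hence the factor is the one of
  \<open>x_F\<close>.\<close>

lemma F_E: "\<pi> (fps_nth (F_fps a) m) * \<pi> (fps_nth (E_fps b) n) =
    (\<Sum>i=0..n. \<pi> (fps_nth (contract_fps q t a b) i) * \<pi> (fps_nth (E_fps b) (n - i)) *
      (if i \<le> m then \<pi> (fps_nth (F_fps a) (m - i)) else 0))"
proof -
  \<comment> \<open>The index is the exponent of the variable, so the coefficients sit at
    \<open>j \<le> 0\<close>; extension by 0 makes the shift relation hold for all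
    \<open>j\<close>.\<close>
  define y where "y j = (if j \<le> 0 then fps_nth (pi_fps (F_fps a)) (nat (- j)) else 0)" for j
  have "y (- int m) * fps_nth (uexp (\<lambda>n. from_center (bc b n) * am n)) n =
    (\<Sum>i=0..n. fps_nth (uexp (\<lambda>n. - (\<pi> (rho a n) * \<pi> (xi q t b (int n))))) i *
      fps_nth (uexp (\<lambda>n. from_center (bc b n) * am n)) (n - i) * y (- int m + int i))"
  proof (rule uexp_intertwine[of "\<lambda>n. from_center (bc b n) * am n"
        "\<lambda>n. \<pi> (rho a n) * \<pi> (xi q t b (int n))" y])
    show "commuting (\<lambda>n. from_center (bc b n) * am n)" by (rule commuting_am)
    fix j and n :: nat assume n: "n > 0"
    have r: "\<pi> (rho a n) * \<pi> (xi q t b (int n)) = - from_center (rc a n * bc b n * hh n)"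
      by (simp add: xi_beta[OF n] pi_rho[OF n] pi_beta[OF n] rc_def bc_def center_reps mult.assoc)
    show "y j * (from_center (bc b n) * am n) = from_center (bc b n) * am n * y j -
        \<pi> (rho a n) * \<pi> (xi q t b (int n)) * y (j + int n)"
    proof (cases "j \<le> 0")
      case True
      then obtain l where l: "j = - int l" by (metis minus_minus nonneg_int_cases neg_0_le_iff_le)
      have "fps_nth (uexp (\<lambda>k. from_center (rc a k) * ap k)) l * (from_center (bc b n) * am n) -
          from_center (bc b n) * am n * fps_nth (uexp (\<lambda>k. from_center (rc a k) * ap k)) l =
          (if n \<le> l then from_center (rc a n * bc b n * hh n) *
            fps_nth (uexp (\<lambda>k. from_center (rc a k) * ap k)) (l - n) else 0)"
      proof (rule uexp_commutator[OF commuting_ap])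
        fix k :: nat assume k: "k > 0"
        have "from_center (rc a k) * ap k * (from_center (bc b n) * am n) -
            from_center (bc b n) * am n * (from_center (rc a k) * ap k) =
            from_center (rc a k) * from_center (bc b n) * (ap k * am n - am n * ap k)"
        proof -
          have "from_center (rc a k) * ap k * (from_center (bc b n) * am n) =
              from_center (rc a k) * from_center (bc b n) * (ap k * am n)"
            by (simp only: mult.assoc central_left_commute[OF center_commute, of "ap k"])
          moreover have "from_center (bc b n) * am n * (from_center (rc a k) * ap k) =
              from_center (rc a k) * from_center (bc b n) * (am n * ap k)"
            by (simp only: mult.assoc central_left_commute[OF center_commute, of "am n"]
                central_left_commute[OF center_commute, of "from_center (bc b n)" "rc a k"])
          ultimately show ?thesis by (simp add: right_diff_distrib)
        qed
        then show "from_center (rc a k) * ap k * (from_center (bc b n) * am n) -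
            from_center (bc b n) * am n * (from_center (rc a k) * ap k) =
            (if k = n then from_center (rc a n * bc b n * hh n) else 0)"
          using alpha_heisenberg[OF k n] by (auto simp: ap_def am_def center_reps)
      qed (use n in \<open>simp_all add: center_commute\<close>)
      moreover have "y j = fps_nth (uexp (\<lambda>k. from_center (rc a k) * ap k)) l"
        using l by (simp add: y_def pi_F del: pi_fps_nth)
      moreover have "y (j + int n) = (if n \<le> l then fps_nth (uexp (\<lambda>k. from_center (rc a k) * ap k)) (l - n) else 0)"
        using l by (auto simp: y_def pi_F nat_diff_distrib simp del: pi_fps_nth)
      ultimately show ?thesis unfolding r by (auto simp: algebra_simps split: if_splits)
    qed (use n in \<open>simp add: y_def\<close>)
  qed (rule central_contract)
  moreover have "y (- int m) = \<pi> (fps_nth (F_fps a) m)" by (simp add: y_def)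
  moreover have "y (- int m + int i) = (if i \<le> m then \<pi> (fps_nth (F_fps a) (m - i)) else 0)" for i
    by (auto simp: y_def nat_diff_distrib)
  ultimately show ?thesis by (simp only: pi_E[symmetric] pi_contract[symmetric] pi_fps_nth)
qed

subsection \<open>Products of structure functions\<close>

lemma pi_g_fps:
  assumes "\<And>n. n > 0 \<Longrightarrow> \<pi> (r n) = from_center (f n)"
  shows "pi_fps (g_fps q t r) = uexp (\<lambda>n. from_center (kk n * f n))"
  unfolding g_fps_def pi_exp_sum
  by (rule uexp_cong) (simp add: pi_mult pi_scalars assms times_center.rep_eq)

lemma pi_r:
  assumes "n > 0"
  shows "\<pi> (r_one n) = from_center 1" "\<pi> (r_p n) = from_center (PP n * GG n)"
    "\<pi> (r_pstar n) = from_center (PS n * GS n)"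
    "\<pi> (r_gam2 n) = from_center (- (yy n * yy n * dd n))"
  using pi_scalars[OF assms] pi_gams(1)[OF assms]
  by (simp_all add: r_one_def r_p_def r_pstar_def r_gam2_def pi_uminus pi_mult
      pi_1 center_reps)

lemma pi_uminus_from_center: "\<pi> a = from_center x \<Longrightarrow> \<pi> (- a) = from_center (- x)"
  by (simp add: pi_uminus uminus_center.rep_eq)

lemma pi_g:
  "pi_fps (g_fps q t r_one) = uexp (\<lambda>n. from_center (kk n * 1))"
  "pi_fps (g_fps q t r_pstar) = uexp (\<lambda>n. from_center (kk n * (PS n * GS n)))"
  "pi_fps (g_fps q t (\<lambda>m. - r_one m)) = uexp (\<lambda>n. from_center (kk n * - 1))"
  "pi_fps (g_fps q t (\<lambda>m. - r_p m)) = uexp (\<lambda>n. from_center (kk n * - (PP n * GG n)))"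
  "pi_fps (g_fps q t (\<lambda>m. - r_gam2 m)) =
    uexp (\<lambda>n. from_center (kk n * - (- (yy n * yy n * dd n))))"
  by (rule pi_g_fps, (rule pi_uminus_from_center)?, erule pi_r)+

text \<open>For opposite signs the ratio (1 - p^n)/(1 - p*^n) meets its inverse and the factor
  becomes independent of \<open>p\<close>; for equal signs one of the two survives.\<close>

lemma pi_swap_center: "pi_fps (swap_fps q t a b) = uexp (\<lambda>n. from_center (- kk n *
   (if a then if b then dd n * (yi n * yi n) * (1 - PP n) * GS n else - dd n
    else if b then - dd n else dd n * (yy n * yy n) * (1 - PS n) * GG n)))"
  unfolding pi_swap
proof (rule uexp_cong)
  fix n :: nat assume n: "n > 0"
  let ?b = "if b then - (dd n * yi n) else dd n * (yy n * ((1 - PS n) * GG n))"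
  let ?x = "if a then - (kk n * (yi n * ((1 - PP n) * GS n))) else kk n * yy n"
  have "?b * ?x = kk n * (if a then if b then dd n * (yi n * yi n) * (1 - PP n) * GS n else - dd n
    else if b then - dd n else dd n * (yy n * yy n) * (1 - PS n) * GG n)" (is "_ = ?r")
  proof -
    have "dd n * (yy n * ((1 - PS n) * GG n)) * (kk n * (yi n * ((1 - PP n) * GS n))) =
      kk n * dd n * (yy n * yi n) * ((1 - PP n) * GS n * ((1 - PS n) * GG n))"
      by (simp only: mult_ac)
    then have 1: "dd n * (yy n * ((1 - PS n) * GG n)) * (kk n * (yi n * ((1 - PP n) * GS n))) = kk n * dd n"
      by (simp only: scalar_rels(1)[OF n] scalar_ids(8)[OF n n n n n]) simp
    have "dd n * yi n * (kk n * yy n) = kk n * dd n * (yy n * yi n)" by (simp only: mult_ac)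
    then have 2: "dd n * yi n * (kk n * yy n) = kk n * dd n" by (simp add: scalar_rels(1)[OF n])
    show ?thesis using 1 2 by (simp add: mult_ac)
  qed
  then show "- (\<pi> (beta b n) * \<pi> (xi q t a (- int n))) = from_center (- kk n *
   (if a then if b then dd n * (yi n * yi n) * (1 - PP n) * GS n else - dd n
    else if b then - dd n else dd n * (yy n * yy n) * (1 - PS n) * GG n))"
    by (simp only: pi_beta[OF n] pi_xi_neg[OF n] times_center.rep_eq[symmetric] uminus_center.rep_eq[symmetric]
        mult_minus_left)
qed

text \<open>The second scalar identity: exchanging currents turns the inverse of g(z;\<gamma>^2)
  into the inverse of g(z;p).\<close>

lemma structure_minus:
  "pi_fps (g_fps q t (\<lambda>m. - r_gam2 m) * swap_fps q t False False) = pi_fps (g_fps q t (\<lambda>m. - r_p m))"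
proof -
  have "kk n * - (- (yy n * yy n * dd n)) + - kk n * (dd n * (yy n * yy n) * (1 - PS n) * GG n) =
      kk n * - (PP n * GG n)" if n: "n > 0" for n
  proof -
    have "kk n * - (- (yy n * yy n * dd n)) + - kk n * (dd n * (yy n * yy n) * (1 - PS n) * GG n) =
      kk n * (yy n * yy n * dd n - dd n * (yy n * yy n) * (1 - PS n) * GG n)"
      by (simp add: algebra_simps)
    then show ?thesis by (simp only: scalar_ids(2)[OF n n n n n])
  qed
  then show ?thesis
    unfolding pi_fps_mult pi_swap_center
pi_g if_False uexp_add_center
    by (intro uexp_cong arg_cong[of _ _ from_center])
qed

text \<open>The first scalar identity, with the inverse of g(z) removing the summand 1 and leaving
  p*^n/(1 - p*^n).\<close>

lemma structure_plus:
  "pi_fps (g_fps q t (\<lambda>m. - r_one m) * g_fps q t (\<lambda>m. - r_gam2 m) * swap_fps q t True True) =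
    pi_fps (g_fps q t r_pstar)"
proof -
  have "kk n * - 1 + kk n * - (- (yy n * yy n * dd n)) + - kk n * (dd n * (yi n * yi n) * (1 - PP n) * GS n) =
      kk n * (PS n * GS n)" if n: "n > 0" for n
  proof -
    have "kk n * - 1 + kk n * - (- (yy n * yy n * dd n)) + - kk n * (dd n * (yi n * yi n) * (1 - PP n) * GS n) =
      kk n * (yy n * yy n * dd n - dd n * (yi n * yi n) * (1 - PP n) * GS n - 1)"
      by (simp add: algebra_simps)
    then show ?thesis by (simp only: scalar_ids(1)[OF n n n n n]) simp
  qed
  then show ?thesis
    unfolding pi_fps_mult pi_swap_center pi_g if_True uexp_add_center
    by (intro uexp_cong arg_cong[of _ _ from_center])
qed

text \<open>Since \<open>dil 2\<close> substitutes \<gamma> z, the exponent is \<kappa>_n / n times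
  \<gamma>^n - \<gamma>^(2n) d + d, where d is 1/(\<gamma>^n - \<gamma>^(-n)); this
  vanishes.\<close>

lemma structure_mixed:
  "pi_fps (dil 2 (g_fps q t r_one) * dil 2 (g_fps q t r_gam2) * swap_fps q t a (\<not> a)) = pi_fps 1"
proof -
  have dil: "pi_fps (dil 2 (g_fps q t r)) = uexp (\<lambda>n. from_center (yy n * yy n * (kk n * f n)))"
    if r: "\<And>n. n > 0 \<Longrightarrow> \<pi> (r n) = from_center (f n)" for r f
  proof -
    have g: "\<pi> (cc (kappa q t (int n) / of_nat n) * r n) = from_center (kk n * f n)" if "n > 0" for n
      using that by (simp add: pi_mult pi_scalars r times_center.rep_eq)
    have "commuting (\<lambda>n. \<pi> (cc (kappa q t (int n) / of_nat n) * r n))"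
      using commuting_from_center[of "\<lambda>n. kk n * f n"] g by (simp add: commuting_def)
    then show ?thesis
      unfolding g_fps_def
      by (subst pi_dil, assumption, intro uexp_cong) (simp only: g pi_gams times_center.rep_eq)
  qed
  have "yy n * yy n * (kk n * 1) + yy n * yy n * (kk n * - (yy n * yy n * dd n)) + - kk n * - dd n = 0"
    if n: "n > 0" for n
  proof -
    have "yy n * yy n * (kk n * 1) + yy n * yy n * (kk n * - (yy n * yy n * dd n)) + - kk n * - dd n =
      kk n * (yy n * yy n - yy n * yy n * yy n * yy n * dd n + dd n)"
      by (simp add: algebra_simps)
    then show ?thesis by (simp only: scalar_ids(3)[OF n n n n n]) simp
  qed
  then have "uexp (\<lambda>n. from_center (yy n * yy n * (kk n * 1) +
      yy n * yy n * (kk n * - (yy n * yy n * dd n)) + - kk n * - dd n)) = uexp (\<lambda>n. 0)"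
    by (intro uexp_cong) (simp only: zero_center.rep_eq)
  moreover have "pi_fps (swap_fps q t a (\<not> a)) = uexp (\<lambda>n. from_center (- kk n * - dd n))"
    by (cases a) (simp_all only: pi_swap_center if_True if_False simp_thms not_True_eq_False not_False_eq_True)
  moreover have "pi_fps (dil 2 (g_fps q t r_one)) = uexp (\<lambda>n. from_center (yy n * yy n * (kk n * 1)))"
    by (rule dil) (rule pi_r)
  moreover have "pi_fps (dil 2 (g_fps q t r_gam2)) =
      uexp (\<lambda>n. from_center (yy n * yy n * (kk n * - (yy n * yy n * dd n))))"
    by (rule dil) (rule pi_r)
  ultimately show ?thesis
    unfolding pi_fps_mult by (simp only: uexp_add_center uexp_zero pi_fps_1)
qed

lemma pi_linear: "pi_fps (1 - fps_const (cc a) * fps_X) = uexp (\<lambda>n. - c (a ^ n / of_nat n))"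
proof -
  have "pi_fps (fps_const x * fps_X) = fps_const (\<pi> x) * fps_X" for x
    by (rule fps_ext) (simp add: fps_X_def pi_0 pi_mult pi_1)
  then show ?thesis by (simp add: pi_fps_diff pi_fps_1 uexp_geometric c_def[symmetric])
qed

lemma uexp_add_c: "uexp (\<lambda>n. c (f n)) * uexp (\<lambda>n. c (g n)) = uexp (\<lambda>n. c (f n + g n))"
proof -
  have "commuting (\<lambda>n. c (h n))" for h unfolding commuting_def using c_comm by blast
  then show ?thesis
    using uexp_add[of "\<lambda>n. c (f n)" "\<lambda>n. c (g n)", OF c_comm] by (simp only: c_add)
qed

text \<open>By \<open>kappa_sum\<close> the coefficients of log g(z) are the difference of those of
  log G^+ and log G^-.\<close>

lemma structure_G: "pi_fps (G_fps q t (- 1) * g_fps q t r_one) = pi_fps (G_fps q t 1)"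
proof -
  have G: "pi_fps (G_fps q t e) = uexp (\<lambda>n. c (- ((q powi e) ^ n / of_nat n) +
      - ((t powi (- e)) ^ n / of_nat n) + - (((q / t) powi (- e)) ^ n / of_nat n)))" for e
    unfolding G_fps_def pi_fps_mult pi_linear c_uminus[symmetric] uexp_add_c ..
  have g: "pi_fps (g_fps q t r_one) = uexp (\<lambda>n. c (kappa q t (int n) / of_nat n))"
    unfolding g_fps_def pi_exp_sum by (simp add: r_one_def c_def)
  have "- ((q powi (- 1)) ^ n / of_nat n) + - ((t powi (- (- 1))) ^ n / of_nat n) +
      - (((q / t) powi (- (- 1))) ^ n / of_nat n) + kappa q t (int n) / of_nat n =
      - ((q powi 1) ^ n / of_nat n) + - ((t powi (- 1)) ^ n / of_nat n) + - (((q / t) powi (- 1)) ^ n / of_nat n)"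
    for n :: nat
    by (simp add: kappa_sum[OF q t] power_int_minus add_divide_distrib diff_divide_distrib power_inverse)
  then show ?thesis unfolding pi_fps_mult G g uexp_add_c by simp
qed

text \<open>Inserting g(z) times its inverse turns G^- into G^+ and reduces the quadratic case to
  \<open>structure_plus\<close>.\<close>

lemma structure_plus_G:
  "pi_fps (G_fps q t (- 1) * g_fps q t (\<lambda>m. - r_gam2 m) * swap_fps q t True True) =
    pi_fps (G_fps q t 1 * g_fps q t r_pstar)"
proof -
  have 1: "pi_fps (g_fps q t r_one) * pi_fps (g_fps q t (\<lambda>m. - r_one m)) = 1"
    unfolding pi_g uexp_add_center
    by (simp add: zero_center.rep_eq uexp_zero)
  have "pi_fps (G_fps q t 1 * g_fps q t r_pstar) =
      pi_fps (G_fps q t (- 1)) * (pi_fps (g_fps q t r_one) * pi_fps (g_fps q t (\<lambda>m. - r_one m))) *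
      (pi_fps (g_fps q t (\<lambda>m. - r_gam2 m)) * pi_fps (swap_fps q t True True))"
    unfolding pi_fps_mult[of "G_fps q t 1"] structure_G[symmetric] structure_plus[symmetric]
    by (simp only: pi_fps_mult mult.assoc)
  then show ?thesis unfolding 1 by (simp only: pi_fps_mult mult.assoc mult_1_right)
qed

subsection \<open>Cancellation against the Cartan currents\<close>

lemma psi_E_log:
  assumes n: "n > 0"
  shows "\<pi> (- (pp ^ n * geo (pp ^ n) * alpha (- int n) * gam (- int n))) = from_center (- (PP n * GG n * yi n)) * am n"
    "\<pi> (- (geo (pp ^ n) * alpha (- int n) * gam (int n))) = from_center (- (GG n * yy n)) * am n"
    "\<pi> (geo (pp ^ n) * alpha (int n) * gam (int n)) = from_center (GG n * yy n) * ap n"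
    "\<pi> (pp ^ n * geo (pp ^ n) * alpha (int n) * gam (- int n)) = from_center (PP n * GG n * yi n) * ap n"
  by (simp_all only: pi_uminus pi_mult pi_scalars[OF n] center_reps am_def ap_def mult.assoc mult_minus_left
      center_commute[of _ "\<pi> (alpha _)", symmetric])

lemma dil_am:
  assumes a: "\<And>n. n > 0 \<Longrightarrow> \<pi> (a n) = from_center (f n) * am n"
    and g: "\<And>n. n > 0 \<Longrightarrow> \<pi> (gam (k * int n)) = from_center (g n)"
  shows "pi_fps (dil k (exp_sum a)) = uexp (\<lambda>n. from_center (g n * f n) * am n)"
proof -
  have "commuting (\<lambda>n. \<pi> (a n))" using commuting_am[of f] a by (simp add: commuting_def)
  then show ?thesis
    by (subst pi_dil, assumption, intro uexp_cong) (simp only: a g times_center.rep_eq mult.assoc)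
qed

lemma dil_ap:
  assumes a: "\<And>n. n > 0 \<Longrightarrow> \<pi> (a n) = from_center (f n) * ap n"
    and g: "\<And>n. n > 0 \<Longrightarrow> \<pi> (gam (k * int n)) = from_center (g n)"
  shows "pi_fps (dil k (exp_sum a)) = uexp (\<lambda>n. from_center (g n * f n) * ap n)"
proof -
  have "commuting (\<lambda>n. \<pi> (a n))" using commuting_ap[of f] a by (simp add: commuting_def)
  then show ?thesis
    by (subst pi_dil, assumption, intro uexp_cong) (simp only: a g times_center.rep_eq mult.assoc)
qed

lemma uexp_center_zero:
  assumes "\<And>n. n > 0 \<Longrightarrow> f n = (0 :: 'u center)"
  shows "uexp (\<lambda>n. from_center (f n) * x n) = 1"
proof -
  have "uexp (\<lambda>n. from_center (f n) * x n) = uexp (\<lambda>n. 0)"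
    by (rule uexp_cong) (simp add: assms zero_center.rep_eq)
  then show ?thesis by (simp add: uexp_zero)
qed

text \<open>On the support of \<delta>(\<gamma>^(-1) z/w) one has z = \<gamma> w, so E^-(\<alpha>,z)
  becomes \<open>dil 2 (E_fps True)\<close> in w. Mode by mode its logarithm cancels those of
  E^-(\<alpha>',w) and of the part of \<psi>^+ in positive powers.\<close>

lemma cancel_E_plus: "pi_fps (E_fps False * psi_E True * dil 2 (E_fps True)) = pi_fps 1"
proof -
  have psi: "pi_fps (psi_E True) = uexp (\<lambda>n. from_center (- (PP n * GG n * yi n)) * am n)"
    unfolding psi_E_def if_True pi_exp_sum by (rule uexp_cong) (rule psi_E_log)
  have E: "pi_fps (dil 2 (E_fps True)) = uexp (\<lambda>n. from_center (yy n * yy n * bc True n) * am n)"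
    unfolding E_fps_def by (rule dil_am[OF E_log pi_gams(1)])
  have "bc False n + - (PP n * GG n * yi n) + yy n * yy n * bc True n = 0" if n: "n > 0" for n
  proof -
    have "yy n * yy n * bc True n = - (dd n * yy n * (yy n * yi n))"
      by (simp add: bc_def mult_ac)
    then have "bc False n + - (PP n * GG n * yi n) + yy n * yy n * bc True n =
        dd n * yy n * ((1 - PS n) * GG n - 1) - PP n * GG n * yi n"
      using scalar_rels(1)[OF n] by (simp add: bc_def right_diff_distrib mult.assoc)
    then show ?thesis using scalar_ids(4)[OF n n n n n] by simp
  qed
  then show ?thesis
    unfolding pi_fps_mult psi E pi_E uexp_add_am pi_fps_1 by (rule uexp_center_zero)
qed

lemma cancel_F_plus: "pi_fps (dil (- 2) (F_fps True) * psi_F True * F_fps False) = pi_fps 1"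
proof -
  have psi: "pi_fps (psi_F True) = uexp (\<lambda>n. from_center (GG n * yy n) * ap n)"
    unfolding psi_F_def if_True pi_exp_sum by (rule uexp_cong) (rule psi_E_log)
  have F: "pi_fps (dil (- 2) (F_fps True)) = uexp (\<lambda>n. from_center (yi n * yi n * rc True n) * ap n)"
    unfolding F_fps_def by (rule dil_ap[OF F_log pi_gams(2)])
  have "yi n * yi n * rc True n + GG n * yy n + rc False n = 0" if n: "n > 0" for n
  proof -
    have "yi n * yi n * rc True n = dd n * yi n * (yy n * yi n)"
      by (simp add: rc_def mult_ac)
    then have "yi n * yi n * rc True n + GG n * yy n + rc False n =
        dd n * yi n - dd n * (yy n * yy n * yy n) * (1 - PS n) * GG n + GG n * yy n"
      using scalar_rels(1)[OF n] by (simp add: rc_def)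
    then show ?thesis using scalar_ids(5)[OF n n n n n] by simp
  qed
  then show ?thesis
    unfolding pi_fps_mult psi F pi_F uexp_add_ap pi_fps_1 by (rule uexp_center_zero)
qed

text \<open>Now z = \<gamma>^(-1) w, and \<psi>^- too is evaluated at \<gamma>^(-1) w; hence both
  dilations are by \<open>- 2\<close>.\<close>

lemma cancel_E_minus:
  "pi_fps (E_fps False * dil (- 2) (psi_E False) * dil (- 2) (E_fps True)) = pi_fps 1"
proof -
  have psi: "pi_fps (dil (- 2) (psi_E False)) = uexp (\<lambda>n. from_center (yi n * yi n * - (GG n * yy n)) * am n)"
    unfolding psi_E_def if_False by (rule dil_am[OF psi_E_log(2) pi_gams(2)])
  have E: "pi_fps (dil (- 2) (E_fps True)) = uexp (\<lambda>n. from_center (yi n * yi n * bc True n) * am n)"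
    unfolding E_fps_def by (rule dil_am[OF E_log pi_gams(2)])
  have "bc False n + yi n * yi n * - (GG n * yy n) + yi n * yi n * bc True n = 0" if n: "n > 0" for n
  proof -
    have "yi n * yi n * - (GG n * yy n) = - (GG n * yi n * (yy n * yi n))"
      by (simp add: mult_ac)
    then have "bc False n + yi n * yi n * - (GG n * yy n) + yi n * yi n * bc True n =
        - (dd n * (yi n * yi n * yi n)) + dd n * yy n * (1 - PS n) * GG n - GG n * yi n"
      using scalar_rels(1)[OF n] by (simp add: bc_def mult_ac)
    then show ?thesis using scalar_ids(6)[OF n n n n n] by simp
  qed
  then show ?thesis
    unfolding pi_fps_mult psi E pi_E uexp_add_am pi_fps_1 by (rule uexp_center_zero)
qed

text \<open>In negative powers, dilation by \<open>2\<close> is again the substitution of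
  \<gamma>^(-1) w.\<close>

lemma cancel_F_minus: "pi_fps (dil 2 (F_fps True) * dil 2 (psi_F False) * F_fps False) = pi_fps 1"
proof -
  have psi: "pi_fps (dil 2 (psi_F False)) = uexp (\<lambda>n. from_center (yy n * yy n * (PP n * GG n * yi n)) * ap n)"
    unfolding psi_F_def if_False by (rule dil_ap[OF psi_E_log(4) pi_gams(1)])
  have F: "pi_fps (dil 2 (F_fps True)) = uexp (\<lambda>n. from_center (yy n * yy n * rc True n) * ap n)"
    unfolding F_fps_def by (rule dil_ap[OF F_log pi_gams(1)])
  have "yy n * yy n * rc True n + yy n * yy n * (PP n * GG n * yi n) + rc False n = 0" if n: "n > 0" for n
  proof -
    have "yy n * yy n * (PP n * GG n * yi n) = PP n * GG n * yy n * (yy n * yi n)"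
      by (simp add: mult_ac)
    then have "yy n * yy n * rc True n + yy n * yy n * (PP n * GG n * yi n) + rc False n =
        dd n * (yy n * yy n * yy n) - dd n * (yy n * yy n * yy n) * (1 - PS n) * GG n + PP n * GG n * yy n"
      using scalar_rels(1)[OF n] by (simp add: rc_def mult_ac)
    then show ?thesis using scalar_ids(7)[OF n n n n n] by simp
  qed
  then show ?thesis
    unfolding pi_fps_mult psi F pi_F uexp_add_ap pi_fps_1 by (rule uexp_center_zero)
qed

end

section \<open>Reordering of products\<close>

definition up :: "free_alg fps \<Rightarrow> var \<Rightarrow> factor" where
  "up F v = (Up v, at_var (in_pos F) v)"

definition dn :: "free_alg fps \<Rightarrow> var \<Rightarrow> factor" where
  "dn F v = (Down v, at_var (in_neg F) v)"

definition ray :: "free_alg fps \<Rightarrow> var \<Rightarrow> var \<Rightarrow> factor" where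
  "ray F w z = (Ray w z, at_ratio (in_pos F) w z)"

definition line :: "int series \<Rightarrow> var \<Rightarrow> factor" where
  "line X v = (Line v, at_var X v)"

definition diag :: "int \<Rightarrow> var \<Rightarrow> var \<Rightarrow> factor" where
  "diag k z w = (Diag z w, at_ratio (dilate k delta) z w)"

definition con :: "free_alg \<Rightarrow> factor" where
  "con a = (Box 0, const_ser a)"

definition box :: "nat \<Rightarrow> (var \<Rightarrow> int) series \<Rightarrow> factor" where
  "box n B = (Box n, B)"

definition Z_ser :: "bool \<Rightarrow> int series" where
  "Z_ser s = (if s then Z_plus else Z_minus)"

lemmas factor_defs = up_def dn_def ray_def line_def diag_def con_def box_def

lemma fst_factor [simp]:
  "fst (up F v) = Up v" "fst (dn F v) = Down v" "fst (ray F w z) = Ray w z" "fst (line X v) = Line v"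
  "fst (diag k z w) = Diag z w" "fst (con a) = Box 0" "fst (box n B) = Box n"
  by (simp_all add: factor_defs)

definition graded_factor :: "factor \<Rightarrow> bool" where
  "graded_factor A \<longleftrightarrow> graded (fst A) (snd A)"

text \<open>As a simplification rule it settles convergence of explicit lists: gradings come from
  rules for single factors, the condition on shapes is computed.\<close>

lemma convergentI [simp]:
  assumes "\<forall>A\<in>set As. graded_factor A" "admissible_shapes (map fst As)"
  shows "convergent_list As"
  using assms by (simp add: convergent_list_def graded_list_def graded_factor_def admissible_convergent)

lemma graded_up: "(\<And>n. fps_nth F n \<in> homog (- int n)) \<Longrightarrow> graded_factor (up F v)"
  unfolding graded_factor_def up_def fst_conv snd_conv
proof (rule graded_at_var_Up)
  fix n assume F: "\<And>n. fps_nth F n \<in> homog (- int n)"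
  show "in_pos F n \<in> homog (- n)" using F[of "nat n"] by (cases "n \<ge> 0") (simp_all add: in_pos_def)
qed (simp add: in_pos_def)

lemma graded_dn: "(\<And>n. fps_nth F n \<in> homog (int n)) \<Longrightarrow> graded_factor (dn F v)"
  unfolding graded_factor_def dn_def fst_conv snd_conv
proof (rule graded_at_var_Down)
  fix n assume F: "\<And>n. fps_nth F n \<in> homog (int n)"
  show "in_neg F n \<in> homog (- n)" using F[of "nat (- n)"] by (cases "n \<le> 0") (simp_all add: in_neg_def)
qed (simp add: in_neg_def)

lemma graded_ray: "(\<And>n. fps_nth F n \<in> homog 0) \<Longrightarrow> graded_factor (ray F w z)"
  unfolding graded_factor_def ray_def fst_conv snd_conv
  by (rule graded_at_ratio_Ray) (auto simp: in_pos_def)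

lemma graded_line: "(\<And>n. X n \<in> homog (- n)) \<Longrightarrow> graded_factor (line X v)"
  unfolding graded_factor_def line_def fst_conv snd_conv by (rule graded_at_var_Line)

lemma graded_diag [simp]: "graded_factor (diag k z w)"
  unfolding graded_factor_def diag_def fst_conv snd_conv
  by (rule graded_at_ratio_Diag) (simp add: dilate_def delta_def)

lemma graded_con: "a \<in> homog 0 \<Longrightarrow> graded_factor (con a)"
  unfolding graded_factor_def con_def fst_conv snd_conv by (rule graded_const)

lemma graded_mono:
  assumes "vdeg e = 0" "\<And>v. \<bar>e v\<bar> \<le> int n"
  shows "graded_factor (box n (mono_ser e))"
  using assms by (auto simp: graded_factor_def box_def graded_def mono_ser_def)

lemma bracket_homog: "bracket z w u m \<in> homog (- vdeg m)"
proof -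
  have "mono_ser (vexp a 1 - vexp b 1) m \<in> homog (- vdeg m)" for a b
    by (auto simp: mono_ser_def)
  then show ?thesis by (simp add: bracket_def homog_add homog_diff)
qed

lemma graded_bracket [simp]: "graded_factor (box 1 (bracket z w u))"
proof -
  have "mono_ser (vexp a 1 - vexp b 1) m = 0" if "m \<notin> support (Box 1)" for a b m
  proof -
    have "\<bar>(if x then 1 else 0) - (if y then 1 else 0)\<bar> \<le> (1 :: int)" for x y by simp
    then have "vexp a 1 - vexp b 1 \<in> support (Box 1)" by (simp add: vexp_apply)
    with that show ?thesis by (auto simp: mono_ser_def simp del: support.simps)
  qed
  then have "bracket z w u m = 0" if "m \<notin> support (Box 1)" for m
    using that by (simp add: bracket_def del: support.simps)
  then show ?thesis
    by (simp add: graded_factor_def box_def graded_def bracket_homog del: support.simps)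
qed

text \<open>The form in which the rule is met once \<open>1\<close> has been rewritten to
  \<open>Suc 0\<close>.\<close>

lemmas graded_bracket_Suc [simp] = graded_bracket[unfolded One_nat_def]

lemma in_pos_homog: "(\<And>n. fps_nth F n \<in> homog (- int n)) \<Longrightarrow> in_pos F n \<in> homog (- n)"
proof -
  assume "\<And>n. fps_nth F n \<in> homog (- int n)"
  from this[of "nat n"] show ?thesis by (cases "n \<ge> 0") (simp_all add: in_pos_def)
qed

lemma in_neg_homog: "(\<And>n. fps_nth F n \<in> homog (int n)) \<Longrightarrow> in_neg F n \<in> homog (- n)"
proof -
  assume "\<And>n. fps_nth F n \<in> homog (int n)"
  from this[of "nat (- n)"] show ?thesis by (cases "n \<le> 0") (simp_all add: in_neg_def)
qed

lemma smult_int_homog: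
  fixes F G :: "int series"
  assumes "\<And>m. F m \<in> homog (- m)" "\<And>m. G m \<in> homog (- m)"
  shows "(F \<star> G) m \<in> homog (- m)"
  unfolding smult_def
proof (rule homog_infsum)
  fix k
  show "F k * G (m - k) \<in> homog (- m)"
    using homog_mult[OF assms(1)[of k] assms(2)[of "m - k"]] by simp
qed

lemma X_ser_homog: "X_ser s n \<in> homog (- n)"
  using homog_letter[of "Xplus (- n)"] homog_letter[of "Xminus (- n)"]
  by (simp add: X_ser_def x_plus_def x_minus_def)

lemma Z_ser_split: "Z_ser s = in_pos (E_fps s) \<star> X_ser s \<star> in_neg (F_fps s)"
  unfolding E_ser_fps[symmetric] F_ser_fps[symmetric]
  by (cases s) (simp_all add: Z_ser_def Z_plus_def Z_minus_def E_ser_def F_ser_def X_ser_def)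

lemma Z_ser_homog: "Z_ser s n \<in> homog (- n)"
  unfolding Z_ser_split
  by (intro smult_int_homog in_pos_homog in_neg_homog E_fps_homog F_fps_homog X_ser_homog)

lemma const_ser_homog: "a \<in> homog 0 \<Longrightarrow> const_ser a n \<in> homog (- n)" for n :: int
  by (simp add: const_ser_def)

lemma psi_split:
  "psi_plus = const_ser (letter Psi0p) \<star> in_pos (psi_E True) \<star> in_neg (psi_F True)"
  "psi_minus = const_ser (letter Psi0m) \<star> in_pos (psi_E False) \<star> in_neg (psi_F False)"
  by (simp_all add: psi_plus_def psi_minus_def psi_E_def psi_F_def)

lemma homog_Psi [simp]: "letter Psi0p \<in> homog 0" "letter Psi0m \<in> homog 0"
  using homog_letter[of Psi0p] homog_letter[of Psi0m] by simp_all

lemma psi_homog: "psi_plus n \<in> homog (- n)" "psi_minus n \<in> homog (- n)"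
  unfolding psi_split
  by (intro smult_int_homog in_pos_homog in_neg_homog psi_E_homog psi_F_homog const_ser_homog homog_Psi)+

lemma graded_factors [simp]:
  "graded_factor (up (E_fps s) v)" "graded_factor (up (psi_E s) v)"
  "graded_factor (up (dil k (E_fps s)) v)" "graded_factor (up (dil k (psi_E s)) v)"
  "graded_factor (dn (F_fps s) v)" "graded_factor (dn (psi_F s) v)"
  "graded_factor (dn (dil k (F_fps s)) v)" "graded_factor (dn (dil k (psi_F s)) v)"
  "graded_factor (line (X_ser s) v)" "graded_factor (line (Z_ser s) v)"
  "graded_factor (line psi_plus v)"
  "graded_factor (ray (swap_fps q t a b) w z)" "graded_factor (ray (contract_fps q t a b) w z)"
  "graded_factor (ray (G_fps q t e) w z)"
  "graded_factor (con (letter Psi0p))" "graded_factor (con (letter Psi0m))" "graded_factor (con (const_C q t))"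
  by (auto intro!: graded_up graded_dn graded_line graded_ray graded_con E_fps_homog F_fps_homog psi_E_homog
      psi_F_homog dil_homog X_ser_homog Z_ser_homog psi_homog swap_fps_homog contract_fps_homog G_fps_homog
      simp: const_C_def)

lemma graded_dilate_psi [simp]: "graded_factor (line (dilate k psi_minus) v)"
  by (rule graded_line) (simp add: dilate_def homog_mult_0 psi_homog)

lemma graded_g [simp]:
  assumes "r \<in> {r_one, r_p, r_pstar, r_gam2}"
  shows "graded_factor (ray (g_fps q t r) w z)" "graded_factor (ray (g_fps q t (\<lambda>m. - r m)) w z)"
    "graded_factor (ray (dil k (g_fps q t r)) w z)"
  using assms by (auto intro!: graded_ray g_fps_homog dil_homog homog_uminus)

lemma ser_prod_rays:
  assumes "w \<noteq> z"
  shows "ser_prod (map (\<lambda>F. ray F w z) Fs) = at_ratio (in_pos (prod_list Fs)) w z"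
proof (induction Fs)
  case (Cons F Fs)
  then show ?case by (simp add: ray_def at_ratio_smult[OF assms, symmetric] smult_in_pos)
qed (simp add: at_ratio_one)

lemma ser_prod_ups: "ser_prod (map (\<lambda>F. up F v) Fs) = at_var (in_pos (prod_list Fs)) v"
proof (induction Fs)
  case (Cons F Fs)
  then show ?case by (simp add: up_def at_var_smult[symmetric] smult_in_pos)
qed (simp add: at_var_one)

lemma ser_prod_dns: "ser_prod (map (\<lambda>F. dn F v) Fs) = at_var (in_neg (prod_list Fs)) v"
proof (induction Fs)
  case (Cons F Fs)
  then show ?case by (simp add: dn_def at_var_smult[symmetric] smult_in_neg)
qed (simp add: at_var_one)

section \<open>Coefficients of products of a few factors in two variables\<close>

lemma ratio_shift:
  assumes "z \<noteq> w"
  shows "m - (vexp w n - vexp z n) = vexp z ((m - (vexp w n - vexp z n)) z) + vexp w ((m - (vexp w n - vexp z n)) w)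
    \<longleftrightarrow> m = vexp z (m z) + vexp w (m w)"
  using assms by (auto simp: fun_eq_iff vexp_apply)

lemma ratio_pair:
  assumes "z \<noteq> w"
  shows "(at_ratio S w z \<star> (at_var Y w \<star> at_var X z)) m =
      (if m = vexp z (m z) + vexp w (m w) then \<Sum>\<^sub>\<infinity>n. S n * (Y (m w - n) * X (m z + n)) else 0)"
    "(at_ratio S w z \<star> (at_var X z \<star> at_var Y w)) m =
      (if m = vexp z (m z) + vexp w (m w) then \<Sum>\<^sub>\<infinity>n. S n * (X (m z + n) * Y (m w - n)) else 0)"
proof -
  have e: "(m - (vexp w n - vexp z n)) w = m w - n" "(m - (vexp w n - vexp z n)) z = m z + n" for n
    using assms by (simp_all add: vexp_apply)
  have sh: "m - (vexp w n - vexp z n) = vexp z (m z + n) + vexp w (m w - n) \<longleftrightarrow>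
      m = vexp z (m z) + vexp w (m w)" for n
    using ratio_shift[OF assms, of m n] unfolding e .
  have sh': "m - (vexp w n - vexp z n) = vexp w (m w - n) + vexp z (m z + n) \<longleftrightarrow>
      m = vexp z (m z) + vexp w (m w)" for n
    using sh[of n] by (simp only: add.commute)
  show "(at_ratio S w z \<star> (at_var Y w \<star> at_var X z)) m =
      (if m = vexp z (m z) + vexp w (m w) then \<Sum>\<^sub>\<infinity>n. S n * (Y (m w - n) * X (m z + n)) else 0)"
    unfolding smult_at_ratio[OF assms[symmetric]] smult_at_var2[OF assms[symmetric]] e sh' by simp
  show "(at_ratio S w z \<star> (at_var X z \<star> at_var Y w)) m =
      (if m = vexp z (m z) + vexp w (m w) then \<Sum>\<^sub>\<infinity>n. S n * (X (m z + n) * Y (m w - n)) else 0)"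
    unfolding smult_at_ratio[OF assms[symmetric]] smult_at_var2[OF assms] e sh by simp
qed

lemma infsum_nat_range:
  assumes "\<And>n. n < 0 \<or> n > int N \<Longrightarrow> f n = (0 :: free_alg)"
  shows "infsum f UNIV = (\<Sum>i=0..N. f (int i))"
proof -
  have "infsum f UNIV = infsum f {0..int N}"
    by (rule infsum_cong_neutral) (use assms in auto)
  also have "\<dots> = sum f {0..int N}" by simp
  also have "\<dots> = (\<Sum>i=0..N. f (int i))"
    by (rule sum.reindex_bij_witness[of _ int nat]) auto
  finally show ?thesis .
qed

text \<open>Each monomial receives a single term. In all four products the series contributes its
  coefficient at the sum of the two exponents, which is how the delta function identifies the
  variables.\<close>

lemma diag_mult:
  assumes "z \<noteq> w"
  shows "(at_var X z \<star> at_ratio D z w) m = (if m = vexp z (m z) + vexp w (m w) then X (m z + m w) * D (- m w) else 0)"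
    "(at_var X w \<star> at_ratio D z w) m = (if m = vexp z (m z) + vexp w (m w) then X (m z + m w) * D (m z) else 0)"
    "(at_ratio D z w \<star> at_var X z) m = (if m = vexp z (m z) + vexp w (m w) then D (- m w) * X (m z + m w) else 0)"
    "(at_ratio D z w \<star> at_var X w) m = (if m = vexp z (m z) + vexp w (m w) then D (m z) * X (m z + m w) else 0)"
proof -
  note d = smult_at_var smult_at_ratio[OF assms]
  have D: "at_ratio D z w k = (if k = vexp z (k z) + vexp w (k w) \<and> k w = - k z then D (k z) else 0)" for k
  proof -
    have "k = vexp z (k z) - vexp w (k z) \<longleftrightarrow> k = vexp z (k z) + vexp w (k w) \<and> k w = - k z"
      using assms by (auto simp: fun_eq_iff vexp_apply)
    then show ?thesis by (simp add: at_ratio_def)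
  qed
  have V: "at_var X v k = (if k = vexp z (k z) + vexp w (k w) \<and> k (if v = z then w else z) = 0 then X (k v) else 0)"
    if "v = z \<or> v = w" for k v
  proof -
    have "k = vexp v (k v) \<longleftrightarrow> k = vexp z (k z) + vexp w (k w) \<and> k (if v = z then w else z) = 0"
      using assms that by (auto simp: fun_eq_iff vexp_apply)
    then show ?thesis by (simp add: at_var_def)
  qed
  have s: "m - vexp z n = vexp z (m z - n) + vexp w (m w) \<longleftrightarrow> m = vexp z (m z) + vexp w (m w)"
    "m - vexp w n = vexp z (m z) + vexp w (m w - n) \<longleftrightarrow> m = vexp z (m z) + vexp w (m w)"
    "m - (vexp z n - vexp w n) = vexp z (m z - n) + vexp w (m w + n) \<longleftrightarrow> m = vexp z (m z) + vexp w (m w)" for n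
    using assms by (auto simp: fun_eq_iff vexp_apply)
  have c: "(m - vexp z n) z = m z - n" "(m - vexp z n) w = m w" "(m - vexp w n) z = m z"
    "(m - vexp w n) w = m w - n" "(m - (vexp z n - vexp w n)) z = m z - n"
    "(m - (vexp z n - vexp w n)) w = m w + n" for n
    using assms by (simp_all add: vexp_apply)
  have Vz: "at_var X z k = (if k = vexp z (k z) + vexp w (k w) \<and> k w = 0 then X (k z) else 0)"
    and Vw: "at_var X w k = (if k = vexp z (k z) + vexp w (k w) \<and> k z = 0 then X (k w) else 0)" for k
    using V[of z k] V[of w k] assms by simp_all
  show "(at_var X z \<star> at_ratio D z w) m = (if m = vexp z (m z) + vexp w (m w) then X (m z + m w) * D (- m w) else 0)"
    unfolding d by (subst infsum_delta[of "m z + m w"]) (simp_all only: D c s, auto)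
  show "(at_var X w \<star> at_ratio D z w) m = (if m = vexp z (m z) + vexp w (m w) then X (m z + m w) * D (m z) else 0)"
    unfolding d by (subst infsum_delta[of "m z + m w"]) (simp_all only: D c s, auto)
  show "(at_ratio D z w \<star> at_var X z) m = (if m = vexp z (m z) + vexp w (m w) then D (- m w) * X (m z + m w) else 0)"
    unfolding d by (subst infsum_delta[of "- m w"]) (simp_all only: Vz c s, auto)
  show "(at_ratio D z w \<star> at_var X w) m = (if m = vexp z (m z) + vexp w (m w) then D (m z) * X (m z + m w) else 0)"
    unfolding d by (subst infsum_delta[of "m z"]) (simp_all only: Vw c s, auto simp: add.commute)
qed

context ell_quotient
begin

section \<open>Rewriting lists of factors modulo the ideal\<close>

lemma cong_prodI: "(\<And>m. \<pi> (ser_prod As m) = \<pi> (ser_prod Bs m)) \<Longrightarrow> cong_prod I As Bs"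
  unfolding cong_prod_def pi_eq_iff[symmetric] by blast

lemma cong_prodD: "cong_prod I As Bs \<Longrightarrow> \<pi> (ser_prod As m) = \<pi> (ser_prod Bs m)"
  unfolding cong_prod_def pi_eq_iff[symmetric] by blast

lemma cong_trans [trans]: "cong_prod I As Bs \<Longrightarrow> cong_prod I Bs Cs \<Longrightarrow> cong_prod I As Cs"
  by (rule cong_prodI) (metis cong_prodD)

lemma cong_sym: "cong_prod I As Bs \<Longrightarrow> cong_prod I Bs As"
  by (rule cong_prodI) (metis cong_prodD)

text \<open>The basic rewriting rule: \<open>L\<close> sits in \<open>M\<close> at position
  \<open>n\<close> and is replaced by \<open>L'\<close>. With explicit lists all side conditions are
  computable.\<close>

lemma cong_step:
  assumes "cong_prod I L L'" "take (length L) (drop n M) = L" "M' = take n M @ L' @ drop (n + length L) M"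
    "convergent_list M" "convergent_list M'"
  shows "cong_prod I M M'"
proof -
  have "M = take n M @ drop n M" by simp
  also have "drop n M = take (length L) (drop n M) @ drop (length L) (drop n M)"
    by (rule append_take_drop_id[symmetric])
  finally have M: "M = take n M @ L @ drop (n + length L) M"
    using assms(2) by (simp add: add.commute)
  from assms(4) have "convergent_list (take n M @ L @ drop (n + length L) M)" using M by argo
  with cong_prod_context[OF ideal closed_I this, of L'] assms(1,3,5) M show ?thesis by argo
qed

text \<open>The termwise differences lie in \<open>I\<close>, and a closed ideal contains their
  infinite sum.\<close>

lemma infsum_cong_pi:
  fixes f g :: "'i \<Rightarrow> free_alg"
  assumes "null_family f A" "null_family g A" "\<And>i. i \<in> A \<Longrightarrow> \<pi> (f i) = \<pi> (g i)"
  shows "\<pi> (infsum f A) = \<pi> (infsum g A)"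
proof -
  have "null_family (\<lambda>i. - 1 * g i) A" by (rule null_family_left_mult[OF assms(2)])
  from infsum_add_null[OF assms(1) this] infsum_left_mult[OF assms(2), of "- 1"]
  have "infsum f A - infsum g A = (\<Sum>\<^sub>\<infinity>i\<in>A. f i + - 1 * g i)" by simp
  also have "\<dots> \<in> I"
    by (rule infsum_in_closed[OF closed_I])
       (use assms(3) in \<open>simp_all add: ideal_simps[OF ideal] pi_eq_iff\<close>)
  finally show ?thesis by (simp add: pi_eq_iff)
qed

text \<open>Reflecting the summation index, \<open>k\<close> to \<open>m - k\<close>, exchanges the
  roles of the two factors.\<close>

lemma ser_prod_commute:
  assumes "convergent_list (As @ Bs)" "convergent_list (Bs @ As)"
    and comm: "\<And>k l. \<pi> (ser_prod As k) * \<pi> (ser_prod Bs l) = \<pi> (ser_prod Bs l) * \<pi> (ser_prod As k)"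
  shows "cong_prod I (As @ Bs) (Bs @ As)"
proof (rule cong_prodI)
  fix m :: "var \<Rightarrow> int"
  have bij: "bij_betw (\<lambda>k. m - k) UNIV UNIV"
    by (rule bij_betw_byWitness[of _ "\<lambda>k. m - k"]) auto
  have null: "null_family (\<lambda>k. ser_prod Bs (m - k) * ser_prod As (m - (m - k))) UNIV"
    by (rule null_family_reindex[OF ser_prod_null2[OF assms(2)]]) (auto simp: inj_on_def)
  have "\<pi> (ser_prod (As @ Bs) m) = \<pi> (\<Sum>\<^sub>\<infinity>k. ser_prod As k * ser_prod Bs (m - k))"
    by (simp add: ser_prod_append[OF assms(1)] smult_def)
  also have "\<dots> = \<pi> (\<Sum>\<^sub>\<infinity>k. ser_prod Bs (m - k) * ser_prod As (m - (m - k)))"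
    by (rule infsum_cong_pi[OF ser_prod_null2[OF assms(1)] null]) (simp add: pi_mult comm)
  also have "(\<Sum>\<^sub>\<infinity>k. ser_prod Bs (m - k) * ser_prod As (m - (m - k))) =
      (\<Sum>\<^sub>\<infinity>k. ser_prod Bs k * ser_prod As (m - k))"
    by (rule infsum_reindex_bij_betw[OF bij])
  also have "\<dots> = ser_prod (Bs @ As) m"
    by (simp add: ser_prod_append[OF assms(2)] smult_def)
  finally show "\<pi> (ser_prod (As @ Bs) m) = \<pi> (ser_prod (Bs @ As) m)" .
qed

definition central_factor :: "factor \<Rightarrow> bool" where
  "central_factor A \<longleftrightarrow> (\<forall>k. central (snd A k))"

lemma move_left:
  assumes "central_factor (M ! k)" "n \<le> k" "k < length M" "convergent_list M" "convergent_list M'"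
    and M': "M' = take n M @ M ! k # drop n (take k M) @ drop (Suc k) M"
  shows "cong_prod I M M'"
proof -
  let ?L = "drop n (take k M)"
  have M: "M = take n M @ (?L @ [M ! k]) @ drop (Suc k) M"
  proof -
    have "take n M @ ?L = take k M"
      using assms(2) by (metis append_take_drop_id min.absorb1 take_take)
    then have "take n M @ (?L @ [M ! k]) @ drop (Suc k) M = take k M @ M ! k # drop (Suc k) M" by simp
    then show ?thesis using assms(3) by (simp add: id_take_nth_drop[symmetric])
  qed
  have M2: "M' = take n M @ ([M ! k] @ ?L) @ drop (Suc k) M" using M' by simp
  have c1: "convergent_list (take n M @ (?L @ [M ! k]) @ drop (Suc k) M)" using assms(4) M by argo
  have c2: "convergent_list (take n M @ ([M ! k] @ ?L) @ drop (Suc k) M)" using assms(5) M2 by argo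
  have "cong_prod I (?L @ [M ! k]) ([M ! k] @ ?L)"
  proof (rule ser_prod_commute)
    show "convergent_list (?L @ [M ! k])" "convergent_list ([M ! k] @ ?L)"
      using convergent_list_append[OF c1] convergent_list_append[OF c2] convergent_list_append by blast+
    show "\<pi> (ser_prod ?L i) * \<pi> (ser_prod [M ! k] l) = \<pi> (ser_prod [M ! k] l) * \<pi> (ser_prod ?L i)" for i l
      using assms(1) centralD[of "snd (M ! k) l"] by (simp add: central_factor_def)
  qed
  from cong_prod_context[OF ideal closed_I c1 c2 this] show ?thesis using M M2 by argo
qed

lemma swap_adjacent:
  assumes "\<And>i j. \<pi> (snd A i) * \<pi> (snd B j) = \<pi> (snd B j) * \<pi> (snd A i)"
    "convergent_list [A, B]" "convergent_list [B, A]"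
  shows "cong_prod I [A, B] [B, A]"
  using ser_prod_commute[of "[A]" "[B]"] assms by simp

section \<open>Central series and commuting half vertex operators\<close>

definition central_fps :: "free_alg fps \<Rightarrow> bool" where
  "central_fps F \<longleftrightarrow> (\<forall>n. central (fps_nth F n))"

lemma central_0: "central 0" and central_1: "central 1"
  by (simp_all add: central_def pi_0 pi_1)

lemma central_add: "central a \<Longrightarrow> central b \<Longrightarrow> central (a + b)"
  and central_diff: "central a \<Longrightarrow> central b \<Longrightarrow> central (a - b)"
  by (simp_all add: central_def pi_add pi_diff distrib_left distrib_right left_diff_distrib right_diff_distrib)

lemma central_uminus: "central a \<Longrightarrow> central (- a)"
  using central_diff[OF central_0] by fastforce

lemma central_mult: "central a \<Longrightarrow> central b \<Longrightarrow> central (a * b)"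
  unfolding central_def pi_mult by (metis mult.assoc)

lemma central_fps_uexp:
  assumes "pi_fps F = uexp f" "\<And>n x. n > 0 \<Longrightarrow> f n * x = x * f n"
  shows "central_fps F"
proof -
  have "\<pi> (fps_nth F n) * x = x * \<pi> (fps_nth F n)" for n x
    using uexp_commute[of x f n] assms by (metis pi_fps_nth)
  then show ?thesis by (simp add: central_fps_def central_def)
qed

lemma central_fps_center:
  "pi_fps F = uexp (\<lambda>n. from_center (f n)) \<Longrightarrow> central_fps F"
  by (rule central_fps_uexp) (auto intro: center_commute)

lemma central_fps_mult: "central_fps F \<Longrightarrow> central_fps G \<Longrightarrow> central_fps (F * G)"
proof -
  assume FG: "central_fps F" "central_fps G"
  have "central (sum f A)" if "\<And>i. central (f i)" for f and A :: "nat set"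
    by (induction A rule: infinite_finite_induct) (auto intro: central_0 central_add that)
  then show ?thesis using FG by (simp add: central_fps_def fps_mult_nth central_mult)
qed

lemma central_fps_linear: "central_fps (1 - fps_const (cc a) * fps_X)"
  by (auto simp: central_fps_def fps_X_def intro!: central_diff central_uminus central_0 central_1 central_mult central_cc)

lemma central_fps_simps [simp]:
  "central_fps (swap_fps q t a b)" "central_fps (contract_fps q t a b)"
  "central_fps (g_fps q t r_one)" "central_fps (g_fps q t r_pstar)" "central_fps (g_fps q t r_gam2)"
  "central_fps (g_fps q t (\<lambda>m. - r_one m))" "central_fps (g_fps q t (\<lambda>m. - r_p m))"
  "central_fps (g_fps q t (\<lambda>m. - r_gam2 m))" "central_fps (G_fps q t e)"
proof -
  show "central_fps (swap_fps q t a b)" by (rule central_fps_center[OF pi_swap_center])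
  show "central_fps (contract_fps q t a b)"
    by (rule central_fps_uexp[OF pi_contract]) (simp add: central_contract)
  show "central_fps (G_fps q t e)"
    unfolding G_fps_def by (intro central_fps_mult central_fps_linear)
  show "central_fps (g_fps q t r_gam2)"
    by (rule central_fps_center[OF pi_g_fps]) (rule pi_r)
qed (rule central_fps_center, rule pi_g)+

lemma central_ray [simp]: "central_fps F \<Longrightarrow> central_factor (ray F w z)"
  by (auto simp: central_factor_def ray_def at_ratio_def in_pos_def central_fps_def intro: central_0)

lemma central_diag [simp]: "central_factor (diag k z w)"
  by (auto simp: central_factor_def diag_def at_ratio_def dilate_def delta_def intro: central_0 central_gam)

lemma central_mono [simp]: "central_factor (box n (mono_ser e))"
  by (auto simp: central_factor_def box_def mono_ser_def intro: central_0 central_1)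

lemma central_bracket [simp]: "central_factor (box n (bracket z w u))"
proof -
  have "central (mono_ser e m)" for e m
    by (simp add: mono_ser_def central_0 central_1)
  then show ?thesis
    by (auto simp: central_factor_def box_def bracket_def intro!: central_add central_diff)
qed

lemma central_con [simp]:
  "central_factor (con (letter Psi0p))" "central_factor (con (letter Psi0m))" "central_factor (con (const_C q' t'))"
  by (auto simp: central_factor_def con_def const_ser_def const_C_def
      intro: central_0 central_letters central_cc)

text \<open>The logarithm is a central combination of negative modes. These commute among
  themselves, so any two such series commute.\<close>

definition minus_fps :: "free_alg fps \<Rightarrow> bool" where
  "minus_fps F \<longleftrightarrow> (\<exists>f. pi_fps F = uexp (\<lambda>n. from_center (f n) * am n))"

definition plus_fps :: "free_alg fps \<Rightarrow> bool" where
  "plus_fps F \<longleftrightarrow> (\<exists>f. pi_fps F = uexp (\<lambda>n. from_center (f n) * ap n))"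

lemma minus_fpsI:
  assumes "\<And>n. n > 0 \<Longrightarrow> \<pi> (a n) = from_center (f n) * am n"
  shows "minus_fps (exp_sum a)" "minus_fps (dil k (exp_sum a))"
proof -
  have "pi_fps (exp_sum a) = uexp (\<lambda>n. from_center (f n) * am n)"
    unfolding pi_exp_sum by (rule uexp_cong) (rule assms)
  then show "minus_fps (exp_sum a)" unfolding minus_fps_def by blast
  have "pi_fps (dil k (exp_sum a)) = uexp (\<lambda>n. from_center (cen (gam (k * int n)) * f n) * am n)"
    by (rule dil_am[OF assms]) (simp_all add: from_cen central_gam)
  then show "minus_fps (dil k (exp_sum a))"
    unfolding minus_fps_def by (rule exI[of _ "\<lambda>n. cen (gam (k * int n)) * f n"])
qed

lemma plus_fpsI:
  assumes "\<And>n. n > 0 \<Longrightarrow> \<pi> (a n) = from_center (f n) * ap n"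
  shows "plus_fps (exp_sum a)" "plus_fps (dil k (exp_sum a))"
proof -
  have "pi_fps (exp_sum a) = uexp (\<lambda>n. from_center (f n) * ap n)"
    unfolding pi_exp_sum by (rule uexp_cong) (rule assms)
  then show "plus_fps (exp_sum a)" unfolding plus_fps_def by blast
  have "pi_fps (dil k (exp_sum a)) = uexp (\<lambda>n. from_center (cen (gam (k * int n)) * f n) * ap n)"
    by (rule dil_ap[OF assms]) (simp_all add: from_cen central_gam)
  then show "plus_fps (dil k (exp_sum a))"
    unfolding plus_fps_def by (rule exI[of _ "\<lambda>n. cen (gam (k * int n)) * f n"])
qed

lemma minus_fps_simps [simp]:
  "minus_fps (E_fps s)" "minus_fps (dil k (E_fps s))" "minus_fps (psi_E s)" "minus_fps (dil k (psi_E s))"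
proof -
  show "minus_fps (E_fps s)" "minus_fps (dil k (E_fps s))"
    unfolding E_fps_def by (rule minus_fpsI, erule E_log)+
  show "minus_fps (psi_E s)" "minus_fps (dil k (psi_E s))"
    by (cases s; simp only: psi_E_def if_True if_False; rule minus_fpsI, erule psi_E_log)+
qed

lemma plus_fps_simps [simp]:
  "plus_fps (F_fps s)" "plus_fps (dil k (F_fps s))" "plus_fps (psi_F s)" "plus_fps (dil k (psi_F s))"
proof -
  show "plus_fps (F_fps s)" "plus_fps (dil k (F_fps s))"
    unfolding F_fps_def by (rule plus_fpsI, erule F_log)+
  show "plus_fps (psi_F s)" "plus_fps (dil k (psi_F s))"
    by (cases s; simp only: psi_F_def if_True if_False; rule plus_fpsI, erule psi_E_log)+
qed

lemma uexp_commute2: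
  assumes "\<And>m n. m > 0 \<Longrightarrow> n > 0 \<Longrightarrow> a m * b n = b n * a m"
  shows "fps_nth (uexp a) i * fps_nth (uexp b) j = fps_nth (uexp b) j * fps_nth (uexp a) i"
proof (rule uexp_commute)
  fix n :: nat assume n: "n > 0"
  have "b n * fps_nth (uexp a) i = fps_nth (uexp a) i * b n"
    by (rule uexp_commute) (use assms n in metis)
  then show "fps_nth (uexp a) i * b n = b n * fps_nth (uexp a) i" by simp
qed

lemma up_commute:
  assumes "minus_fps F" "minus_fps G" "convergent_list [up F v, up G w]" "convergent_list [up G w, up F v]"
  shows "cong_prod I [up F v, up G w] [up G w, up F v]"
proof (rule swap_adjacent)
  obtain f g where fg: "pi_fps F = uexp (\<lambda>n. from_center (f n) * am n)"
    "pi_fps G = uexp (\<lambda>n. from_center (g n) * am n)" using assms(1,2) unfolding minus_fps_def by blast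
  have "\<pi> (fps_nth F i) * \<pi> (fps_nth G j) = \<pi> (fps_nth G j) * \<pi> (fps_nth F i)" for i j
    unfolding pi_fps_nth[symmetric] fg
    by (rule uexp_commute2) (rule commuting_center[of am, OF am_commute])
  then show "\<pi> (snd (up F v) i) * \<pi> (snd (up G w) j) = \<pi> (snd (up G w) j) * \<pi> (snd (up F v) i)" for i j
    by (simp add: up_def at_var_def in_pos_def pi_0)
qed (use assms in auto)

lemma dn_commute:
  assumes "plus_fps F" "plus_fps G" "convergent_list [dn F v, dn G w]" "convergent_list [dn G w, dn F v]"
  shows "cong_prod I [dn F v, dn G w] [dn G w, dn F v]"
proof (rule swap_adjacent)
  obtain f g where fg: "pi_fps F = uexp (\<lambda>n. from_center (f n) * ap n)"
    "pi_fps G = uexp (\<lambda>n. from_center (g n) * ap n)" using assms(1,2) unfolding plus_fps_def by blast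
  have "\<pi> (fps_nth F i) * \<pi> (fps_nth G j) = \<pi> (fps_nth G j) * \<pi> (fps_nth F i)" for i j
    unfolding pi_fps_nth[symmetric] fg
    by (rule uexp_commute2) (rule commuting_center[of ap, OF ap_commute])
  then show "\<pi> (snd (dn F v) i) * \<pi> (snd (dn G w) j) = \<pi> (snd (dn G w) j) * \<pi> (snd (dn F v) i)" for i j
    by (simp add: dn_def at_var_def in_neg_def pi_0)
qed (use assms in auto)

lemma rays_cong:
  assumes "w \<noteq> z" "pi_fps (prod_list Fs) = pi_fps (prod_list Gs)"
  shows "cong_prod I (map (\<lambda>F. ray F w z) Fs) (map (\<lambda>F. ray F w z) Gs)"
proof (rule cong_prodI)
  fix m
  have "\<pi> (fps_nth (prod_list Fs) n) = \<pi> (fps_nth (prod_list Gs) n)" for n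
    using assms(2) by (metis pi_fps_nth)
  then show "\<pi> (ser_prod (map (\<lambda>F. ray F w z) Fs) m) = \<pi> (ser_prod (map (\<lambda>F. ray F w z) Gs) m)"
    unfolding ser_prod_rays[OF assms(1)] by (simp add: at_ratio_def in_pos_def)
qed

lemma ups_cong:
  assumes "pi_fps (prod_list Fs) = pi_fps 1"
  shows "cong_prod I (map (\<lambda>F. up F v) Fs) []"
proof (rule cong_prodI)
  fix m
  have "\<pi> (fps_nth (prod_list Fs) n) = \<pi> (fps_nth 1 n)" for n
    using assms by (metis pi_fps_nth)
  moreover have "ser_prod [] = at_var (in_pos 1) v" by (simp add: at_var_one)
  ultimately show "\<pi> (ser_prod (map (\<lambda>F. up F v) Fs) m) = \<pi> (ser_prod [] m)"
    unfolding ser_prod_ups by (simp add: at_var_def in_pos_def del: fps_one_nth)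
qed

lemma dns_cong:
  assumes "pi_fps (prod_list Fs) = pi_fps 1"
  shows "cong_prod I (map (\<lambda>F. dn F v) Fs) []"
proof (rule cong_prodI)
  fix m
  have "\<pi> (fps_nth (prod_list Fs) n) = \<pi> (fps_nth 1 n)" for n
    using assms by (metis pi_fps_nth)
  moreover have "ser_prod [] = at_var (in_neg 1) v" by (simp add: at_var_one)
  ultimately show "\<pi> (ser_prod (map (\<lambda>F. dn F v) Fs) m) = \<pi> (ser_prod [] m)"
    unfolding ser_prod_dns by (simp add: at_var_def in_neg_def del: fps_one_nth)
qed

text \<open>For a fixed monomial only finitely many exponents of the ray contribute, and the
  resulting finite sum is the one in \<open>x_E\<close>.\<close>

lemma x_up:
  assumes zw: "z \<noteq> w"
  shows "cong_prod I [line (X_ser a) z, up (E_fps b) w]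
    [ray (swap_fps q t a b) w z, up (E_fps b) w, line (X_ser a) z]"
proof (rule cong_prodI)
  fix m
  let ?S = "in_pos (swap_fps q t a b)" and ?E = "in_pos (E_fps b)" and ?X = "X_ser a"
  have "(\<Sum>\<^sub>\<infinity>n. ?S n * (?E (m w - n) * ?X (m z + n))) =
      (\<Sum>i=0..nat (m w). ?S (int i) * (?E (m w - int i) * ?X (m z + int i)))"
    by (rule infsum_nat_range) (auto simp: in_pos_def)
  moreover have "\<pi> (?X (m z) * ?E (m w)) =
      \<pi> (\<Sum>i=0..nat (m w). ?S (int i) * (?E (m w - int i) * ?X (m z + int i)))"
  proof (cases "m w \<ge> 0")
    case True
    then show ?thesis
      by (auto simp: pi_mult pi_sum in_pos_def x_E mult.assoc nat_diff_distrib intro!: sum.cong)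
  qed (simp add: in_pos_def)
  ultimately show "\<pi> (ser_prod [line ?X z, up (E_fps b) w] m) =
      \<pi> (ser_prod [ray (swap_fps q t a b) w z, up (E_fps b) w, line ?X z] m)"
    by (simp add: factor_defs ratio_pair[OF zw] smult_at_var2[OF zw])
qed

lemma x_dn:
  assumes zw: "z \<noteq> w"
  shows "cong_prod I [line (X_ser b) w, dn (F_fps a) z]
    [ray (contract_fps q t a b) w z, dn (F_fps a) z, line (X_ser b) w]"
proof (rule cong_prodI)
  fix m
  let ?S = "in_pos (contract_fps q t a b)" and ?F = "in_neg (F_fps a)" and ?X = "X_ser b"
  have "(\<Sum>\<^sub>\<infinity>n. ?S n * (?F (m z + n) * ?X (m w - n))) =
      (\<Sum>i=0..nat (- m z). ?S (int i) * (?F (m z + int i) * ?X (m w - int i)))"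
    by (rule infsum_nat_range) (auto simp: in_pos_def in_neg_def)
  moreover have "\<pi> (?X (m w) * ?F (m z)) =
      \<pi> (\<Sum>i=0..nat (- m z). ?S (int i) * (?F (m z + int i) * ?X (m w - int i)))"
  proof (cases "m z \<le> 0")
    case True
    have "nat (- m z - int i) = nat (- m z) - i" for i by simp
    with True show ?thesis
      by (auto simp: pi_mult pi_sum in_pos_def in_neg_def x_F mult.assoc intro!: sum.cong)
  qed (simp add: in_neg_def)
  moreover have "m = vexp w (m w) + vexp z (m z) \<longleftrightarrow> m = vexp z (m z) + vexp w (m w)"
    by (simp only: add.commute)
  ultimately show "\<pi> (ser_prod [line ?X w, dn (F_fps a) z] m) =
      \<pi> (ser_prod [ray (contract_fps q t a b) w z, dn (F_fps a) z, line ?X w] m)"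
    by (simp add: factor_defs ratio_pair[OF zw] smult_at_var2[OF zw[symmetric]])
qed

lemma dn_up:
  assumes zw: "z \<noteq> w"
  shows "cong_prod I [dn (F_fps a) z, up (E_fps b) w]
    [ray (contract_fps q t a b) w z, up (E_fps b) w, dn (F_fps a) z]"
proof (rule cong_prodI)
  fix m
  let ?S = "in_pos (contract_fps q t a b)" and ?F = "in_neg (F_fps a)" and ?E = "in_pos (E_fps b)"
  have "(\<Sum>\<^sub>\<infinity>n. ?S n * (?E (m w - n) * ?F (m z + n))) =
      (\<Sum>i=0..nat (m w). ?S (int i) * (?E (m w - int i) * ?F (m z + int i)))"
    by (rule infsum_nat_range) (auto simp: in_pos_def)
  moreover have "\<pi> (?F (m z) * ?E (m w)) =
      \<pi> (\<Sum>i=0..nat (m w). ?S (int i) * (?E (m w - int i) * ?F (m z + int i)))"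
  proof (cases "m w \<ge> 0")
    case w: True
    have F: "\<pi> (?F (m z + int i)) = (if i \<le> nat (- m z) then \<pi> (fps_nth (F_fps a) (nat (- m z) - i)) else 0)"
      if "m z \<le> 0" for i
    proof -
      have "nat (- m z - int i) = nat (- m z) - i" by simp
      then show ?thesis using that by (auto simp: in_neg_def pi_0)
    qed
    show ?thesis
    proof (cases "m z \<le> 0")
      case True
      have "\<pi> (?F (m z) * ?E (m w)) = \<pi> (fps_nth (F_fps a) (nat (- m z))) * \<pi> (fps_nth (E_fps b) (nat (m w)))"
        using True w by (simp add: pi_mult in_neg_def in_pos_def)
      also have "\<dots> = (\<Sum>i=0..nat (m w). \<pi> (?S (int i)) * (\<pi> (?E (m w - int i)) * \<pi> (?F (m z + int i))))"
        unfolding F_E F[OF True] using w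
        by (auto simp: in_pos_def mult.assoc nat_diff_distrib intro!: sum.cong)
      finally show ?thesis by (simp only: pi_mult pi_sum)
    next
      case False
      then show ?thesis by (simp add: in_neg_def)
    qed
  qed (simp add: in_pos_def)
  ultimately show "\<pi> (ser_prod [dn (F_fps a) z, up (E_fps b) w] m) =
      \<pi> (ser_prod [ray (contract_fps q t a b) w z, up (E_fps b) w, dn (F_fps a) z] m)"
    by (simp add: factor_defs ratio_pair[OF zw] smult_at_var2[OF zw])
qed

text \<open>The contraction factors produced by $E^-(w)$ and by $x(w)$ are inverse to each other.\<close>

lemma dn_up_x:
  assumes zw: "z \<noteq> w"
  shows "cong_prod I [dn (F_fps a) z, up (E_fps b) w, line (X_ser b) w]
    [up (E_fps b) w, line (X_ser b) w, dn (F_fps a) z]"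
proof -
  note n = zw zw[symmetric]
  have "cong_prod I [dn (F_fps a) z, up (E_fps b) w, line (X_ser b) w]
      [ray (contract_fps q t a b) w z, up (E_fps b) w, dn (F_fps a) z, line (X_ser b) w]"
    by (rule cong_step[OF dn_up[OF zw], where n = 0]) (simp_all add: n)
  \<comment> \<open>The same product is reached from the target: moving E^+ to the left through x
    creates the same ray as moving it to the right through E^-.\<close>
  moreover have 2: "cong_prod I [up (E_fps b) w, line (X_ser b) w, dn (F_fps a) z]
      [up (E_fps b) w, ray (contract_fps q t a b) w z, dn (F_fps a) z, line (X_ser b) w]"
    by (rule cong_step[OF x_dn[OF zw], where n = 1]) (simp_all add: n)
  moreover have 3: "cong_prod I
      [up (E_fps b) w, ray (contract_fps q t a b) w z, dn (F_fps a) z, line (X_ser b) w]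
      [ray (contract_fps q t a b) w z, up (E_fps b) w, dn (F_fps a) z, line (X_ser b) w]"
    by (rule move_left[where k = 1 and n = 0]) (simp_all add: n)
  ultimately show ?thesis using cong_trans[OF _ cong_sym[OF cong_trans[OF 2 3]]] by blast
qed

lemma Z_expand: "cong_prod I [line (Z_ser s) v] [up (E_fps s) v, line (X_ser s) v, dn (F_fps s) v]"
proof (rule cong_prodI)
  fix m
  have "ser_prod [line (Z_ser s) v] = foldl (\<star>) (mono_ser 0)
      (map snd [up (E_fps s) v, line (X_ser s) v, dn (F_fps s) v])"
    by (simp add: factor_defs Z_ser_split at_var_smult)
  also have "\<dots> = ser_prod [up (E_fps s) v, line (X_ser s) v, dn (F_fps s) v]"
    by (rule ser_prod_foldl[symmetric]) simp
  finally show "\<pi> (ser_prod [line (Z_ser s) v] m) =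
      \<pi> (ser_prod [up (E_fps s) v, line (X_ser s) v, dn (F_fps s) v] m)" by simp
qed

lemma Z_pair:
  assumes zw: "z \<noteq> w"
  shows "cong_prod I [line (Z_ser a) z, line (Z_ser b) w]
    [ray (swap_fps q t a b) w z, up (E_fps a) z, up (E_fps b) w, line (X_ser a) z, line (X_ser b) w,
     dn (F_fps a) z, dn (F_fps b) w]"
proof -
  note n = zw zw[symmetric]
  have "cong_prod I [line (Z_ser a) z, line (Z_ser b) w]
    [up (E_fps a) z, line (X_ser a) z, dn (F_fps a) z, line (Z_ser b) w]"
    by (rule cong_step[OF Z_expand, where n = 0]) (simp_all add: n)
  also have "cong_prod I \<dots>
    [up (E_fps a) z, line (X_ser a) z, dn (F_fps a) z, up (E_fps b) w, line (X_ser b) w, dn (F_fps b) w]"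
    by (rule cong_step[OF Z_expand, where n = 3]) (simp_all add: n)
  also have "cong_prod I \<dots>
    [up (E_fps a) z, line (X_ser a) z, up (E_fps b) w, line (X_ser b) w, dn (F_fps a) z, dn (F_fps b) w]"
    by (rule cong_step[OF dn_up_x[OF zw], where n = 2]) (simp_all add: n)
  also have "cong_prod I \<dots>
    [up (E_fps a) z, ray (swap_fps q t a b) w z, up (E_fps b) w, line (X_ser a) z, line (X_ser b) w,
     dn (F_fps a) z, dn (F_fps b) w]"
    by (rule cong_step[OF x_up[OF zw], where n = 1]) (simp_all add: n)
  also have "cong_prod I \<dots>
    [ray (swap_fps q t a b) w z, up (E_fps a) z, up (E_fps b) w, line (X_ser a) z, line (X_ser b) w,
     dn (F_fps a) z, dn (F_fps b) w]"
    by (rule move_left[where k = 1 and n = 0]) (simp_all add: n)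
  finally show ?thesis .
qed

end

section \<open>The relations between the currents\<close>

text \<open>The conclusion with the ideal as a parameter, so that it can also be stated for an ideal
  obtained by choice.\<close>

definition Z_relations :: "complex \<Rightarrow> complex \<Rightarrow> free_alg set \<Rightarrow> bool" where
  "Z_relations q t I \<longleftrightarrow>
    (\<forall>Z\<in>{Z_plus, Z_minus}.
        mono_ser (vexp Zv 3) \<star> at_ratio (Gpol q t (- 1)) Wv Zv
          \<star> at_ratio (gser_inv q t r_gam2) Wv Zv \<star> at_var Z Zv \<star> at_var Z Wv
        \<approx>\<^bsub>I\<^esub>
        - (mono_ser (vexp Wv 3) \<star> at_ratio (Gpol q t (- 1)) Zv Wv
          \<star> at_ratio (gser_inv q t r_gam2) Zv Wv \<star> at_var Z Wv \<star> at_var Z Zv))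
     \<and>
     at_ratio (dilate 2 (gser q t r_one)) Wv Zv \<star> at_ratio (dilate 2 (gser q t r_gam2)) Wv Zv
         \<star> at_var Z_plus Zv \<star> at_var Z_minus Wv
       - at_ratio (dilate 2 (gser q t r_one)) Zv Wv \<star> at_ratio (dilate 2 (gser q t r_gam2)) Zv Wv
         \<star> at_var Z_minus Wv \<star> at_var Z_plus Zv
       \<approx>\<^bsub>I\<^esub>
       const_ser (const_C q t) \<star>
         (at_ratio (dilate (- 2) delta) Zv Wv \<star> const_ser (letter Psi0p)
          - at_ratio (dilate 2 delta) Zv Wv \<star> const_ser (letter Psi0m))
     \<and>
     perm_sum (\<lambda>z w u.
         at_ratio (gser_inv q t r_one) w z \<star> at_ratio (gser_inv q t r_one) u w
         \<star> at_ratio (gser_inv q t r_one) u z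
         \<star> at_ratio (gser_inv q t r_gam2) w z \<star> at_ratio (gser_inv q t r_gam2) u w
         \<star> at_ratio (gser_inv q t r_gam2) u z \<star> bracket z w u
         \<star> at_var Z_plus z \<star> at_var Z_plus w \<star> at_var Z_plus u)
       \<approx>\<^bsub>I\<^esub> 0
     \<and>
     perm_sum (\<lambda>z w u.
         at_ratio (gser_inv q t r_gam2) w z \<star> at_ratio (gser_inv q t r_gam2) u w
         \<star> at_ratio (gser_inv q t r_gam2) u z \<star> bracket z w u
         \<star> at_var Z_minus z \<star> at_var Z_minus w \<star> at_var Z_minus u)
       \<approx>\<^bsub>I\<^esub> 0"

text \<open>The leading monomials z^3 and w^3 have nonzero degree and cannot be graded factors with
  a \<open>Box\<close> support; they are split off here.\<close>

lemma foldl_mono: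
  fixes e :: "var \<Rightarrow> int"
  assumes "convergent_list As"
  shows "foldl (\<star>) (mono_ser e) (map snd As) = mono_ser e \<star> ser_prod As"
proof -
  have "foldl (\<star>) (mono_ser e) Fs = mono_ser e \<star> foldl (\<star>) (mono_ser 0) Fs" for Fs
  proof (induction Fs rule: rev_induct)
    case Nil
    show ?case by (simp only: foldl.simps smult_mono_0)
  next
    case (snoc F Fs)
    then show ?case by (simp only: foldl_append foldl.simps smult_mono_assoc)
  qed
  then show ?thesis by (simp add: ser_prod_foldl[OF assms])
qed

lemma sum_apply: "(sum f A) x = (\<Sum>i\<in>A. f i x)"
  by (induction A rule: infinite_finite_induct) auto

text \<open>The left factor bounds \<open>i\<close> from below; the degree \<open>i - n\<close> of
  the right factor bounds it from above modulo \<open>deep N\<close>.\<close>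

lemma null_family_int:
  fixes X Y :: "int series"
  assumes "\<And>i. i < 0 \<Longrightarrow> X i = 0" "\<And>m. Y m \<in> homog (- m)"
  shows "null_family (\<lambda>i. X i * Y (n - i)) UNIV"
proof (rule null_family_deepI)
  fix N
  have "0 \<le> i \<and> i \<le> N + n" if "X i * Y (n - i) \<notin> deep N" for i
  proof -
    have "Y (n - i) \<in> deep (i - n)" using homog_deep[OF assms(2)[of "n - i"]] by simp
    then have "X i * Y (n - i) \<in> deep N" if "N \<le> i - n"
      using deep_mono[OF _ that] deep_left_mult by blast
    then have "i - n < N" using that by force
    moreover have "0 \<le> i" using that assms(1)[of i] by (cases "i < 0") auto
    ultimately show ?thesis by simp
  qed
  then show "finite {i \<in> UNIV. X i * Y (n - i) \<notin> deep N}"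
    by (auto intro: finite_subset[of _ "{0..N + n}"])
qed

context ell_quotient
begin

text \<open>The E^+ factors pass to the right freely by \<open>dn_up_x\<close>; each exchange of an
  x with a later E^- leaves one ray, one for every pair of variables. Every intermediate list has to
  pass the convergence check.\<close>

lemma Z_triple:
  assumes zw: "z \<noteq> w" and wu: "w \<noteq> u" and zu: "z \<noteq> u"
  shows "cong_prod I [line (Z_ser s) z, line (Z_ser s) w, line (Z_ser s) u]
    [ray (swap_fps q t s s) w z, ray (swap_fps q t s s) u w, ray (swap_fps q t s s) u z,
     up (E_fps s) z, up (E_fps s) w, up (E_fps s) u,
     line (X_ser s) z, line (X_ser s) w, line (X_ser s) u,
     dn (F_fps s) z, dn (F_fps s) w, dn (F_fps s) u]"
proof -
  let ?Z = "line (Z_ser s)" and ?E = "up (E_fps s)" and ?X = "line (X_ser s)" and ?F = "dn (F_fps s)"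
    and ?R = "ray (swap_fps q t s s)"
  note n = zw zw[symmetric] wu wu[symmetric] zu zu[symmetric]
  have "cong_prod I [?Z z, ?Z w, ?Z u] [?E z, ?X z, ?F z, ?Z w, ?Z u]"
    by (rule cong_step[OF Z_expand, where n = 0]) (simp_all add: n)
  also have "cong_prod I \<dots> [?E z, ?X z, ?F z, ?E w, ?X w, ?F w, ?Z u]"
    by (rule cong_step[OF Z_expand, where n = 3]) (simp_all add: n)
  also have "cong_prod I \<dots> [?E z, ?X z, ?F z, ?E w, ?X w, ?F w, ?E u, ?X u, ?F u]"
    by (rule cong_step[OF Z_expand, where n = 6]) (simp_all add: n)
  also have "cong_prod I \<dots> [?E z, ?X z, ?F z, ?E w, ?X w, ?E u, ?X u, ?F w, ?F u]"
    by (rule cong_step[OF dn_up_x[OF wu], where n = 5]) (simp_all add: n)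
  also have "cong_prod I \<dots> [?E z, ?X z, ?E w, ?X w, ?F z, ?E u, ?X u, ?F w, ?F u]"
    by (rule cong_step[OF dn_up_x[OF zw], where n = 2]) (simp_all add: n)
  also have "cong_prod I \<dots> [?E z, ?X z, ?E w, ?X w, ?E u, ?X u, ?F z, ?F w, ?F u]"
    by (rule cong_step[OF dn_up_x[OF zu], where n = 4]) (simp_all add: n)
  also have "cong_prod I \<dots> [?E z, ?X z, ?E w, ?R u w, ?E u, ?X w, ?X u, ?F z, ?F w, ?F u]"
    by (rule cong_step[OF x_up[OF wu], where n = 3]) (simp_all add: n)
  also have "cong_prod I \<dots> [?E z, ?R w z, ?E w, ?X z, ?R u w, ?E u, ?X w, ?X u, ?F z, ?F w, ?F u]"
    by (rule cong_step[OF x_up[OF zw], where n = 1]) (simp_all add: n)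
  also have "cong_prod I \<dots> [?E z, ?R w z, ?R u w, ?E w, ?X z, ?E u, ?X w, ?X u, ?F z, ?F w, ?F u]"
    by (rule move_left[where k = 4 and n = 2]) (simp_all add: n)
  also have "cong_prod I \<dots> [?E z, ?R w z, ?R u w, ?E w, ?R u z, ?E u, ?X z, ?X w, ?X u, ?F z, ?F w, ?F u]"
    by (rule cong_step[OF x_up[OF zu], where n = 4]) (simp_all add: n)
  also have "cong_prod I \<dots> [?E z, ?R w z, ?R u w, ?R u z, ?E w, ?E u, ?X z, ?X w, ?X u, ?F z, ?F w, ?F u]"
    by (rule move_left[where k = 4 and n = 3]) (simp_all add: n)
  also have "cong_prod I \<dots> [?R w z, ?E z, ?R u w, ?R u z, ?E w, ?E u, ?X z, ?X w, ?X u, ?F z, ?F w, ?F u]"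
    by (rule move_left[where k = 1 and n = 0]) (simp_all add: n)
  also have "cong_prod I \<dots> [?R w z, ?R u w, ?E z, ?R u z, ?E w, ?E u, ?X z, ?X w, ?X u, ?F z, ?F w, ?F u]"
    by (rule move_left[where k = 2 and n = 1]) (simp_all add: n)
  also have "cong_prod I \<dots> [?R w z, ?R u w, ?R u z, ?E z, ?E w, ?E u, ?X z, ?X w, ?X u, ?F z, ?F w, ?F u]"
    by (rule move_left[where k = 3 and n = 2]) (simp_all add: n)
  finally show ?thesis .
qed

subsection \<open>The quadratic relations\<close>

text \<open>Together with \<open>g_rel\<close>, the structure functions in the relations for x, so
  that one argument treats both signs.\<close>

definition G_rel :: "bool \<Rightarrow> free_alg fps" where
  "G_rel s = G_fps q t (if s then 1 else - 1)"

definition g_rel :: "bool \<Rightarrow> free_alg fps" where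
  "g_rel s = (if s then g_fps q t r_pstar else g_fps q t (\<lambda>m. - r_p m))"

lemma rel_simps [simp]:
  "graded_factor (ray (G_rel s) w z)" "graded_factor (ray (g_rel s) w z)"
  "central_fps (G_rel s)" "central_fps (g_rel s)"
  by (cases s; simp add: G_rel_def g_rel_def)+

definition quad :: "bool \<Rightarrow> var \<Rightarrow> var \<Rightarrow> factor list" where
  "quad s z w = [ray (G_rel s) w z, ray (g_rel s) w z, line (X_ser s) z, line (X_ser s) w]"

lemma x_quad:
  "\<pi> (ser_prod (quad s Zv Wv) (m - vexp Zv 3)) + \<pi> (ser_prod (quad s Wv Zv) (m - vexp Wv 3)) = 0"
proof -
  have e: "mono_ser (vexp z 3) \<star> at_ratio (in_pos (G_rel s)) w z \<star> at_ratio (in_pos (g_rel s)) w z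
      \<star> at_var (X_ser s) z \<star> at_var (X_ser s) w = mono_ser (vexp z 3) \<star> ser_prod (quad s z w)"
    if "z \<noteq> w" for z w
    using foldl_mono[of "quad s z w" "vexp z 3"] that by (simp add: quad_def) (simp add: factor_defs)
  have "mono_ser (vexp Zv 3) \<star> at_ratio (in_pos (G_rel s)) Wv Zv \<star> at_ratio (in_pos (g_rel s)) Wv Zv
      \<star> at_var (X_ser s) Zv \<star> at_var (X_ser s) Wv \<approx>\<^bsub>I\<^esub>
    - (mono_ser (vexp Wv 3) \<star> at_ratio (in_pos (G_rel s)) Zv Wv \<star> at_ratio (in_pos (g_rel s)) Zv Wv
      \<star> at_var (X_ser s) Wv \<star> at_var (X_ser s) Zv)"
  proof (cases s)
    case True
    show ?thesis
      using rels[THEN conjunct2, THEN conjunct2, THEN conjunct2, THEN conjunct2, THEN conjunct2,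
          THEN conjunct2, THEN conjunct2, THEN conjunct2, THEN conjunct2, THEN conjunct2,
          THEN conjunct2, THEN conjunct2, THEN conjunct2, THEN conjunct2, THEN conjunct1]
      by (simp only: True if_True G_rel_def g_rel_def X_ser_def Gpol_fps gser_fps)
  next
    case False
    show ?thesis
      using rels[THEN conjunct2, THEN conjunct2, THEN conjunct2, THEN conjunct2, THEN conjunct2,
          THEN conjunct2, THEN conjunct2, THEN conjunct2, THEN conjunct2, THEN conjunct2,
          THEN conjunct2, THEN conjunct2, THEN conjunct2, THEN conjunct2, THEN conjunct2, THEN conjunct1]
      by (simp only: False if_False G_rel_def g_rel_def X_ser_def Gpol_fps gser_inv_fps)
  qed
  then have "\<pi> ((mono_ser (vexp Zv 3) \<star> ser_prod (quad s Zv Wv)) m) =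
      \<pi> ((- (mono_ser (vexp Wv 3) \<star> ser_prod (quad s Wv Zv))) m)"
    unfolding e[of Zv Wv, simplified] e[of Wv Zv, simplified] ser_eq_def elt_eq_pi by blast
  then show ?thesis by (simp add: smult_mono_left pi_uminus)
qed

definition Z_quad :: "bool \<Rightarrow> var \<Rightarrow> var \<Rightarrow> factor list" where
  "Z_quad s z w = [ray (G_fps q t (- 1)) w z, ray (g_fps q t (\<lambda>m. - r_gam2 m)) w z,
     line (Z_ser s) z, line (Z_ser s) w]"

lemma structure_quad:
  "pi_fps (prod_list [G_fps q t (- 1), g_fps q t (\<lambda>m. - r_gam2 m), swap_fps q t s s]) =
    pi_fps (prod_list [G_rel s, g_rel s])"
  using structure_plus_G structure_minus
  by (cases s) (simp_all add: G_rel_def g_rel_def mult.assoc pi_fps_mult)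

lemma Z_quad_cong:
  assumes zw: "z \<noteq> w"
  shows "cong_prod I (Z_quad s z w)
    ([up (E_fps s) z, up (E_fps s) w] @ quad s z w @ [dn (F_fps s) z, dn (F_fps s) w])"
proof -
  let ?Z = "line (Z_ser s)" and ?E = "up (E_fps s)" and ?X = "line (X_ser s)" and ?F = "dn (F_fps s)"
  note n = zw zw[symmetric]
  have "cong_prod I (Z_quad s z w)
    [ray (G_fps q t (- 1)) w z, ray (g_fps q t (\<lambda>m. - r_gam2 m)) w z, ray (swap_fps q t s s) w z,
     ?E z, ?E w, ?X z, ?X w, ?F z, ?F w]"
    unfolding Z_quad_def by (rule cong_step[OF Z_pair[OF zw], where n = 2]) (simp_all add: n)
  also have "cong_prod I \<dots> [ray (G_rel s) w z, ray (g_rel s) w z, ?E z, ?E w, ?X z, ?X w, ?F z, ?F w]"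
    by (rule cong_step[OF rays_cong[OF zw[symmetric] structure_quad], where n = 0]) (simp_all add: n)
  also have "cong_prod I \<dots> [?E z, ?E w, ray (G_rel s) w z, ray (g_rel s) w z, ?X z, ?X w, ?F z, ?F w]"
  \<comment> \<open>Proved in reverse, since \<open>move_left\<close> moves central factors to the
    left only.\<close>
  proof (rule cong_sym)
    have "cong_prod I [?E z, ?E w, ray (G_rel s) w z, ray (g_rel s) w z, ?X z, ?X w, ?F z, ?F w]
      [ray (G_rel s) w z, ?E z, ?E w, ray (g_rel s) w z, ?X z, ?X w, ?F z, ?F w]"
      by (rule move_left[where k = 2 and n = 0]) (simp_all add: n)
    also have "cong_prod I \<dots> [ray (G_rel s) w z, ray (g_rel s) w z, ?E z, ?E w, ?X z, ?X w, ?F z, ?F w]"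
      by (rule move_left[where k = 3 and n = 1]) (simp_all add: n)
    finally show "cong_prod I [?E z, ?E w, ray (G_rel s) w z, ray (g_rel s) w z, ?X z, ?X w, ?F z, ?F w]
      [ray (G_rel s) w z, ray (g_rel s) w z, ?E z, ?E w, ?X z, ?X w, ?F z, ?F w]" .
  qed
  finally show ?thesis by (simp add: quad_def)
qed

lemma Z_quad_relation:
  "\<pi> (ser_prod (Z_quad s Zv Wv) (m - vexp Zv 3)) + \<pi> (ser_prod (Z_quad s Wv Zv) (m - vexp Wv 3)) = 0"
proof -
  let ?E = "up (E_fps s)" and ?F = "dn (F_fps s)"
  let ?A = "[?E Zv, ?E Wv]" and ?B = "[?F Zv, ?F Wv]"
  \<comment> \<open>The relation is divided by w^3: the monomial z^3/w^3 has degree 0, so it is a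
    graded central factor that may stand inside a list.\<close>
  define e where "e = vexp Zv 3 - vexp Wv 3"
  let ?M = "box 3 (mono_ser e)"
  have g: "graded_factor ?M" by (rule graded_mono) (simp_all add: e_def vexp_apply)
  let ?L = "\<lambda>j. if j then ?M # quad s Zv Wv else quad s Wv Zv"
  have M: "ser_prod (?M # L) k = ser_prod L (k - e)" for L k
    by (simp add: box_def smult_mono_left)
  have "(\<Sum>j\<in>UNIV. of_int 1 * ser_prod (?A @ ?L j @ ?B) k) \<in> I" for k
  proof (rule ser_prod_context[OF ideal closed_I])
    show "convergent_list (?A @ ?L j @ ?B)" for j
      by (cases j) (simp_all add: quad_def g)
    fix k
    have "\<pi> (ser_prod (?M # quad s Zv Wv) k + ser_prod (quad s Wv Zv) k) = \<pi> 0"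
      using x_quad[of s "k + vexp Wv 3"]
      by (simp only: M pi_add pi_0) (simp del: ser_prod.simps add: e_def algebra_simps)
    then show "(\<Sum>j\<in>UNIV. of_int 1 * ser_prod (?L j) k) \<in> I"
      unfolding pi_eq_iff by (simp add: UNIV_bool add.commute)
  qed
  from this[of "m - vexp Wv 3"]
  have "\<pi> (ser_prod (?A @ (?M # quad s Zv Wv) @ ?B) (m - vexp Wv 3)) +
      \<pi> (ser_prod (?A @ quad s Wv Zv @ ?B) (m - vexp Wv 3)) = 0"
    unfolding pi_add[symmetric] pi_0[symmetric] pi_eq_iff by (simp add: UNIV_bool add.commute)
  moreover have move: "cong_prod I (?A @ (?M # quad s Zv Wv) @ ?B) (?M # ?A @ quad s Zv Wv @ ?B)"
    by (rule move_left[where k = 2 and n = 0]) (simp_all add: quad_def g)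
  have "\<pi> (ser_prod (?A @ (?M # quad s Zv Wv) @ ?B) (m - vexp Wv 3)) =
      \<pi> (ser_prod (?A @ quad s Zv Wv @ ?B) (m - vexp Zv 3))"
    unfolding cong_prodD[OF move] M by (simp del: ser_prod.simps add: e_def)
  moreover have "cong_prod I (Z_quad s Wv Zv) (?A @ quad s Wv Zv @ ?B)"
  proof -
    have "cong_prod I (Z_quad s Wv Zv) ([?E Wv, ?E Zv] @ quad s Wv Zv @ [?F Wv, ?F Zv])"
      by (rule Z_quad_cong) simp
    also have "cong_prod I \<dots> (?A @ quad s Wv Zv @ [?F Wv, ?F Zv])"
      by (rule cong_step[OF up_commute, where n = 0]) (simp_all add: quad_def)
    also have "cong_prod I \<dots> (?A @ quad s Wv Zv @ ?B)"
      by (rule cong_step[OF dn_commute, where n = 6]) (simp_all add: quad_def)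
    finally show ?thesis .
  qed
  ultimately show ?thesis
    using cong_prodD[OF Z_quad_cong[of Zv Wv s]] by (simp add: cong_prodD)
qed

subsection \<open>The cubic relations\<close>

definition cubic :: "bool \<Rightarrow> var \<Rightarrow> var \<Rightarrow> var \<Rightarrow> factor list" where
  "cubic s z w u = [ray (g_rel s) w z, ray (g_rel s) u w, ray (g_rel s) u z, box 1 (bracket z w u),
     line (X_ser s) z, line (X_ser s) w, line (X_ser s) u]"

definition perms :: "(var \<Rightarrow> var) set" where
  "perms = {\<sigma>. \<sigma> permutes {Zv, Wv, Uv}}"

lemma perms_distinct:
  "\<sigma> \<in> perms \<Longrightarrow> \<sigma> Zv \<noteq> \<sigma> Wv \<and> \<sigma> Wv \<noteq> \<sigma> Uv \<and> \<sigma> Zv \<noteq> \<sigma> Uv"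
  unfolding perms_def using permutes_inj[of \<sigma> "{Zv, Wv, Uv}"] by (auto dest: injD)

lemma perm_sum_perms:
  assumes T: "\<And>z w u. z \<noteq> w \<Longrightarrow> w \<noteq> u \<Longrightarrow> z \<noteq> u \<Longrightarrow> T z w u = T' z w u"
  shows "perm_sum T m = (\<Sum>\<sigma>\<in>perms. T' (\<sigma> Zv) (\<sigma> Wv) (\<sigma> Uv) m)"
proof -
  have "perm_sum T m = (\<Sum>\<sigma>\<in>perms. T (\<sigma> Zv) (\<sigma> Wv) (\<sigma> Uv) m)"
    by (simp add: perm_sum_def perms_def sum_apply)
  also have "\<dots> = (\<Sum>\<sigma>\<in>perms. T' (\<sigma> Zv) (\<sigma> Wv) (\<sigma> Uv) m)"
  proof (rule sum.cong[OF refl])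
    fix \<sigma> assume "\<sigma> \<in> perms"
    then show "T (\<sigma> Zv) (\<sigma> Wv) (\<sigma> Uv) m = T' (\<sigma> Zv) (\<sigma> Wv) (\<sigma> Uv) m"
      using T[of "\<sigma> Zv" "\<sigma> Wv" "\<sigma> Uv"] perms_distinct[of \<sigma>] by presburger
  qed
  finally show ?thesis .
qed

lemma x_cubic: "\<pi> (\<Sum>\<sigma>\<in>perms. ser_prod (cubic s (\<sigma> Zv) (\<sigma> Wv) (\<sigma> Uv)) m) = 0"
proof -
  let ?T = "\<lambda>z w u. at_ratio (in_pos (g_rel s)) w z \<star> at_ratio (in_pos (g_rel s)) u w
        \<star> at_ratio (in_pos (g_rel s)) u z \<star> bracket z w u
        \<star> at_var (X_ser s) z \<star> at_var (X_ser s) w \<star> at_var (X_ser s) u"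
  have e: "?T z w u = ser_prod (cubic s z w u)" if "z \<noteq> w" "w \<noteq> u" "z \<noteq> u" for z w u
    using ser_prod_foldl[of "cubic s z w u"] that that[symmetric]
    by (simp add: cubic_def) (simp add: factor_defs)
  have "perm_sum ?T \<approx>\<^bsub>I\<^esub> 0"
  proof (cases s)
    case True
    show ?thesis
      using rels[THEN conjunct2, THEN conjunct2, THEN conjunct2, THEN conjunct2, THEN conjunct2,
          THEN conjunct2, THEN conjunct2, THEN conjunct2, THEN conjunct2, THEN conjunct2,
          THEN conjunct2, THEN conjunct2, THEN conjunct2, THEN conjunct2, THEN conjunct2,
          THEN conjunct2, THEN conjunct1]
      by (simp only: True if_True g_rel_def X_ser_def gser_fps)
  next
    case False
    show ?thesis
      using rels[THEN conjunct2, THEN conjunct2, THEN conjunct2, THEN conjunct2, THEN conjunct2,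
          THEN conjunct2, THEN conjunct2, THEN conjunct2, THEN conjunct2, THEN conjunct2,
          THEN conjunct2, THEN conjunct2, THEN conjunct2, THEN conjunct2, THEN conjunct2,
          THEN conjunct2, THEN conjunct2]
      by (simp only: False if_False g_rel_def X_ser_def gser_inv_fps)
  qed
  then have "\<pi> (perm_sum ?T m) = 0" by (simp add: ser_eq_def elt_eq_pi pi_0)
  moreover have "perm_sum ?T m = (\<Sum>\<sigma>\<in>perms. ser_prod (cubic s (\<sigma> Zv) (\<sigma> Wv) (\<sigma> Uv)) m)"
    by (rule perm_sum_perms) (rule e)
  ultimately show ?thesis by simp
qed

text \<open>All six orders are words of length at most three in the two adjacent transpositions; the
  identity is a transposition applied twice, \<open>s11\<close>.\<close>

lemma ups_reorder:
  assumes F: "minus_fps F" "\<And>v. graded_factor (up F v)" and n: "z \<noteq> w" "w \<noteq> u" "z \<noteq> u"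
  shows "cong_prod I [up F z, up F w, up F u] [up F Zv, up F Wv, up F Uv]"
proof -
  have s1: "cong_prod I [up F a, up F b, up F c] [up F b, up F a, up F c]" for a b c
    by (rule cong_step[OF up_commute, where n = 0]) (simp_all add: F)
  have s2: "cong_prod I [up F a, up F b, up F c] [up F a, up F c, up F b]" for a b c
    by (rule cong_step[OF up_commute, where n = 1]) (simp_all add: F)
  note s12 = cong_trans[OF s1 s2] and s21 = cong_trans[OF s2 s1] and s11 = cong_trans[OF s1 s1]
  note s121 = cong_trans[OF s12 s1]
  show ?thesis
    using n by (cases z; cases w; cases u) (auto intro: s1 s2 s12 s21 s11 s121)
qed

lemma dns_reorder:
  assumes F: "plus_fps F" "\<And>v. graded_factor (dn F v)" and n: "z \<noteq> w" "w \<noteq> u" "z \<noteq> u"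
  shows "cong_prod I [dn F z, dn F w, dn F u] [dn F Zv, dn F Wv, dn F Uv]"
proof -
  have s1: "cong_prod I [dn F a, dn F b, dn F c] [dn F b, dn F a, dn F c]" for a b c
    by (rule cong_step[OF dn_commute, where n = 0]) (simp_all add: F)
  have s2: "cong_prod I [dn F a, dn F b, dn F c] [dn F a, dn F c, dn F b]" for a b c
    by (rule cong_step[OF dn_commute, where n = 1]) (simp_all add: F)
  note s12 = cong_trans[OF s1 s2] and s21 = cong_trans[OF s2 s1] and s11 = cong_trans[OF s1 s1]
  note s121 = cong_trans[OF s12 s1]
  show ?thesis
    using n by (cases z; cases w; cases u) (auto intro: s1 s2 s12 s21 s11 s121)
qed

definition Z_cubic :: "bool \<Rightarrow> var \<Rightarrow> var \<Rightarrow> var \<Rightarrow> factor list" where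
  "Z_cubic s z w u = (if s then [ray (g_fps q t (\<lambda>m. - r_one m)) w z, ray (g_fps q t (\<lambda>m. - r_one m)) u w,
       ray (g_fps q t (\<lambda>m. - r_one m)) u z] else []) @
     [ray (g_fps q t (\<lambda>m. - r_gam2 m)) w z, ray (g_fps q t (\<lambda>m. - r_gam2 m)) u w,
      ray (g_fps q t (\<lambda>m. - r_gam2 m)) u z, box 1 (bracket z w u),
      line (Z_ser s) z, line (Z_ser s) w, line (Z_ser s) u]"

lemma structure_cubic:
  "pi_fps (prod_list [g_fps q t (\<lambda>m. - r_one m), g_fps q t (\<lambda>m. - r_gam2 m), swap_fps q t True True]) =
    pi_fps (prod_list [g_rel True])"
  "pi_fps (prod_list [g_fps q t (\<lambda>m. - r_gam2 m), swap_fps q t False False]) = pi_fps (prod_list [g_rel False])"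
  using structure_plus structure_minus by (simp_all add: g_rel_def mult.assoc)

text \<open>For each pair of variables the central rays in the same ratio are brought together and
  merged into \<open>g_rel\<close>.\<close>

lemma Z_cubic_structure:
  assumes zw: "z \<noteq> w" and wu: "w \<noteq> u" and zu: "z \<noteq> u"
  shows "cong_prod I (Z_cubic s z w u)
    [ray (g_rel s) w z, ray (g_rel s) u w, ray (g_rel s) u z, box 1 (bracket z w u),
     up (E_fps s) z, up (E_fps s) w, up (E_fps s) u,
     line (X_ser s) z, line (X_ser s) w, line (X_ser s) u,
     dn (F_fps s) z, dn (F_fps s) w, dn (F_fps s) u]"
proof -
  let ?Z = "line (Z_ser s)" and ?E = "up (E_fps s)" and ?X = "line (X_ser s)" and ?F = "dn (F_fps s)"
    and ?R = "ray (swap_fps q t s s)" and ?g = "ray (g_fps q t (\<lambda>m. - r_gam2 m))"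
    and ?h = "ray (g_fps q t (\<lambda>m. - r_one m))" and ?p = "ray (g_rel s)" and ?b = "box 1 (bracket z w u)"
  note n = zw zw[symmetric] wu wu[symmetric] zu zu[symmetric]
  show ?thesis
  proof (cases s)
    case s: True
    note merge = rays_cong[OF _ structure_cubic(1)]
    have "cong_prod I (Z_cubic s z w u) [?h w z, ?h u w, ?h u z, ?g w z, ?g u w, ?g u z, ?b,
      ?R w z, ?R u w, ?R u z, ?E z, ?E w, ?E u, ?X z, ?X w, ?X u, ?F z, ?F w, ?F u]"
      unfolding Z_cubic_def
      by (rule cong_step[OF Z_triple[OF zw wu zu], where n = 7]) (simp_all add: n s)
    also have "cong_prod I \<dots> [?h w z, ?g w z, ?h u w, ?h u z, ?g u w, ?g u z, ?b,
      ?R w z, ?R u w, ?R u z, ?E z, ?E w, ?E u, ?X z, ?X w, ?X u, ?F z, ?F w, ?F u]"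
      by (rule move_left[where k = 3 and n = 1]) (simp_all add: n)
    also have "cong_prod I \<dots> [?h w z, ?g w z, ?R w z, ?h u w, ?h u z, ?g u w, ?g u z, ?b,
      ?R u w, ?R u z, ?E z, ?E w, ?E u, ?X z, ?X w, ?X u, ?F z, ?F w, ?F u]"
      by (rule move_left[where k = 7 and n = 2]) (simp_all add: n)
    also have "cong_prod I \<dots> [?p w z, ?h u w, ?h u z, ?g u w, ?g u z, ?b,
      ?R u w, ?R u z, ?E z, ?E w, ?E u, ?X z, ?X w, ?X u, ?F z, ?F w, ?F u]"
      by (rule cong_step[OF merge[OF zw[symmetric]], where n = 0]) (simp_all add: n s)
    also have "cong_prod I \<dots> [?p w z, ?h u w, ?g u w, ?h u z, ?g u z, ?b,
      ?R u w, ?R u z, ?E z, ?E w, ?E u, ?X z, ?X w, ?X u, ?F z, ?F w, ?F u]"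
      by (rule move_left[where k = 3 and n = 2]) (simp_all add: n)
    also have "cong_prod I \<dots> [?p w z, ?h u w, ?g u w, ?R u w, ?h u z, ?g u z, ?b,
      ?R u z, ?E z, ?E w, ?E u, ?X z, ?X w, ?X u, ?F z, ?F w, ?F u]"
      by (rule move_left[where k = 6 and n = 3]) (simp_all add: n)
    also have "cong_prod I \<dots> [?p w z, ?p u w, ?h u z, ?g u z, ?b,
      ?R u z, ?E z, ?E w, ?E u, ?X z, ?X w, ?X u, ?F z, ?F w, ?F u]"
      by (rule cong_step[OF merge[OF wu[symmetric]], where n = 1]) (simp_all add: n s)
    also have "cong_prod I \<dots> [?p w z, ?p u w, ?h u z, ?g u z, ?R u z, ?b,
      ?E z, ?E w, ?E u, ?X z, ?X w, ?X u, ?F z, ?F w, ?F u]"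
      by (rule move_left[where k = 5 and n = 4]) (simp_all add: n)
    also have "cong_prod I \<dots> [?p w z, ?p u w, ?p u z, ?b,
      ?E z, ?E w, ?E u, ?X z, ?X w, ?X u, ?F z, ?F w, ?F u]"
      by (rule cong_step[OF merge[OF zu[symmetric]], where n = 2]) (simp_all add: n s)
    finally show ?thesis .
  next
    case s: False
    note merge = rays_cong[OF _ structure_cubic(2)]
    have "cong_prod I (Z_cubic s z w u) [?g w z, ?g u w, ?g u z, ?b,
      ?R w z, ?R u w, ?R u z, ?E z, ?E w, ?E u, ?X z, ?X w, ?X u, ?F z, ?F w, ?F u]"
      unfolding Z_cubic_def
      by (rule cong_step[OF Z_triple[OF zw wu zu], where n = 4]) (simp_all add: n s)
    also have "cong_prod I \<dots> [?g w z, ?R w z, ?g u w, ?g u z, ?b,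
      ?R u w, ?R u z, ?E z, ?E w, ?E u, ?X z, ?X w, ?X u, ?F z, ?F w, ?F u]"
      by (rule move_left[where k = 4 and n = 1]) (simp_all add: n)
    also have "cong_prod I \<dots> [?p w z, ?g u w, ?g u z, ?b,
      ?R u w, ?R u z, ?E z, ?E w, ?E u, ?X z, ?X w, ?X u, ?F z, ?F w, ?F u]"
      by (rule cong_step[OF merge[OF zw[symmetric]], where n = 0]) (simp_all add: n s)
    also have "cong_prod I \<dots> [?p w z, ?g u w, ?R u w, ?g u z, ?b,
      ?R u z, ?E z, ?E w, ?E u, ?X z, ?X w, ?X u, ?F z, ?F w, ?F u]"
      by (rule move_left[where k = 4 and n = 2]) (simp_all add: n)
    also have "cong_prod I \<dots> [?p w z, ?p u w, ?g u z, ?b,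
      ?R u z, ?E z, ?E w, ?E u, ?X z, ?X w, ?X u, ?F z, ?F w, ?F u]"
      by (rule cong_step[OF merge[OF wu[symmetric]], where n = 1]) (simp_all add: n s)
    also have "cong_prod I \<dots> [?p w z, ?p u w, ?g u z, ?R u z, ?b,
      ?E z, ?E w, ?E u, ?X z, ?X w, ?X u, ?F z, ?F w, ?F u]"
      by (rule move_left[where k = 4 and n = 3]) (simp_all add: n)
    also have "cong_prod I \<dots> [?p w z, ?p u w, ?p u z, ?b,
      ?E z, ?E w, ?E u, ?X z, ?X w, ?X u, ?F z, ?F w, ?F u]"
      by (rule cong_step[OF merge[OF zu[symmetric]], where n = 2]) (simp_all add: n s)
    finally show ?thesis .
  qed
qed

text \<open>The outer operators are put into one fixed order of the variables, so that all six terms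
  of the cubic relation share the same context.\<close>

lemma Z_cubic_cong:
  assumes zw: "z \<noteq> w" and wu: "w \<noteq> u" and zu: "z \<noteq> u"
  shows "cong_prod I (Z_cubic s z w u)
    ([up (E_fps s) Zv, up (E_fps s) Wv, up (E_fps s) Uv] @ cubic s z w u @
     [dn (F_fps s) Zv, dn (F_fps s) Wv, dn (F_fps s) Uv])"
proof -
  let ?E = "up (E_fps s)" and ?X = "line (X_ser s)" and ?F = "dn (F_fps s)"
    and ?p = "ray (g_rel s)" and ?b = "box 1 (bracket z w u)"
  let ?x = "[?X z, ?X w, ?X u]"
  note n = zw zw[symmetric] wu wu[symmetric] zu zu[symmetric]
  have "cong_prod I (Z_cubic s z w u) [?p w z, ?p u w, ?p u z, ?b, ?E z, ?E w, ?E u, ?X z, ?X w, ?X u, ?F z, ?F w, ?F u]"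
    by (rule Z_cubic_structure[OF zw wu zu])
  also have "cong_prod I \<dots> [?E z, ?E w, ?E u, ?p w z, ?p u w, ?p u z, ?b, ?X z, ?X w, ?X u, ?F z, ?F w, ?F u]"
  proof (rule cong_sym)
    have "cong_prod I [?E z, ?E w, ?E u, ?p w z, ?p u w, ?p u z, ?b, ?X z, ?X w, ?X u, ?F z, ?F w, ?F u]
      [?p w z, ?E z, ?E w, ?E u, ?p u w, ?p u z, ?b, ?X z, ?X w, ?X u, ?F z, ?F w, ?F u]"
      by (rule move_left[where k = 3 and n = 0]) (simp_all add: n)
    also have "cong_prod I \<dots> [?p w z, ?p u w, ?E z, ?E w, ?E u, ?p u z, ?b, ?X z, ?X w, ?X u, ?F z, ?F w, ?F u]"
      by (rule move_left[where k = 4 and n = 1]) (simp_all add: n)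
    also have "cong_prod I \<dots> [?p w z, ?p u w, ?p u z, ?E z, ?E w, ?E u, ?b, ?X z, ?X w, ?X u, ?F z, ?F w, ?F u]"
      by (rule move_left[where k = 5 and n = 2]) (simp_all add: n)
    also have "cong_prod I \<dots> [?p w z, ?p u w, ?p u z, ?b, ?E z, ?E w, ?E u, ?X z, ?X w, ?X u, ?F z, ?F w, ?F u]"
      by (rule move_left[where k = 6 and n = 3]) (simp_all add: n)
    finally show "cong_prod I [?E z, ?E w, ?E u, ?p w z, ?p u w, ?p u z, ?b, ?X z, ?X w, ?X u, ?F z, ?F w, ?F u]
      [?p w z, ?p u w, ?p u z, ?b, ?E z, ?E w, ?E u, ?X z, ?X w, ?X u, ?F z, ?F w, ?F u]" .
  qed
  also have "cong_prod I \<dots> [?E Zv, ?E Wv, ?E Uv, ?p w z, ?p u w, ?p u z, ?b, ?X z, ?X w, ?X u, ?F z, ?F w, ?F u]"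
    by (rule cong_step[OF ups_reorder[OF _ _ zw wu zu], where n = 0]) (simp_all add: n)
  also have "cong_prod I \<dots> [?E Zv, ?E Wv, ?E Uv, ?p w z, ?p u w, ?p u z, ?b, ?X z, ?X w, ?X u, ?F Zv, ?F Wv, ?F Uv]"
    by (rule cong_step[OF dns_reorder[OF _ _ zw wu zu], where n = 10]) (simp_all add: n)
  finally show ?thesis by (simp add: cubic_def)
qed

lemma Z_cubic_relation: "\<pi> (\<Sum>\<sigma>\<in>perms. ser_prod (Z_cubic s (\<sigma> Zv) (\<sigma> Wv) (\<sigma> Uv)) m) = 0"
proof -
  let ?A = "[up (E_fps s) Zv, up (E_fps s) Wv, up (E_fps s) Uv]"
  let ?B = "[dn (F_fps s) Zv, dn (F_fps s) Wv, dn (F_fps s) Uv]"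
  let ?L = "\<lambda>\<sigma>. cubic s (\<sigma> Zv) (\<sigma> Wv) (\<sigma> Uv)"
  have "(\<Sum>\<sigma>\<in>perms. of_int 1 * ser_prod (?A @ ?L \<sigma> @ ?B) m) \<in> I"
  proof (rule ser_prod_context[OF ideal closed_I])
    fix \<sigma> assume "\<sigma> \<in> perms"
    from perms_distinct[OF this] show "convergent_list (?A @ ?L \<sigma> @ ?B)"
      by (auto simp: cubic_def)
  next
    fix k
    show "(\<Sum>\<sigma>\<in>perms. of_int 1 * ser_prod (?L \<sigma>) k) \<in> I"
      using x_cubic[of s k] by (simp add: pi_0[symmetric] pi_eq_iff del: pi_0)
  qed
  then have "\<pi> (\<Sum>\<sigma>\<in>perms. ser_prod (?A @ ?L \<sigma> @ ?B) m) = \<pi> 0"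
    unfolding pi_eq_iff by simp
  moreover have "\<pi> (ser_prod (?A @ ?L \<sigma> @ ?B) m) = \<pi> (ser_prod (Z_cubic s (\<sigma> Zv) (\<sigma> Wv) (\<sigma> Uv)) m)"
    if "\<sigma> \<in> perms" for \<sigma>
    using perms_distinct[OF that] by (intro cong_prodD[symmetric] Z_cubic_cong) auto
  ultimately show ?thesis by (simp add: pi_sum pi_0)
qed

subsection \<open>The mixed relation\<close>

text \<open>On the support of the delta function at \<gamma>^(k/2) z/w one has z = \<gamma>^(-k/2)
  w.\<close>

lemma up_diag:
  assumes zw: "z \<noteq> w"
  shows "cong_prod I [up F z, diag k z w] [up (dil (- k) F) w, diag k z w]"
proof (rule cong_prodI)
  fix m :: "var \<Rightarrow> int"
  let ?s = "m z + m w"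
  have "\<pi> (in_pos F ?s * gam (k * - m w)) = \<pi> (in_pos (dil (- k) F) ?s * gam (k * m z))"
  proof (cases "?s \<ge> 0")
    case True
    have "k * - m w = - k * ?s + k * m z" by (simp add: algebra_simps)
    then have "\<pi> (gam (k * - m w)) = \<pi> (gam (- k * ?s)) * \<pi> (gam (k * m z))"
      by (simp only: pi_gam_add)
    then show ?thesis using True centralD[OF central_gam, of "- k * ?s" "\<pi> (fps_nth F (nat ?s))"]
      by (simp add: in_pos_def dil_def pi_mult mult.assoc[symmetric])
  qed (simp add: in_pos_def)
  then show "\<pi> (ser_prod [up F z, diag k z w] m) = \<pi> (ser_prod [up (dil (- k) F) w, diag k z w] m)"
    by (simp add: up_def diag_def diag_mult[OF zw] dilate_def delta_def)
qed

text \<open>The same substitution as in \<open>up_diag\<close>; the sign of the dilation differs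
  because the series is in inverse powers.\<close>

lemma diag_dn:
  assumes zw: "z \<noteq> w"
  shows "cong_prod I [diag k z w, dn F z] [diag k z w, dn (dil k F) w]"
proof (rule cong_prodI)
  fix m :: "var \<Rightarrow> int"
  let ?s = "m z + m w"
  have "\<pi> (gam (k * - m w) * in_neg F ?s) = \<pi> (gam (k * m z) * in_neg (dil k F) ?s)"
  proof (cases "?s \<le> 0")
    case True
    have "k * - m w = k * m z + k * - ?s" by (simp add: algebra_simps)
    then have "\<pi> (gam (k * - m w)) = \<pi> (gam (k * m z)) * \<pi> (gam (k * - ?s))"
      by (simp only: pi_gam_add)
    then show ?thesis using True by (simp add: in_neg_def dil_def pi_mult mult.assoc)
  qed (simp add: in_neg_def)
  then show "\<pi> (ser_prod [diag k z w, dn F z] m) = \<pi> (ser_prod [diag k z w, dn (dil k F) w] m)"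
    by (simp add: dn_def diag_def diag_mult[OF zw] dilate_def delta_def)
qed

lemma at_var_const: "at_var (const_ser a) v = const_ser a"
proof
  fix m
  have "m = 0" if "m = vexp v (m v)" "m v = 0" using that by (metis vexp_0)
  then show "at_var (const_ser a) v m = const_ser a m"
    by (cases "m = 0") (auto simp: at_var_def const_ser_def)
qed

text \<open>\<gamma> is central only modulo the ideal, so its power is distributed over each term
  under \<open>\<pi>\<close>. The second series sits in negative powers and therefore receives
  \<open>- k\<close>.\<close>

lemma dilate_product:
  assumes F: "\<And>n. fps_nth G n \<in> homog (int n)"
  shows "\<pi> (dilate k (const_ser a \<star> in_pos F \<star> in_neg G) n) =
    \<pi> ((const_ser a \<star> in_pos (dil k F) \<star> in_neg (dil (- k) G)) n)"
proof -
  let ?A = "\<lambda>i. a * in_pos F i" and ?A' = "\<lambda>i. a * in_pos (dil k F) i"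
  have e: "(const_ser a \<star> in_pos X \<star> in_neg Y) n = (\<Sum>\<^sub>\<infinity>i. a * in_pos X i * in_neg Y (n - i))" for X Y
    by (simp add: smult_def[of _ "in_neg Y"] smult_const_left)
  have n1: "null_family (\<lambda>i. ?A i * in_neg G (n - i)) UNIV"
    by (rule null_family_int) (simp_all add: in_pos_def in_neg_homog F)
  have n2: "null_family (\<lambda>i. ?A' i * in_neg (dil (- k) G) (n - i)) UNIV"
    by (rule null_family_int) (simp_all add: in_pos_def in_neg_homog F dil_homog)
  have "\<pi> (dilate k (const_ser a \<star> in_pos F \<star> in_neg G) n) =
      \<pi> (\<Sum>\<^sub>\<infinity>i. gam (k * n) * (?A i * in_neg G (n - i)))"
    by (simp add: dilate_def e infsum_left_mult[OF n1])
  also have "\<dots> = \<pi> (\<Sum>\<^sub>\<infinity>i. ?A' i * in_neg (dil (- k) G) (n - i))"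
  proof (rule infsum_cong_pi[OF null_family_left_mult[OF n1] n2])
    fix i
    have 1: "in_pos (dil k F) i = gam (k * i) * in_pos F i" by (simp add: in_pos_def dil_def)
    have 2: "in_neg (dil (- k) G) j = gam (k * j) * in_neg G j" for j by (simp add: in_neg_def dil_def)
    have "k * n = k * i + k * (n - i)" by (simp add: algebra_simps)
    then have g: "\<pi> (gam (k * n)) = \<pi> (gam (k * i)) * \<pi> (gam (k * (n - i)))" by (simp only: pi_gam_add)
    show "\<pi> (gam (k * n) * (?A i * in_neg G (n - i))) = \<pi> (?A' i * in_neg (dil (- k) G) (n - i))"
      unfolding 1 2 pi_mult g
      by (simp only: mult.assoc central_left_commute[OF centralD[OF central_gam], of "\<pi> a"]
          central_left_commute[OF centralD[OF central_gam], of "\<pi> (in_pos F i)"])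
  qed
  also have "(\<Sum>\<^sub>\<infinity>i. ?A' i * in_neg (dil (- k) G) (n - i)) =
      (const_ser a \<star> in_pos (dil k F) \<star> in_neg (dil (- k) G)) n"
    by (simp only: e)
  finally show ?thesis .
qed

definition psi0 :: "bool \<Rightarrow> free_alg" where
  "psi0 s = letter (if s then Psi0p else Psi0m)"

definition psi_pos :: "bool \<Rightarrow> free_alg fps" where
  "psi_pos s = (if s then psi_E True else dil (- 2) (psi_E False))"

definition psi_neg :: "bool \<Rightarrow> free_alg fps" where
  "psi_neg s = (if s then psi_F True else dil 2 (psi_F False))"

definition psi_ser :: "bool \<Rightarrow> int series" where
  "psi_ser s = (if s then psi_plus else dilate (- 2) psi_minus)"

text \<open>Counted in half powers: \<psi>^+ comes with the delta function at \<gamma>^(-1) z/w and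
  \<psi>^- with the one at \<gamma> z/w.\<close>

definition shift :: "bool \<Rightarrow> int" where
  "shift s = (if s then - 2 else 2)"

lemma psi_simps [simp]:
  "graded_factor (con (psi0 s))" "central_factor (con (psi0 s))" "graded_factor (up (psi_pos s) v)"
  "graded_factor (dn (psi_neg s) v)" "graded_factor (line (psi_ser s) v)"
  "minus_fps (psi_pos s)" "plus_fps (psi_neg s)"
  by (cases s; simp add: psi0_def psi_pos_def psi_neg_def psi_ser_def)+

lemma psi_expand:
  "cong_prod I [line (psi_ser s) v] [con (psi0 s), up (psi_pos s) v, dn (psi_neg s) v]"
proof (rule cong_prodI)
  fix m
  have "ser_prod [con (psi0 s), up (psi_pos s) v, dn (psi_neg s) v] =
      foldl (\<star>) (mono_ser 0) (map snd [con (psi0 s), up (psi_pos s) v, dn (psi_neg s) v])"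
    by (rule ser_prod_foldl) simp
  also have "\<dots> = at_var (const_ser (psi0 s) \<star> in_pos (psi_pos s) \<star> in_neg (psi_neg s)) v"
    by (simp add: con_def up_def dn_def at_var_smult at_var_const)
  finally have e: "ser_prod [con (psi0 s), up (psi_pos s) v, dn (psi_neg s) v] =
      at_var (const_ser (psi0 s) \<star> in_pos (psi_pos s) \<star> in_neg (psi_neg s)) v" .
  have "\<pi> (psi_ser s n) = \<pi> ((const_ser (psi0 s) \<star> in_pos (psi_pos s) \<star> in_neg (psi_neg s)) n)" for n
    using dilate_product[of "psi_F False" "- 2" "letter Psi0m" "psi_E False" n, OF psi_F_homog]
    by (cases s) (simp_all add: psi_ser_def psi0_def psi_pos_def psi_neg_def psi_split)
  then show "\<pi> (ser_prod [line (psi_ser s) v] m) =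
      \<pi> (ser_prod [con (psi0 s), up (psi_pos s) v, dn (psi_neg s) v] m)"
    unfolding e by (simp add: line_def at_var_def)
qed

text \<open>The Cartan current is split around the delta function, positive powers to the left and
  negative powers to the right. In this form the list stays admissible for
  \<open>admissible_shapes\<close> when the half vertex operators in z and w are put around
  it.\<close>

lemma psi_list:
  "cong_prod I [con (const_C q t), diag k Zv Wv, line (psi_ser s) Wv]
    [con (const_C q t), con (psi0 s), up (psi_pos s) Wv, diag k Zv Wv, dn (psi_neg s) Wv]"
proof -
  have "cong_prod I [con (const_C q t), diag k Zv Wv, line (psi_ser s) Wv]
    [con (const_C q t), diag k Zv Wv, con (psi0 s), up (psi_pos s) Wv, dn (psi_neg s) Wv]"
    by (rule cong_step[OF psi_expand, where n = 2]) simp_all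
  also have "cong_prod I \<dots>
    [con (const_C q t), con (psi0 s), diag k Zv Wv, up (psi_pos s) Wv, dn (psi_neg s) Wv]"
    by (rule move_left[where k = 2 and n = 1]) simp_all
  also have "cong_prod I \<dots>
    [con (const_C q t), con (psi0 s), up (psi_pos s) Wv, diag k Zv Wv, dn (psi_neg s) Wv]"
    by (rule cong_sym, rule move_left[where k = 3 and n = 2]) simp_all
  finally show ?thesis .
qed

text \<open>The delta function turns the operators in z into operators in w. On either side of it
  they are gathered with the operator in w and one half of \<psi>, and each group multiplies to
  1.\<close>

lemma cancel_psi:
  "cong_prod I
    ([up (E_fps True) Zv, up (E_fps False) Wv] @
     [con (const_C q t), con (psi0 s), up (psi_pos s) Wv, diag (shift s) Zv Wv, dn (psi_neg s) Wv] @
     [dn (F_fps True) Zv, dn (F_fps False) Wv])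
    [con (const_C q t), con (psi0 s), diag (shift s) Zv Wv]"
proof -
  let ?C = "con (const_C q t)" and ?P = "con (psi0 s)" and ?D = "diag (shift s) Zv Wv"
    and ?u = "up (psi_pos s) Wv" and ?d = "dn (psi_neg s) Wv"
    and ?E = "up (E_fps True) Zv" and ?E' = "up (E_fps False) Wv"
    and ?F = "dn (F_fps True) Zv" and ?F' = "dn (F_fps False) Wv"
    and ?G = "up (dil (- shift s) (E_fps True)) Wv" and ?H = "dn (dil (shift s) (F_fps True)) Wv"
  have E: "pi_fps (prod_list [E_fps False, psi_pos s, dil (- shift s) (E_fps True)]) = pi_fps 1"
    using cancel_E_plus cancel_E_minus by (cases s) (simp_all add: psi_pos_def shift_def mult.assoc)
  have F: "pi_fps (prod_list [dil (shift s) (F_fps True), psi_neg s, F_fps False]) = pi_fps 1"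
    using cancel_F_plus cancel_F_minus by (cases s) (simp_all add: psi_neg_def shift_def mult.assoc)
  have "cong_prod I [?E, ?E', ?C, ?P, ?u, ?D, ?d, ?F, ?F'] [?C, ?E, ?E', ?P, ?u, ?D, ?d, ?F, ?F']"
    by (rule move_left[where k = 2 and n = 0]) simp_all
  also have "cong_prod I \<dots> [?C, ?P, ?E, ?E', ?u, ?D, ?d, ?F, ?F']"
    by (rule move_left[where k = 3 and n = 1]) simp_all
  also have "cong_prod I \<dots> [?C, ?P, ?E', ?E, ?u, ?D, ?d, ?F, ?F']"
    by (rule cong_step[OF up_commute, where n = 2]) simp_all
  also have "cong_prod I \<dots> [?C, ?P, ?E', ?u, ?E, ?D, ?d, ?F, ?F']"
    by (rule cong_step[OF up_commute, where n = 3]) simp_all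
  also have "cong_prod I \<dots> [?C, ?P, ?E', ?u, ?G, ?D, ?d, ?F, ?F']"
    by (rule cong_step[OF up_diag, where n = 4]) simp_all
  also have "cong_prod I \<dots> [?C, ?P, ?E', ?u, ?G, ?D, ?F, ?d, ?F']"
    by (rule cong_step[OF dn_commute, where n = 6]) simp_all
  also have "cong_prod I \<dots> [?C, ?P, ?E', ?u, ?G, ?D, ?H, ?d, ?F']"
    by (rule cong_step[OF diag_dn, where n = 5]) simp_all
  also have "cong_prod I \<dots> [?C, ?P, ?D, ?H, ?d, ?F']"
    by (rule cong_step[OF ups_cong[OF E], where n = 2]) simp_all
  also have "cong_prod I \<dots> [?C, ?P, ?D]"
    by (rule cong_step[OF dns_cong[OF F], where n = 3]) simp_all
  finally show ?thesis by simp
qed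

lemma x_mixed:
  "\<pi> (ser_prod [line (X_ser True) Zv, line (X_ser False) Wv] m) -
   \<pi> (ser_prod [line (X_ser False) Wv, line (X_ser True) Zv] m) =
   \<pi> (ser_prod [con (const_C q t), diag (shift True) Zv Wv, line (psi_ser True) Wv] m) -
   \<pi> (ser_prod [con (const_C q t), diag (shift False) Zv Wv, line (psi_ser False) Wv] m)"
proof -
  have "at_var x_plus Zv \<star> at_var x_minus Wv - at_var x_minus Wv \<star> at_var x_plus Zv \<approx>\<^bsub>I\<^esub>
      const_ser (const_C q t) \<star>
        (at_ratio (dilate (- 2) delta) Zv Wv \<star> at_var psi_plus Wv
         - at_ratio (dilate 2 delta) Zv Wv \<star> at_var (dilate (- 2) psi_minus) Wv)"
    using rels[THEN conjunct2, THEN conjunct2, THEN conjunct2, THEN conjunct2, THEN conjunct2,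
        THEN conjunct2, THEN conjunct2, THEN conjunct2, THEN conjunct2, THEN conjunct2,
        THEN conjunct2, THEN conjunct2, THEN conjunct2, THEN conjunct1] .
  then have "\<pi> ((at_var x_plus Zv \<star> at_var x_minus Wv - at_var x_minus Wv \<star> at_var x_plus Zv) m) =
      \<pi> ((const_ser (const_C q t) \<star>
        (at_ratio (dilate (- 2) delta) Zv Wv \<star> at_var psi_plus Wv
         - at_ratio (dilate 2 delta) Zv Wv \<star> at_var (dilate (- 2) psi_minus) Wv)) m)"
    unfolding ser_eq_def elt_eq_pi by blast
  then show ?thesis
    by (simp add: line_def con_def diag_def X_ser_def psi_ser_def shift_def smult_const_left pi_diff pi_mult
        right_diff_distrib)
qed

definition Z_mixed :: "bool \<Rightarrow> var \<Rightarrow> var \<Rightarrow> factor list" where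
  "Z_mixed s z w = [ray (dil 2 (g_fps q t r_one)) w z, ray (dil 2 (g_fps q t r_gam2)) w z,
     line (Z_ser s) z, line (Z_ser (\<not> s)) w]"

text \<open>The structure functions of the mixed relation are the inverse of the exchange factor, so
  the three rays merge to the empty list.\<close>

lemma Z_mixed_cong:
  assumes zw: "z \<noteq> w"
  shows "cong_prod I (Z_mixed s z w)
    [up (E_fps s) z, up (E_fps (\<not> s)) w, line (X_ser s) z, line (X_ser (\<not> s)) w,
     dn (F_fps s) z, dn (F_fps (\<not> s)) w]"
proof -
  note n = zw zw[symmetric]
  have st: "pi_fps (prod_list [dil 2 (g_fps q t r_one), dil 2 (g_fps q t r_gam2), swap_fps q t s (\<not> s)]) =
      pi_fps (prod_list [])"
    using structure_mixed[of s] by (simp add: mult.assoc)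
  have "cong_prod I (Z_mixed s z w)
    [ray (dil 2 (g_fps q t r_one)) w z, ray (dil 2 (g_fps q t r_gam2)) w z, ray (swap_fps q t s (\<not> s)) w z,
     up (E_fps s) z, up (E_fps (\<not> s)) w, line (X_ser s) z, line (X_ser (\<not> s)) w,
     dn (F_fps s) z, dn (F_fps (\<not> s)) w]"
    unfolding Z_mixed_def by (rule cong_step[OF Z_pair[OF zw], where n = 2]) (simp_all add: n)
  also have "cong_prod I \<dots> [up (E_fps s) z, up (E_fps (\<not> s)) w, line (X_ser s) z, line (X_ser (\<not> s)) w,
     dn (F_fps s) z, dn (F_fps (\<not> s)) w]"
    by (rule cong_step[OF rays_cong[OF zw[symmetric] st], where n = 0]) (simp_all add: n)
  finally show ?thesis .
qed

lemma Z_mixed_relation: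
  "\<pi> (ser_prod (Z_mixed True Zv Wv) m) - \<pi> (ser_prod (Z_mixed False Wv Zv) m) =
   \<pi> (ser_prod [con (const_C q t), con (psi0 True), diag (shift True) Zv Wv] m) -
   \<pi> (ser_prod [con (const_C q t), con (psi0 False), diag (shift False) Zv Wv] m)"
proof -
  let ?A = "[up (E_fps True) Zv, up (E_fps False) Wv]" and ?B = "[dn (F_fps True) Zv, dn (F_fps False) Wv]"
  let ?X = "[line (X_ser True) Zv, line (X_ser False) Wv]" and ?X' = "[line (X_ser False) Wv, line (X_ser True) Zv]"
  let ?P = "\<lambda>s. [con (const_C q t), con (psi0 s), up (psi_pos s) Wv, diag (shift s) Zv Wv, dn (psi_neg s) Wv]"
  \<comment> \<open>The mixed relation as one combination of four lists: both orders of the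
    currents, with the two \<psi> terms brought to the same side.\<close>
  let ?L = "\<lambda>j. [?X, ?X', ?P True, ?P False] ! j" and ?c = "\<lambda>j. [1, - 1, - 1, 1] ! j"
  have set4: "{..<4::nat} = {0, 1, 2, 3}" by auto
  have "(\<Sum>j\<in>{..<4}. of_int (?c j) * ser_prod (?A @ ?L j @ ?B) m) \<in> I"
  proof (rule ser_prod_context[OF ideal closed_I])
    fix j :: nat assume "j \<in> {..<4}"
    then consider "j = 0" | "j = 1" | "j = 2" | "j = 3" by force
    then show "convergent_list (?A @ ?L j @ ?B)" by cases simp_all
  next
    fix k
    have "\<pi> (ser_prod ?X k) - \<pi> (ser_prod ?X' k) - \<pi> (ser_prod (?P True) k) + \<pi> (ser_prod (?P False) k) = 0"
      using x_mixed[of k] cong_prodD[OF psi_list, where m = k] by (simp del: ser_prod.simps)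
    then have "\<pi> (ser_prod ?X k - ser_prod ?X' k - ser_prod (?P True) k + ser_prod (?P False) k) = \<pi> 0"
      by (simp only: pi_add pi_diff pi_0)
    then show "(\<Sum>j\<in>{..<4}. of_int (?c j) * ser_prod (?L j) k) \<in> I"
      unfolding pi_eq_iff set4 by (simp del: ser_prod.simps add: algebra_simps)
  qed
  then have "\<pi> (ser_prod (?A @ ?X @ ?B) m - ser_prod (?A @ ?X' @ ?B) m - ser_prod (?A @ ?P True @ ?B) m +
      ser_prod (?A @ ?P False @ ?B) m) = \<pi> 0"
    unfolding pi_eq_iff set4 by (simp del: ser_prod.simps append.simps add: algebra_simps)
  then have "\<pi> (ser_prod (?A @ ?X @ ?B) m) - \<pi> (ser_prod (?A @ ?X' @ ?B) m) =
      \<pi> (ser_prod (?A @ ?P True @ ?B) m) - \<pi> (ser_prod (?A @ ?P False @ ?B) m)"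
    by (simp only: pi_add pi_diff pi_0) (simp add: algebra_simps)
  also have "\<pi> (ser_prod (?A @ ?X @ ?B) m) = \<pi> (ser_prod (Z_mixed True Zv Wv) m)"
    by (rule cong_prodD, rule cong_sym) (use Z_mixed_cong[of Zv Wv True] in simp)
  also have "\<pi> (ser_prod (?A @ ?X' @ ?B) m) = \<pi> (ser_prod (Z_mixed False Wv Zv) m)"
  proof (rule cong_prodD, rule cong_sym)
    have "cong_prod I (Z_mixed False Wv Zv) ([up (E_fps False) Wv, up (E_fps True) Zv] @ ?X' @
        [dn (F_fps False) Wv, dn (F_fps True) Zv])"
      using Z_mixed_cong[of Wv Zv False] by simp
    also have "cong_prod I \<dots> (?A @ ?X' @ [dn (F_fps False) Wv, dn (F_fps True) Zv])"
      by (rule cong_step[OF up_commute, where n = 0]) simp_all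
    also have "cong_prod I \<dots> (?A @ ?X' @ ?B)"
      by (rule cong_step[OF dn_commute, where n = 4]) simp_all
    finally show "cong_prod I (Z_mixed False Wv Zv) (?A @ ?X' @ ?B)" .
  qed
  also have "\<pi> (ser_prod (?A @ ?P True @ ?B) m) = \<pi> (ser_prod [con (const_C q t), con (psi0 True), diag (shift True) Zv Wv] m)"
    by (rule cong_prodD[OF cancel_psi])
  also have "\<pi> (ser_prod (?A @ ?P False @ ?B) m) = \<pi> (ser_prod [con (const_C q t), con (psi0 False), diag (shift False) Zv Wv] m)"
    by (rule cong_prodD[OF cancel_psi])
  finally show ?thesis .
qed

theorem Z_relations: "Z_relations q t I"
proof -
  have quad: "mono_ser (vexp Zv 3) \<star> at_ratio (Gpol q t (- 1)) Wv Zv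
          \<star> at_ratio (gser_inv q t r_gam2) Wv Zv \<star> at_var (Z_ser s) Zv \<star> at_var (Z_ser s) Wv
        \<approx>\<^bsub>I\<^esub>
        - (mono_ser (vexp Wv 3) \<star> at_ratio (Gpol q t (- 1)) Zv Wv
          \<star> at_ratio (gser_inv q t r_gam2) Zv Wv \<star> at_var (Z_ser s) Wv \<star> at_var (Z_ser s) Zv)" for s
  proof -
    have e: "mono_ser (vexp z 3) \<star> at_ratio (Gpol q t (- 1)) w z
          \<star> at_ratio (gser_inv q t r_gam2) w z \<star> at_var (Z_ser s) z \<star> at_var (Z_ser s) w =
        mono_ser (vexp z 3) \<star> ser_prod (Z_quad s z w)" if "z \<noteq> w" for z w
      using foldl_mono[of "Z_quad s z w" "vexp z 3"] that
      by (simp add: Z_quad_def) (simp add: factor_defs Gpol_fps gser_inv_fps)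
    show ?thesis
      unfolding e[of Zv Wv, simplified] e[of Wv Zv, simplified] ser_eq_def elt_eq_pi
      using Z_quad_relation[of s] by (simp add: smult_mono_left pi_uminus eq_neg_iff_add_eq_0)
  qed
  have mixed: "at_ratio (dilate 2 (gser q t r_one)) Wv Zv \<star> at_ratio (dilate 2 (gser q t r_gam2)) Wv Zv
         \<star> at_var Z_plus Zv \<star> at_var Z_minus Wv
       - at_ratio (dilate 2 (gser q t r_one)) Zv Wv \<star> at_ratio (dilate 2 (gser q t r_gam2)) Zv Wv
         \<star> at_var Z_minus Wv \<star> at_var Z_plus Zv
       \<approx>\<^bsub>I\<^esub>
       const_ser (const_C q t) \<star>
         (at_ratio (dilate (- 2) delta) Zv Wv \<star> const_ser (letter Psi0p)
          - at_ratio (dilate 2 delta) Zv Wv \<star> const_ser (letter Psi0m))"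
  proof -
    have e: "at_ratio (dilate 2 (gser q t r_one)) w z \<star> at_ratio (dilate 2 (gser q t r_gam2)) w z
         \<star> at_var (Z_ser s) z \<star> at_var (Z_ser (\<not> s)) w = ser_prod (Z_mixed s z w)" if "z \<noteq> w" for s z w
      using ser_prod_foldl[of "Z_mixed s z w"] that
      by (simp add: Z_mixed_def) (simp add: factor_defs gser_fps dilate_in_pos)
    \<comment> \<open>The constant \<open>psi0 s\<close> stands to the left of the delta function in
      the list and to its right in the statement; centrality reconciles the two.\<close>
    have p: "\<pi> (ser_prod [con (const_C q t), con (psi0 s), diag k Zv Wv] m) =
        \<pi> (const_C q t) * \<pi> ((at_ratio (dilate k delta) Zv Wv \<star> const_ser (psi0 s)) m)" for s k m
    proof -
      have "central (psi0 s)" by (cases s) (simp_all add: psi0_def central_letters)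
      then show ?thesis
        by (simp add: con_def diag_def smult_const_left smult_const_right pi_mult centralD)
    qed
    show ?thesis
      using e[of Zv Wv True] e[of Wv Zv False]
      unfolding ser_eq_def elt_eq_pi
      using Z_mixed_relation[unfolded p]
      by (simp add: Z_ser_def pi_diff smult_const_left pi_mult right_diff_distrib psi0_def shift_def
          del: ser_prod.simps)
  qed
  have cubic: "perm_sum (\<lambda>z w u. T z w u) \<approx>\<^bsub>I\<^esub> 0"
    if T: "\<And>z w u. z \<noteq> w \<Longrightarrow> w \<noteq> u \<Longrightarrow> z \<noteq> u \<Longrightarrow> T z w u = ser_prod (Z_cubic s z w u)" for T s
    unfolding ser_eq_def elt_eq_pi
  proof
    fix m
    have "perm_sum T m = (\<Sum>\<sigma>\<in>perms. ser_prod (Z_cubic s (\<sigma> Zv) (\<sigma> Wv) (\<sigma> Uv)) m)"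
      by (rule perm_sum_perms) (rule T)
    then show "\<pi> (perm_sum (\<lambda>z w u. T z w u) m) = \<pi> (0 m)"
      using Z_cubic_relation[of s m] by (simp add: pi_0)
  qed
  have cubic_plus: "at_ratio (gser_inv q t r_one) w z \<star> at_ratio (gser_inv q t r_one) u w
         \<star> at_ratio (gser_inv q t r_one) u z
         \<star> at_ratio (gser_inv q t r_gam2) w z \<star> at_ratio (gser_inv q t r_gam2) u w
         \<star> at_ratio (gser_inv q t r_gam2) u z \<star> bracket z w u
         \<star> at_var Z_plus z \<star> at_var Z_plus w \<star> at_var Z_plus u = ser_prod (Z_cubic True z w u)"
    if n: "z \<noteq> w" "w \<noteq> u" "z \<noteq> u" for z w u
    using ser_prod_foldl[of "Z_cubic True z w u"] n n[symmetric]
    by (simp add: Z_cubic_def) (simp add: factor_defs gser_inv_fps Z_ser_def)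
  have cubic_minus: "at_ratio (gser_inv q t r_gam2) w z \<star> at_ratio (gser_inv q t r_gam2) u w
         \<star> at_ratio (gser_inv q t r_gam2) u z \<star> bracket z w u
         \<star> at_var Z_minus z \<star> at_var Z_minus w \<star> at_var Z_minus u = ser_prod (Z_cubic False z w u)"
    if n: "z \<noteq> w" "w \<noteq> u" "z \<noteq> u" for z w u
    using ser_prod_foldl[of "Z_cubic False z w u"] n n[symmetric]
    by (simp add: Z_cubic_def) (simp add: factor_defs gser_inv_fps Z_ser_def)
  show ?thesis
    unfolding Z_relations_def
    using quad[of True] quad[of False]
    by (intro conjI mixed cubic[OF cubic_plus] cubic[OF cubic_minus]) (auto simp: Z_ser_def)
qed

end

section \<open>The quotient ring\<close>

text \<open>
  There are no types depending on \<open>q\<close> and \<open>t\<close>, so the quotient by \<open>ell_ideal q t\<close> is not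
  available as a type for variable parameters.  Instead the quotient is taken by an ideal
  chosen to be a counterexample, if there is one.
\<close>

definition proper_ideal :: "free_alg set \<Rightarrow> bool" where
  "proper_ideal I \<longleftrightarrow> two_sided_ideal I \<and> 1 \<notin> I"

definition bad_ideal :: "free_alg set \<Rightarrow> bool" where
  "bad_ideal I \<longleftrightarrow> proper_ideal I \<and>
    (\<exists>q t. q \<noteq> 0 \<and> t \<noteq> 0 \<and> I = ell_ideal q t \<and> \<not> Z_relations q t I)"

definition chosen_ideal :: "free_alg set" where
  "chosen_ideal = (SOME I. proper_ideal I \<and> (Ex bad_ideal \<longrightarrow> bad_ideal I))"

lemma chosen_ideal: "proper_ideal chosen_ideal" "Ex bad_ideal \<Longrightarrow> bad_ideal chosen_ideal"
proof -
  \<comment> \<open>The zero ideal is the default when there is no counterexample. Properness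
    provides \<open>0 \<noteq> 1\<close> in the quotient ring.\<close>
  have "proper_ideal {0}" by (simp add: proper_ideal_def two_sided_ideal_def)
  then have "\<exists>I. proper_ideal I \<and> (Ex bad_ideal \<longrightarrow> bad_ideal I)"
    unfolding bad_ideal_def by blast
  from someI_ex[OF this]
  show "proper_ideal chosen_ideal" "Ex bad_ideal \<Longrightarrow> bad_ideal chosen_ideal"
    unfolding chosen_ideal_def by blast+
qed

lemma two_sided_chosen: "two_sided_ideal chosen_ideal"
  using chosen_ideal(1) by (simp add: proper_ideal_def)

lemmas chosen_simps = ideal_simps[OF two_sided_chosen]

quotient_type quot_alg = free_alg / "\<lambda>a b. a - b \<in> chosen_ideal"
proof (rule equivpI)
  show "reflp (\<lambda>a b. a - b \<in> chosen_ideal)"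
    by (rule reflpI) (simp add: chosen_simps(1))
  show "symp (\<lambda>a b. a - b \<in> chosen_ideal)"
    by (rule sympI) (metis chosen_simps(4) minus_diff_eq)
  show "transp (\<lambda>a b. a - b \<in> chosen_ideal)"
  proof (rule transpI)
    fix a b d assume "a - b \<in> chosen_ideal" "b - d \<in> chosen_ideal"
    from chosen_simps(3)[OF this] show "a - d \<in> chosen_ideal" by simp
  qed
qed

instantiation quot_alg :: ring_1
begin

lift_definition zero_quot_alg :: quot_alg is 0 .
lift_definition one_quot_alg :: quot_alg is 1 .
lift_definition plus_quot_alg :: "quot_alg \<Rightarrow> quot_alg \<Rightarrow> quot_alg" is "(+)"
proof -
  fix a a' b b' assume "a - a' \<in> chosen_ideal" "b - b' \<in> chosen_ideal"
  from chosen_simps(3)[OF this] show "a + b - (a' + b') \<in> chosen_ideal" by (simp add: algebra_simps)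
qed
lift_definition uminus_quot_alg :: "quot_alg \<Rightarrow> quot_alg" is uminus
proof -
  fix a a' assume "a - a' \<in> chosen_ideal"
  from chosen_simps(4)[OF this] show "- a - - a' \<in> chosen_ideal" by simp
qed
lift_definition minus_quot_alg :: "quot_alg \<Rightarrow> quot_alg \<Rightarrow> quot_alg" is "(-)"
proof -
  fix a a' b b' assume "a - a' \<in> chosen_ideal" "b - b' \<in> chosen_ideal"
  from chosen_simps(2)[OF this] show "a - b - (a' - b') \<in> chosen_ideal" by (simp add: algebra_simps)
qed
lift_definition times_quot_alg :: "quot_alg \<Rightarrow> quot_alg \<Rightarrow> quot_alg" is "(*)"
proof -
  fix a a' b b' assume "a - a' \<in> chosen_ideal" "b - b' \<in> chosen_ideal"
  \<comment> \<open>The difference of the products is a right multiple plus a left multiple of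
    elements of the ideal.\<close>
  then have "(a - a') * b + a' * (b - b') \<in> chosen_ideal"
    using chosen_simps(3)[OF chosen_simps(6) chosen_simps(5)] by blast
  then show "a * b - a' * b' \<in> chosen_ideal" by (simp add: algebra_simps)
qed

instance
proof
  show "(0 :: quot_alg) \<noteq> 1"
  proof (transfer, rule notI)
    assume "0 - 1 \<in> chosen_ideal"
    from chosen_simps(4)[OF this] show False using chosen_ideal(1) by (simp add: proper_ideal_def)
  qed
qed (transfer; simp add: algebra_simps chosen_simps(1))+

end

theorem theorem2p4:
  fixes q t :: complex
  assumes "q \<noteq> 0" and "t \<noteq> 0"
    and "\<forall>n::nat>0. q ^ n \<noteq> 1" and "\<forall>n::nat>0. t ^ n \<noteq> 1" and "\<forall>n::nat>0. (q / t) ^ n \<noteq> 1"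
  shows
    "(\<forall>Z\<in>{Z_plus, Z_minus}.
        mono_ser (vexp Zv 3) \<star> at_ratio (Gpol q t (- 1)) Wv Zv
          \<star> at_ratio (gser_inv q t r_gam2) Wv Zv \<star> at_var Z Zv \<star> at_var Z Wv
        \<approx>\<^bsub>ell_ideal q t\<^esub>
        - (mono_ser (vexp Wv 3) \<star> at_ratio (Gpol q t (- 1)) Zv Wv
          \<star> at_ratio (gser_inv q t r_gam2) Zv Wv \<star> at_var Z Wv \<star> at_var Z Zv))
     \<and>
     at_ratio (dilate 2 (gser q t r_one)) Wv Zv \<star> at_ratio (dilate 2 (gser q t r_gam2)) Wv Zv
         \<star> at_var Z_plus Zv \<star> at_var Z_minus Wv
       - at_ratio (dilate 2 (gser q t r_one)) Zv Wv \<star> at_ratio (dilate 2 (gser q t r_gam2)) Zv Wv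
         \<star> at_var Z_minus Wv \<star> at_var Z_plus Zv
       \<approx>\<^bsub>ell_ideal q t\<^esub>
       const_ser (const_C q t) \<star>
         (at_ratio (dilate (- 2) delta) Zv Wv \<star> const_ser (letter Psi0p)
          - at_ratio (dilate 2 delta) Zv Wv \<star> const_ser (letter Psi0m))
     \<and>
     perm_sum (\<lambda>z w u.
         at_ratio (gser_inv q t r_one) w z \<star> at_ratio (gser_inv q t r_one) u w
         \<star> at_ratio (gser_inv q t r_one) u z
         \<star> at_ratio (gser_inv q t r_gam2) w z \<star> at_ratio (gser_inv q t r_gam2) u w
         \<star> at_ratio (gser_inv q t r_gam2) u z \<star> bracket z w u
         \<star> at_var Z_plus z \<star> at_var Z_plus w \<star> at_var Z_plus u)
       \<approx>\<^bsub>ell_ideal q t\<^esub> 0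
     \<and>
     perm_sum (\<lambda>z w u.
         at_ratio (gser_inv q t r_gam2) w z \<star> at_ratio (gser_inv q t r_gam2) u w
         \<star> at_ratio (gser_inv q t r_gam2) u z \<star> bracket z w u
         \<star> at_var Z_minus z \<star> at_var Z_minus w \<star> at_var Z_minus u)
       \<approx>\<^bsub>ell_ideal q t\<^esub> 0"
  unfolding Z_relations_def[symmetric]
proof (rule ccontr)
  assume fails: "\<not> Z_relations q t (ell_ideal q t)"
  \<comment> \<open>Modulo an improper ideal every congruence holds, so a failure of the relations
    forces properness.\<close>
  have "1 \<notin> ell_ideal q t"
  proof
    assume "1 \<in> ell_ideal q t"
    then have "a \<in> ell_ideal q t" for a
      using ideal_simps(5)[OF two_sided_ideal_ell_ideal, of 1 q t a] by simp
    then have "Z_relations q t (ell_ideal q t)"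
      by (simp add: Z_relations_def ser_eq_def elt_eq_def)
    with fails show False ..
  qed
  then have "bad_ideal (ell_ideal q t)"
    using fails assms(1,2) two_sided_ideal_ell_ideal by (auto simp: bad_ideal_def proper_ideal_def)
  then have "bad_ideal chosen_ideal" using chosen_ideal(2) by blast
  \<comment> \<open>The chosen counterexample may belong to parameters other than \<open>q\<close>
    and \<open>t\<close>; the contradiction arises for its own parameters.\<close>
  then obtain q' t' where qt: "q' \<noteq> 0" "t' \<noteq> 0" "chosen_ideal = ell_ideal q' t'"
    "\<not> Z_relations q' t' chosen_ideal" unfolding bad_ideal_def by blast
  interpret ell_quotient abs_quot_alg chosen_ideal q' t'
  proof
    have "\<exists>x. y = abs_quot_alg x" for y by (induction y rule: quot_alg.abs_induct) blast
    then show "surj abs_quot_alg" by (simp add: surj_def)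
    show "closed chosen_ideal" unfolding qt(3) by (rule closed_ell_ideal)
    show "ell_relations q' t' chosen_ideal" unfolding qt(3) by (rule ell_relations_ell_ideal)
  qed (simp_all add: plus_quot_alg.abs_eq times_quot_alg.abs_eq one_quot_alg.abs_eq quot_alg.abs_eq_iff
      two_sided_chosen qt(1,2))
  from Z_relations qt(4) show False by blast
qed

end
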